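(* Let $G$ be a Lie group and $A$ a smooth $G$-module. Then $H^2_{lsm}(G,A)$ parametrizes the equivalence classes of locally split smooth extensions of $G$ by $A$. That is, associating to a locally split smooth extension $$1\to A\xrightarrow{\imath}E\xrightarrow{\pi}G\to 1$$ the class in $H^2_{lsm}(G,A)$ of the $2$-cocycle $F_\sigma(s_1,s_2)=\sigma(s_1)\sigma(s_2)\sigma(s_1s_2)^{-1}$, where $\sigma\colon G\to E$ is any measurable section of $\pi$ that is smooth in a neighbourhood of the identity of $G$, gives a well-defined bijection from the set of equivalence classes of locally split smooth extensions of $G$ by $A$ onto $H^2_{lsm}(G,A)$.
   Context: A smooth $G$-module is an abelian Lie group $A$ (written additively) with an action of $G$ by group automorphisms such that $G\times A\to A$ is smooth. Set $C^0_{lsm}(G,A)=A$, and for $n\ge1$ let $C^n_{lsm}(G,A)$ be the group of all (Borel) measurable functions $f\colon G^n\to A$ which are smooth in some neighbourhood of the identity of $G^n$. The coboundary is $$d^nf(s_1,\dots,s_{n+1})=s_1\cdot f(s_2,\dots,s_{n+1})+\sum_{i=1}^n(-1)^i f(s_1,\dots,s_is_{i+1},\dots,s_{n+1})+(-1)^{n+1}f(s_1,\dots,s_n),$$ and $H^n_{lsm}(G,A)=\ker d^n/\operatorname{im}d^{n-1}$ for $n\ge1$. A locally split smooth extension of $G$ by $A$ is a short exact sequence $1\to A\xrightarrow{\imath}E\xrightarrow{\pi}G\to1$ of Lie groups ($\imath,\pi$ smooth homomorphisms, $\imath$ a closed map, $\pi$ an open map), such that conjugation in $E$ induces the given action of $G$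 on $A$, and such that $\pi$ admits a measurable cross section $\sigma\colon G\to E$ which is smooth in a neighbourhood of the identity of $G$. Two extensions are equivalent if there is an isomorphism of Lie groups $E\to E'$ compatible with the identity maps on $A$ and on $G$. *)

theory Defs
  imports "HOL-Analysis.Analysis" "HOL-Algebra.Coset" "HOL-Algebra.Bij" "HOL-Algebra.FiniteProduct"
begin

section \<open>Smooth maps between open subsets of Euclidean spaces\<close>

text \<open>
  The dimension has to vary inside a single set of Lie groups (the middle terms of extensions),
  so \<open>R^n\<close> is the library's topology \<open>Euclidean_space n\<close>: the sequences \<open>x :: nat \<Rightarrow> real\<close> with
  \<open>x i = 0\<close> for all \<open>i \<ge> n\<close>. A function is \<open>C^k\<close> if it is continuous and, for \<open>k > 0\<close>, its first partial
  derivatives exist and are \<open>C^(k-1)\<close>. The predicate is meant for \<open>W\<close> open in \<open>Euclidean_space n\<close>;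
  then only the values of \<open>f\<close> on \<open>W\<close> matter.
\<close>

primrec Ck_on :: "nat \<Rightarrow> nat \<Rightarrow> (nat \<Rightarrow> real) set \<Rightarrow> ((nat \<Rightarrow> real) \<Rightarrow> real) \<Rightarrow> bool" where
  "Ck_on n 0 W f \<longleftrightarrow>
     continuous_map (subtopology (Euclidean_space n) W) euclideanreal f"
| "Ck_on n (Suc k) W f \<longleftrightarrow>
     continuous_map (subtopology (Euclidean_space n) W) euclideanreal f \<and>
     (\<exists>g :: nat \<Rightarrow> (nat \<Rightarrow> real) \<Rightarrow> real. \<forall>i<n.
        (\<forall>x\<in>W. ((\<lambda>t. f (x(i := t))) has_real_derivative g i x) (at (x i))) \<and>
        Ck_on n k W (g i))"

definition smooth_euclidean ::
  "nat \<Rightarrow> nat \<Rightarrow> (nat \<Rightarrow> real) set \<Rightarrow> ((nat \<Rightarrow> real) \<Rightarrow> nat \<Rightarrow> real) \<Rightarrow> bool" where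
  "smooth_euclidean n m W h \<longleftrightarrow> (\<forall>k. \<forall>j<m. Ck_on n k W (\<lambda>x. h x j))"

section \<open>Smooth manifolds\<close>

text \<open>
  A chart is a pair of its domain and its coordinate map. The atlas is not required to be maximal.
\<close>

record 'a manifold =
  mtop :: "'a topology"
  mdim :: nat
  atlas :: "('a set \<times> ('a \<Rightarrow> nat \<Rightarrow> real)) set"

definition smooth_manifold :: "'a manifold \<Rightarrow> bool" where
  "smooth_manifold M \<longleftrightarrow>
     Hausdorff_space (mtop M) \<and> second_countable (mtop M) \<and>
     \<Union> (fst ` atlas M) = topspace (mtop M) \<and>
     (\<forall>(U, \<phi>) \<in> atlas M.
        openin (mtop M) U \<and> openin (Euclidean_space (mdim M)) (\<phi> ` U) \<and>
        homeomorphic_map (subtopology (mtop M) U)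
          (subtopology (Euclidean_space (mdim M)) (\<phi> ` U)) \<phi>) \<and>
     (\<forall>(U, \<phi>) \<in> atlas M. \<forall>(V, \<psi>) \<in> atlas M.
        smooth_euclidean (mdim M) (mdim M) (\<phi> ` (U \<inter> V)) (\<psi> \<circ> inv_into U \<phi>))"

definition smooth_map_on :: "'a manifold \<Rightarrow> 'b manifold \<Rightarrow> 'a set \<Rightarrow> ('a \<Rightarrow> 'b) \<Rightarrow> bool" where
  "smooth_map_on M N D f \<longleftrightarrow>
     openin (mtop M) D \<and>
     continuous_map (subtopology (mtop M) D) (mtop N) f \<and>
     (\<forall>(U, \<phi>) \<in> atlas M. \<forall>(V, \<psi>) \<in> atlas N.
        smooth_euclidean (mdim M) (mdim N) (\<phi> ` (D \<inter> U \<inter> f -` V)) (\<psi> \<circ> f \<circ> inv_into U \<phi>))"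

abbreviation smooth_map :: "'a manifold \<Rightarrow> 'b manifold \<Rightarrow> ('a \<Rightarrow> 'b) \<Rightarrow> bool" where
  "smooth_map M N f \<equiv> smooth_map_on M N (topspace (mtop M)) f"

definition smooth_near :: "'a manifold \<Rightarrow> 'b manifold \<Rightarrow> 'a \<Rightarrow> ('a \<Rightarrow> 'b) \<Rightarrow> bool" where
  "smooth_near M N p f \<longleftrightarrow> (\<exists>D. p \<in> D \<and> smooth_map_on M N D f)"

text \<open>Product charts list the coordinates of the factors one after the other.\<close>

definition prod_manifold :: "'a manifold \<Rightarrow> 'b manifold \<Rightarrow> ('a \<times> 'b) manifold" where
  "prod_manifold M N =
     \<lparr>mtop = prod_topology (mtop M) (mtop N),
      mdim = mdim M + mdim N,
      atlas = {(U \<times> V, \<lambda>(x, y) i. if i < mdim M then \<phi> x i else \<psi> y (i - mdim M)) | U \<phi> V \<psi>.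
                 (U, \<phi>) \<in> atlas M \<and> (V, \<psi>) \<in> atlas N}\<rparr>"

text \<open>The \<open>n\<close>-fold power; its points are the families indexed by \<open>{1..n}\<close>.\<close>

definition power_manifold :: "'a manifold \<Rightarrow> nat \<Rightarrow> (nat \<Rightarrow> 'a) manifold" where
  "power_manifold M n =
     \<lparr>mtop = product_topology (\<lambda>_. mtop M) {1..n},
      mdim = n * mdim M,
      atlas = {(PiE {1..n} U,
                \<lambda>s k. if k < n * mdim M
                      then \<phi> (Suc (k div mdim M)) (s (Suc (k div mdim M))) (k mod mdim M)
                      else 0) | U \<phi>.
                 \<forall>i\<in>{1..n}. (U i, \<phi> i) \<in> atlas M}\<rparr>"

definition borel_of :: "'a topology \<Rightarrow> 'a measure" where
  "borel_of T = sigma (topspace T) {U. openin T U}"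

abbreviation borel_measurable_map :: "'a manifold \<Rightarrow> 'b manifold \<Rightarrow> ('a \<Rightarrow> 'b) \<Rightarrow> bool" where
  "borel_measurable_map M N f \<equiv> f \<in> measurable (borel_of (mtop M)) (borel_of (mtop N))"

section \<open>Lie groups and smooth modules\<close>

record 'a lie_struct = "'a monoid" +
  mfd :: "'a manifold"

definition lie_group :: "'a lie_struct \<Rightarrow> bool" where
  "lie_group G \<longleftrightarrow>
     group G \<and> smooth_manifold (mfd G) \<and> topspace (mtop (mfd G)) = carrier G \<and>
     smooth_map (prod_manifold (mfd G) (mfd G)) (mfd G) (\<lambda>(x, y). x \<otimes>\<^bsub>G\<^esub> y) \<and>
     smooth_map (mfd G) (mfd G) (\<lambda>x. inv\<^bsub>G\<^esub> x)"

text \<open>The module \<open>A\<close> is written multiplicatively, as abelian groups are in HOL-Algebra.\<close>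

definition smooth_module :: "'g lie_struct \<Rightarrow> 'a lie_struct \<Rightarrow> ('g \<Rightarrow> 'a \<Rightarrow> 'a) \<Rightarrow> bool" where
  "smooth_module G A act \<longleftrightarrow>
     lie_group A \<and> comm_group A \<and> act \<in> hom G (AutoGroup A) \<and>
     smooth_map (prod_manifold (mfd G) (mfd A)) (mfd A) (\<lambda>(g, a). act g a)"

section \<open>Locally smooth measurable cohomology\<close>

abbreviation power_carrier :: "'g lie_struct \<Rightarrow> nat \<Rightarrow> (nat \<Rightarrow> 'g) set" where
  "power_carrier G n \<equiv> PiE {1..n} (\<lambda>_. carrier G)"

text \<open>
  Cochains are extensional functions, so that equality of cochains is equality on \<open>G^n\<close>.
  For \<open>n = 0\<close> this is the group of all functions from the one-point space \<open>G^0\<close> to \<open>A\<close>, that is, \<open>A\<close>.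
\<close>

definition lsm_cochains :: "'g lie_struct \<Rightarrow> 'a lie_struct \<Rightarrow> nat \<Rightarrow> ((nat \<Rightarrow> 'g) \<Rightarrow> 'a) monoid" where
  "lsm_cochains G A n =
     \<lparr>carrier = {f \<in> power_carrier G n \<rightarrow>\<^sub>E carrier A.
         borel_measurable_map (power_manifold (mfd G) n) (mfd A) f \<and>
         smooth_near (power_manifold (mfd G) n) (mfd A) (\<lambda>i\<in>{1..n}. \<one>\<^bsub>G\<^esub>) f},
      mult = (\<lambda>f h. \<lambda>s\<in>power_carrier G n. f s \<otimes>\<^bsub>A\<^esub> h s),
      one = (\<lambda>s\<in>power_carrier G n. \<one>\<^bsub>A\<^esub>)\<rparr>"

definition merge_at :: "'g lie_struct \<Rightarrow> nat \<Rightarrow> nat \<Rightarrow> (nat \<Rightarrow> 'g) \<Rightarrow> nat \<Rightarrow> 'g" where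
  "merge_at G n i s =
     (\<lambda>j\<in>{1..n}. if j < i then s j else if j = i then s i \<otimes>\<^bsub>G\<^esub> s (Suc i) else s (Suc j))"

definition coboundary ::
  "'g lie_struct \<Rightarrow> 'a lie_struct \<Rightarrow> ('g \<Rightarrow> 'a \<Rightarrow> 'a) \<Rightarrow> nat \<Rightarrow> ((nat \<Rightarrow> 'g) \<Rightarrow> 'a) \<Rightarrow> (nat \<Rightarrow> 'g) \<Rightarrow> 'a" where
  "coboundary G A act n f =
     (\<lambda>s\<in>power_carrier G (Suc n).
        act (s 1) (f (\<lambda>i\<in>{1..n}. s (Suc i)))
        \<otimes>\<^bsub>A\<^esub> (\<Otimes>\<^bsub>A\<^esub>i\<in>{1..n}. f (merge_at G n i s) [^]\<^bsub>A\<^esub> ((-1) ^ i :: int))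
        \<otimes>\<^bsub>A\<^esub> f (restrict s {1..n}) [^]\<^bsub>A\<^esub> ((-1) ^ Suc n :: int))"

definition lsm_cocycles ::
  "'g lie_struct \<Rightarrow> 'a lie_struct \<Rightarrow> ('g \<Rightarrow> 'a \<Rightarrow> 'a) \<Rightarrow> nat \<Rightarrow> ((nat \<Rightarrow> 'g) \<Rightarrow> 'a) monoid" where
  "lsm_cocycles G A act n =
     lsm_cochains G A n
       \<lparr>carrier := kernel (lsm_cochains G A n) (lsm_cochains G A (Suc n)) (coboundary G A act n)\<rparr>"

text \<open>For \<open>n \<ge> 1\<close>.\<close>

definition lsm_coboundaries ::
  "'g lie_struct \<Rightarrow> 'a lie_struct \<Rightarrow> ('g \<Rightarrow> 'a \<Rightarrow> 'a) \<Rightarrow> nat \<Rightarrow> ((nat \<Rightarrow> 'g) \<Rightarrow> 'a) set" where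
  "lsm_coboundaries G A act n = coboundary G A act (n - 1) ` carrier (lsm_cochains G A (n - 1))"

definition lsm_cohomology ::
  "'g lie_struct \<Rightarrow> 'a lie_struct \<Rightarrow> ('g \<Rightarrow> 'a \<Rightarrow> 'a) \<Rightarrow> nat \<Rightarrow> ((nat \<Rightarrow> 'g) \<Rightarrow> 'a) set monoid" where
  "lsm_cohomology G A act n = lsm_cocycles G A act n Mod lsm_coboundaries G A act n"

definition lsm_class ::
  "'g lie_struct \<Rightarrow> 'a lie_struct \<Rightarrow> ('g \<Rightarrow> 'a \<Rightarrow> 'a) \<Rightarrow> nat \<Rightarrow> ((nat \<Rightarrow> 'g) \<Rightarrow> 'a) \<Rightarrow> ((nat \<Rightarrow> 'g) \<Rightarrow> 'a) set" where
  "lsm_class G A act n f = lsm_coboundaries G A act n #>\<^bsub>lsm_cocycles G A act n\<^esub> f"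

section \<open>Locally split smooth extensions\<close>

record ('g, 'a, 'e) extension =
  ext :: "'e lie_struct"
  incl :: "'a \<Rightarrow> 'e"
  proj :: "'e \<Rightarrow> 'g"

definition lsm_section :: "'g lie_struct \<Rightarrow> ('g, 'a, 'e) extension \<Rightarrow> ('g \<Rightarrow> 'e) \<Rightarrow> bool" where
  "lsm_section G X \<sigma> \<longleftrightarrow>
     borel_measurable_map (mfd G) (mfd (ext X)) \<sigma> \<and>
     (\<forall>s\<in>carrier G. proj X (\<sigma> s) = s) \<and>
     smooth_near (mfd G) (mfd (ext X)) \<one>\<^bsub>G\<^esub> \<sigma>"

definition locally_split_extension ::
  "'g lie_struct \<Rightarrow> 'a lie_struct \<Rightarrow> ('g \<Rightarrow> 'a \<Rightarrow> 'a) \<Rightarrow> ('g, 'a, 'e) extension \<Rightarrow> bool" where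
  "locally_split_extension G A act X \<longleftrightarrow>
     lie_group (ext X) \<and>
     incl X \<in> hom A (ext X) \<and> smooth_map (mfd A) (mfd (ext X)) (incl X) \<and>
     proj X \<in> hom (ext X) G \<and> smooth_map (mfd (ext X)) (mfd G) (proj X) \<and>
     inj_on (incl X) (carrier A) \<and>
     incl X ` carrier A = kernel (ext X) G (proj X) \<and>
     proj X ` carrier (ext X) = carrier G \<and>
     closed_map (mtop (mfd A)) (mtop (mfd (ext X))) (incl X) \<and>
     open_map (mtop (mfd (ext X))) (mtop (mfd G)) (proj X) \<and>
     (\<forall>e\<in>carrier (ext X). \<forall>a\<in>carrier A.
        e \<otimes>\<^bsub>ext X\<^esub> incl X a \<otimes>\<^bsub>ext X\<^esub> inv\<^bsub>ext X\<^esub> e = incl X (act (proj X e) a)) \<and>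
     (\<exists>\<sigma>. lsm_section G X \<sigma>)"

definition locally_split_extensions ::
  "'g lie_struct \<Rightarrow> 'a lie_struct \<Rightarrow> ('g \<Rightarrow> 'a \<Rightarrow> 'a) \<Rightarrow> ('g, 'a, 'e) extension set" where
  "locally_split_extensions G A act = {X. locally_split_extension G A act X}"

definition lie_iso :: "'a lie_struct \<Rightarrow> 'b lie_struct \<Rightarrow> ('a \<Rightarrow> 'b) \<Rightarrow> bool" where
  "lie_iso G H \<theta> \<longleftrightarrow>
     \<theta> \<in> iso G H \<and> smooth_map (mfd G) (mfd H) \<theta> \<and>
     smooth_map (mfd H) (mfd G) (inv_into (carrier G) \<theta>)"

definition extension_equivalence ::
  "'g lie_struct \<Rightarrow> 'a lie_struct \<Rightarrow> ('g \<Rightarrow> 'a \<Rightarrow> 'a)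
    \<Rightarrow> (('g, 'a, 'e) extension \<times> ('g, 'a, 'e) extension) set" where
  "extension_equivalence G A act =
     {(X, Y). X \<in> locally_split_extensions G A act \<and> Y \<in> locally_split_extensions G A act \<and>
        (\<exists>\<theta>. lie_iso (ext X) (ext Y) \<theta> \<and>
           (\<forall>a\<in>carrier A. \<theta> (incl X a) = incl Y a) \<and>
           (\<forall>e\<in>carrier (ext X). proj Y (\<theta> e) = proj X e))}"

text \<open>
  The values \<open>\<sigma>(s\<^sub>1) \<sigma>(s\<^sub>2) \<sigma>(s\<^sub>1 s\<^sub>2)\<inverse>\<close> lie in the image of \<open>A\<close> and are read in \<open>A\<close> through \<open>incl X\<close>.
\<close>

definition factor_set ::
  "'g lie_struct \<Rightarrow> 'a lie_struct \<Rightarrow> ('g, 'a, 'e) extension \<Rightarrow> ('g \<Rightarrow> 'e) \<Rightarrow> (nat \<Rightarrow> 'g) \<Rightarrow> 'a" where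
  "factor_set G A X \<sigma> =
     (\<lambda>s\<in>power_carrier G 2. inv_into (carrier A) (incl X)
        (\<sigma> (s 1) \<otimes>\<^bsub>ext X\<^esub> \<sigma> (s 2) \<otimes>\<^bsub>ext X\<^esub> inv\<^bsub>ext X\<^esub> \<sigma> (s 1 \<otimes>\<^bsub>G\<^esub> s 2)))"

text \<open>
  Extensions form a set only after fixing the type \<open>'e\<close> of the elements of their middle terms. As a
  set, every middle term is in bijection with \<open>G \<times> A\<close>, so all equivalence classes are represented
  over \<open>'e\<close> exactly when \<open>'e\<close> has room for a copy of \<open>G \<times> A\<close>.
\<close>

definition large_enough :: "'g lie_struct \<Rightarrow> 'a lie_struct \<Rightarrow> 'e itself \<Rightarrow> bool" where
  "large_enough G A (_ :: 'e itself) \<longleftrightarrow>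
     (\<exists>j :: 'g \<times> 'a \<Rightarrow> 'e. inj_on j (carrier G \<times> carrier A))"

end

theory Submission
  imports Defs
begin

text \<open>
  Factor sets and extensions correspond as in pure algebra; the point is that measurability, together
  with smoothness near the identity, suffices on the analytic side.

  A quotient of two sections takes values in \<open>\<iota>(A)\<close>, and it is smooth as a map into \<open>A\<close> because an injective
  closed smooth homomorphism is an embedding. Hence the class does not depend on the section. If the
  classes of two extensions agree, the sections can be chosen with the same factor set; matching them
  gives an isomorphism of groups that is smooth near the identity, hence everywhere by translation.

  A cocycle \<open>f\<close> makes \<open>A \<times> G\<close> a group \<open>E\<close>. For a small neighbourhood \<open>V\<close> of the identity of \<open>G\<close>, the left
  translates of \<open>A \<times> V\<close> form a smooth atlas for which left translations are smooth everywhere, and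
  multiplication and inversion near the identity. What is missing is the smoothness of conjugations at the
  identity. They are Borel homomorphisms of \<open>E\<close>, hence continuous by Pettis' argument, and a continuous
  homomorphism is smooth: comparing \<open>\<theta> (x x)\<close> with \<open>\<theta> x\<close> shows that it is Lipschitz at the identity, so in charts
  it is additive up to a quadratic error, so it is differentiable at the identity, and the functional
  equation spreads differentiability of all orders to a neighbourhood.
\<close>

section \<open>Functions of class \<open>C\<^sup>k\<close>\<close>

text \<open>The obstacle is a circularity. The atlas of left translates makes only left translations
  smooth for free; right translations are at first merely Borel. Conjugations are to be proved
  smooth as homomorphisms of a group that is not yet known to be a Lie group. Homomorphisms are
  therefore studied for groups whose multiplication and inversion are controlled at the identity
  alone, and explicit estimates in one chart take the place of an exponential map and of the inverse
  function theorem. The errors are quadratic because a product differs from the sum of the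
  coordinates by a term that vanishes as soon as one factor is trivial. The differentiability lemma
  asks for multiplicativity on a subgroup, so that one argument covers homomorphisms and also the
  inverse of the embedding of \<open>A\<close>, which lives on a subset of \<open>E\<close>. Second
  countability supplies countable covers by translates, both for Pettis' argument and for comparing
  the Borel sets of \<open>E\<close> with those of \<open>A \<times> G\<close>.\<close>

abbreviation EE :: "nat \<Rightarrow> (nat \<Rightarrow> real) set" where
  "EE n \<equiv> topspace (Euclidean_space n)"

text \<open>The l1 form is chosen because changing one coordinate moves a point by exactly that
  change, and the distance of concatenated points is the sum of the distances. It ignores the
  coordinates from \<open>n\<close> on, so it separates points only within
  \<open>EE n\<close>.\<close>

definition l1dist :: "nat \<Rightarrow> (nat \<Rightarrow> real) \<Rightarrow> (nat \<Rightarrow> real) \<Rightarrow> real" where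
  "l1dist n x y = (\<Sum>i<n. \<bar>x i - y i\<bar>)"

lemma l1dist_nonneg [simp]: "0 \<le> l1dist n x y"
  by (simp add: l1dist_def sum_nonneg)

lemma l1dist_self [simp]: "l1dist n x x = 0"
  by (simp add: l1dist_def)

lemma l1dist_commute: "l1dist n x y = l1dist n y x"
  by (simp add: l1dist_def abs_minus_commute)

lemma l1dist_triangle: "l1dist n x z \<le> l1dist n x y + l1dist n y z"
  unfolding l1dist_def sum.distrib[symmetric] by (rule sum_mono) linarith

lemma l1dist_coord: "i < n \<Longrightarrow> \<bar>x i - y i\<bar> \<le> l1dist n x y"
  unfolding l1dist_def by (rule member_le_sum) auto

lemma l1dist_upd: "i < n \<Longrightarrow> l1dist n x (x(i := t)) = \<bar>x i - t\<bar>"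
  unfolding l1dist_def by (subst sum.remove[of _ i]) auto

lemma EE_upd: "x \<in> EE n \<Longrightarrow> i < n \<Longrightarrow> x(i := t) \<in> EE n"
  by (auto simp: topspace_Euclidean_space)

lemma EE_eqI: "x \<in> EE n \<Longrightarrow> y \<in> EE n \<Longrightarrow> (\<And>i. i < n \<Longrightarrow> x i = y i) \<Longrightarrow> x = y"
  by (rule ext) (metis (mono_tags, lifting) leI mem_Collect_eq topspace_Euclidean_space)

lemma continuous_map_coord: "continuous_map (Euclidean_space n) euclideanreal (\<lambda>x. x i)"
  unfolding Euclidean_space_def
  by (intro continuous_map_from_subtopology continuous_map_product_coordinates) simp

lemma openin_l1ball: "openin (Euclidean_space n) {y \<in> EE n. l1dist n x y < e}"
proof -
  have "continuous_map (Euclidean_space n) euclideanreal (l1dist n x)"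
    unfolding l1dist_def
    by (intro continuous_map_sum continuous_map_real_abs continuous_map_diff continuous_map_coord)
      (auto intro: continuous_map_const[THEN iffD2])
  from openin_continuous_map_preimage[OF this, of "{..<e}"] show ?thesis
    by auto
qed

text \<open>All coordinates from \<open>n\<close> on vanish in \<open>EE n\<close>, so only the
  first \<open>n\<close> factors of a basic box restrict a point, and the least of finitely many
  radii will do. Later arguments in coordinates use this metric form.\<close>

lemma openin_Euclidean_iff:
  "openin (Euclidean_space n) W \<longleftrightarrow>
     W \<subseteq> EE n \<and> (\<forall>x\<in>W. \<exists>e>0. \<forall>y\<in>EE n. l1dist n x y < e \<longrightarrow> y \<in> W)"
proof (intro iffI conjI ballI)
  assume W: "openin (Euclidean_space n) W"
  then show "W \<subseteq> EE n" by (rule openin_subset)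
  fix x assume x: "x \<in> W"
  obtain T where T: "openin (powertop_real UNIV) T" "W = T \<inter> {x. \<forall>i\<ge>n. x i = 0}"
    using W unfolding Euclidean_space_def openin_subtopology by blast
  obtain X where X: "\<And>i. openin euclideanreal (X i)"
      "x \<in> Pi\<^sub>E UNIV X" "Pi\<^sub>E UNIV X \<subseteq> T"
  proof -
    have "x \<in> T" using T(2) x by simp
    with T(1)[unfolded openin_product_topology_alt] show thesis
      using that by (metis UNIV_I)
  qed
  have "\<forall>i. \<exists>e>0. \<forall>t. \<bar>t - x i\<bar> < e \<longrightarrow> t \<in> X i"
  proof
    fix i
    have "open (X i)" "x i \<in> X i" using X by (auto simp: PiE_iff)
    then show "\<exists>e>0. \<forall>t. \<bar>t - x i\<bar> < e \<longrightarrow> t \<in> X i"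
      unfolding open_dist by (auto simp: dist_real_def)
  qed
  then obtain e where e: "\<And>i. e i > 0" "\<And>i t. \<bar>t - x i\<bar> < e i \<Longrightarrow> t \<in> X i" by metis
  \<comment> \<open>The extra \<open>1\<close> keeps the set nonempty when
    \<open>n = 0\<close>.\<close>
  define d where "d = Min (insert 1 (e ` {..<n}))"
  have d: "d > 0" "\<And>i. i < n \<Longrightarrow> d \<le> e i" unfolding d_def using e(1) by auto
  have "y \<in> W" if y: "y \<in> EE n" "l1dist n x y < d" for y
  proof -
    have "y i \<in> X i" for i
    proof (cases "i < n")
      case True
      then have "\<bar>y i - x i\<bar> < e i"
        using l1dist_coord[OF True, of x y] y(2) d(2)[OF True] by linarith
      then show ?thesis by (rule e)
    next
      case False
      then have "y i = x i" using y(1) x T(2) by (auto simp: topspace_Euclidean_space)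
      then show ?thesis using e(2)[of "y i" i] e(1)[of i] by simp
    qed
    then have "y \<in> T" using X(3) by (auto simp: PiE_iff)
    then show ?thesis using y(1) T(2) by (auto simp: topspace_Euclidean_space)
  qed
  with d(1) show "\<exists>e>0. \<forall>y\<in>EE n. l1dist n x y < e \<longrightarrow> y \<in> W" by blast
next
  assume *: "W \<subseteq> EE n \<and> (\<forall>x\<in>W. \<exists>e>0. \<forall>y\<in>EE n. l1dist n x y < e \<longrightarrow> y \<in> W)"
  show "openin (Euclidean_space n) W"
  proof (subst openin_subopen, intro ballI)
    fix x assume x: "x \<in> W"
    then obtain e where e: "e > 0" "\<forall>y\<in>EE n. l1dist n x y < e \<longrightarrow> y \<in> W" using * by blast
    show "\<exists>T. openin (Euclidean_space n) T \<and> x \<in> T \<and> T \<subseteq> W"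
      using e x * openin_l1ball[of n x e] by (intro exI[of _ "{y \<in> EE n. l1dist n x y < e}"]) auto
  qed
qed

lemma openin_EuclideanE:
  assumes "openin (Euclidean_space n) W" "x \<in> W"
  obtains d where "d > 0" "\<And>y. y \<in> EE n \<Longrightarrow> l1dist n x y < d \<Longrightarrow> y \<in> W"
  using assms unfolding openin_Euclidean_iff by blast

lemma continuous_Euclidean_iff:
  assumes W: "openin (Euclidean_space n) W"
  shows "continuous_map (subtopology (Euclidean_space n) W) euclideanreal f \<longleftrightarrow>
     (\<forall>x\<in>W. \<forall>e>0. \<exists>d>0. \<forall>y\<in>W. l1dist n x y < d \<longrightarrow> \<bar>f y - f x\<bar> < e)" (is "?L = ?R")
proof
  assume L: ?L
  show ?R
  proof (intro ballI allI impI)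
    fix x e assume x: "x \<in> W" and e: "(e::real) > 0"
    have "openin (subtopology (Euclidean_space n) W)
            {y \<in> topspace (subtopology (Euclidean_space n) W). f y \<in> ball (f x) e}"
      by (rule openin_continuous_map_preimage[OF L]) simp
    then have "openin (Euclidean_space n) {y \<in> topspace (subtopology (Euclidean_space n) W). f y \<in> ball (f x) e}"
      using W openin_trans_full by blast
    then obtain d where "d > 0" "\<forall>y\<in>EE n. l1dist n x y < d \<longrightarrow>
        y \<in> {y \<in> topspace (subtopology (Euclidean_space n) W). f y \<in> ball (f x) e}"
      unfolding openin_Euclidean_iff using x e openin_subset[OF W] by fastforce
    then show "\<exists>d>0. \<forall>y\<in>W. l1dist n x y < d \<longrightarrow> \<bar>f y - f x\<bar> < e"
      using openin_subset[OF W] by (intro exI[of _ d]) (auto simp: dist_real_def abs_minus_commute)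
  qed
next
  assume R: ?R
  show ?L unfolding continuous_map_def
  proof (intro conjI allI impI)
    fix U assume "openin euclideanreal U"
    then have U: "open U" by simp
    have "openin (Euclidean_space n) {x \<in> W. f x \<in> U}"
      unfolding openin_Euclidean_iff
    proof (intro conjI ballI)
      show "{x \<in> W. f x \<in> U} \<subseteq> EE n" using openin_subset[OF W] by auto
      fix x assume x: "x \<in> {x \<in> W. f x \<in> U}"
      then obtain e where e: "e > 0" "\<And>t. \<bar>t - f x\<bar> < e \<Longrightarrow> t \<in> U"
        using U unfolding open_dist dist_real_def by blast
      obtain d where d: "d > 0" "\<And>y. y \<in> W \<Longrightarrow> l1dist n x y < d \<Longrightarrow> \<bar>f y - f x\<bar> < e"
        using R x e(1) by blast
      obtain d' where d': "d' > 0" "\<And>y. y \<in> EE n \<Longrightarrow> l1dist n x y < d' \<Longrightarrow> y \<in> W"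
        using W x unfolding openin_Euclidean_iff by blast
      show "\<exists>e>0. \<forall>y\<in>EE n. l1dist n x y < e \<longrightarrow> y \<in> {x \<in> W. f x \<in> U}"
        using d d' e(2) by (intro exI[of _ "min d d'"]) auto
    qed
    then show "openin (subtopology (Euclidean_space n) W)
        {x \<in> topspace (subtopology (Euclidean_space n) W). f x \<in> U}"
      using W openin_subset[OF W]
      by (auto simp: openin_open_subtopology topspace_subtopology intro: back_subst[of "openin _"])
  qed auto
qed

section \<open>Partial derivatives and closure properties of \<open>C\<^sup>k\<close>\<close>

definition pdv :: "nat \<Rightarrow> ((nat \<Rightarrow> real) \<Rightarrow> real) \<Rightarrow> (nat \<Rightarrow> real) \<Rightarrow> real" where
  "pdv i f x = deriv (\<lambda>t. f (x(i := t))) (x i)"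

text \<open>A partial derivative at \<open>x\<close> sees \<open>f\<close> on a small segment around
  \<open>x\<close>, and openness of \<open>W\<close> keeps that segment inside
  \<open>W\<close>.\<close>

lemma Ck_cong:
  assumes W: "openin (Euclidean_space n) W" and eq: "\<And>x. x \<in> W \<Longrightarrow> f x = f' x"
    and f: "Ck_on n k W f"
  shows "Ck_on n k W f'"
proof -
  have c: "continuous_map (subtopology (Euclidean_space n) W) euclideanreal f'"
    by (rule continuous_map_eq[where f = f]) (use eq f in \<open>cases k; auto\<close>)+
  show ?thesis
  proof (cases k)
    case (Suc k')
    then obtain g where g: "\<And>i x. i < n \<Longrightarrow> x \<in> W \<Longrightarrow> ((\<lambda>t. f (x(i := t))) has_real_derivative g i x) (at (x i))"
       "\<And>i. i < n \<Longrightarrow> Ck_on n k' W (g i)" using f by auto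
    have "((\<lambda>t. f' (x(i := t))) has_real_derivative g i x) (at (x i))" if i: "i < n" and x: "x \<in> W" for i x
    proof (rule DERIV_cong_ev[THEN iffD1, OF refl _ refl g(1)[OF i x]])
      obtain d where d: "d > 0" "\<And>y. y \<in> EE n \<Longrightarrow> l1dist n x y < d \<Longrightarrow> y \<in> W"
        using W x unfolding openin_Euclidean_iff by blast
      have "f (x(i := t)) = f' (x(i := t))" if "dist t (x i) < d" for t
        by (rule eq, rule d(2)) (use that i x openin_subset[OF W] EE_upd in \<open>auto simp: l1dist_upd dist_real_def abs_minus_commute\<close>)
      then show "\<forall>\<^sub>F t in nhds (x i). f (x(i := t)) = f' (x(i := t))"
        unfolding eventually_nhds_metric using d(1) by blast
    qed
    then show ?thesis using Suc c g(2) by auto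
  qed (use c in simp)
qed

lemma Ck_cont: "Ck_on n k W f \<Longrightarrow> continuous_map (subtopology (Euclidean_space n) W) euclideanreal f"
  by (cases k) auto

text \<open>Derivatives are unique, so on \<open>W\<close> the witnesses in the definition agree
  with \<open>pdv i f\<close>. Having one fixed function in place of the existential quantifier lets
  later inductions on \<open>k\<close> combine derivatives of several functions.\<close>

lemma Ck_Suc_iff:
  assumes W: "openin (Euclidean_space n) W"
  shows "Ck_on n (Suc k) W f \<longleftrightarrow>
     continuous_map (subtopology (Euclidean_space n) W) euclideanreal f \<and>
     (\<forall>i<n. (\<forall>x\<in>W. ((\<lambda>t. f (x(i := t))) has_real_derivative pdv i f x) (at (x i))) \<and>
        Ck_on n k W (pdv i f))" (is "?L = ?R")
proof
  assume ?L
  then obtain g where c: "continuous_map (subtopology (Euclidean_space n) W) euclideanreal f"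
     and g: "\<And>i x. i < n \<Longrightarrow> x \<in> W \<Longrightarrow> ((\<lambda>t. f (x(i := t))) has_real_derivative g i x) (at (x i))"
       "\<And>i. i < n \<Longrightarrow> Ck_on n k W (g i)" by auto
  have eq: "g i x = pdv i f x" if "i < n" "x \<in> W" for i x
    unfolding pdv_def using DERIV_imp_deriv[OF g(1)[OF that]] by simp
  then have "Ck_on n k W (pdv i f)" if "i < n" for i using Ck_cong[OF W _ g(2)[OF that]] that by auto
  with eq g c show ?R by auto
next
  assume ?R
  then show ?L by (auto intro!: exI[of _ "\<lambda>i. pdv i f"])
qed

declare Ck_on.simps(2) [simp del]

lemma Ck_SucD:
  assumes "openin (Euclidean_space n) W" "Ck_on n (Suc k) W f"
  shows "i < n \<Longrightarrow> x \<in> W \<Longrightarrow> ((\<lambda>t. f (x(i := t))) has_real_derivative pdv i f x) (at (x i))"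
    and "i < n \<Longrightarrow> Ck_on n k W (pdv i f)"
  using assms Ck_Suc_iff by auto

lemma Ck_SucI:
  assumes W: "openin (Euclidean_space n) W"
    and "continuous_map (subtopology (Euclidean_space n) W) euclideanreal f"
    and "\<And>i x. i < n \<Longrightarrow> x \<in> W \<Longrightarrow> ((\<lambda>t. f (x(i := t))) has_real_derivative g i x) (at (x i))"
    and "\<And>i. i < n \<Longrightarrow> Ck_on n k W (g i)"
  shows "Ck_on n (Suc k) W f"
  unfolding Ck_on.simps using assms by auto

lemma Ck_Suc_imp:
  assumes W: "openin (Euclidean_space n) W"
  shows "Ck_on n (Suc k) W f \<Longrightarrow> Ck_on n k W f"
proof (induction k arbitrary: f)
  case 0 then show ?case by (simp add: Ck_on.simps)
next
  case (Suc k)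
  note f = Suc.prems[unfolded Ck_Suc_iff[OF W, of "Suc k"]]
  show ?case unfolding Ck_Suc_iff[OF W] using f Suc.IH by blast
qed

lemma Ck_subset:
  assumes "W' \<subseteq> W"
  shows "Ck_on n k W f \<Longrightarrow> Ck_on n k W' f"
proof (induction k arbitrary: f)
  case 0 then show ?case using assms by (auto intro: continuous_map_from_subtopology_mono)
next
  case (Suc k)
  from Suc.prems obtain g where g: "continuous_map (subtopology (Euclidean_space n) W) euclideanreal f"
    "\<forall>i<n. (\<forall>x\<in>W. ((\<lambda>t. f (x(i := t))) has_real_derivative g i x) (at (x i))) \<and> Ck_on n k W (g i)"
    unfolding Ck_on.simps by blast
  show ?case unfolding Ck_on.simps
  proof (intro conjI exI[of _ g] allI impI ballI)
    show "continuous_map (subtopology (Euclidean_space n) W') euclideanreal f"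
      by (rule continuous_map_from_subtopology_mono[OF g(1) assms])
  qed (use g(2) Suc.IH assms in auto)
qed

text \<open>\<open>pdv i f\<close> does not mention the neighbourhood, so the derivatives found on
  different neighbourhoods are already restrictions of one function and agree on overlaps.\<close>

lemma Ck_local:
  assumes W: "openin (Euclidean_space n) W"
    and "\<And>x. x \<in> W \<Longrightarrow> \<exists>W'. openin (Euclidean_space n) W' \<and> x \<in> W' \<and> Ck_on n k W' f"
  shows "Ck_on n k W f"
proof -
  have c: "continuous_map (subtopology (Euclidean_space n) W) euclideanreal f"
    if loc: "\<And>x. x \<in> W \<Longrightarrow> \<exists>W'. openin (Euclidean_space n) W' \<and> x \<in> W' \<and> Ck_on n j W' f" for f j
    unfolding continuous_Euclidean_iff[OF W]
  proof (intro ballI allI impI)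
    fix x and e :: real assume x: "x \<in> W" and e: "e > 0"
    obtain W' where W': "openin (Euclidean_space n) W'" "x \<in> W'" "Ck_on n j W' f" using loc[OF x] by blast
    obtain d where d: "d > 0" "\<And>y. y \<in> W' \<Longrightarrow> l1dist n x y < d \<Longrightarrow> \<bar>f y - f x\<bar> < e"
      using continuous_Euclidean_iff[OF W'(1), THEN iffD1, OF Ck_cont[OF W'(3)]] e W'(2) by blast
    obtain d' where d': "d' > 0" "\<And>y. y \<in> EE n \<Longrightarrow> l1dist n x y < d' \<Longrightarrow> y \<in> W'"
      using W' unfolding openin_Euclidean_iff by blast
    show "\<exists>d>0. \<forall>y\<in>W. l1dist n x y < d \<longrightarrow> \<bar>f y - f x\<bar> < e"
      using d d' openin_subset[OF W] by (intro exI[of _ "min d d'"]) auto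
  qed
  show ?thesis using assms(2)
  proof (induction k arbitrary: f)
    case 0 then show ?case using c[of 0] by auto
  next
    case (Suc k)
    show ?case unfolding Ck_Suc_iff[OF W]
    proof (intro conjI allI impI ballI)
      fix i assume i: "i < n"
      { fix x assume "x \<in> W"
        then obtain W' where W': "openin (Euclidean_space n) W'" "x \<in> W'" "Ck_on n (Suc k) W' f"
          using Suc.prems by blast
        show "((\<lambda>t. f (x(i := t))) has_real_derivative pdv i f x) (at (x i))"
          using Ck_SucD(1)[OF W'(1,3) i W'(2)] . }
      show "Ck_on n k W (pdv i f)"
        by (rule Suc.IH) (metis Suc.prems Ck_SucD(2) i)
    qed (rule c[OF Suc.prems])
  qed
qed

lemma Ck_const:
  assumes W: "openin (Euclidean_space n) W" shows "Ck_on n k W (\<lambda>x. c)"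
proof (induction k arbitrary: c)
  case (Suc k) then show ?case by (intro Ck_SucI[OF W, where g = "\<lambda>_ _. 0"]) auto
qed simp

lemma Ck_coord:
  assumes W: "openin (Euclidean_space n) W" shows "Ck_on n k W (\<lambda>x. x j)"
proof -
  have c: "continuous_map (subtopology (Euclidean_space n) W) euclideanreal (\<lambda>x. x j)"
    by (intro continuous_map_from_subtopology continuous_map_coord)
  show ?thesis
  proof (cases k)
    case (Suc k')
    then show ?thesis
      by (auto intro!: Ck_SucI[OF W c, where g = "\<lambda>i _. if i = j then 1 else 0"] Ck_const[OF W] derivative_eq_intros)
  qed (use c in simp)
qed

lemma Ck_add:
  assumes W: "openin (Euclidean_space n) W"
  shows "Ck_on n k W f \<Longrightarrow> Ck_on n k W g \<Longrightarrow> Ck_on n k W (\<lambda>x. f x + g x)"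
proof (induction k arbitrary: f g)
  case 0 then show ?case by (auto intro: continuous_map_add)
next
  case (Suc k)
  show ?case
    by (rule Ck_SucI[OF W, where g = "\<lambda>i x. pdv i f x + pdv i g x"])
      (rule continuous_map_add DERIV_add Suc.IH Ck_cont[OF Suc.prems(1)] Ck_cont[OF Suc.prems(2)]
         Ck_SucD[OF W Suc.prems(1)] Ck_SucD[OF W Suc.prems(2)] | assumption)+
qed

lemma Ck_mult:
  assumes W: "openin (Euclidean_space n) W"
  shows "Ck_on n k W f \<Longrightarrow> Ck_on n k W g \<Longrightarrow> Ck_on n k W (\<lambda>x. f x * g x)"
proof (induction k arbitrary: f g)
  case 0 then show ?case by (auto intro: continuous_map_real_mult)
next
  case (Suc k)
  show ?case
  proof (rule Ck_SucI[OF W, where g = "\<lambda>i x. pdv i f x * g x + pdv i g x * f x"])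
    show "Ck_on n k W (\<lambda>x. pdv i f x * g x + pdv i g x * f x)" if "i < n" for i
      using that by (intro Ck_add[OF W] Suc.IH Ck_SucD(2)[OF W Suc.prems(1)] Ck_SucD(2)[OF W Suc.prems(2)]
         Ck_Suc_imp[OF W Suc.prems(1)] Ck_Suc_imp[OF W Suc.prems(2)])
    show "((\<lambda>t. f (x(i := t)) * g (x(i := t))) has_real_derivative pdv i f x * g x + pdv i g x * f x) (at (x i))"
      if "i < n" "x \<in> W" for i x
      using DERIV_mult[OF Ck_SucD(1)[OF W Suc.prems(1) that] Ck_SucD(1)[OF W Suc.prems(2) that]]
      by (simp only: fun_upd_triv)
  qed (intro continuous_map_real_mult Ck_cont[OF Suc.prems(1)] Ck_cont[OF Suc.prems(2)])
qed

lemma Ck_sum: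
  assumes W: "openin (Euclidean_space n) W"
  shows "(\<And>j. j \<in> J \<Longrightarrow> Ck_on n k W (f j)) \<Longrightarrow> Ck_on n k W (\<lambda>x. \<Sum>j\<in>J. f j x)"
  by (induction J rule: infinite_finite_induct) (auto intro: Ck_add[OF W] Ck_const[OF W])

text \<open>Pass from \<open>z\<close> to \<open>y\<close> by exchanging one coordinate at a time,
  and on each segment apply the mean value theorem to \<open>f\<close> minus the linear map
  \<open>c\<close>. Each coordinate of an intermediate point lies between those of \<open>y\<close>
  and \<open>z\<close>, so its distance to \<open>p\<close> is at most the sum in
  \<open>yz\<close>.\<close>

lemma telescope_mean_value:
  assumes deriv: "\<And>i x. i < n \<Longrightarrow> x \<in> EE n \<Longrightarrow> l1dist n p x < r \<Longrightarrow>
        ((\<lambda>t. f (x(i := t))) has_real_derivative g i x) (at (x i)) \<and> \<bar>g i x - c i\<bar> \<le> e"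
    and y: "y \<in> EE n" and z: "z \<in> EE n" and yz: "l1dist n p y + l1dist n p z < r"
  shows "\<bar>f y - f z - (\<Sum>i<n. c i * (y i - z i))\<bar> \<le> e * l1dist n z y"
proof -
  define w where "w k = (\<lambda>i. if i < k then y i else z i)" for k
  have wE: "w k \<in> EE n" for k using y z by (auto simp: w_def topspace_Euclidean_space)
  have w0: "w 0 = z" by (auto simp: w_def)
  have wn: "w n = y" by (rule EE_eqI[OF wE y]) (auto simp: w_def)
  have step: "\<bar>f (w (Suc k)) - f (w k) - c k * (y k - z k)\<bar> \<le> e * \<bar>z k - y k\<bar>" if k: "k < n" for k
  proof -
    define u where "u t = (w k)(k := z k + t * (y k - z k))" for t
    have uE: "u t \<in> EE n" for t unfolding u_def by (rule EE_upd[OF wE k])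
    have ud: "l1dist n p (u t) < r" if t: "0 \<le> t" "t \<le> 1" for t
    proof -
      have "\<bar>p i - u t i\<bar> \<le> \<bar>p i - y i\<bar> + \<bar>p i - z i\<bar>" for i
      proof (cases "i = k")
        case True
        have "p k - u t k = (1 - t) * (p k - z k) + t * (p k - y k)" by (simp add: u_def algebra_simps)
        also have "\<bar>\<dots>\<bar> \<le> (1 - t) * \<bar>p k - z k\<bar> + t * \<bar>p k - y k\<bar>"
          using t by (intro order_trans[OF abs_triangle_ineq]) (simp add: abs_mult)
        also have "\<dots> \<le> \<bar>p k - z k\<bar> + \<bar>p k - y k\<bar>"
          using t by (intro add_mono mult_left_le_one_le) auto
        finally show ?thesis using True by simp
      qed (auto simp: u_def w_def)
      then have "l1dist n p (u t) \<le> l1dist n p y + l1dist n p z"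
        unfolding l1dist_def sum.distrib[symmetric] by (intro sum_mono) auto
      then show ?thesis using yz by linarith
    qed
    have D: "((\<lambda>s. f (u s) - c k * (s * (y k - z k))) has_real_derivative (g k (u t) - c k) * (y k - z k)) (at t)"
      if t: "0 \<le> t" "t \<le> 1" for t
    proof -
      have 1: "((\<lambda>s. f ((u t)(k := s))) has_real_derivative g k (u t)) (at (u t k))"
        using deriv[OF k uE ud[OF t]] by blast
      have 2: "((\<lambda>s. z k + s * (y k - z k)) has_real_derivative (y k - z k)) (at t)"
        by (auto intro!: derivative_eq_intros)
      have 3: "((\<lambda>s. f ((u t)(k := z k + s * (y k - z k)))) has_real_derivative g k (u t) * (y k - z k)) (at t)"
        using DERIV_chain[OF _ 2, of "\<lambda>s. f ((u t)(k := s))" "g k (u t)"] 1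
        by (simp add: o_def u_def)
      have 4: "(u t)(k := z k + s * (y k - z k)) = u s" for s by (simp add: u_def)
      show ?thesis using 3 unfolding 4
        by (auto intro!: derivative_eq_intros simp: algebra_simps)
    qed
    have "\<exists>t::real. 0 < t \<and> t < 1 \<and> (f (u 1) - c k * (1 * (y k - z k))) - (f (u 0) - c k * (0 * (y k - z k)))
            = (1 - 0) * ((g k (u t) - c k) * (y k - z k))"
      by (rule MVT2) (use D in auto)
    then obtain t where t: "0 < t" "t < 1"
      "f (u 1) - f (u 0) - c k * (y k - z k) = (g k (u t) - c k) * (y k - z k)" by auto
    have "u 1 = w (Suc k)" "u 0 = w k" by (auto simp: u_def w_def)
    moreover have "\<bar>g k (u t) - c k\<bar> \<le> e" using deriv[OF k uE ud] t by auto
    ultimately show ?thesis using t(3)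
      by (simp add: abs_mult mult_right_mono abs_minus_commute)
  qed
  have "f y - f z - (\<Sum>i<n. c i * (y i - z i)) = (\<Sum>k<n. f (w (Suc k)) - f (w k) - c k * (y k - z k))"
    unfolding sum_subtractf using sum_lessThan_telescope[of "\<lambda>k. f (w k)" n] w0 wn by (simp add: sum_subtractf)
  also have "\<bar>\<dots>\<bar> \<le> (\<Sum>k<n. e * \<bar>z k - y k\<bar>)"
    by (rule order_trans[OF sum_abs]) (use step in \<open>auto intro: sum_mono\<close>)
  finally show ?thesis by (simp add: l1dist_def sum_distrib_left)
qed

text \<open>Strict differentiability at \<open>p\<close>, with both points varying. The partial
  derivatives stay within \<open>e\<close> of their values at \<open>p\<close> on a ball of radius
  \<open>r\<close>, and two points of the ball of radius \<open>r/2\<close> have distances adding up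
  to less than \<open>r\<close>, as the mean value estimate requires.\<close>

lemma Ck_strict_diff:
  assumes W: "openin (Euclidean_space n) W" and f: "Ck_on n (Suc k) W f" and p: "p \<in> W" and e: "e > 0"
  obtains d where "d > 0" "\<And>y. y \<in> EE n \<Longrightarrow> l1dist n p y < d \<Longrightarrow> y \<in> W"
    "\<And>y z. y \<in> EE n \<Longrightarrow> z \<in> EE n \<Longrightarrow> l1dist n p y < d \<Longrightarrow> l1dist n p z < d \<Longrightarrow>
      \<bar>f y - f z - (\<Sum>i<n. pdv i f p * (y i - z i))\<bar> \<le> e * l1dist n z y"
proof -
  have "\<forall>i. \<exists>d>0. i < n \<longrightarrow> (\<forall>y\<in>W. l1dist n p y < d \<longrightarrow> \<bar>pdv i f y - pdv i f p\<bar> < e)"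
    using continuous_Euclidean_iff[OF W, THEN iffD1, OF Ck_cont[OF Ck_SucD(2)[OF W f]]] p e
    by (metis zero_less_one)
  then obtain d where d: "\<And>i. d i > (0::real)"
    "\<And>i y. i < n \<Longrightarrow> y \<in> W \<Longrightarrow> l1dist n p y < d i \<Longrightarrow> \<bar>pdv i f y - pdv i f p\<bar> < e" by metis
  obtain d0 where d0: "d0 > 0" "\<And>y. y \<in> EE n \<Longrightarrow> l1dist n p y < d0 \<Longrightarrow> y \<in> W"
    using W p unfolding openin_Euclidean_iff by blast
  define r where "r = Min (insert d0 (d ` {..<n}))"
  have r: "r > 0" "r \<le> d0" "\<And>i. i < n \<Longrightarrow> r \<le> d i" unfolding r_def using d d0 by auto
  show ?thesis
  proof (rule that[of "r/2"])
    show "r/2 > 0" using r by simp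
    show "y \<in> W" if "y \<in> EE n" "l1dist n p y < r/2" for y using that r d0 by auto
    show "\<bar>f y - f z - (\<Sum>i<n. pdv i f p * (y i - z i))\<bar> \<le> e * l1dist n z y"
      if "y \<in> EE n" "z \<in> EE n" "l1dist n p y < r/2" "l1dist n p z < r/2" for y z
    proof (rule telescope_mean_value[where p = p and r = r and g = "\<lambda>i. pdv i f"])
      show "((\<lambda>t. f (x(i := t))) has_real_derivative pdv i f x) (at (x i)) \<and> \<bar>pdv i f x - pdv i f p\<bar> \<le> e"
        if i: "i < n" and x: "x \<in> EE n" "l1dist n p x < r" for i x
      proof -
        have "x \<in> W" using d0(2) x r by force
        moreover have "l1dist n p x < d i" using r(3)[OF i] x by linarith
        ultimately show ?thesis using Ck_SucD(1)[OF W f i] d(2)[OF i] by force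
      qed
    qed (use that in auto)
  qed
qed

text \<open>Strict differentiability with tolerance 1; the linear part is bounded by the sum
  \<open>B\<close> of the absolute values of the partial derivatives at \<open>p\<close>.\<close>

lemma Ck_Lipschitz:
  assumes W: "openin (Euclidean_space n) W" and f: "Ck_on n (Suc k) W f" and p: "p \<in> W"
  obtains C d where "C \<ge> 0" "d > 0" "\<And>y. y \<in> EE n \<Longrightarrow> l1dist n p y < d \<Longrightarrow> y \<in> W"
    "\<And>y z. y \<in> EE n \<Longrightarrow> z \<in> EE n \<Longrightarrow> l1dist n p y < d \<Longrightarrow> l1dist n p z < d \<Longrightarrow>
      \<bar>f y - f z\<bar> \<le> C * l1dist n z y"
proof -
  obtain d where d: "d > 0" "\<And>y. y \<in> EE n \<Longrightarrow> l1dist n p y < d \<Longrightarrow> y \<in> W"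
    "\<And>y z. y \<in> EE n \<Longrightarrow> z \<in> EE n \<Longrightarrow> l1dist n p y < d \<Longrightarrow> l1dist n p z < d \<Longrightarrow>
      \<bar>f y - f z - (\<Sum>i<n. pdv i f p * (y i - z i))\<bar> \<le> 1 * l1dist n z y"
    using Ck_strict_diff[OF W f p, of 1] by auto
  define B where "B = (\<Sum>i<n. \<bar>pdv i f p\<bar>)"
  have B: "\<bar>pdv i f p\<bar> \<le> B" if "i < n" for i
    unfolding B_def by (rule member_le_sum) (use that in auto)
  have S: "\<bar>\<Sum>i<n. pdv i f p * (y i - z i)\<bar> \<le> B * l1dist n z y" for y z
    unfolding l1dist_def sum_distrib_left
    by (rule order_trans[OF sum_abs], rule sum_mono)
      (auto simp: abs_mult abs_minus_commute intro!: mult_right_mono B)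
  show ?thesis
  proof (rule that[of "B + 1" d])
    show "B + 1 \<ge> 0" unfolding B_def by (simp add: sum_nonneg add_nonneg_nonneg)
    show "\<bar>f y - f z\<bar> \<le> (B + 1) * l1dist n z y"
      if "y \<in> EE n" "z \<in> EE n" "l1dist n p y < d" "l1dist n p z < d" for y z
      using d(3)[OF that] S[of y z] unfolding distrib_right by linarith
  qed (use d in auto)
qed

text \<open>The curve is only assumed differentiable at \<open>t0\<close>. Split the increment of
  \<open>f\<close> into its linear part and a remainder: by strict differentiability the remainder
  is small against the distance travelled, and that distance divided by
  \<open>\<bar>t - t0\<bar>\<close> stays bounded.\<close>

lemma Ck_chain_curve:
  assumes W: "openin (Euclidean_space m) W" and f: "Ck_on m (Suc k) W f"
    and h: "h t0 \<in> W" "\<And>t. h t \<in> EE m"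
    and dh: "\<And>j. j < m \<Longrightarrow> ((\<lambda>t. h t j) has_real_derivative h' j) (at t0)"
  shows "((\<lambda>t. f (h t)) has_real_derivative (\<Sum>j<m. pdv j f (h t0) * h' j)) (at t0)"
proof -
  let ?L = "\<lambda>t. \<Sum>j<m. pdv j f (h t0) * (h t j - h t0 j)"
  have dq: "((\<lambda>t. (h t j - h t0 j) / (t - t0)) \<longlongrightarrow> h' j) (at t0)" if "j < m" for j
    using dh[OF that] by (simp add: has_field_derivative_iff)
  have L: "((\<lambda>t. ?L t / (t - t0)) \<longlongrightarrow> (\<Sum>j<m. pdv j f (h t0) * h' j)) (at t0)"
    unfolding sum_divide_distrib times_divide_eq_right[symmetric]
    by (intro tendsto_sum tendsto_mult tendsto_const dq) auto
  let ?q = "\<lambda>t. l1dist m (h t0) (h t) / \<bar>t - t0\<bar>"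
  have q: "(?q \<longlongrightarrow> (\<Sum>j<m. \<bar>h' j\<bar>)) (at t0)"
    unfolding l1dist_def sum_divide_distrib
  proof (intro tendsto_sum)
    fix j assume "j \<in> {..<m}"
    then have "((\<lambda>t. \<bar>(h t j - h t0 j) / (t - t0)\<bar>) \<longlongrightarrow> \<bar>h' j\<bar>) (at t0)"
      by (intro tendsto_rabs dq) auto
    then show "((\<lambda>t. \<bar>h t0 j - h t j\<bar> / \<bar>t - t0\<bar>) \<longlongrightarrow> \<bar>h' j\<bar>) (at t0)"
      by (simp add: abs_divide abs_minus_commute)
  qed
  \<comment> \<open>Any number above the limit of \<open>?q\<close> would do; adding 1 also makes
    \<open>Q\<close> positive, so that \<open>e / Q\<close> is a legitimate tolerance.\<close>
  define Q where "Q = (\<Sum>j<m. \<bar>h' j\<bar>) + 1"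
  have Q: "Q > 0" unfolding Q_def by (smt (verit) sum_nonneg abs_ge_zero)
  have evq: "\<forall>\<^sub>F t in at t0. ?q t < Q"
    using order_tendstoD(2)[OF q, of Q] by (simp add: Q_def)
  have hc: "((\<lambda>t. l1dist m (h t0) (h t)) \<longlongrightarrow> 0) (at t0)"
  proof -
    have "((\<lambda>t. \<bar>h t0 j - h t j\<bar>) \<longlongrightarrow> \<bar>h t0 j - h t0 j\<bar>) (at t0)" if "j < m" for j
      using DERIV_isCont[OF dh[OF that]] by (intro tendsto_intros) (simp add: isCont_def)
    then have "((\<lambda>t. \<Sum>j<m. \<bar>h t0 j - h t j\<bar>) \<longlongrightarrow> (\<Sum>j<m. \<bar>h t0 j - h t0 j\<bar>)) (at t0)"
      by (intro tendsto_sum) auto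
    then show ?thesis by (simp add: l1dist_def)
  qed
  have R: "((\<lambda>t. (f (h t) - f (h t0) - ?L t) / (t - t0)) \<longlongrightarrow> 0) (at t0)"
  proof (rule tendstoI)
    fix e :: real assume e: "e > 0"
    obtain d where d: "d > 0"
      "\<And>y z. y \<in> EE m \<Longrightarrow> z \<in> EE m \<Longrightarrow> l1dist m (h t0) y < d \<Longrightarrow> l1dist m (h t0) z < d \<Longrightarrow>
      \<bar>f y - f z - (\<Sum>i<m. pdv i f (h t0) * (y i - z i))\<bar> \<le> e / Q * l1dist m z y"
      by (rule Ck_strict_diff[OF W f h(1) divide_pos_pos[OF e Q]]) (rule that)
    have "\<forall>\<^sub>F t in at t0. l1dist m (h t0) (h t) < d" using order_tendstoD(2)[OF hc d(1)] .
    moreover have "\<forall>\<^sub>F t in at t0. t \<noteq> t0" by (simp add: eventually_at_filter)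
    ultimately show "\<forall>\<^sub>F t in at t0. dist ((f (h t) - f (h t0) - ?L t) / (t - t0)) 0 < e"
      using evq
    proof eventually_elim
      case (elim t)
      have "\<bar>f (h t) - f (h t0) - ?L t\<bar> \<le> e / Q * l1dist m (h t0) (h t)"
        using d(2)[OF h(2) h(2)] elim d(1) by auto
      then have "\<bar>f (h t) - f (h t0) - ?L t\<bar> / \<bar>t - t0\<bar> \<le> e / Q * ?q t"
        using divide_right_mono[OF _ abs_ge_zero[of "t - t0"]] by fastforce
      also have "\<dots> < e / Q * Q" using elim e Q by (intro mult_strict_left_mono) auto
      also have "\<dots> = e" using Q by simp
      finally show ?case by (simp add: abs_divide)
    qed
  qed
  have "((\<lambda>t. (f (h t) - f (h t0) - ?L t) / (t - t0) + ?L t / (t - t0)) \<longlongrightarrow> 0 + (\<Sum>j<m. pdv j f (h t0) * h' j)) (at t0)"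
    by (rule tendsto_add[OF R L])
  then show ?thesis
    unfolding has_field_derivative_iff add_divide_distrib[symmetric] by simp
qed

lemma continuous_map_into_Euclidean:
  assumes "\<And>x. x \<in> topspace X \<Longrightarrow> h x \<in> EE m"
    and "\<And>j. j < m \<Longrightarrow> continuous_map X euclideanreal (\<lambda>x. h x j)"
  shows "continuous_map X (Euclidean_space m) h"
proof (rule continuous_map_eq)
  show "continuous_map X (Euclidean_space m) (\<lambda>x i. if i < m then h x i else 0)"
    by (rule continuous_map_componentwise_Euclidean_space[THEN iffD2]) (use assms in auto)
  show "(\<lambda>i. if i < m then h x i else 0) = h x" if "x \<in> topspace X" for x
    using assms(1)[OF that] by (auto simp: topspace_Euclidean_space)
qed

text \<open>The chain rule writes the partial derivatives as sums of products of
  \<open>pdv j f\<close> composed with \<open>h\<close> and of derivatives of \<open>h\<close>. The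
  first factors are again compositions, to which the induction hypothesis applies with
  \<open>pdv j f\<close> in place of \<open>f\<close>.\<close>

lemma Ck_comp:
  assumes W: "openin (Euclidean_space n) W" and V: "openin (Euclidean_space m) V"
    and h: "h ` W \<subseteq> V"
  shows "(\<And>j. j < m \<Longrightarrow> Ck_on n k W (\<lambda>x. h x j)) \<Longrightarrow> Ck_on m k V f \<Longrightarrow> Ck_on n k W (\<lambda>x. f (h x))"
proof (induction k arbitrary: f)
  case 0
  have "continuous_map (subtopology (Euclidean_space n) W) (Euclidean_space m) h"
    by (rule continuous_map_into_Euclidean)
     (use 0 h openin_subset[OF V] openin_subset[OF W] in \<open>auto simp del: topspace_subtopology simp add: topspace_subtopology\<close>)
  then have "continuous_map (subtopology (Euclidean_space n) W) (subtopology (Euclidean_space m) V) h"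
    using h by (auto simp: continuous_map_in_subtopology)
  from continuous_map_compose[OF this, of euclideanreal f] 0 show ?case by (simp add: o_def)
next
  case (Suc k)
  show ?case
  proof (rule Ck_SucI[OF W, where g = "\<lambda>i x. \<Sum>j<m. pdv j f (h x) * pdv i (\<lambda>x. h x j) x"])
    have "Ck_on n 0 W (\<lambda>x. f (h x))"
    proof -
      have "Ck_on n k W (\<lambda>x. f (h x))"
        by (rule Suc.IH[OF Ck_Suc_imp[OF W Suc.prems(1)] Ck_Suc_imp[OF V Suc.prems(2)]])
      then show ?thesis using Ck_cont by auto
    qed
    then show "continuous_map (subtopology (Euclidean_space n) W) euclideanreal (\<lambda>x. f (h x))" by simp
    fix i assume i: "i < n"
    show "Ck_on n k W (\<lambda>x. \<Sum>j<m. pdv j f (h x) * pdv i (\<lambda>x. h x j) x)"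
    proof (rule Ck_sum[OF W])
      fix j assume "j \<in> {..<m}"
      then have j: "j < m" by simp
      show "Ck_on n k W (\<lambda>x. pdv j f (h x) * pdv i (\<lambda>x. h x j) x)"
        by (rule Ck_mult[OF W Suc.IH[OF Ck_Suc_imp[OF W Suc.prems(1)] Ck_SucD(2)[OF V Suc.prems(2) j]]
              Ck_SucD(2)[OF W Suc.prems(1)[OF j] i]])
    qed
    fix x assume x: "x \<in> W"
    obtain d where d: "d > 0" "\<And>y. y \<in> EE n \<Longrightarrow> l1dist n x y < d \<Longrightarrow> y \<in> W"
      using W x unfolding openin_Euclidean_iff by blast
    \<comment> \<open>The curve is frozen at \<open>h x\<close> outside the interval where
      \<open>x(i := t)\<close> stays in \<open>W\<close>, since the chain rule wants a curve that
      lies in \<open>EE m\<close> for every \<open>t\<close>.\<close>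
    define u where "u t = (if \<bar>t - x i\<bar> < d then h (x(i := t)) else h x)" for t
    have ev: "\<forall>\<^sub>F t in nhds (x i). u t = h (x(i := t))"
      unfolding eventually_nhds_metric using d(1) by (auto simp: u_def dist_real_def)
    have "((\<lambda>t. f (u t)) has_real_derivative (\<Sum>j<m. pdv j f (u (x i)) * pdv i (\<lambda>x. h x j) x)) (at (x i))"
    proof (rule Ck_chain_curve[OF V Suc.prems(2)])
      show "u (x i) \<in> V" using x h d(1) by (auto simp: u_def)
      have "x(i := t) \<in> W" if "\<bar>t - x i\<bar> < d" for t
        by (rule d(2)) (use x openin_subset[OF W] i that in \<open>auto intro: EE_upd simp: l1dist_upd abs_minus_commute\<close>)
      then show "u t \<in> EE m" for t
        using h openin_subset[OF V] x by (auto simp: u_def)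
      fix j assume j: "j < m"
      show "((\<lambda>t. u t j) has_real_derivative pdv i (\<lambda>x. h x j) x) (at (x i))"
        by (rule DERIV_cong_ev[THEN iffD2, OF refl _ refl Ck_SucD(1)[OF W Suc.prems(1)[OF j] i x]])
         (rule eventually_mono[OF ev], simp only:)
    qed
    then have "((\<lambda>t. f (u t)) has_real_derivative (\<Sum>j<m. pdv j f (h x) * pdv i (\<lambda>x. h x j) x)) (at (x i))"
      using d(1) by (simp add: u_def)
    then show "((\<lambda>t. f (h (x(i := t)))) has_real_derivative (\<Sum>j<m. pdv j f (h x) * pdv i (\<lambda>x. h x j) x)) (at (x i))"
      by (rule DERIV_cong_ev[THEN iffD1, OF refl _ refl, rotated]) (use ev in \<open>auto elim: eventually_mono\<close>)
  qed
qed

section \<open>Estimates in coordinates\<close>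

text \<open>The maximum of the constants and the minimum of the radii serve all indices at once. The
  abstract form is used wherever a coordinatewise estimate is turned into one for a vector-valued
  map.\<close>

lemma uniform_constants:
  assumes "\<And>i. i < (n::nat) \<Longrightarrow> \<exists>C d. 0 \<le> C \<and> 0 < d \<and> P i C d"
    and mono: "\<And>i C d C' d'. P i C d \<Longrightarrow> C \<le> C' \<Longrightarrow> 0 < d' \<Longrightarrow> d' \<le> d \<Longrightarrow> P i C' (d'::real)"
  obtains C d :: real where "0 \<le> C" "0 < d" "\<And>i. i < n \<Longrightarrow> P i C d"
proof -
  have "\<exists>C d. 0 \<le> C \<and> 0 < d \<and> (\<forall>i<n. P i C d)"
    using assms(1)
  proof (induction n)
    case 0 then show ?case by (intro exI[of _ 1]) auto
  next
    case (Suc n)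
    then obtain C d C' d' where *: "0 \<le> C" "0 < d" "\<forall>i<n. P i C d" "0 \<le> C'" "0 < d'" "P n C' d'"
      by (metis lessI less_Suc_eq)
    then show ?case
      by (intro exI[of _ "max C C'"] exI[of _ "min d d'"])
        (auto simp: less_Suc_eq intro: mono[where C = C and d = d] mono[where C = C' and d = d'])
  qed
  then show thesis using that by blast
qed

text \<open>These are the coordinates that \<open>prod_manifold\<close> assigns to a pair, so that a
  map of two variables becomes a map on \<open>EE (n + m)\<close>.\<close>

definition cat :: "nat \<Rightarrow> (nat \<Rightarrow> real) \<Rightarrow> (nat \<Rightarrow> real) \<Rightarrow> nat \<Rightarrow> real" where
  "cat n x y = (\<lambda>i. if i < n then x i else y (i - n))"

lemma cat_EE: "x \<in> EE n \<Longrightarrow> y \<in> EE m \<Longrightarrow> cat n x y \<in> EE (n + m)"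
  by (auto simp: cat_def topspace_Euclidean_space)

lemma sum_lessThan_add: "(\<Sum>i<n + m. f i) = (\<Sum>i<n. f i) + (\<Sum>i<m. f (n + i))" for f :: "nat \<Rightarrow> real"
  by (induction m) auto

lemma l1dist_cat: "l1dist (n + m) (cat n x y) (cat n x' y') = l1dist n x x' + l1dist m y y'"
  by (simp add: l1dist_def sum_lessThan_add cat_def)

lemma cat_upd: "cat n x (y(i := t)) = (cat n x y)(n + i := t)"
  by (rule ext) (auto simp: cat_def)

lemma Ck_cat:
  assumes "\<And>r. r < n \<Longrightarrow> Ck_on l k W (\<lambda>x. f x r)" "\<And>r. r < m \<Longrightarrow> Ck_on l k W (\<lambda>x. g x r)" "s < n + m"
  shows "Ck_on l k W (\<lambda>x. cat n (f x) (g x) s)"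
  using assms by (cases "s < n") (auto simp: cat_def)

text \<open>The second difference vanishes if \<open>x = p\<close> or \<open>y = q\<close>, hence
  the product on the right. As a function of \<open>y\<close>, the difference
  \<open>f (cat n x y) - f (cat n p y)\<close> has partial derivatives of size
  \<open>C * l1dist n p x\<close>, because the first partials of \<open>f\<close> are Lipschitz; the
  mean value estimate with zero linear part does the rest.\<close>

lemma Ck_bilinear:
  assumes W: "openin (Euclidean_space (n + m)) W" and f: "Ck_on (n + m) (Suc (Suc k)) W f"
    and pq: "cat n p q \<in> W" "p \<in> EE n" "q \<in> EE m"
  obtains C d where "C \<ge> 0" "d > 0"
    "\<And>x y. x \<in> EE n \<Longrightarrow> y \<in> EE m \<Longrightarrow> l1dist n p x < d \<Longrightarrow> l1dist m q y < d \<Longrightarrow>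
      \<bar>f (cat n x y) - f (cat n x q) - f (cat n p y) + f (cat n p q)\<bar> \<le> C * l1dist n p x * l1dist m q y"
proof -
  obtain d0 where d0: "d0 > 0" "\<And>z. z \<in> EE (n + m) \<Longrightarrow> l1dist (n + m) (cat n p q) z < d0 \<Longrightarrow> z \<in> W"
    using W pq unfolding openin_Euclidean_iff by blast
  have ex: "\<exists>C d. 0 \<le> C \<and> 0 < d \<and>
    (\<forall>y z. y \<in> EE (n+m) \<longrightarrow> z \<in> EE (n+m) \<longrightarrow> l1dist (n+m) (cat n p q) y < d \<longrightarrow> l1dist (n+m) (cat n p q) z < d \<longrightarrow>
      \<bar>pdv (n + i) f y - pdv (n + i) f z\<bar> \<le> C * l1dist (n+m) z y)" if "i < m" for i
  proof -
    have "n + i < n + m" using that by simp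
    from Ck_Lipschitz[OF W Ck_SucD(2)[OF W f this] pq(1)] show ?thesis by metis
  qed
  obtain C d where C: "0 \<le> C" "0 < d" and lip: "\<And>i. i < m \<Longrightarrow>
    (\<forall>y z. y \<in> EE (n+m) \<longrightarrow> z \<in> EE (n+m) \<longrightarrow> l1dist (n+m) (cat n p q) y < d \<longrightarrow> l1dist (n+m) (cat n p q) z < d \<longrightarrow>
      \<bar>pdv (n + i) f y - pdv (n + i) f z\<bar> \<le> C * l1dist (n+m) z y)"
  proof (rule uniform_constants[OF ex])
    fix i C d C' d'
    assume *: "\<forall>y z. y \<in> EE (n+m) \<longrightarrow> z \<in> EE (n+m) \<longrightarrow> l1dist (n+m) (cat n p q) y < d \<longrightarrow> l1dist (n+m) (cat n p q) z < d \<longrightarrow>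
      \<bar>pdv (n + i) f y - pdv (n + i) f z\<bar> \<le> C * l1dist (n+m) z y" "C \<le> C'" "0 < d'" "d' \<le> (d::real)"
    show "\<forall>y z. y \<in> EE (n+m) \<longrightarrow> z \<in> EE (n+m) \<longrightarrow> l1dist (n+m) (cat n p q) y < d' \<longrightarrow> l1dist (n+m) (cat n p q) z < d' \<longrightarrow>
      \<bar>pdv (n + i) f y - pdv (n + i) f z\<bar> \<le> C' * l1dist (n+m) z y"
      using * by (meson l1dist_nonneg less_le_trans mult_right_mono order_trans)
  qed auto
  define e where "e = min d d0 / 2"
  have e: "e > 0" "2 * e \<le> d" "2 * e \<le> d0" using C d0 by (auto simp: e_def)
  show thesis
  proof (rule that[of C "e/2"])
    fix x y assume x: "x \<in> EE n" and y: "y \<in> EE m" and dx: "l1dist n p x < e/2" and dy: "l1dist m q y < e/2"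
    let ?F = "\<lambda>y. f (cat n x y) - f (cat n p y)"
    have "\<bar>?F y - ?F q - (\<Sum>i<m. 0 * (y i - q i))\<bar> \<le> (C * l1dist n p x) * l1dist m q y"
    proof (rule telescope_mean_value[where p = q and r = e and g = "\<lambda>i y. pdv (n + i) f (cat n x y) - pdv (n + i) f (cat n p y)"])
      fix i v assume i: "i < m" and v: "v \<in> EE m" "l1dist m q v < e"
      have E: "cat n x v \<in> EE (n+m)" "cat n p v \<in> EE (n+m)" using x v pq by (auto intro: cat_EE)
      have D: "l1dist (n+m) (cat n p q) (cat n x v) < 2 * e" "l1dist (n+m) (cat n p q) (cat n p v) < 2 * e"
        using v dx e by (auto simp: l1dist_cat)
      have Wm: "cat n x v \<in> W" "cat n p v \<in> W" using d0(2) E D e by force+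
      have i': "n + i < n + m" using i by simp
      have 1: "((\<lambda>t. f (cat n w (v(i := t)))) has_real_derivative pdv (n + i) f (cat n w v)) (at (v i))"
        if "cat n w v \<in> W" for w
        using Ck_SucD(1)[OF W f i' that] by (simp add: cat_upd) (simp add: cat_def)
      have "\<bar>pdv (n + i) f (cat n x v) - pdv (n + i) f (cat n p v)\<bar> \<le> C * l1dist (n+m) (cat n p v) (cat n x v)"
        using lip[OF i] E D e by force
      then show "((\<lambda>t. f (cat n x (v(i := t))) - f (cat n p (v(i := t)))) has_real_derivative
          pdv (n + i) f (cat n x v) - pdv (n + i) f (cat n p v)) (at (v i)) \<and>
          \<bar>pdv (n + i) f (cat n x v) - pdv (n + i) f (cat n p v) - 0\<bar> \<le> C * l1dist n p x"
        using DERIV_diff[OF 1[OF Wm(1)] 1[OF Wm(2)]] by (simp add: l1dist_cat)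
    qed (use y pq dy e in auto)
    then show "\<bar>f (cat n x y) - f (cat n x q) - f (cat n p y) + f (cat n p q)\<bar> \<le> C * l1dist n p x * l1dist m q y"
      by (simp add: algebra_simps)
  qed (use C e in auto)
qed

text \<open>The first partials are Lipschitz at \<open>p\<close>, so on a ball around
  \<open>p\<close> reaching beyond \<open>y\<close> they differ from their values at
  \<open>p\<close> by a multiple of the radius; the mean value estimate multiplies this by the
  distance once more.\<close>

lemma Ck_second_order:
  assumes W: "openin (Euclidean_space n) W" and f: "Ck_on n (Suc (Suc k)) W f" and p: "p \<in> W"
  obtains C d where "C \<ge> 0" "d > 0"
    "\<And>y. y \<in> EE n \<Longrightarrow> l1dist n p y < d \<Longrightarrow>
      \<bar>f y - f p - (\<Sum>i<n. pdv i f p * (y i - p i))\<bar> \<le> C * (l1dist n p y)\<^sup>2"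
proof -
  have pE: "p \<in> EE n" using openin_subset[OF W] p by auto
  obtain d0 where d0: "d0 > 0" "\<And>z. z \<in> EE n \<Longrightarrow> l1dist n p z < d0 \<Longrightarrow> z \<in> W"
    using W p unfolding openin_Euclidean_iff by blast
  have ex: "\<exists>C d. 0 \<le> C \<and> 0 < d \<and>
    (\<forall>y. y \<in> EE n \<longrightarrow> l1dist n p y < d \<longrightarrow> \<bar>pdv i f y - pdv i f p\<bar> \<le> C * l1dist n p y)" if "i < n" for i
    using Ck_Lipschitz[OF W Ck_SucD(2)[OF W f that] p] pE by (metis l1dist_self)
  obtain C d where C: "0 \<le> C" "0 < d" and lip: "\<And>i. i < n \<Longrightarrow>
    (\<forall>y. y \<in> EE n \<longrightarrow> l1dist n p y < d \<longrightarrow> \<bar>pdv i f y - pdv i f p\<bar> \<le> C * l1dist n p y)"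
  proof (rule uniform_constants[OF ex])
    fix i C d C' d'
    assume *: "\<forall>y. y \<in> EE n \<longrightarrow> l1dist n p y < d \<longrightarrow> \<bar>pdv i f y - pdv i f p\<bar> \<le> C * l1dist n p y" "C \<le> C'" "0 < d'" "d' \<le> (d::real)"
    show "\<forall>y. y \<in> EE n \<longrightarrow> l1dist n p y < d' \<longrightarrow> \<bar>pdv i f y - pdv i f p\<bar> \<le> C' * l1dist n p y"
      using * by (meson l1dist_nonneg less_le_trans mult_right_mono order_trans)
  qed auto
  define e where "e = min d d0 / 2"
  have e: "e > 0" "2 * e \<le> d" "2 * e \<le> d0" using C d0 by (auto simp: e_def)
  show thesis
  proof (rule that[of "2 * C" e])
    fix y assume y: "y \<in> EE n" "l1dist n p y < e"
    show "\<bar>f y - f p - (\<Sum>i<n. pdv i f p * (y i - p i))\<bar> \<le> 2 * C * (l1dist n p y)\<^sup>2"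
    \<comment> \<open>The mean value estimate is used on the ball of radius
      \<open>2 * l1dist n p y\<close>, which contains \<open>y\<close> strictly only if this is
      positive.\<close>
    proof (cases "l1dist n p y = 0")
      case True
      have "\<bar>p i - y i\<bar> \<le> 0" if "i < n" for i using l1dist_coord[OF that, of p y] True by simp
      then have "y = p" using y pE by (intro EE_eqI) auto
      then show ?thesis by simp
    next
      case False
      have pos: "l1dist n p y > 0" using False by (simp add: less_le)
      have "\<bar>f y - f p - (\<Sum>i<n. pdv i f p * (y i - p i))\<bar> \<le> (C * (2 * l1dist n p y)) * l1dist n p y"
      proof (rule telescope_mean_value[where p = p and r = "2 * l1dist n p y" and g = "\<lambda>i. pdv i f"])
        fix i x assume i: "i < n" and x: "x \<in> EE n" "l1dist n p x < 2 * l1dist n p y"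
        have "x \<in> W" using d0(2) x y e by force
        moreover have "\<bar>pdv i f x - pdv i f p\<bar> \<le> C * l1dist n p x"
          using lip[OF i] x y e by force
        moreover have "C * l1dist n p x \<le> C * (2 * l1dist n p y)" using x C by (intro mult_left_mono) auto
        ultimately show "((\<lambda>t. f (x(i := t))) has_real_derivative pdv i f x) (at (x i)) \<and>
            \<bar>pdv i f x - pdv i f p\<bar> \<le> C * (2 * l1dist n p y)"
          using Ck_SucD(1)[OF W f i] by force
      qed (use y pE pos in auto)
      then show ?thesis by (simp add: power2_eq_square algebra_simps)
    qed
  qed (use C e in auto)
qed

section \<open>Estimates for vector-valued maps\<close>

lemma smooth_euclideanD: "smooth_euclidean n m W f \<Longrightarrow> j < m \<Longrightarrow> Ck_on n k W (\<lambda>x. f x j)"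
  by (simp add: smooth_euclidean_def)

lemma smooth_Lipschitz:
  assumes W: "openin (Euclidean_space n) W" and f: "smooth_euclidean n m W f" and p: "p \<in> W"
  obtains C d where "C \<ge> 0" "d > 0" "\<And>y. y \<in> EE n \<Longrightarrow> l1dist n p y < d \<Longrightarrow> y \<in> W"
    "\<And>y z. y \<in> EE n \<Longrightarrow> z \<in> EE n \<Longrightarrow> l1dist n p y < d \<Longrightarrow> l1dist n p z < d \<Longrightarrow>
      l1dist m (f y) (f z) \<le> C * l1dist n y z"
proof -
  obtain d0 where d0: "d0 > 0" "\<And>z. z \<in> EE n \<Longrightarrow> l1dist n p z < d0 \<Longrightarrow> z \<in> W"
    using W p unfolding openin_Euclidean_iff by blast
  let ?P = "\<lambda>j C d. \<forall>y\<in>EE n. \<forall>z\<in>EE n. l1dist n p y < d \<longrightarrow> l1dist n p z < d \<longrightarrow> \<bar>f y j - f z j\<bar> \<le> C * l1dist n y z"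
  have ex: "\<exists>C d. 0 \<le> C \<and> 0 < d \<and> ?P j C d" if "j < m" for j
    using Ck_Lipschitz[OF W smooth_euclideanD[OF f that] p] by (metis l1dist_commute)
  obtain C d where C: "0 \<le> C" "0 < d" and lip: "\<And>j. j < m \<Longrightarrow> ?P j C d"
  proof (rule uniform_constants[OF ex])
    fix i C d C' d'
    assume "?P i C d" "C \<le> C'" "0 < d'" "d' \<le> (d::real)"
    then show "?P i C' d'"
      by (meson l1dist_nonneg less_le_trans mult_right_mono order_trans)
  qed auto
  show thesis
  proof (rule that[of "real m * C" "min d d0"])
    fix y z assume yz: "y \<in> EE n" "z \<in> EE n" "l1dist n p y < min d d0" "l1dist n p z < min d d0"
    have "l1dist m (f y) (f z) \<le> (\<Sum>j<m. C * l1dist n y z)"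
      unfolding l1dist_def[of m] by (rule sum_mono) (use lip yz in auto)
    then show "l1dist m (f y) (f z) \<le> real m * C * l1dist n y z" by simp
  qed (use C d0 in auto)
qed

lemma smooth_bilinear:
  assumes W: "openin (Euclidean_space (n + m)) W" and f: "smooth_euclidean (n + m) l W f"
    and pq: "cat n p q \<in> W" "p \<in> EE n" "q \<in> EE m"
  obtains C d where "C \<ge> 0" "d > 0"
    "\<And>x y. x \<in> EE n \<Longrightarrow> y \<in> EE m \<Longrightarrow> l1dist n p x < d \<Longrightarrow> l1dist m q y < d \<Longrightarrow>
      (\<Sum>j<l. \<bar>f (cat n x y) j - f (cat n x q) j - f (cat n p y) j + f (cat n p q) j\<bar>)
        \<le> C * l1dist n p x * l1dist m q y"
proof -
  let ?P = "\<lambda>j C d. \<forall>x\<in>EE n. \<forall>y\<in>EE m. l1dist n p x < d \<longrightarrow> l1dist m q y < d \<longrightarrow>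
     \<bar>f (cat n x y) j - f (cat n x q) j - f (cat n p y) j + f (cat n p q) j\<bar> \<le> C * l1dist n p x * l1dist m q y"
  have ex: "\<exists>C d. 0 \<le> C \<and> 0 < d \<and> ?P j C d" if "j < l" for j
    using Ck_bilinear[OF W smooth_euclideanD[OF f that] pq] by metis
  obtain C d where C: "0 \<le> C" "0 < d" and b: "\<And>j. j < l \<Longrightarrow> ?P j C d"
  proof (rule uniform_constants[OF ex])
    fix i C d C' d'
    assume "?P i C d" "C \<le> C'" "0 < d'" "d' \<le> (d::real)"
    then show "?P i C' d'"
      by (meson l1dist_nonneg less_le_trans mult_right_mono order_trans)
  qed auto
  show thesis
  proof (rule that[of "real l * C" d])
    fix x y assume xy: "x \<in> EE n" "y \<in> EE m" "l1dist n p x < d" "l1dist m q y < d"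
    have "(\<Sum>j<l. \<bar>f (cat n x y) j - f (cat n x q) j - f (cat n p y) j + f (cat n p q) j\<bar>)
      \<le> (\<Sum>j<l. C * l1dist n p x * l1dist m q y)"
      by (rule sum_mono) (use b xy in auto)
    then show "(\<Sum>j<l. \<bar>f (cat n x y) j - f (cat n x q) j - f (cat n p y) j + f (cat n p q) j\<bar>)
        \<le> real l * C * l1dist n p x * l1dist m q y" by (simp add: mult.assoc)
  qed (use C in auto)
qed

lemma smooth_second_order:
  assumes W: "openin (Euclidean_space n) W" and f: "smooth_euclidean n m W f" and p: "p \<in> W"
  obtains C d where "C \<ge> 0" "d > 0"
    "\<And>y j. y \<in> EE n \<Longrightarrow> l1dist n p y < d \<Longrightarrow> j < m \<Longrightarrow>
      \<bar>f y j - f p j - (\<Sum>i<n. pdv i (\<lambda>x. f x j) p * (y i - p i))\<bar> \<le> C * (l1dist n p y)\<^sup>2"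
proof -
  let ?P = "\<lambda>j C d. \<forall>y\<in>EE n. l1dist n p y < d \<longrightarrow>
     \<bar>f y j - f p j - (\<Sum>i<n. pdv i (\<lambda>x. f x j) p * (y i - p i))\<bar> \<le> C * (l1dist n p y)\<^sup>2"
  have ex: "\<exists>C d. 0 \<le> C \<and> 0 < d \<and> ?P j C d" if j: "j < m" for j
  proof -
    obtain C d where "C \<ge> 0" "d > 0" "\<And>y. y \<in> EE n \<Longrightarrow> l1dist n p y < d \<Longrightarrow>
      \<bar>f y j - f p j - (\<Sum>i<n. pdv i (\<lambda>x. f x j) p * (y i - p i))\<bar> \<le> C * (l1dist n p y)\<^sup>2"
      by (rule Ck_second_order[OF W smooth_euclideanD[OF f j] p]) (rule that)
    then show ?thesis by blast
  qed
  obtain C d where C: "0 \<le> C" "0 < d" and b: "\<And>j. j < m \<Longrightarrow> ?P j C d"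
  proof (rule uniform_constants[OF ex])
    fix i C d C' d'
    assume "?P i C d" "C \<le> C'" "0 < d'" "d' \<le> (d::real)"
    then show "?P i C' d'"
      by (meson zero_le_power2 less_le_trans mult_right_mono order_trans)
  qed auto
  show thesis by (rule that[OF C]) (use b in auto)
qed

text \<open>
  Under \<open>sq\<close> the quantity \<open>a\<close> at most doubles and \<open>b\<close> at least doubles, up to quadratic errors, which
  \<open>ln (1 + C a)\<close> and \<open>- ln (1 - C b)\<close> absorb. Iterating until \<open>a\<close> leaves the range compares \<open>b\<close> with \<open>a\<close>.
\<close>

lemma doubling_Lipschitz:
  fixes a b :: "'x \<Rightarrow> real"
  assumes C: "C > 0" and r: "r > 0"
    and sq: "\<And>x. x \<in> S \<Longrightarrow> a x < r \<Longrightarrow> sq x \<in> S"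
    and a: "\<And>x. x \<in> S \<Longrightarrow> a x < r \<Longrightarrow> 0 \<le> a x"
      "\<And>x. x \<in> S \<Longrightarrow> 0 \<le> a (sq x)"
      "\<And>x. x \<in> S \<Longrightarrow> a x < r \<Longrightarrow> a (sq x) \<le> 2 * a x + C * (a x)\<^sup>2"
    and b: "\<And>x. x \<in> S \<Longrightarrow> a x < r \<Longrightarrow> 0 \<le> b x \<and> C * b x \<le> 1/2"
      "\<And>x. x \<in> S \<Longrightarrow> a x < r \<Longrightarrow> 2 * b x - C * (b x)\<^sup>2 \<le> b (sq x)"
  obtains K where "K \<ge> 0" "\<And>x. x \<in> S \<Longrightarrow> a x < r \<Longrightarrow> b x \<le> K * a x"
proof -
  define al where "al x = ln (1 + C * a x)" for x
  define be where "be x = - ln (1 - C * b x)" for x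
  define a0 where "a0 = ln (1 + C * r)"
  have a0: "a0 > 0" unfolding a0_def using C r by (intro ln_gt_zero) simp
  have lt: "al x < a0 \<longleftrightarrow> a x < r" if "0 \<le> a x" for x
    unfolding al_def a0_def using C r that by (subst ln_less_cancel_iff) (auto intro: add_pos_nonneg)
  \<comment> \<open>While \<open>C * b x\<close> is at most 1/2, \<open>be x\<close> is at most
    \<open>ln 2\<close>. If \<open>al x\<close> is below \<open>a0 / 2^k\<close>, then
    \<open>k\<close> squarings stay inside the range, so the bound \<open>ln 2\<close> can be
    divided by \<open>2^k\<close>.\<close>
  have key: "be x \<le> ln 2 / 2^k" if "x \<in> S" "0 \<le> a x" "al x < a0 / 2^k" for k x
    using that
  proof (induction k arbitrary: x)
    case 0
    then have "C * b x \<le> 1/2" using b(1)[of x] lt[of x] by auto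
    then have "ln (1/2) \<le> ln (1 - C * b x)" by (intro ln_mono) auto
    then show ?case by (simp add: be_def ln_div)
  next
    case (Suc k)
    have "a0 / 2 ^ Suc k \<le> a0" using a0 by (simp add: field_simps) (use one_le_power[of "2::real" k] in linarith)
    then have ax: "a x < r" using lt[of x] Suc.prems by simp
    have s: "sq x \<in> S" "0 \<le> a (sq x)" using sq a ax Suc.prems by auto
    have "1 + C * a (sq x) \<le> 1 + C * (2 * a x + C * (a x)\<^sup>2)"
      using a(3)[OF Suc.prems(1) ax] C by simp
    also have "\<dots> = (1 + C * a x)\<^sup>2" by (simp add: power2_eq_square algebra_simps)
    finally have "ln (1 + C * a (sq x)) \<le> ln ((1 + C * a x)\<^sup>2)"
      using s C by (intro ln_mono) (auto intro: add_pos_nonneg)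
    also have "\<dots> = 2 * ln (1 + C * a x)" using C Suc.prems by (simp add: ln_realpow add_pos_nonneg)
    finally have "al (sq x) \<le> 2 * al x" by (simp add: al_def)
    then have als: "al (sq x) < a0 / 2 ^ k" using Suc.prems(3) by simp
    have "a0 / 2 ^ k \<le> a0" using a0 one_le_power[of "2::real" k] by (simp add: field_simps)
    then have asq: "a (sq x) < r" using lt[OF s(2)] als by simp
    have bs: "C * b (sq x) \<le> 1/2" using b(1)[OF s(1) asq] by simp
    have bx: "C * b x \<le> 1/2" using b(1)[OF Suc.prems(1) ax] by simp
    have "C * (2 * b x - C * (b x)\<^sup>2) \<le> C * b (sq x)"
      using b(2)[OF Suc.prems(1) ax] C by (intro mult_left_mono) auto
    then have "1 - C * b (sq x) \<le> (1 - C * b x)\<^sup>2" by (simp add: power2_eq_square algebra_simps)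
    then have "ln (1 - C * b (sq x)) \<le> ln ((1 - C * b x)\<^sup>2)" using bs by (intro ln_mono) auto
    also have "\<dots> = 2 * ln (1 - C * b x)" using bx by (simp add: ln_realpow)
    finally have "2 * be x \<le> be (sq x)" by (simp add: be_def)
    with Suc.IH[OF s als] show ?case by simp
  qed
  show thesis
  proof (rule that[of "2 * ln 2 / a0"])
    show "2 * ln 2 / a0 \<ge> 0" using a0 by simp
    fix x assume x: "x \<in> S" "a x < r"
    have ax: "0 \<le> a x" using a x by auto
    have bx: "0 \<le> b x" "C * b x \<le> 1/2" using b(1)[OF x] by auto
    have alC: "al x \<le> C * a x" unfolding al_def using C ax by (intro ln_add_one_self_le_self) auto
    have al0: "al x \<ge> 0" unfolding al_def using C ax by simp
    have beC: "C * b x \<le> be x" unfolding be_def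
      using ln_le_minus_one[of "1 - C * b x"] bx by simp
    have "be x \<le> 2 * ln 2 / a0 * al x"
    proof (cases "al x = 0")
      case True
      have "be x \<le> ln 2 / 2^k" for k using key[OF x(1) ax, of k] True a0 by simp
      moreover have "(\<lambda>k. ln 2 / 2^k :: real) \<longlonglongrightarrow> 0" by real_asymp
      ultimately have "be x \<le> 0" by (intro LIMSEQ_le_const) auto
      then show ?thesis using True by simp
    next
      case False
      then have "al x > 0" using al0 by simp
      have "(\<lambda>k. a0 / 2^k :: real) \<longlonglongrightarrow> 0" by real_asymp
      then have "\<forall>\<^sub>F k in sequentially. a0 / 2^k < al x" using order_tendstoD(2) \<open>al x > 0\<close> by blast
      then have ex: "\<exists>k. a0 / 2^k \<le> al x" by (auto simp: eventually_sequentially intro: less_imp_le)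
      \<comment> \<open>By minimality \<open>k - 1\<close> squarings are still allowed, so the bound
        with \<open>2^(k-1)\<close> holds; replacing it by \<open>2^k\<close> costs the factor 2 in
        \<open>2 * ln 2 / a0\<close>.\<close>
      define k where "k = (LEAST k. a0 / 2^k \<le> al x)"
      have k: "a0 / 2^k \<le> al x" unfolding k_def by (rule LeastI_ex[OF ex])
      have "k \<noteq> 0"
      proof
        assume "k = 0"
        then show False using k lt[OF ax] x by simp
      qed
      then obtain k' where k': "k = Suc k'" by (cases k) auto
      have "al x < a0 / 2^k'" using not_less_Least[of k' "\<lambda>k. a0 / 2^k \<le> al x"] k' by (simp add: k_def[symmetric])
      from key[OF x(1) ax this] have "be x \<le> ln 2 / 2^k'" .
      also have "\<dots> = 2 * ln 2 / a0 * (a0 / 2^k)" using a0 k' by simp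
      also have "\<dots> \<le> 2 * ln 2 / a0 * al x" using k a0 by (intro mult_left_mono) auto
      finally show ?thesis .
    qed
    also have "\<dots> \<le> 2 * ln 2 / a0 * (C * a x)" using alC a0 by (intro mult_left_mono) auto
    finally have "C * b x \<le> C * (2 * ln 2 / a0 * a x)" using beC by (simp add: algebra_simps)
    then show "b x \<le> 2 * ln 2 / a0 * a x" using C mult_le_cancel_left_pos by blast
  qed
qed

text \<open>The quotients \<open>g s / s\<close> are bounded, so along some null sequence they
  converge to a number \<open>d\<close>. Comparing \<open>g (k * s)\<close> with
  \<open>k * g s\<close> costs at most \<open>C * (k * s)\<^sup>2\<close> whatever \<open>k\<close>
  is, and multiples of small \<open>s\<close> approximate every \<open>t\<close>; hence
  \<open>d\<close> is the derivative at 0, with a quadratic error. Negative \<open>t\<close> are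
  reduced to positive ones through \<open>g 0 = 0\<close>, which doubles the constant.\<close>

lemma approximately_additive_real:
  fixes g :: "real \<Rightarrow> real"
  assumes r: "r > 0" and C: "C \<ge> 0"
    and add: "\<And>s t. \<bar>s\<bar> < r \<Longrightarrow> \<bar>t\<bar> < r \<Longrightarrow> \<bar>s + t\<bar> < r \<Longrightarrow> \<bar>g (s + t) - g s - g t\<bar> \<le> C * \<bar>s\<bar> * \<bar>t\<bar>"
    and bd: "\<And>s. \<bar>s\<bar> < r \<Longrightarrow> \<bar>g s\<bar> \<le> L * \<bar>s\<bar>"
  obtains d where "\<And>s. \<bar>s\<bar> < r \<Longrightarrow> \<bar>g s - d * s\<bar> \<le> 2 * C * s\<^sup>2"
proof -
  have g0: "g 0 = 0" using bd[of 0] r by simp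
  have mult: "\<bar>g (real k * s) - real k * g s\<bar> \<le> C * (real k * s)\<^sup>2" if "s \<ge> 0" "real k * s < r" "s < r" for k s
    using that(2)
  proof (induction k)
    case 0 then show ?case using g0 by simp
  next
    case (Suc k)
    have eq: "real (Suc k) * s = real k * s + s" by (simp add: algebra_simps)
    have ks: "0 \<le> real k * s" "real k * s < r" using Suc.prems that by (auto simp: algebra_simps)
    have "\<bar>g (real k * s + s) - g (real k * s) - g s\<bar> \<le> C * \<bar>real k * s\<bar> * \<bar>s\<bar>"
      by (rule add) (use ks that Suc.prems eq in auto)
    moreover note Suc.IH[OF ks(2)]
    \<comment> \<open>The square is the right shape for the bound: its increment from
      \<open>k\<close> to \<open>k + 1\<close> absorbs the new cross term.\<close>
    moreover have "C * (real k * s)\<^sup>2 + C * \<bar>real k * s\<bar> * \<bar>s\<bar> \<le> C * (real k * s + s)\<^sup>2"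
    proof -
      have "C * (real k * s + s)\<^sup>2 = C * (real k * s)\<^sup>2 + C * (real k * s) * s + C * (real k * s + s) * s"
        by (simp add: power2_eq_square algebra_simps)
      moreover have "0 \<le> C * (real k * s + s) * s" using C that ks by simp
      ultimately show ?thesis using ks that by simp
    qed
    moreover have "g (real (Suc k) * s) - real (Suc k) * g s
       = (g (real k * s + s) - g (real k * s) - g s) + (g (real k * s) - real k * g s)"
      unfolding eq by (simp add: algebra_simps)
    ultimately show ?case unfolding eq by linarith
  qed
  \<comment> \<open>With \<open>n + 2\<close> rather than \<open>n + 1\<close> the value at
    \<open>n = 0\<close> is already below \<open>r\<close>.\<close>
  define s where "s n = r / real (n + 2)" for n
  have s: "0 < s n" "s n < r" for n using r by (auto simp: s_def field_simps intro: add_pos_nonneg)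
  define q where "q n = g (s n) / s n" for n
  have "\<bar>q n\<bar> \<le> L" for n
    using bd[of "s n"] s[of n] unfolding q_def abs_divide by (simp add: field_simps)
  then have "bounded (range q)" by (auto simp: bounded_iff)
  then obtain d f where f: "strict_mono f" and d: "(q \<circ> f) \<longlonglongrightarrow> d"
    using bounded_imp_convergent_subsequence by blast
  have s0: "(s \<circ> f) \<longlonglongrightarrow> 0"
  proof -
    have "s \<longlonglongrightarrow> 0" unfolding s_def by real_asymp
    then show ?thesis using f by (rule LIMSEQ_subseq_LIMSEQ)
  qed
  have pos: "\<bar>g t - d * t\<bar> \<le> C * t\<^sup>2" if t: "0 \<le> t" "t < r" for t
  proof -
    define N where "N n = nat \<lfloor>t / s (f n)\<rfloor>" for n
    define e where "e n = t - real (N n) * s (f n)" for n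
    have e: "0 \<le> e n" "e n \<le> s (f n)" for n
    proof -
      have "real (N n) = of_int \<lfloor>t / s (f n)\<rfloor>" unfolding N_def using t s[of "f n"] by simp
      then have "real (N n) \<le> t / s (f n)" "t / s (f n) \<le> real (N n) + 1" by linarith+
      then show "0 \<le> e n" "e n \<le> s (f n)" using s[of "f n"] by (auto simp: e_def field_simps)
    qed
    have e0: "e \<longlonglongrightarrow> 0"
      by (rule tendsto_sandwich[OF _ _ tendsto_const s0]) (use e in auto)
    have Ns: "(\<lambda>n. t - e n) \<longlonglongrightarrow> t" using tendsto_diff[OF tendsto_const e0, of t] by simp
    have est: "\<bar>g t - (t - e n) * q (f n)\<bar> \<le> C * (t - e n)\<^sup>2 + (\<bar>L\<bar> * e n + C * t * e n)" for n
    proof -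
      have 1: "t - e n = real (N n) * s (f n)" by (simp add: e_def)
      then have te: "0 \<le> t - e n" using s[of "f n"] by simp
      have er: "e n < r" using e[of n] s[of "f n"] by linarith
      have "\<bar>g (t - e n) - real (N n) * g (s (f n))\<bar> \<le> C * (t - e n)\<^sup>2"
        unfolding 1 by (rule mult) (use s[of "f n"] 1 e[of n] t in auto)
      moreover have "real (N n) * g (s (f n)) = (t - e n) * q (f n)"
        unfolding 1 q_def using s[of "f n"] by simp
      moreover have "\<bar>g ((t - e n) + e n) - g (t - e n) - g (e n)\<bar> \<le> C * \<bar>t - e n\<bar> * \<bar>e n\<bar>"
        by (rule add) (use te e[of n] t er in auto)
      moreover have "C * \<bar>t - e n\<bar> * \<bar>e n\<bar> \<le> C * t * e n"
        using te e[of n] C by (intro mult_mono) auto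
      moreover have "\<bar>g (e n)\<bar> \<le> \<bar>L\<bar> * e n"
        using bd[of "e n"] e[of n] er by (smt (verit) mult_right_mono)
      moreover have "(t - e n) + e n = t" by simp
      ultimately show ?thesis by (simp only:) linarith
    qed
    have "(\<lambda>n. \<bar>g t - (t - e n) * (q \<circ> f) n\<bar>) \<longlonglongrightarrow> \<bar>g t - t * d\<bar>"
      by (intro tendsto_intros Ns d)
    moreover have "(\<lambda>n. C * (t - e n)\<^sup>2 + (\<bar>L\<bar> * e n + C * t * e n)) \<longlonglongrightarrow> C * t\<^sup>2 + (\<bar>L\<bar> * 0 + C * t * 0)"
      by (intro tendsto_intros Ns e0)
    ultimately have "\<bar>g t - t * d\<bar> \<le> C * t\<^sup>2 + (\<bar>L\<bar> * 0 + C * t * 0)"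
      by (rule LIMSEQ_le) (use est in auto)
    then show ?thesis by (simp add: mult.commute)
  qed
  show thesis
  proof (rule that[of d])
    fix t :: real assume t: "\<bar>t\<bar> < r"
    show "\<bar>g t - d * t\<bar> \<le> 2 * C * t\<^sup>2"
    proof (cases "t \<ge> 0")
      case True
      then show ?thesis using pos[of t] t C by (smt (verit) mult_right_mono zero_le_power2)
    next
      case False
      have "\<bar>g (t + - t) - g t - g (- t)\<bar> \<le> C * \<bar>t\<bar> * \<bar>- t\<bar>" by (rule add) (use t r in auto)
      moreover have "C * \<bar>t\<bar> * \<bar>- t\<bar> = C * t\<^sup>2" by (simp add: power2_eq_square mult.assoc)
      moreover have "\<bar>g (- t) - d * (- t)\<bar> \<le> C * (- t)\<^sup>2" using pos[of "- t"] t False by simp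
      moreover have "t + - t = 0" "(- t)\<^sup>2 = t\<^sup>2" by simp_all
      ultimately show ?thesis using g0 by (simp only:)
    qed
  qed
qed

text \<open>Build \<open>v\<close> up one coordinate at a time. Each step costs
  \<open>C * R\<^sup>2\<close> for additivity and \<open>2 * C * R\<^sup>2\<close> for the
  one-dimensional estimate, which is where \<open>3 * C\<close> comes from.\<close>

lemma approximately_additive:
  fixes f :: "(nat \<Rightarrow> real) \<Rightarrow> real"
  assumes r: "r > 0" and C: "C \<ge> 0"
    and add: "\<And>v w. v \<in> EE n \<Longrightarrow> w \<in> EE n \<Longrightarrow> l1dist n (\<lambda>_. 0) v < r \<Longrightarrow> l1dist n (\<lambda>_. 0) w < r \<Longrightarrow>
       l1dist n (\<lambda>_. 0) (\<lambda>i. v i + w i) < r \<Longrightarrow>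
       \<bar>f (\<lambda>i. v i + w i) - f v - f w\<bar> \<le> C * l1dist n (\<lambda>_. 0) v * l1dist n (\<lambda>_. 0) w"
    and bd: "\<And>v. v \<in> EE n \<Longrightarrow> l1dist n (\<lambda>_. 0) v < r \<Longrightarrow> \<bar>f v\<bar> \<le> L * l1dist n (\<lambda>_. 0) v"
  obtains d C' where "C' \<ge> 0"
    "\<And>v. v \<in> EE n \<Longrightarrow> l1dist n (\<lambda>_. 0) v < r \<Longrightarrow> \<bar>f v - (\<Sum>i<n. d i * v i)\<bar> \<le> C' * (l1dist n (\<lambda>_. 0) v)\<^sup>2"
proof -
  define sg where "sg i s = (\<lambda>j. if j = i then s else 0 :: real)" for i :: nat and s
  have sgE: "sg i s \<in> EE n" if "i < n" for i s using that by (auto simp: sg_def topspace_Euclidean_space)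
  have sgn: "l1dist n (\<lambda>_. 0) (sg i s) = \<bar>s\<bar>" if "i < n" for i s
    unfolding l1dist_def sg_def using that by (subst sum.remove[of _ i]) auto
  have "\<exists>d. \<forall>s. \<bar>s\<bar> < r \<longrightarrow> \<bar>f (sg i s) - d * s\<bar> \<le> 2 * C * s\<^sup>2" if i: "i < n" for i
  proof -
    have "\<bar>f (sg i (s + t)) - f (sg i s) - f (sg i t)\<bar> \<le> C * \<bar>s\<bar> * \<bar>t\<bar>"
      if "\<bar>s\<bar> < r" "\<bar>t\<bar> < r" "\<bar>s + t\<bar> < r" for s t
    proof -
      have eq: "(\<lambda>j. sg i s j + sg i t j) = sg i (s + t)" by (auto simp: sg_def)
      show ?thesis
        using add[OF sgE[OF i, of s] sgE[OF i, of t]] that sgn[OF i] unfolding eq by simp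
    qed
    moreover have "\<bar>f (sg i s)\<bar> \<le> L * \<bar>s\<bar>" if "\<bar>s\<bar> < r" for s
      using bd[OF sgE[OF i, of s]] that sgn[OF i] by simp
    ultimately show ?thesis using approximately_additive_real[OF r C, of "\<lambda>s. f (sg i s)" L] by metis
  qed
  then obtain d where d: "\<And>i s. i < n \<Longrightarrow> \<bar>s\<bar> < r \<Longrightarrow> \<bar>f (sg i s) - d i * s\<bar> \<le> 2 * C * s\<^sup>2" by metis
  show thesis
  proof (rule that[of "real n * (3 * C)" d])
    fix v assume v: "v \<in> EE n" "l1dist n (\<lambda>_. 0) v < r"
    define R where "R = l1dist n (\<lambda>_. 0) v"
    define p where "p k = (\<lambda>i. if i < k then v i else 0)" for k
    have pn: "p n = v" using v by (auto simp: p_def topspace_Euclidean_space)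
    have pE: "p k \<in> EE n" for k using v by (auto simp: p_def topspace_Euclidean_space)
    have pR: "l1dist n (\<lambda>_. 0) (p k) \<le> R" for k
      unfolding R_def l1dist_def by (rule sum_mono) (auto simp: p_def)
    have vi: "\<bar>v i\<bar> \<le> R" if "i < n" for i using l1dist_coord[OF that, of "\<lambda>_. 0" v] by (simp add: R_def)
    have "\<bar>f (p k) - (\<Sum>i<k. d i * v i)\<bar> \<le> real k * (3 * C * R\<^sup>2)" if "k \<le> n" for k
      using that
    proof (induction k)
      case 0
      have "p 0 = (\<lambda>_. 0)" by (simp add: p_def)
      then show ?case using bd[OF pE[of 0]] r by simp
    next
      case (Suc k)
      then have k: "k < n" by simp
      have eq: "(\<lambda>i. p k i + sg k (v k) i) = p (Suc k)" by (auto simp: p_def sg_def)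
      have Rr: "R < r" using v by (simp add: R_def)
      have "\<bar>f (p (Suc k)) - f (p k) - f (sg k (v k))\<bar> \<le> C * l1dist n (\<lambda>_. 0) (p k) * l1dist n (\<lambda>_. 0) (sg k (v k))"
        using add[OF pE[of k] sgE[OF k, of "v k"]] pR[of k] pR[of "Suc k"] Rr vi[OF k] sgn[OF k] unfolding eq by fastforce
      also have "\<dots> \<le> C * R * R"
        unfolding sgn[OF k] using pR[of k] vi[OF k] C by (intro mult_mono) (auto simp: R_def)
      finally have 1: "\<bar>f (p (Suc k)) - f (p k) - f (sg k (v k))\<bar> \<le> C * R\<^sup>2" by (simp add: power2_eq_square)
      have "\<bar>f (sg k (v k)) - d k * v k\<bar> \<le> 2 * C * (v k)\<^sup>2" by (rule d[OF k]) (use vi[OF k] Rr in auto)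
      also have "\<dots> \<le> 2 * C * R\<^sup>2"
        using C vi[OF k] by (intro mult_left_mono) (auto simp: abs_le_square_iff[symmetric] R_def)
      finally have "\<bar>f (p (Suc k)) - ((\<Sum>i<k. d i * v i) + d k * v k)\<bar> \<le> real k * (3 * C * R\<^sup>2) + 3 * C * R\<^sup>2"
        using 1 Suc by linarith
      then show ?case by (simp add: algebra_simps)
    qed
    from this[of n] show "\<bar>f v - (\<Sum>i<n. d i * v i)\<bar> \<le> real n * (3 * C) * (l1dist n (\<lambda>_. 0) v)\<^sup>2"
      by (simp add: pn R_def algebra_simps)
  qed (use C in simp)
qed

text \<open>Independent rows admit dual functionals, by induction on their number. The new row minus
  its expansion in the old ones is a vector \<open>c\<close> on which all old functionals
  \<open>L i\<close> vanish. Independence makes it nonzero, and an entry \<open>c p\<close>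
  different from 0 yields a functional \<open>n\<close> for the new row, by which the old
  functionals are then corrected.\<close>

lemma left_inverse_matrix:
  fixes M :: "nat \<Rightarrow> nat \<Rightarrow> real"
  assumes "\<And>x. (\<And>j. j < N \<Longrightarrow> (\<Sum>k<a. x k * M k j) = 0) \<Longrightarrow> (\<And>k. k < a \<Longrightarrow> x k = 0)"
  obtains L where "\<And>i k. i < a \<Longrightarrow> k < a \<Longrightarrow> (\<Sum>j<N. L i j * M k j) = (if i = k then 1 else 0 :: real)"
proof -
  have "\<exists>L. \<forall>i<a. \<forall>k<a. (\<Sum>j<N. L i j * M k j) = (if i = k then 1 else 0 :: real)"
    using assms
  proof (induction a)
    case (Suc a)
    have ind: "x k = 0" if x: "\<And>j. j < N \<Longrightarrow> (\<Sum>k<a. x k * M k j) = 0" "k < a" for x k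
    proof -
      have "(x(a := 0)) k = 0"
      proof (rule Suc.prems)
        fix j assume "j < N"
        have "(\<Sum>k<a. (x(a := 0)) k * M k j) = (\<Sum>k<a. x k * M k j)" by (rule sum.cong) auto
        then show "(\<Sum>k<Suc a. (x(a := 0)) k * M k j) = 0" using x(1)[OF \<open>j < N\<close>] by simp
      qed (use x in simp)
      then show "x k = 0" using x by simp
    qed
    have "\<exists>L. \<forall>i<a. \<forall>k<a. (\<Sum>j<N. L i j * M k j) = (if i = k then 1 else 0 :: real)"
      by (rule Suc.IH) (rule ind)
    then obtain L where L: "\<And>i k. i < a \<Longrightarrow> k < a \<Longrightarrow> (\<Sum>j<N. L i j * M k j) = (if i = k then 1 else 0)"
      by blast
    define la where "la i = (\<Sum>j<N. L i j * M a j)" for i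
    define c where "c j = M a j - (\<Sum>k<a. la k * M k j)" for j
    have "\<exists>p<N. c p \<noteq> 0"
    proof (rule ccontr)
      assume "\<not> (\<exists>p<N. c p \<noteq> 0)"
      then have c: "\<And>j. j < N \<Longrightarrow> c j = 0" by auto
      have "(\<lambda>k. if k = a then 1 else - la k) a = (0::real)"
      proof (rule Suc.prems[where x = "\<lambda>k. if k = a then 1 else - la k"])
        fix j assume "j < N"
        have "(\<Sum>k<a. (if k = a then 1 else - la k) * M k j) = (\<Sum>k<a. - (la k * M k j))"
          by (rule sum.cong) auto
        then show "(\<Sum>k<Suc a. (if k = a then 1 else - la k) * M k j) = 0"
          using c[OF \<open>j < N\<close>] by (simp add: c_def sum_negf)
      qed simp
      then show False by simp
    qed
    then obtain p where p: "p < N" "c p \<noteq> 0" by blast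
    \<comment> \<open>\<open>n\<close> takes the \<open>p\<close>-th entry of a vector after
      removing its components along the old rows, scaled to be 1 on row \<open>a\<close>; on the old
      rows it vanishes.\<close>
    define n where "n j = ((if j = p then 1 else 0) - (\<Sum>k<a. L k j * M k p)) / c p" for j
    have n: "(\<Sum>j<N. n j * y j) = (y p - (\<Sum>k<a. (\<Sum>j<N. L k j * y j) * M k p)) / c p" for y
    proof -
      have "(\<Sum>j<N. n j * y j) = (\<Sum>j<N. (if j = p then y j else 0) - (\<Sum>k<a. L k j * y j * M k p)) / c p"
        unfolding n_def sum_divide_distrib
        by (rule sum.cong) (auto simp: left_diff_distrib sum_distrib_right mult_ac sum_distrib_left right_diff_distrib)
      also have "(\<Sum>j<N. (if j = p then y j else 0) - (\<Sum>k<a. L k j * y j * M k p))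
          = y p - (\<Sum>k<a. (\<Sum>j<N. L k j * y j) * M k p)"
        unfolding sum_subtractf by (subst sum.swap) (use p in \<open>simp add: sum_distrib_right\<close>)
      finally show ?thesis .
    qed
    have nk: "(\<Sum>j<N. n j * M k j) = 0" if "k < a" for k
    proof -
      have "(\<Sum>i<a. (\<Sum>j<N. L i j * M k j) * M i p) = (\<Sum>i<a. (if i = k then M k p else 0))"
        by (rule sum.cong) (use L that in auto)
      then show ?thesis unfolding n using that by simp
    qed
    have na: "(\<Sum>j<N. n j * M a j) = 1"
      unfolding n using p by (simp add: c_def la_def)
    define L' where "L' i j = (if i = a then n j else L i j - la i * n j)" for i j
    have "(\<Sum>j<N. L' i j * M k j) = (if i = k then 1 else 0)" if "i < Suc a" "k < Suc a" for i k
    proof (cases "i = a")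
      case True
      then show ?thesis using nk na that by (auto simp: L'_def less_Suc_eq)
    next
      case False
      then have i: "i < a" using that by simp
      have "(\<Sum>j<N. L' i j * M k j) = (\<Sum>j<N. L i j * M k j) - la i * (\<Sum>j<N. n j * M k j)"
        using False by (simp add: L'_def left_diff_distrib sum_subtractf sum_distrib_left mult.assoc)
      then show ?thesis using i nk na L that by (cases "k = a") (auto simp: la_def less_Suc_eq)
    qed
    then show ?case by blast
  qed simp
  then show thesis using that by blast
qed

text \<open>
  Differentiating \<open>u x' = \<mu> (u x, z x x')\<close> at \<open>x' = x\<close> expresses the partial derivatives of \<open>u\<close> as
  smooth functions of \<open>x\<close> and \<open>u x\<close>, so \<open>u\<close> gains one degree of smoothness at a time. The map \<open>z\<close> only
  needs to be known up to a quadratic error in \<open>x' - x\<close>.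
\<close>

lemma smooth_bootstrap:
  fixes u :: "(nat \<Rightarrow> real) \<Rightarrow> nat \<Rightarrow> real" and z :: "(nat \<Rightarrow> real) \<Rightarrow> (nat \<Rightarrow> real) \<Rightarrow> nat \<Rightarrow> real"
  assumes W: "openin (Euclidean_space m) W" and Om: "openin (Euclidean_space (m + m)) Om"
    and Z: "openin (Euclidean_space (a + a)) Z"
    and G: "smooth_euclidean (m + m) N Om G" and mu: "smooth_euclidean (a + a) a Z mu"
    and q: "q \<in> EE a" and u: "\<And>x. x \<in> W \<Longrightarrow> u x \<in> EE a"
    and zE: "\<And>x x'. x \<in> W \<Longrightarrow> x' \<in> W \<Longrightarrow> z x x' \<in> EE a"
    and zZ: "\<And>x x'. x \<in> W \<Longrightarrow> x' \<in> W \<Longrightarrow> cat a (u x) (z x x') \<in> Z"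
    and uz: "\<And>x x' j. x \<in> W \<Longrightarrow> x' \<in> W \<Longrightarrow> j < a \<Longrightarrow> u x' j = mu (cat a (u x) (z x x')) j"
    and cO: "\<And>x x'. x \<in> W \<Longrightarrow> x' \<in> W \<Longrightarrow> cat m x x' \<in> Om"
    and est: "\<And>x x' j. x \<in> W \<Longrightarrow> x' \<in> W \<Longrightarrow> j < a \<Longrightarrow>
       \<bar>z x x' j - q j - (\<Sum>l<N. T j l * (G (cat m x x') l - G (cat m x x) l))\<bar> \<le> C * (l1dist m x x')\<^sup>2"
  shows "smooth_euclidean m a W u"
proof -
  have zq: "z x x = q" if "x \<in> W" for x
  proof (rule EE_eqI[OF zE[OF that that] q])
    fix i assume "i < a"
    from est[OF that that this] show "z x x i = q i" by simp
  qed
  have WE: "x \<in> EE m" if "x \<in> W" for x using openin_subset[OF W] that by auto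
  have upd: "\<exists>d>0. \<forall>t. \<bar>t - x i\<bar> < d \<longrightarrow> x(i := t) \<in> W" if xi: "x \<in> W" "i < m" for x i
  proof -
    obtain d where "d > 0" "\<And>y. y \<in> EE m \<Longrightarrow> l1dist m x y < d \<Longrightarrow> y \<in> W"
      by (rule openin_EuclideanE[OF W xi(1)]) (rule that)
    then show ?thesis using xi WE by (intro exI[of _ d]) (auto simp: l1dist_upd EE_upd abs_minus_commute)
  qed
  \<comment> \<open>Continuity of \<open>u\<close> has to be established before any derivative:
    \<open>z x x'\<close> differs from \<open>q\<close> by at most a multiple of the distance of
    \<open>x\<close> and \<open>x'\<close>, and \<open>mu\<close> is continuous.\<close>
  have lip: "\<exists>K d. 0 \<le> K \<and> 0 < d \<and> (\<forall>x'\<in>W. l1dist m x x' < d \<longrightarrow> l1dist a (z x x') q \<le> K * l1dist m x x')"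
    if x: "x \<in> W" for x
  proof -
    obtain B d where B: "B \<ge> 0" "d > 0"
      "\<And>y z. y \<in> EE (m+m) \<Longrightarrow> z \<in> EE (m+m) \<Longrightarrow> l1dist (m+m) (cat m x x) y < d \<Longrightarrow> l1dist (m+m) (cat m x x) z < d \<Longrightarrow>
        l1dist N (G y) (G z) \<le> B * l1dist (m+m) y z"
      by (rule smooth_Lipschitz[OF Om G cO[OF x x]]) (rule that)
    define S where "S = (\<Sum>j<a. \<Sum>l<N. \<bar>T j l\<bar>)"
    have S: "S \<ge> 0" by (simp add: S_def sum_nonneg)
    show ?thesis
    proof (rule exI[of _ "S * B + real a * \<bar>C\<bar>"], rule exI[of _ "min d 1"], intro conjI ballI impI)
      fix x' assume x': "x' \<in> W" and dx: "l1dist m x x' < min d 1"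
      let ?d = "l1dist m x x'"
      have "l1dist N (G (cat m x x')) (G (cat m x x)) \<le> B * l1dist (m+m) (cat m x x') (cat m x x)"
        by (rule B(3)) (use dx WE[OF x] WE[OF x'] B(2) in \<open>auto intro!: cat_EE simp: l1dist_cat\<close>)
      then have Gl: "l1dist N (G (cat m x x')) (G (cat m x x)) \<le> B * ?d" by (simp add: l1dist_cat l1dist_commute)
      have "\<bar>z x x' j - q j\<bar> \<le> (\<Sum>l<N. \<bar>T j l\<bar>) * (B * ?d) + \<bar>C\<bar> * ?d" if j: "j < a" for j
      proof -
        have "\<bar>\<Sum>l<N. T j l * (G (cat m x x') l - G (cat m x x) l)\<bar> \<le> (\<Sum>l<N. \<bar>T j l\<bar> * (B * ?d))"
        proof (rule order_trans[OF sum_abs], rule sum_mono)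
          fix l assume "l \<in> {..<N}"
          then have "\<bar>G (cat m x x') l - G (cat m x x) l\<bar> \<le> B * ?d"
            using l1dist_coord[of l N "G (cat m x x')" "G (cat m x x)"] Gl by auto
          then show "\<bar>T j l * (G (cat m x x') l - G (cat m x x) l)\<bar> \<le> \<bar>T j l\<bar> * (B * ?d)"
            by (simp add: abs_mult mult_left_mono)
        qed
        moreover have "C * ?d\<^sup>2 \<le> \<bar>C\<bar> * ?d"
        proof -
          have "?d\<^sup>2 \<le> ?d" using dx by (simp add: power2_eq_square mult_left_le)
          then have "\<bar>C\<bar> * ?d\<^sup>2 \<le> \<bar>C\<bar> * ?d" by (intro mult_left_mono) auto
          moreover have "C * ?d\<^sup>2 \<le> \<bar>C\<bar> * ?d\<^sup>2" by (intro mult_right_mono) auto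
          ultimately show ?thesis by linarith
        qed
        ultimately show ?thesis using est[OF x x' j] unfolding sum_distrib_right by linarith
      qed
      then have "l1dist a (z x x') q \<le> (\<Sum>j<a. (\<Sum>l<N. \<bar>T j l\<bar>) * (B * ?d) + \<bar>C\<bar> * ?d)"
        unfolding l1dist_def[of a] by (intro sum_mono) auto
      also have "\<dots> = (S * B + real a * \<bar>C\<bar>) * ?d"
        by (simp add: sum.distrib S_def sum_distrib_right[symmetric] algebra_simps) (simp add: sum_distrib_left)
      finally show "l1dist a (z x x') q \<le> (S * B + real a * \<bar>C\<bar>) * ?d" .
    qed (use S B in auto)
  qed
  have cont: "continuous_map (subtopology (Euclidean_space m) W) euclideanreal (\<lambda>x. u x j)" if j: "j < a" for j
    unfolding continuous_Euclidean_iff[OF W]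
  proof (intro ballI allI impI)
    fix x and e :: real assume x: "x \<in> W" and e: "e > 0"
    obtain K d where K: "0 \<le> K" "0 < d" "\<And>x'. x' \<in> W \<Longrightarrow> l1dist m x x' < d \<Longrightarrow> l1dist a (z x x') q \<le> K * l1dist m x x'"
      using lip[OF x] by metis
    have cZ: "cat a (u x) q \<in> Z" using zZ[OF x x] zq[OF x] by simp
    obtain d' where d': "d' > 0" "\<And>y. y \<in> Z \<Longrightarrow> l1dist (a+a) (cat a (u x) q) y < d' \<Longrightarrow> \<bar>mu y j - mu (cat a (u x) q) j\<bar> < e"
      using continuous_Euclidean_iff[OF Z, THEN iffD1, OF Ck_cont[OF smooth_euclideanD[OF mu j]]] cZ e by blast
    show "\<exists>d>0. \<forall>y\<in>W. l1dist m x y < d \<longrightarrow> \<bar>u y j - u x j\<bar> < e"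
    proof (intro exI[of _ "min d (d' / (K + 1))"] conjI ballI impI)
      fix y assume y: "y \<in> W" "l1dist m x y < min d (d' / (K + 1))"
      have "l1dist a (z x y) q \<le> K * l1dist m x y" using K(3) y by simp
      also have "\<dots> \<le> (K + 1) * l1dist m x y" by (simp add: distrib_right)
      also have "\<dots> < d'" using y K by (simp add: field_simps)
      finally have "l1dist (a+a) (cat a (u x) q) (cat a (u x) (z x y)) < d'" by (simp add: l1dist_cat l1dist_commute)
      from d'(2)[OF zZ[OF x y(1)] this] show "\<bar>u y j - u x j\<bar> < e"
        using uz[OF x y(1) j] uz[OF x x j] zq[OF x] by simp
    qed (use K d' in auto)
  qed
  \<comment> \<open>The derivative of \<open>cat a (u x) (z x x')\<close> in the \<open>i\<close>-th
    coordinate of \<open>x'\<close> at \<open>x' = x\<close>. The first \<open>a\<close> entries are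
    0 because \<open>u x\<close> is held fixed.\<close>
  define D where "D i x s = (if s < a then 0 else \<Sum>l<N. T (s - a) l * pdv (m + i) (\<lambda>y. G y l) (cat m x x))" for i x s
  have dz: "((\<lambda>t. z x (x(i := t)) j) has_real_derivative D i x (a + j)) (at (x i))"
    if x: "x \<in> W" and i: "i < m" and j: "j < a" for x i j
  proof -
    let ?S = "\<lambda>t. \<Sum>l<N. T j l * (G (cat m x (x(i := t))) l - G (cat m x x) l)"
    have i': "m + i < m + m" using i by simp
    have "((\<lambda>t. G (cat m x (x(i := t))) l) has_real_derivative pdv (m + i) (\<lambda>y. G y l) (cat m x x)) (at (x i))"
      if "l < N" for l
      using Ck_SucD(1)[OF Om smooth_euclideanD[OF G that] i' cO[OF x x]] by (simp add: cat_upd) (simp add: cat_def)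
    then have S: "(?S has_real_derivative D i x (a + j)) (at (x i))"
      unfolding D_def by (auto intro!: derivative_eq_intros sum.cong)
    obtain d where d: "d > 0" "\<And>t. \<bar>t - x i\<bar> < d \<Longrightarrow> x(i := t) \<in> W" using upd[OF x i] by blast
    \<comment> \<open>The quadratic error in \<open>est\<close> has derivative 0 at the base point,
      so \<open>z\<close> may be differentiated through its substitute \<open>?S\<close>.\<close>
    have "((\<lambda>t. z x (x(i := t)) j - q j - ?S t) has_real_derivative 0) (at (x i))"
      unfolding has_field_derivative_iff
    proof (rule Lim_null_comparison)
      have "\<forall>\<^sub>F t in at (x i). \<bar>t - x i\<bar> < d \<and> t \<noteq> x i"
        unfolding eventually_at using d(1) by (auto simp: dist_real_def)
      then show "\<forall>\<^sub>F t in at (x i). norm ((z x (x(i := t)) j - q j - ?S t - (z x (x(i := x i)) j - q j - ?S (x i))) / (t - x i))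
          \<le> C * \<bar>t - x i\<bar>"
      proof eventually_elim
        case (elim t)
        have "\<bar>z x (x(i := t)) j - q j - ?S t\<bar> \<le> C * \<bar>t - x i\<bar>\<^sup>2"
          using est[OF x d(2) j, of t] elim l1dist_upd[OF i, of x t] by (simp add: abs_minus_commute)
        then have "\<bar>z x (x(i := t)) j - q j - ?S t\<bar> / \<bar>t - x i\<bar> \<le> C * \<bar>t - x i\<bar>"
          using elim by (subst pos_divide_le_eq) (auto simp: power2_eq_square mult.assoc)
        then show ?case using zq[OF x] by (simp add: abs_divide)
      qed
      have "((\<lambda>t. C * \<bar>t - x i\<bar>) \<longlongrightarrow> C * \<bar>x i - x i\<bar>) (at (x i))" by (intro tendsto_intros)
      then show "((\<lambda>t. C * \<bar>t - x i\<bar>) \<longlongrightarrow> 0) (at (x i))" by simp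
    qed
    from DERIV_add[OF this S] have "((\<lambda>t. z x (x(i := t)) j - q j) has_real_derivative D i x (a + j)) (at (x i))" by simp
    from DERIV_add[OF this DERIV_const[of "q j"]] show ?thesis by simp
  qed
  define g where "g j i x = (\<Sum>s<a+a. pdv s (\<lambda>y. mu y j) (cat a (u x) q) * D i x s)" for j i x
  have du: "((\<lambda>t. u (x(i := t)) j) has_real_derivative g j i x) (at (x i))"
    if x: "x \<in> W" and i: "i < m" and j: "j < a" for x i j
  proof -
    obtain d where d: "d > 0" "\<And>t. \<bar>t - x i\<bar> < d \<Longrightarrow> x(i := t) \<in> W" using upd[OF x i] by blast
    define h where "h t = (if \<bar>t - x i\<bar> < d then cat a (u x) (z x (x(i := t))) else cat a (u x) q)" for t
    have ev: "\<forall>\<^sub>F t in nhds (x i). \<bar>t - x i\<bar> < d"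
      unfolding eventually_nhds_metric using d(1) by (auto simp: dist_real_def)
    have "((\<lambda>t. mu (h t) j) has_real_derivative (\<Sum>s<a+a. pdv s (\<lambda>y. mu y j) (h (x i)) * D i x s)) (at (x i))"
    proof (rule Ck_chain_curve[OF Z smooth_euclideanD[OF mu j]])
      show "h (x i) \<in> Z" using zZ[OF x x] zq[OF x] d(1) by (simp add: h_def)
      show "h t \<in> EE (a + a)" for t
        unfolding h_def using u[OF x] zE[OF x d(2)] q by (auto intro: cat_EE)
      fix s assume s: "s < a + a"
      have "((\<lambda>t. cat a (u x) (z x (x(i := t))) s) has_real_derivative D i x s) (at (x i))"
      proof (cases "s < a")
        case True then show ?thesis by (simp add: cat_def D_def)
      next
        case False
        then have "s - a < a" "a + (s - a) = s" using s by auto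
        with dz[OF x i this(1)] False show ?thesis by (simp add: cat_def)
      qed
      then show "((\<lambda>t. h t s) has_real_derivative D i x s) (at (x i))"
        by (rule DERIV_cong_ev[THEN iffD1, OF refl _ refl, rotated])
          (rule eventually_mono[OF ev], simp add: h_def)
    qed
    then have "((\<lambda>t. mu (h t) j) has_real_derivative g j i x) (at (x i))"
      using d(1) zq[OF x] by (simp add: h_def g_def)
    then show ?thesis
      by (rule DERIV_cong_ev[THEN iffD1, OF refl _ refl, rotated])
        (rule eventually_mono[OF ev], simp add: h_def uz[OF x d(2) j])
  qed
  have "\<forall>j<a. Ck_on m k W (\<lambda>x. u x j)" for k
  proof (induction k)
    case 0 then show ?case using cont by simp
  next
    case (Suc k)
    show ?case
    proof (intro allI impI, rule Ck_SucI[OF W cont])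
      fix j i assume j: "j < a" and i: "i < m"
      have i': "m + i < m + m" using i by simp
      have 1: "Ck_on m k W (\<lambda>x. pdv s (\<lambda>y. mu y j) (cat a (u x) q))" if "s < a + a" for s
      proof (rule Ck_comp[OF W Z _ _ Ck_SucD(2)[OF Z smooth_euclideanD[OF mu j] that]])
        show "(\<lambda>x. cat a (u x) q) ` W \<subseteq> Z" using zZ[OF _ _] zq by (auto simp: image_iff)
        fix r assume "r < a + a"
        then show "Ck_on m k W (\<lambda>x. cat a (u x) q r)" using Suc.IH Ck_const[OF W] by (intro Ck_cat) auto
      qed
      have 2: "Ck_on m k W (\<lambda>x. pdv (m + i) (\<lambda>y. G y l) (cat m x x))" if "l < N" for l
      proof (rule Ck_comp[OF W Om _ _ Ck_SucD(2)[OF Om smooth_euclideanD[OF G that] i']])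
        show "(\<lambda>x. cat m x x) ` W \<subseteq> Om" using cO by auto
        show "Ck_on m k W (\<lambda>x. cat m x x r)" if "r < m + m" for r using that by (intro Ck_cat Ck_coord[OF W])
      qed
      have 3: "Ck_on m k W (\<lambda>x. D i x s)" for s
        unfolding D_def by (cases "s < a") (auto intro!: Ck_const[OF W] Ck_sum[OF W] Ck_mult[OF W] 2)
      show "Ck_on m k W (g j i)"
        unfolding g_def by (intro Ck_sum[OF W] Ck_mult[OF W] 1 3) auto
    qed (use du in auto)
  qed
  then show ?thesis by (simp add: smooth_euclidean_def)
qed

section \<open>Manifolds and smooth maps\<close>

lemma smooth_euclidean_cong:
  assumes "openin (Euclidean_space n) W" "\<And>x j. x \<in> W \<Longrightarrow> j < m \<Longrightarrow> f x j = g x j" "smooth_euclidean n m W f"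
  shows "smooth_euclidean n m W g"
  unfolding smooth_euclidean_def
proof (intro allI impI)
  fix k j assume j: "j < m"
  show "Ck_on n k W (\<lambda>x. g x j)"
    by (rule Ck_cong[OF assms(1) _ smooth_euclideanD[OF assms(3) j]]) (rule assms(2)[OF _ j])
qed

lemma smooth_euclidean_subset: "W' \<subseteq> W \<Longrightarrow> smooth_euclidean n m W f \<Longrightarrow> smooth_euclidean n m W' f"
  unfolding smooth_euclidean_def using Ck_subset by blast

lemma smooth_euclidean_comp:
  assumes W: "openin (Euclidean_space n) W" and V: "openin (Euclidean_space m) V"
    and h: "h ` W \<subseteq> V" "smooth_euclidean n m W h" and g: "smooth_euclidean m l V g"
  shows "smooth_euclidean n l W (\<lambda>x. g (h x))"
  unfolding smooth_euclidean_def
proof (intro allI impI)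
  fix k j assume j: "j < l"
  show "Ck_on n k W (\<lambda>x. g (h x) j)"
    by (rule Ck_comp[OF W V h(1) _ smooth_euclideanD[OF g j]]) (rule smooth_euclideanD[OF h(2)])
qed

lemma smooth_euclidean_continuous:
  assumes W: "openin (Euclidean_space n) W" and f: "smooth_euclidean n m W f" "f ` W \<subseteq> EE m"
  shows "continuous_map (subtopology (Euclidean_space n) W) (Euclidean_space m) f"
proof (rule continuous_map_into_Euclidean)
  show "continuous_map (subtopology (Euclidean_space n) W) euclideanreal (\<lambda>x. f x j)" if "j < m" for j
    using Ck_cont smooth_euclideanD[OF f(1) that] by blast
qed (use f openin_subset[OF W] in auto)

text \<open>\<open>smooth_manifold\<close> without its separation and countability axioms.
  Smoothness arguments rest on charts alone, and the extension built from a cocycle has to be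
  handled before it is known to be Hausdorff.\<close>

definition charted :: "'a manifold \<Rightarrow> bool" where
  "charted M \<longleftrightarrow>
     \<Union> (fst ` atlas M) = topspace (mtop M) \<and>
     (\<forall>(U, \<phi>) \<in> atlas M.
        openin (mtop M) U \<and> openin (Euclidean_space (mdim M)) (\<phi> ` U) \<and>
        homeomorphic_map (subtopology (mtop M) U)
          (subtopology (Euclidean_space (mdim M)) (\<phi> ` U)) \<phi>) \<and>
     (\<forall>(U, \<phi>) \<in> atlas M. \<forall>(V, \<psi>) \<in> atlas M.
        smooth_euclidean (mdim M) (mdim M) (\<phi> ` (U \<inter> V)) (\<psi> \<circ> inv_into U \<phi>))"

lemma smooth_manifold_charted:
  "smooth_manifold M \<longleftrightarrow> Hausdorff_space (mtop M) \<and> second_countable (mtop M) \<and> charted M"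
  by (auto simp: smooth_manifold_def charted_def)

lemma chart_at:
  assumes "charted M" "p \<in> topspace (mtop M)"
  obtains U \<phi> where "(U, \<phi>) \<in> atlas M" "p \<in> U"
proof -
  have "p \<in> \<Union> (fst ` atlas M)" using assms by (simp add: charted_def)
  then show thesis using that by fastforce
qed

context
  fixes M :: "'a manifold" and U \<phi>
  assumes M: "charted M" and U: "(U, \<phi>) \<in> atlas M"
begin

lemma chart_open: "openin (mtop M) U"
  and chart_homeo: "homeomorphic_map (subtopology (mtop M) U) (subtopology (Euclidean_space (mdim M)) (\<phi> ` U)) \<phi>"
  and chart_image_open': "openin (Euclidean_space (mdim M)) (\<phi> ` U)"
  using M U unfolding charted_def by (auto split: prod.splits)

lemma chart_subset: "U \<subseteq> topspace (mtop M)"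
  by (rule openin_subset[OF chart_open])

lemma chart_inj: "inj_on \<phi> U"
  using homeomorphic_imp_injective_map[OF chart_homeo] chart_subset by (simp add: topspace_subtopology Int_absorb1)

lemma chart_inv: "x \<in> U \<Longrightarrow> inv_into U \<phi> (\<phi> x) = x"
  by (rule inv_into_f_f[OF chart_inj])

lemma chart_EE: "x \<in> U \<Longrightarrow> \<phi> x \<in> EE (mdim M)"
  using openin_subset[OF chart_image_open'] by auto

lemma chart_cont: "continuous_map (subtopology (mtop M) U) (Euclidean_space (mdim M)) \<phi>"
  using homeomorphic_imp_continuous_map[OF chart_homeo] by (simp add: continuous_map_in_subtopology)

lemma chart_image_open:
  assumes "openin (mtop M) D" "D \<subseteq> U"
  shows "openin (Euclidean_space (mdim M)) (\<phi> ` D)"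
proof -
  have "openin (subtopology (mtop M) U) D" using assms chart_open openin_open_subtopology by blast
  then have "openin (subtopology (Euclidean_space (mdim M)) (\<phi> ` U)) (\<phi> ` D)"
    using homeomorphic_imp_open_map[OF chart_homeo] unfolding open_map_def by blast
  then show ?thesis using chart_image_open' openin_trans_full by blast
qed

lemma chart_preimage_open:
  assumes "openin (Euclidean_space (mdim M)) W"
  shows "openin (mtop M) {x \<in> U. \<phi> x \<in> W}"
proof -
  have "openin (subtopology (mtop M) U) {x \<in> topspace (subtopology (mtop M) U). \<phi> x \<in> W}"
    by (rule openin_continuous_map_preimage[OF chart_cont assms])
  then have "openin (mtop M) {x \<in> topspace (subtopology (mtop M) U). \<phi> x \<in> W}"
    using chart_open openin_trans_full by blast
  moreover have "{x \<in> topspace (subtopology (mtop M) U). \<phi> x \<in> W} = {x \<in> U. \<phi> x \<in> W}"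
    using chart_subset by auto
  ultimately show ?thesis by simp
qed

lemma chart_inv_cont:
  "continuous_map (subtopology (Euclidean_space (mdim M)) (\<phi> ` U)) (mtop M) (inv_into U \<phi>)"
proof -
  obtain g where g: "homeomorphic_maps (subtopology (mtop M) U) (subtopology (Euclidean_space (mdim M)) (\<phi> ` U)) \<phi> g"
    using chart_homeo homeomorphic_map_maps by blast
  have "continuous_map (subtopology (Euclidean_space (mdim M)) (\<phi> ` U)) (mtop M) g"
    using g by (simp add: homeomorphic_maps_def continuous_map_in_subtopology)
  moreover have "g y = inv_into U \<phi> y" if "y \<in> topspace (subtopology (Euclidean_space (mdim M)) (\<phi> ` U))" for y
  proof -
    have "y \<in> \<phi> ` U" using that by simp
    then obtain x where x: "x \<in> U" "y = \<phi> x" by blast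
    have "x \<in> topspace (subtopology (mtop M) U)" using x chart_subset by auto
    then have "g (\<phi> x) = x" using g unfolding homeomorphic_maps_def by blast
    then show ?thesis using x chart_inv by simp
  qed
  ultimately show ?thesis by (rule continuous_map_eq)
qed

lemma chart_nbhd:
  assumes "openin (mtop M) Q" "p \<in> Q" "p \<in> U"
  obtains r where "r > 0" "\<And>v. v \<in> EE (mdim M) \<Longrightarrow> l1dist (mdim M) (\<phi> p) v < r \<Longrightarrow> \<exists>x\<in>U \<inter> Q. \<phi> x = v"
    "\<And>x. x \<in> U \<Longrightarrow> l1dist (mdim M) (\<phi> p) (\<phi> x) < r \<Longrightarrow> x \<in> Q"
proof -
  have o: "openin (Euclidean_space (mdim M)) (\<phi> ` (U \<inter> Q))"
    by (rule chart_image_open) (use assms chart_open in auto)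
  obtain r where r: "r > 0" "\<And>v. v \<in> EE (mdim M) \<Longrightarrow> l1dist (mdim M) (\<phi> p) v < r \<Longrightarrow> v \<in> \<phi> ` (U \<inter> Q)"
    by (rule openin_EuclideanE[OF o, of "\<phi> p"]) (use assms in auto)
  show thesis
  proof (rule that[OF r(1)])
    fix x assume x: "x \<in> U" "l1dist (mdim M) (\<phi> p) (\<phi> x) < r"
    then obtain x' where "x' \<in> U \<inter> Q" "\<phi> x = \<phi> x'" using r(2)[of "\<phi> x"] chart_EE by auto
    then show "x \<in> Q" using chart_inj x by (auto dest: inj_onD)
  qed (use r in blast)
qed

end

lemma charted_compat:
  assumes "charted M" "(U, \<phi>) \<in> atlas M" "(V, \<psi>) \<in> atlas M"
  shows "smooth_euclidean (mdim M) (mdim M) (\<phi> ` (U \<inter> V)) (\<psi> \<circ> inv_into U \<phi>)"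
  using assms unfolding charted_def by fast

section \<open>Smoothness near a point\<close>

lemma smooth_map_onD:
  assumes "smooth_map_on M N D f"
  shows "openin (mtop M) D" "continuous_map (subtopology (mtop M) D) (mtop N) f"
    and "(U, \<phi>) \<in> atlas M \<Longrightarrow> (V, \<psi>) \<in> atlas N \<Longrightarrow>
        smooth_euclidean (mdim M) (mdim N) (\<phi> ` (D \<inter> U \<inter> f -` V)) (\<psi> \<circ> f \<circ> inv_into U \<phi>)"
  using assms unfolding smooth_map_on_def by fast+

lemma openin_preimage_on:
  assumes "openin X D" "continuous_map (subtopology X D) Y f" "openin Y Q"
  shows "openin X {x \<in> D. f x \<in> Q}"
proof -
  have "openin (subtopology X D) {x \<in> topspace (subtopology X D). f x \<in> Q}"
    by (rule openin_continuous_map_preimage[OF assms(2,3)])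
  moreover have "{x \<in> topspace (subtopology X D). f x \<in> Q} = {x \<in> D. f x \<in> Q}"
    using openin_subset[OF assms(1)] by auto
  ultimately show ?thesis using assms(1) openin_trans_full by metis
qed

lemma continuous_map_on_into:
  assumes "openin X D" "continuous_map (subtopology X D) Y f" "x \<in> D"
  shows "f x \<in> topspace Y"
  using assms openin_subset[OF assms(1)] by (auto simp: continuous_map_def)

lemma smooth_nearD:
  assumes "smooth_near M N p f"
  obtains D where "p \<in> D" "smooth_map_on M N D f"
  using assms unfolding smooth_near_def by blast

lemma smooth_near_into:
  assumes "smooth_near M N p f"
  shows "p \<in> topspace (mtop M)" "f p \<in> topspace (mtop N)"
proof -
  obtain D where D: "p \<in> D" "smooth_map_on M N D f" using assms unfolding smooth_near_def by blast
  note D' = smooth_map_onD(1,2)[OF D(2)]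
  show "p \<in> topspace (mtop M)" using openin_subset[OF D'(1)] D(1) by auto
  show "f p \<in> topspace (mtop N)" by (rule continuous_map_on_into[OF D' D(1)])
qed

lemma smooth_near_open:
  assumes "smooth_near M N p f" "openin (mtop N) Q" "f p \<in> Q"
  obtains D where "openin (mtop M) D" "p \<in> D" "f ` D \<subseteq> Q"
proof -
  obtain D where D: "p \<in> D" "smooth_map_on M N D f" using assms(1) by (rule smooth_nearD)
  show thesis
    by (rule that[OF openin_preimage_on[OF smooth_map_onD(1,2)[OF D(2)] assms(2)]])
      (use D(1) assms(3) in auto)
qed

lemma smooth_near_chartD:
  assumes M: "charted M" and N: "charted N" and f: "smooth_near M N p f"
    and U: "(U, \<phi>) \<in> atlas M" "p \<in> U" and V: "(V, \<psi>) \<in> atlas N" "f p \<in> V"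
    and P: "openin (mtop M) P" "p \<in> P" and Q: "openin (mtop N) Q" "f p \<in> Q"
  obtains D where "openin (mtop M) D" "p \<in> D" "D \<subseteq> U \<inter> P" "f ` D \<subseteq> V \<inter> Q"
    "smooth_euclidean (mdim M) (mdim N) (\<phi> ` D) (\<psi> \<circ> f \<circ> inv_into U \<phi>)"
proof -
  obtain D where D: "p \<in> D" "smooth_map_on M N D f" using f by (rule smooth_nearD)
  note D' = smooth_map_onD[OF D(2)]
  show thesis
  proof (rule that[of "{x \<in> D. f x \<in> V \<inter> Q} \<inter> (U \<inter> P)"])
    show "openin (mtop M) ({x \<in> D. f x \<in> V \<inter> Q} \<inter> (U \<inter> P))"
      by (intro openin_Int openin_preimage_on[OF D'(1,2)] chart_open[OF M U(1)] chart_open[OF N V(1)] P Q)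
    show "smooth_euclidean (mdim M) (mdim N) (\<phi> ` ({x \<in> D. f x \<in> V \<inter> Q} \<inter> (U \<inter> P))) (\<psi> \<circ> f \<circ> inv_into U \<phi>)"
      by (rule smooth_euclidean_subset[OF _ D'(3)[OF U(1) V(1)]]) auto
  qed (use D U P V Q in auto)
qed

text \<open>A single pair of charts decides: continuity of \<open>f\<close> is read off its
  coordinate form, and any other pair of charts is reached by composing with transition maps on both
  sides.\<close>

lemma smooth_map_on_chartI:
  assumes M: "charted M" and N: "charted N" and D: "openin (mtop M) D"
    and U: "(U, \<phi>) \<in> atlas M" "D \<subseteq> U" and V: "(V, \<psi>) \<in> atlas N" "f ` D \<subseteq> V"
    and s: "smooth_euclidean (mdim M) (mdim N) (\<phi> ` D) (\<psi> \<circ> f \<circ> inv_into U \<phi>)"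
  shows "smooth_map_on M N D f"
proof -
  note iU = chart_inv[OF M U(1)] and iV = chart_inv[OF N V(1)]
  have into: "(\<psi> \<circ> f \<circ> inv_into U \<phi>) x \<in> \<psi> ` V" if "x \<in> \<phi> ` D" for x
  proof -
    obtain x' where "x' \<in> D" "x = \<phi> x'" using \<open>x \<in> \<phi> ` D\<close> by blast
    moreover from this have "x' \<in> U" using U by auto
    ultimately show ?thesis using V iU by auto
  qed
  have oD: "openin (Euclidean_space (mdim M)) (\<phi> ` D)" by (rule chart_image_open[OF M U(1) D U(2)])
  have c1: "continuous_map (subtopology (Euclidean_space (mdim M)) (\<phi> ` D)) (Euclidean_space (mdim N)) (\<psi> \<circ> f \<circ> inv_into U \<phi>)"
  proof (rule smooth_euclidean_continuous[OF oD s])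
    show "(\<psi> \<circ> f \<circ> inv_into U \<phi>) ` \<phi> ` D \<subseteq> EE (mdim N)"
    proof
      fix y assume "y \<in> (\<psi> \<circ> f \<circ> inv_into U \<phi>) ` \<phi> ` D"
      then have "y \<in> \<psi> ` V" using into by auto
      then show "y \<in> EE (mdim N)" using chart_EE[OF N V(1)] by auto
    qed
  qed
  have c2: "continuous_map (subtopology (mtop M) D) (subtopology (Euclidean_space (mdim M)) (\<phi> ` D)) \<phi>"
    using continuous_map_from_subtopology_mono[OF chart_cont[OF M U(1)] U(2)]
    by (auto simp: continuous_map_in_subtopology)
  have c3: "continuous_map (subtopology (Euclidean_space (mdim M)) (\<phi> ` D)) (subtopology (Euclidean_space (mdim N)) (\<psi> ` V)) (\<psi> \<circ> f \<circ> inv_into U \<phi>)"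
    using c1 into by (auto simp: continuous_map_in_subtopology)
  have "continuous_map (subtopology (mtop M) D) (mtop N) (inv_into V \<psi> \<circ> ((\<psi> \<circ> f \<circ> inv_into U \<phi>) \<circ> \<phi>))"
    by (rule continuous_map_compose[OF continuous_map_compose[OF c2 c3] chart_inv_cont[OF N V(1)]])
  then have cont: "continuous_map (subtopology (mtop M) D) (mtop N) f"
  proof (rule continuous_map_eq)
    fix x assume "x \<in> topspace (subtopology (mtop M) D)"
    then have "x \<in> D" by auto
    then have "x \<in> U" "f x \<in> V" using U V by auto
    then show "(inv_into V \<psi> \<circ> ((\<psi> \<circ> f \<circ> inv_into U \<phi>) \<circ> \<phi>)) x = f x" using iU iV by simp
  qed
  have "smooth_euclidean (mdim M) (mdim N) (\<phi>' ` (D \<inter> U' \<inter> f -` V')) (\<psi>' \<circ> f \<circ> inv_into U' \<phi>')"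
    if U': "(U', \<phi>') \<in> atlas M" and V': "(V', \<psi>') \<in> atlas N" for U' \<phi>' V' \<psi>'
  proof -
    note iU' = chart_inv[OF M U']
    let ?D = "D \<inter> U' \<inter> f -` V'"
    have eq: "?D = {x \<in> D. f x \<in> V'} \<inter> U'" by auto
    have oD': "openin (mtop M) ?D" unfolding eq
      by (intro openin_Int openin_preimage_on[OF D cont] chart_open[OF N V'] chart_open[OF M U'])
    have o1: "openin (Euclidean_space (mdim M)) (\<phi>' ` ?D)" by (rule chart_image_open[OF M U' oD']) auto
    have o2: "openin (Euclidean_space (mdim M)) (\<phi> ` ?D)" by (rule chart_image_open[OF M U(1) oD']) (use U in auto)
    have o3: "openin (Euclidean_space (mdim N)) (\<psi> ` (V \<inter> V'))"
      by (rule chart_image_open[OF N V(1)]) (use chart_open[OF N V(1)] chart_open[OF N V'] in auto)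
    have s1: "smooth_euclidean (mdim M) (mdim M) (\<phi>' ` ?D) (\<phi> \<circ> inv_into U' \<phi>')"
      by (rule smooth_euclidean_subset[OF _ charted_compat[OF M U' U(1)]]) (use U in auto)
    have s2: "smooth_euclidean (mdim M) (mdim N) (\<phi>' ` ?D) (\<lambda>x. (\<psi> \<circ> f \<circ> inv_into U \<phi>) ((\<phi> \<circ> inv_into U' \<phi>') x))"
    proof (rule smooth_euclidean_comp[OF o1 o2 _ s1])
      show "smooth_euclidean (mdim M) (mdim N) (\<phi> ` ?D) (\<psi> \<circ> f \<circ> inv_into U \<phi>)"
        by (rule smooth_euclidean_subset[OF _ s]) auto
    qed (use iU' in auto)
    have s3: "smooth_euclidean (mdim M) (mdim N) (\<phi>' ` ?D)
        (\<lambda>x. (\<psi>' \<circ> inv_into V \<psi>) ((\<psi> \<circ> f \<circ> inv_into U \<phi>) ((\<phi> \<circ> inv_into U' \<phi>') x)))"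
    proof (rule smooth_euclidean_comp[OF o1 o3 _ s2 charted_compat[OF N V(1) V']])
      show "(\<lambda>x. (\<psi> \<circ> f \<circ> inv_into U \<phi>) ((\<phi> \<circ> inv_into U' \<phi>') x)) ` (\<phi>' ` ?D) \<subseteq> \<psi> ` (V \<inter> V')"
      proof (clarsimp simp: iU')
        fix x assume x: "x \<in> D" "f x \<in> V'"
        then have "x \<in> U" "f x \<in> V" using U V by auto
        then show "\<psi> (f (inv_into U \<phi> (\<phi> x))) \<in> \<psi> ` (V \<inter> V')" using iU x by auto
      qed
    qed
    show ?thesis
    proof (rule smooth_euclidean_cong[OF o1 _ s3])
      fix y j assume "y \<in> \<phi>' ` ?D"
      then obtain x where x: "x \<in> D" "x \<in> U'" "f x \<in> V'" "y = \<phi>' x" by auto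
      then have "x \<in> U" "f x \<in> V" using U V by auto
      then show "(\<psi>' \<circ> inv_into V \<psi>) ((\<psi> \<circ> f \<circ> inv_into U \<phi>) ((\<phi> \<circ> inv_into U' \<phi>') y)) j = (\<psi>' \<circ> f \<circ> inv_into U' \<phi>') y j"
        using x iU iV iU' by simp
    qed
  qed
  then show ?thesis unfolding smooth_map_on_def using D cont by auto
qed

lemma smooth_near_chartI:
  assumes "charted M" "charted N" "openin (mtop M) D" "p \<in> D"
    "(U, \<phi>) \<in> atlas M" "D \<subseteq> U" "(V, \<psi>) \<in> atlas N" "f ` D \<subseteq> V"
    "smooth_euclidean (mdim M) (mdim N) (\<phi> ` D) (\<psi> \<circ> f \<circ> inv_into U \<phi>)"
  shows "smooth_near M N p f"
  unfolding smooth_near_def using smooth_map_on_chartI[OF assms(1-3,5-9)] assms(4) by blast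

lemma smooth_near_cong:
  assumes M: "charted M" and N: "charted N" and f: "smooth_near M N p f"
    and P: "openin (mtop M) P" "p \<in> P" "\<And>x. x \<in> P \<Longrightarrow> f x = g x"
  shows "smooth_near M N p g"
proof -
  obtain U \<phi> where U: "(U, \<phi>) \<in> atlas M" "p \<in> U" using chart_at[OF M smooth_near_into(1)[OF f]] .
  obtain V \<psi> where V: "(V, \<psi>) \<in> atlas N" "f p \<in> V" using chart_at[OF N smooth_near_into(2)[OF f]] .
  obtain D where D: "openin (mtop M) D" "p \<in> D" "D \<subseteq> U \<inter> P" "f ` D \<subseteq> V \<inter> topspace (mtop N)"
    "smooth_euclidean (mdim M) (mdim N) (\<phi> ` D) (\<psi> \<circ> f \<circ> inv_into U \<phi>)"
    by (rule smooth_near_chartD[OF M N f U V P(1,2) openin_topspace smooth_near_into(2)[OF f]])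
  have DU: "D \<subseteq> U" using D by auto
  show ?thesis
  proof (rule smooth_near_chartI[OF M N D(1,2) U(1) DU V(1)])
    have eq: "f x = g x" if "x \<in> D" for x using P(3) that D(3) by blast
    show "g ` D \<subseteq> V" using D(4) eq by auto
    show "smooth_euclidean (mdim M) (mdim N) (\<phi> ` D) (\<psi> \<circ> g \<circ> inv_into U \<phi>)"
      by (rule smooth_euclidean_cong[OF chart_image_open[OF M U(1) D(1) DU] _ D(5)])
        (use eq DU chart_inv[OF M U(1)] in auto)
  qed
qed

lemma smooth_near_comp:
  assumes M: "charted M" and N: "charted N" and P: "charted P"
    and f: "smooth_near M N p f" and g: "smooth_near N P (f p) g"
  shows "smooth_near M P p (\<lambda>x. g (f x))"
proof -
  note fp = smooth_near_into[OF f] and gp = smooth_near_into[OF g]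
  obtain U \<phi> where U: "(U, \<phi>) \<in> atlas M" "p \<in> U" using chart_at[OF M fp(1)] .
  obtain V \<psi> where V: "(V, \<psi>) \<in> atlas N" "f p \<in> V" using chart_at[OF N fp(2)] .
  obtain Q \<xi> where Q: "(Q, \<xi>) \<in> atlas P" "g (f p) \<in> Q" using chart_at[OF P gp(2)] .
  obtain D2 where D2: "openin (mtop N) D2" "f p \<in> D2" "D2 \<subseteq> V \<inter> topspace (mtop N)" "g ` D2 \<subseteq> Q \<inter> topspace (mtop P)"
    "smooth_euclidean (mdim N) (mdim P) (\<psi> ` D2) (\<xi> \<circ> g \<circ> inv_into V \<psi>)"
    by (rule smooth_near_chartD[OF N P g V Q openin_topspace fp(2) openin_topspace gp(2)])
  obtain D where D: "openin (mtop M) D" "p \<in> D" "D \<subseteq> U \<inter> topspace (mtop M)" "f ` D \<subseteq> V \<inter> D2"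
    "smooth_euclidean (mdim M) (mdim N) (\<phi> ` D) (\<psi> \<circ> f \<circ> inv_into U \<phi>)"
    by (rule smooth_near_chartD[OF M N f U V openin_topspace fp(1) D2(1,2)])
  have DU: "D \<subseteq> U" and D2V: "D2 \<subseteq> V" using D D2 by auto
  note iU = chart_inv[OF M U(1)] and iV = chart_inv[OF N V(1)]
  have o1: "openin (Euclidean_space (mdim M)) (\<phi> ` D)" by (rule chart_image_open[OF M U(1) D(1) DU])
  have o2: "openin (Euclidean_space (mdim N)) (\<psi> ` D2)" by (rule chart_image_open[OF N V(1) D2(1) D2V])
  show ?thesis
  proof (rule smooth_near_chartI[OF M P D(1,2) U(1) DU Q(1)])
    show "(\<lambda>x. g (f x)) ` D \<subseteq> Q" using D(4) D2(4) by auto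
    have "smooth_euclidean (mdim M) (mdim P) (\<phi> ` D) (\<lambda>x. (\<xi> \<circ> g \<circ> inv_into V \<psi>) ((\<psi> \<circ> f \<circ> inv_into U \<phi>) x))"
    proof (rule smooth_euclidean_comp[OF o1 o2 _ D(5) D2(5)])
      show "(\<psi> \<circ> f \<circ> inv_into U \<phi>) ` \<phi> ` D \<subseteq> \<psi> ` D2"
      proof (clarsimp)
        fix x assume x: "x \<in> D"
        then have "x \<in> U" using DU by auto
        then show "\<psi> (f (inv_into U \<phi> (\<phi> x))) \<in> \<psi> ` D2" using iU D(4) x by auto
      qed
    qed
    then show "smooth_euclidean (mdim M) (mdim P) (\<phi> ` D) (\<xi> \<circ> (\<lambda>x. g (f x)) \<circ> inv_into U \<phi>)"
    proof (rule smooth_euclidean_cong[OF o1, rotated])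
      fix y j assume "y \<in> \<phi> ` D"
      then obtain x where x: "x \<in> D" "y = \<phi> x" by auto
      then have "x \<in> U" "f x \<in> V" using DU D(4) by auto
      then show "(\<xi> \<circ> g \<circ> inv_into V \<psi>) ((\<psi> \<circ> f \<circ> inv_into U \<phi>) y) j = (\<xi> \<circ> (\<lambda>x. g (f x)) \<circ> inv_into U \<phi>) y j"
        using x iU iV by simp
    qed
  qed
qed

text \<open>By \<open>Ck_local\<close> smoothness can be tested near each point. Compositions, pairs
  and translations are then handled through \<open>smooth_near\<close>, where no common domain has
  to be tracked.\<close>

lemma smooth_map_on_iff:
  assumes M: "charted M" and N: "charted N"
  shows "smooth_map_on M N D f \<longleftrightarrow> openin (mtop M) D \<and> (\<forall>p\<in>D. smooth_near M N p f)"
proof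
  assume "smooth_map_on M N D f"
  then show "openin (mtop M) D \<and> (\<forall>p\<in>D. smooth_near M N p f)"
    using smooth_map_onD(1) unfolding smooth_near_def by blast
next
  assume *: "openin (mtop M) D \<and> (\<forall>p\<in>D. smooth_near M N p f)"
  then have D: "openin (mtop M) D" and near: "\<And>p. p \<in> D \<Longrightarrow> smooth_near M N p f" by auto
  have op: "openin (mtop M) {x \<in> D. f x \<in> Q}" if Q: "openin (mtop N) Q" for Q
  proof (subst openin_subopen, intro ballI)
    fix p assume p: "p \<in> {x \<in> D. f x \<in> Q}"
    then obtain T where "openin (mtop M) T" "p \<in> T" "f ` T \<subseteq> Q"
      using smooth_near_open[OF near[of p] Q] by auto
    then show "\<exists>T. openin (mtop M) T \<and> p \<in> T \<and> T \<subseteq> {x \<in> D. f x \<in> Q}"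
      using D p by (intro exI[of _ "T \<inter> D"]) auto
  qed
  have cont: "continuous_map (subtopology (mtop M) D) (mtop N) f"
    unfolding continuous_map_def
  proof (intro conjI allI impI)
    show "f \<in> topspace (subtopology (mtop M) D) \<rightarrow> topspace (mtop N)"
      using smooth_near_into(2)[OF near] by auto
    fix Q assume Q: "openin (mtop N) Q"
    have "{x \<in> topspace (subtopology (mtop M) D). f x \<in> Q} = {x \<in> D. f x \<in> Q}" using openin_subset[OF D] by auto
    then show "openin (subtopology (mtop M) D) {x \<in> topspace (subtopology (mtop M) D). f x \<in> Q}"
      using op[OF Q] D by (auto simp: openin_open_subtopology)
  qed
  have "smooth_euclidean (mdim M) (mdim N) (\<phi> ` (D \<inter> U \<inter> f -` V)) (\<psi> \<circ> f \<circ> inv_into U \<phi>)"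
    if U: "(U, \<phi>) \<in> atlas M" and V: "(V, \<psi>) \<in> atlas N" for U \<phi> V \<psi>
  proof -
    let ?D = "D \<inter> U \<inter> f -` V"
    have eq: "?D = {x \<in> D. f x \<in> V} \<inter> U" by auto
    have oD: "openin (mtop M) ?D" unfolding eq by (intro openin_Int op chart_open[OF N V] chart_open[OF M U])
    have o1: "openin (Euclidean_space (mdim M)) (\<phi> ` ?D)" by (rule chart_image_open[OF M U oD]) auto
    show ?thesis unfolding smooth_euclidean_def
    proof (intro allI impI Ck_local[OF o1])
      fix k j x assume j: "j < mdim N" and "x \<in> \<phi> ` ?D"
      then obtain p where p: "p \<in> ?D" "x = \<phi> p" by auto
      have pU: "p \<in> U" and pV: "f p \<in> V" and pD: "p \<in> D" using p by auto
      obtain T where T: "openin (mtop M) T" "p \<in> T" "T \<subseteq> U \<inter> ?D" "f ` T \<subseteq> V \<inter> topspace (mtop N)"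
        "smooth_euclidean (mdim M) (mdim N) (\<phi> ` T) (\<psi> \<circ> f \<circ> inv_into U \<phi>)"
        by (rule smooth_near_chartD[OF M N near[OF pD] U pU V pV oD p(1) openin_topspace smooth_near_into(2)[OF near[OF pD]]])
      have "openin (Euclidean_space (mdim M)) (\<phi> ` T)" by (rule chart_image_open[OF M U T(1)]) (use T in auto)
      then show "\<exists>W'. openin (Euclidean_space (mdim M)) W' \<and> x \<in> W' \<and> Ck_on (mdim M) k W' (\<lambda>x. (\<psi> \<circ> f \<circ> inv_into U \<phi>) x j)"
        using T(2) p(2) smooth_euclideanD[OF T(5) j] by blast
    qed
  qed
  then show "smooth_map_on M N D f" unfolding smooth_map_on_def using D cont by auto
qed

lemma smooth_near_id:
  assumes M: "charted M" and p: "p \<in> topspace (mtop M)"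
  shows "smooth_near M M p (\<lambda>x. x)"
proof -
  obtain U \<phi> where U: "(U, \<phi>) \<in> atlas M" "p \<in> U" using chart_at[OF M p] .
  show ?thesis
    by (rule smooth_near_chartI[OF M M chart_open[OF M U(1)] U(2) U(1) subset_refl U(1)])
      (use charted_compat[OF M U(1) U(1)] in \<open>auto simp: o_def\<close>)
qed

lemma smooth_near_const:
  assumes M: "charted M" and N: "charted N" and p: "p \<in> topspace (mtop M)" and c: "c \<in> topspace (mtop N)"
  shows "smooth_near M N p (\<lambda>x. c)"
proof -
  obtain U \<phi> where U: "(U, \<phi>) \<in> atlas M" "p \<in> U" using chart_at[OF M p] .
  obtain V \<psi> where V: "(V, \<psi>) \<in> atlas N" "c \<in> V" using chart_at[OF N c] .
  show ?thesis
    by (rule smooth_near_chartI[OF M N chart_open[OF M U(1)] U(2) U(1) subset_refl V(1)])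
      (use V Ck_const[OF chart_image_open'[OF M U(1)]] in \<open>auto simp: o_def smooth_euclidean_def\<close>)
qed

section \<open>Products and powers of manifolds\<close>

text \<open>Product charts, power charts and translated charts are all verified by exhibiting an
  explicit inverse \<open>\<Psi>\<close>; the last conclusion replaces the \<open>inv_into\<close>
  in the transition maps by that inverse.\<close>

lemma chart_from_inverse:
  assumes P: "openin X P" and B: "openin (Euclidean_space k) B"
    and c: "continuous_map (subtopology X P) (Euclidean_space k) \<Phi>"
    and ci: "continuous_map (subtopology (Euclidean_space k) B) X \<Psi>"
    and f: "\<And>x. x \<in> P \<Longrightarrow> \<Phi> x \<in> B \<and> \<Psi> (\<Phi> x) = x"
    and g: "\<And>z. z \<in> B \<Longrightarrow> \<Psi> z \<in> P \<and> \<Phi> (\<Psi> z) = z"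
  shows "\<Phi> ` P = B" "openin (Euclidean_space k) (\<Phi> ` P)"
    "homeomorphic_map (subtopology X P) (subtopology (Euclidean_space k) (\<Phi> ` P)) \<Phi>"
    "\<And>z. z \<in> B \<Longrightarrow> inv_into P \<Phi> z = \<Psi> z"
proof -
  show eq: "\<Phi> ` P = B" using f g by force
  then show "openin (Euclidean_space k) (\<Phi> ` P)" using B by simp
  have "homeomorphic_maps (subtopology X P) (subtopology (Euclidean_space k) B) \<Phi> \<Psi>"
    unfolding homeomorphic_maps_def using c ci f g by (auto simp: continuous_map_in_subtopology)
  then show "homeomorphic_map (subtopology X P) (subtopology (Euclidean_space k) (\<Phi> ` P)) \<Phi>"
    unfolding eq homeomorphic_map_maps by blast
  have inj: "inj_on \<Phi> P" using f by (metis inj_onI)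
  show "inv_into P \<Phi> z = \<Psi> z" if "z \<in> B" for z
    using inv_into_f_f[OF inj] g[OF that] by metis
qed

lemma chartedI:
  assumes "\<Union> (fst ` atlas M) = topspace (mtop M)"
    and "\<And>U \<phi>. (U, \<phi>) \<in> atlas M \<Longrightarrow> openin (mtop M) U \<and> openin (Euclidean_space (mdim M)) (\<phi> ` U) \<and>
        homeomorphic_map (subtopology (mtop M) U) (subtopology (Euclidean_space (mdim M)) (\<phi> ` U)) \<phi>"
    and "\<And>U \<phi> V \<psi>. (U, \<phi>) \<in> atlas M \<Longrightarrow> (V, \<psi>) \<in> atlas M \<Longrightarrow>
        smooth_euclidean (mdim M) (mdim M) (\<phi> ` (U \<inter> V)) (\<psi> \<circ> inv_into U \<phi>)"
  shows "charted M"
  unfolding charted_def case_prod_beta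
  using assms(1) by (intro conjI ballI) (auto dest: assms(2) intro: assms(3))

text \<open>Padding by zeros makes the extracted block a point of \<open>EE d\<close>, so that
  slices recover the two parts of a \<open>cat\<close> exactly.\<close>

definition slice :: "nat \<Rightarrow> nat \<Rightarrow> (nat \<Rightarrow> real) \<Rightarrow> nat \<Rightarrow> real" where
  "slice a d z = (\<lambda>j. if j < d then z (a + j) else 0)"

lemma slice_EE: "slice a d z \<in> EE d"
  by (auto simp: slice_def topspace_Euclidean_space)

lemma slice_cont: "continuous_map (Euclidean_space k) (Euclidean_space d) (slice a d)"
  by (rule continuous_map_into_Euclidean[OF slice_EE]) (simp add: slice_def continuous_map_coord)

lemma slice_Ck:
  assumes "openin (Euclidean_space n) W"
  shows "Ck_on n k W (\<lambda>z. slice a d z j)"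
  by (cases "j < d") (auto simp: slice_def intro: Ck_coord[OF assms] Ck_const[OF assms])

lemma slice_cat:
  "x \<in> EE n \<Longrightarrow> slice 0 n (cat n x y) = x" "y \<in> EE m \<Longrightarrow> slice n m (cat n x y) = y"
  by (rule EE_eqI[OF slice_EE], assumption, simp add: slice_def cat_def)+

lemma cat_slice: "z \<in> EE (n + m) \<Longrightarrow> cat n (slice 0 n z) (slice n m z) = z"
  by (rule ext) (auto simp: slice_def cat_def topspace_Euclidean_space)

section \<open>Binary products\<close>

lemma prod_manifold_simps [simp]:
  "mtop (prod_manifold M N) = prod_topology (mtop M) (mtop N)"
  "mdim (prod_manifold M N) = mdim M + mdim N"
  by (simp_all add: prod_manifold_def)

lemma atlas_prod_iff:
  "(P, \<Phi>) \<in> atlas (prod_manifold M N) \<longleftrightarrow> (\<exists>U \<phi> V \<psi>. P = U \<times> V \<and> \<Phi> = (\<lambda>(x, y). cat (mdim M) (\<phi> x) (\<psi> y)) \<and>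
     (U, \<phi>) \<in> atlas M \<and> (V, \<psi>) \<in> atlas N)"
  unfolding prod_manifold_def cat_def by auto

lemma prod_chart:
  assumes M: "charted M" and N: "charted N" and U: "(U, \<phi>) \<in> atlas M" and V: "(V, \<psi>) \<in> atlas N"
  defines "\<Phi> \<equiv> \<lambda>(x, y). cat (mdim M) (\<phi> x) (\<psi> y)"
  shows "openin (prod_topology (mtop M) (mtop N)) (U \<times> V)"
    "openin (Euclidean_space (mdim M + mdim N)) (\<Phi> ` (U \<times> V))"
    "homeomorphic_map (subtopology (prod_topology (mtop M) (mtop N)) (U \<times> V))
       (subtopology (Euclidean_space (mdim M + mdim N)) (\<Phi> ` (U \<times> V))) \<Phi>"
    "\<And>z. z \<in> \<Phi> ` (U \<times> V) \<Longrightarrow>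
       inv_into (U \<times> V) \<Phi> z = (inv_into U \<phi> (slice 0 (mdim M) z), inv_into V \<psi> (slice (mdim M) (mdim N) z))"
proof -
  let ?m = "mdim M" and ?n = "mdim N"
  note iU = chart_inv[OF M U] and iV = chart_inv[OF N V]
  note EU = chart_EE[OF M U] and EV = chart_EE[OF N V]
  show op: "openin (prod_topology (mtop M) (mtop N)) (U \<times> V)"
    using chart_open[OF M U] chart_open[OF N V] by (simp add: openin_prod_Times_iff)
  define B where "B = {z \<in> EE (?m + ?n). slice 0 ?m z \<in> \<phi> ` U} \<inter> {z \<in> EE (?m + ?n). slice ?m ?n z \<in> \<psi> ` V}"
  have B: "openin (Euclidean_space (?m + ?n)) B"
    unfolding B_def by (intro openin_Int openin_continuous_map_preimage[OF slice_cont] chart_image_open'[OF M U] chart_image_open'[OF N V])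
  let ?\<Psi> = "\<lambda>z. (inv_into U \<phi> (slice 0 ?m z), inv_into V \<psi> (slice ?m ?n z))"
  have top: "subtopology (prod_topology (mtop M) (mtop N)) (U \<times> V) = prod_topology (subtopology (mtop M) U) (subtopology (mtop N) V)"
    by (simp add: subtopology_Times)
  have c: "continuous_map (subtopology (prod_topology (mtop M) (mtop N)) (U \<times> V)) (Euclidean_space (?m + ?n)) \<Phi>"
    unfolding top
  proof (rule continuous_map_into_Euclidean)
    fix p assume "p \<in> topspace (prod_topology (subtopology (mtop M) U) (subtopology (mtop N) V))"
    then show "\<Phi> p \<in> EE (?m + ?n)" using EU EV by (auto simp: \<Phi>_def intro: cat_EE)
  next
    fix j assume "j < ?m + ?n"
    have 1: "continuous_map (subtopology (mtop M) U) euclideanreal (\<lambda>x. \<phi> x j)" for j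
      using continuous_map_compose[OF chart_cont[OF M U] continuous_map_coord] by (simp add: o_def)
    have 2: "continuous_map (subtopology (mtop N) V) euclideanreal (\<lambda>x. \<psi> x j)" for j
      using continuous_map_compose[OF chart_cont[OF N V] continuous_map_coord] by (simp add: o_def)
    show "continuous_map (prod_topology (subtopology (mtop M) U) (subtopology (mtop N) V)) euclideanreal (\<lambda>p. \<Phi> p j)"
    proof (cases "j < ?m")
      case True
      then show ?thesis using continuous_map_compose[OF continuous_map_fst 1[of j]]
        by (simp add: \<Phi>_def cat_def o_def case_prod_beta)
    next
      case False
      then show ?thesis using continuous_map_compose[OF continuous_map_snd 2[of "j - ?m"]]
        by (simp add: \<Phi>_def cat_def o_def case_prod_beta)
    qed
  qed
  have ci: "continuous_map (subtopology (Euclidean_space (?m + ?n)) B) (prod_topology (mtop M) (mtop N)) ?\<Psi>"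
  proof (intro continuous_map_pairedI)
    have "continuous_map (subtopology (Euclidean_space (?m + ?n)) B) (subtopology (Euclidean_space ?m) (\<phi> ` U)) (slice 0 ?m)"
      using continuous_map_from_subtopology[OF slice_cont] by (auto simp: continuous_map_in_subtopology B_def)
    from continuous_map_compose[OF this chart_inv_cont[OF M U]]
    show "continuous_map (subtopology (Euclidean_space (?m + ?n)) B) (mtop M) (\<lambda>z. inv_into U \<phi> (slice 0 ?m z))" by (simp add: o_def)
    have "continuous_map (subtopology (Euclidean_space (?m + ?n)) B) (subtopology (Euclidean_space ?n) (\<psi> ` V)) (slice ?m ?n)"
      using continuous_map_from_subtopology[OF slice_cont] by (auto simp: continuous_map_in_subtopology B_def)
    from continuous_map_compose[OF this chart_inv_cont[OF N V]]
    show "continuous_map (subtopology (Euclidean_space (?m + ?n)) B) (mtop N) (\<lambda>z. inv_into V \<psi> (slice ?m ?n z))" by (simp add: o_def)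
  qed
  have f: "\<Phi> p \<in> B \<and> ?\<Psi> (\<Phi> p) = p" if "p \<in> U \<times> V" for p
    using that EU EV iU iV by (auto simp: \<Phi>_def B_def slice_cat intro: cat_EE)
  have g: "?\<Psi> z \<in> U \<times> V \<and> \<Phi> (?\<Psi> z) = z" if z: "z \<in> B" for z
  proof -
    obtain x y where xy: "x \<in> U" "slice 0 ?m z = \<phi> x" "y \<in> V" "slice ?m ?n z = \<psi> y" using z by (auto simp: B_def)
    have "cat ?m (\<phi> x) (\<psi> y) = z" using cat_slice[of z ?m ?n] z xy by (simp add: B_def)
    then show ?thesis using xy iU iV by (simp add: \<Phi>_def)
  qed
  note X = chart_from_inverse[OF op B c ci f g]
  show "openin (Euclidean_space (?m + ?n)) (\<Phi> ` (U \<times> V))" using X(2) by simp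
  show "homeomorphic_map (subtopology (prod_topology (mtop M) (mtop N)) (U \<times> V))
       (subtopology (Euclidean_space (?m + ?n)) (\<Phi> ` (U \<times> V))) \<Phi>" using X(3) by simp
  show "\<And>z. z \<in> \<Phi> ` (U \<times> V) \<Longrightarrow>
       inv_into (U \<times> V) \<Phi> z = (inv_into U \<phi> (slice 0 ?m z), inv_into V \<psi> (slice ?m ?n z))" using X(1,4) by simp
qed

lemma charted_prod:
  assumes M: "charted M" and N: "charted N"
  shows "charted (prod_manifold M N)"
proof (rule chartedI)
  have "\<Union> (fst ` atlas (prod_manifold M N)) = \<Union> (fst ` atlas M) \<times> \<Union> (fst ` atlas N)"
  proof -
    have "p \<in> \<Union> (fst ` atlas (prod_manifold M N)) \<longleftrightarrow> (\<exists>P \<Phi>. (P, \<Phi>) \<in> atlas (prod_manifold M N) \<and> p \<in> P)" for p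
      by (auto simp: image_iff Bex_def)
    moreover have "(\<exists>P \<Phi>. (P, \<Phi>) \<in> atlas (prod_manifold M N) \<and> p \<in> P) \<longleftrightarrow>
        (\<exists>U \<phi> V \<psi>. p \<in> U \<times> V \<and> (U, \<phi>) \<in> atlas M \<and> (V, \<psi>) \<in> atlas N)" for p
      unfolding atlas_prod_iff by blast
    moreover have "(\<exists>U \<phi> V \<psi>. p \<in> U \<times> V \<and> (U, \<phi>) \<in> atlas M \<and> (V, \<psi>) \<in> atlas N)
        \<longleftrightarrow> p \<in> \<Union> (fst ` atlas M) \<times> \<Union> (fst ` atlas N)" for p
      by (cases p) (auto simp: image_iff Bex_def)
    ultimately show ?thesis by (intro Set.set_eqI) simp
  qed
  then show "\<Union> (fst ` atlas (prod_manifold M N)) = topspace (mtop (prod_manifold M N))"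
    using M N by (simp add: charted_def)
next
  fix P \<Phi> assume "(P, \<Phi>) \<in> atlas (prod_manifold M N)"
  then obtain U \<phi> V \<psi> where *: "P = U \<times> V" "\<Phi> = (\<lambda>(x, y). cat (mdim M) (\<phi> x) (\<psi> y))"
     "(U, \<phi>) \<in> atlas M" "(V, \<psi>) \<in> atlas N" unfolding atlas_prod_iff by blast
  show "openin (mtop (prod_manifold M N)) P \<and> openin (Euclidean_space (mdim (prod_manifold M N))) (\<Phi> ` P) \<and>
     homeomorphic_map (subtopology (mtop (prod_manifold M N)) P) (subtopology (Euclidean_space (mdim (prod_manifold M N))) (\<Phi> ` P)) \<Phi>"
    unfolding * prod_manifold_simps using prod_chart(1-3)[OF M N *(3,4)] by blast
next
  fix P \<Phi> P' \<Phi>' assume "(P, \<Phi>) \<in> atlas (prod_manifold M N)" "(P', \<Phi>') \<in> atlas (prod_manifold M N)"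
  then obtain U \<phi> V \<psi> U' \<phi>' V' \<psi>' where *: "P = U \<times> V" "\<Phi> = (\<lambda>(x, y). cat (mdim M) (\<phi> x) (\<psi> y))"
      "P' = U' \<times> V'" "\<Phi>' = (\<lambda>(x, y). cat (mdim M) (\<phi>' x) (\<psi>' y))"
    and U: "(U, \<phi>) \<in> atlas M" "(U', \<phi>') \<in> atlas M" and V: "(V, \<psi>) \<in> atlas N" "(V', \<psi>') \<in> atlas N"
    unfolding atlas_prod_iff by blast
  let ?m = "mdim M" and ?n = "mdim N"
  let ?W = "\<Phi> ` ((U \<inter> U') \<times> (V \<inter> V'))"
  have PP: "P \<inter> P' = (U \<inter> U') \<times> (V \<inter> V')" using * by auto
  have o1: "openin (Euclidean_space ?m) (\<phi> ` (U \<inter> U'))"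
    by (rule chart_image_open[OF M U(1)]) (use chart_open[OF M U(1)] chart_open[OF M U(2)] in auto)
  have o2: "openin (Euclidean_space ?n) (\<psi> ` (V \<inter> V'))"
    by (rule chart_image_open[OF N V(1)]) (use chart_open[OF N V(1)] chart_open[OF N V(2)] in auto)
  have sl: "slice 0 ?m (\<Phi> p) = \<phi> (fst p)" "slice ?m ?n (\<Phi> p) = \<psi> (snd p)" if "p \<in> U \<times> V" for p
    using that chart_EE[OF M U(1)] chart_EE[OF N V(1)] by (auto simp: * slice_cat)
  have ow: "openin (Euclidean_space (?m + ?n)) ?W"
  proof -
    have "?W = {z \<in> EE (?m + ?n). slice 0 ?m z \<in> \<phi> ` (U \<inter> U')} \<inter> {z \<in> EE (?m + ?n). slice ?m ?n z \<in> \<psi> ` (V \<inter> V')}"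
    proof (rule equalityI; rule subsetI)
      fix z assume "z \<in> ?W"
      then obtain x y where xy: "z = \<Phi> (x, y)" "x \<in> U" "x \<in> U'" "y \<in> V" "y \<in> V'" by auto
      have "\<Phi> (x, y) \<in> EE (?m + ?n)"
        using xy chart_EE[OF M U(1)] chart_EE[OF N V(1)] by (auto simp: * intro: cat_EE)
      then show "z \<in> {z \<in> EE (?m + ?n). slice 0 ?m z \<in> \<phi> ` (U \<inter> U')} \<inter> {z \<in> EE (?m + ?n). slice ?m ?n z \<in> \<psi> ` (V \<inter> V')}"
        using xy sl[of "(x, y)"] by auto
    next
      fix z assume z: "z \<in> {z \<in> EE (?m + ?n). slice 0 ?m z \<in> \<phi> ` (U \<inter> U')} \<inter> {z \<in> EE (?m + ?n). slice ?m ?n z \<in> \<psi> ` (V \<inter> V')}"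
      then obtain x y where xy: "slice 0 ?m z = \<phi> x" "slice ?m ?n z = \<psi> y" "x \<in> U" "x \<in> U'" "y \<in> V" "y \<in> V'" by auto
      have "z = \<Phi> (x, y)" using cat_slice[of z ?m ?n] z xy by (simp add: *)
      then show "z \<in> ?W" using xy by blast
    qed
    then show ?thesis
      using openin_Int[OF openin_continuous_map_preimage[OF slice_cont o1] openin_continuous_map_preimage[OF slice_cont o2]] by simp
  qed
  have "smooth_euclidean (?m + ?n) (?m + ?n) ?W
     (\<lambda>z. cat ?m ((\<phi>' \<circ> inv_into U \<phi>) (slice 0 ?m z)) ((\<psi>' \<circ> inv_into V \<psi>) (slice ?m ?n z)))"
    unfolding smooth_euclidean_def
  proof (intro allI impI Ck_cat)
    fix k r assume r: "r < ?m"
    show "Ck_on (?m + ?n) k ?W (\<lambda>z. (\<phi>' \<circ> inv_into U \<phi>) (slice 0 ?m z) r)"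
      by (rule Ck_comp[OF ow o1 _ _ smooth_euclideanD[OF charted_compat[OF M U] r]])
        (use sl slice_Ck[OF ow] in auto)
  next
    fix k r assume r: "r < ?n"
    show "Ck_on (?m + ?n) k ?W (\<lambda>z. (\<psi>' \<circ> inv_into V \<psi>) (slice ?m ?n z) r)"
      by (rule Ck_comp[OF ow o2 _ _ smooth_euclideanD[OF charted_compat[OF N V] r]])
        (use sl slice_Ck[OF ow] in auto)
  qed
  then show "smooth_euclidean (mdim (prod_manifold M N)) (mdim (prod_manifold M N)) (\<Phi> ` (P \<inter> P')) (\<Phi>' \<circ> inv_into P \<Phi>)"
    unfolding prod_manifold_simps PP
  proof (rule smooth_euclidean_cong[OF ow, rotated])
    fix z j assume "z \<in> ?W"
    then have "z \<in> \<Phi> ` (U \<times> V)" by auto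
    then have "inv_into P \<Phi> z = (inv_into U \<phi> (slice 0 ?m z), inv_into V \<psi> (slice ?m ?n z))"
      unfolding * by (rule prod_chart(4)[OF M N U(1) V(1)])
    then show "cat ?m ((\<phi>' \<circ> inv_into U \<phi>) (slice 0 ?m z)) ((\<psi>' \<circ> inv_into V \<psi>) (slice ?m ?n z)) j
       = (\<Phi>' \<circ> inv_into P \<Phi>) z j" by (simp add: *(4))
  qed
qed

lemma smooth_near_fst:
  assumes M: "charted M" and N: "charted N" and p: "p \<in> topspace (prod_topology (mtop M) (mtop N))"
  shows "smooth_near (prod_manifold M N) M p fst"
proof -
  have fp: "fst p \<in> topspace (mtop M)" "snd p \<in> topspace (mtop N)" using p by auto
  obtain U \<phi> where U: "(U, \<phi>) \<in> atlas M" "fst p \<in> U" using chart_at[OF M fp(1)] .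
  obtain V \<psi> where V: "(V, \<psi>) \<in> atlas N" "snd p \<in> V" using chart_at[OF N fp(2)] .
  note C = prod_chart[OF M N U(1) V(1)]
  let ?\<Phi> = "\<lambda>(x, y). cat (mdim M) (\<phi> x) (\<psi> y)"
  show ?thesis
  proof (rule smooth_near_chartI[OF charted_prod[OF M N] M _ _ _ subset_refl U(1)])
    show "openin (mtop (prod_manifold M N)) (U \<times> V)" using C(1) by simp
    show "p \<in> U \<times> V" using U V by (cases p) auto
    show "(U \<times> V, ?\<Phi>) \<in> atlas (prod_manifold M N)" using U V unfolding atlas_prod_iff by blast
    have "smooth_euclidean (mdim M + mdim N) (mdim M) (?\<Phi> ` (U \<times> V)) (slice 0 (mdim M))"
      unfolding smooth_euclidean_def using slice_Ck[OF C(2)] by blast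
    then show "smooth_euclidean (mdim (prod_manifold M N)) (mdim M) (?\<Phi> ` (U \<times> V)) (\<phi> \<circ> fst \<circ> inv_into (U \<times> V) ?\<Phi>)"
      unfolding prod_manifold_simps
    proof (rule smooth_euclidean_cong[OF C(2), rotated])
      fix z j assume z: "z \<in> ?\<Phi> ` (U \<times> V)"
      then have "slice 0 (mdim M) z \<in> \<phi> ` U" using chart_EE[OF M U(1)] by (auto simp: slice_cat)
      then have "\<phi> (inv_into U \<phi> (slice 0 (mdim M) z)) = slice 0 (mdim M) z" by (rule f_inv_into_f)
      then show "slice 0 (mdim M) z j = (\<phi> \<circ> fst \<circ> inv_into (U \<times> V) ?\<Phi>) z j" using C(4)[OF z] by simp
    qed
  qed auto
qed

lemma smooth_near_snd:
  assumes M: "charted M" and N: "charted N" and p: "p \<in> topspace (prod_topology (mtop M) (mtop N))"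
  shows "smooth_near (prod_manifold M N) N p snd"
proof -
  have fp: "fst p \<in> topspace (mtop M)" "snd p \<in> topspace (mtop N)" using p by auto
  obtain U \<phi> where U: "(U, \<phi>) \<in> atlas M" "fst p \<in> U" using chart_at[OF M fp(1)] .
  obtain V \<psi> where V: "(V, \<psi>) \<in> atlas N" "snd p \<in> V" using chart_at[OF N fp(2)] .
  note C = prod_chart[OF M N U(1) V(1)]
  let ?\<Phi> = "\<lambda>(x, y). cat (mdim M) (\<phi> x) (\<psi> y)"
  show ?thesis
  proof (rule smooth_near_chartI[OF charted_prod[OF M N] N _ _ _ subset_refl V(1)])
    show "openin (mtop (prod_manifold M N)) (U \<times> V)" using C(1) by simp
    show "p \<in> U \<times> V" using U V by (cases p) auto
    show "(U \<times> V, ?\<Phi>) \<in> atlas (prod_manifold M N)" using U V unfolding atlas_prod_iff by blast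
    have "smooth_euclidean (mdim M + mdim N) (mdim N) (?\<Phi> ` (U \<times> V)) (slice (mdim M) (mdim N))"
      unfolding smooth_euclidean_def using slice_Ck[OF C(2)] by blast
    then show "smooth_euclidean (mdim (prod_manifold M N)) (mdim N) (?\<Phi> ` (U \<times> V)) (\<psi> \<circ> snd \<circ> inv_into (U \<times> V) ?\<Phi>)"
      unfolding prod_manifold_simps
    proof (rule smooth_euclidean_cong[OF C(2), rotated])
      fix z j assume z: "z \<in> ?\<Phi> ` (U \<times> V)"
      then have "slice (mdim M) (mdim N) z \<in> \<psi> ` V" using chart_EE[OF N V(1)] by (auto simp: slice_cat)
      then have "\<psi> (inv_into V \<psi> (slice (mdim M) (mdim N) z)) = slice (mdim M) (mdim N) z" by (rule f_inv_into_f)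
      then show "slice (mdim M) (mdim N) z j = (\<psi> \<circ> snd \<circ> inv_into (U \<times> V) ?\<Phi>) z j" using C(4)[OF z] by simp
    qed
  qed auto
qed

lemma smooth_near_pair:
  assumes L: "charted L" and M: "charted M" and N: "charted N"
    and f: "smooth_near L M p f" and g: "smooth_near L N p g"
  shows "smooth_near L (prod_manifold M N) p (\<lambda>x. (f x, g x))"
proof -
  note fp = smooth_near_into[OF f] and gp = smooth_near_into[OF g]
  obtain Q \<xi> where Q: "(Q, \<xi>) \<in> atlas L" "p \<in> Q" using chart_at[OF L fp(1)] .
  obtain U \<phi> where U: "(U, \<phi>) \<in> atlas M" "f p \<in> U" using chart_at[OF M fp(2)] .
  obtain V \<psi> where V: "(V, \<psi>) \<in> atlas N" "g p \<in> V" using chart_at[OF N gp(2)] .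
  obtain D1 where D1: "openin (mtop L) D1" "p \<in> D1" "D1 \<subseteq> Q \<inter> topspace (mtop L)" "f ` D1 \<subseteq> U \<inter> topspace (mtop M)"
    "smooth_euclidean (mdim L) (mdim M) (\<xi> ` D1) (\<phi> \<circ> f \<circ> inv_into Q \<xi>)"
    by (rule smooth_near_chartD[OF L M f Q U openin_topspace fp(1) openin_topspace fp(2)])
  obtain D where D: "openin (mtop L) D" "p \<in> D" "D \<subseteq> Q \<inter> D1" "g ` D \<subseteq> V \<inter> topspace (mtop N)"
    "smooth_euclidean (mdim L) (mdim N) (\<xi> ` D) (\<psi> \<circ> g \<circ> inv_into Q \<xi>)"
    by (rule smooth_near_chartD[OF L N g Q V D1(1,2) openin_topspace gp(2)])
  have DQ: "D \<subseteq> Q" using D by auto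
  let ?\<Phi> = "\<lambda>(x, y). cat (mdim M) (\<phi> x) (\<psi> y)"
  show ?thesis
  proof (rule smooth_near_chartI[OF L charted_prod[OF M N] D(1,2) Q(1) DQ])
    show "(U \<times> V, ?\<Phi>) \<in> atlas (prod_manifold M N)" using U V unfolding atlas_prod_iff by blast
    show "(\<lambda>x. (f x, g x)) ` D \<subseteq> U \<times> V" using D(3,4) D1(4) by blast
    have "smooth_euclidean (mdim L) (mdim M + mdim N) (\<xi> ` D)
        (\<lambda>x. cat (mdim M) ((\<phi> \<circ> f \<circ> inv_into Q \<xi>) x) ((\<psi> \<circ> g \<circ> inv_into Q \<xi>) x))"
      unfolding smooth_euclidean_def
    proof (intro allI impI Ck_cat)
      have "\<xi> ` D \<subseteq> \<xi> ` D1" using D(3) by blast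
      from smooth_euclidean_subset[OF this D1(5)]
      show "r < mdim M \<Longrightarrow> Ck_on (mdim L) k (\<xi> ` D) (\<lambda>x. (\<phi> \<circ> f \<circ> inv_into Q \<xi>) x r)" for k r
        by (rule smooth_euclideanD)
      show "r < mdim N \<Longrightarrow> Ck_on (mdim L) k (\<xi> ` D) (\<lambda>x. (\<psi> \<circ> g \<circ> inv_into Q \<xi>) x r)" for k r
        by (rule smooth_euclideanD[OF D(5)])
    qed
    then show "smooth_euclidean (mdim L) (mdim (prod_manifold M N)) (\<xi> ` D) (?\<Phi> \<circ> (\<lambda>x. (f x, g x)) \<circ> inv_into Q \<xi>)"
      by (simp add: o_def)
  qed
qed

section \<open>Powers\<close>

lemma power_manifold_simps [simp]:
  "mtop (power_manifold M n) = product_topology (\<lambda>_. mtop M) {1..n}"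
  "mdim (power_manifold M n) = n * mdim M"
  by (simp_all add: power_manifold_def)

text \<open>Blocks of coordinates are counted from 0 and the factors of the power from 1, hence the
  \<open>Suc\<close>. The zeros from \<open>n * d\<close> on make the result a point of
  \<open>EE (n * d)\<close>.\<close>

definition power_chart :: "nat \<Rightarrow> nat \<Rightarrow> (nat \<Rightarrow> 'a \<Rightarrow> nat \<Rightarrow> real) \<Rightarrow> (nat \<Rightarrow> 'a) \<Rightarrow> nat \<Rightarrow> real" where
  "power_chart n d \<phi> s = (\<lambda>k. if k < n * d then \<phi> (Suc (k div d)) (s (Suc (k div d))) (k mod d) else 0)"

lemma atlas_power_iff:
  "(P, \<Phi>) \<in> atlas (power_manifold M n) \<longleftrightarrow> (\<exists>U \<phi>. P = PiE {1..n} U \<and> \<Phi> = power_chart n (mdim M) \<phi> \<and>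
     (\<forall>i\<in>{1..n}. (U i, \<phi> i) \<in> atlas M))"
  unfolding power_manifold_def power_chart_def by auto

lemma power_chart_EE: "power_chart n d \<phi> s \<in> EE (n * d)"
  by (auto simp: power_chart_def topspace_Euclidean_space)

lemma block_index:
  assumes "i \<in> {1..n}" "j < d"
  shows "(i - 1) * d + j < n * d" "Suc (((i - 1) * d + j) div d) = i" "((i - 1) * d + j) mod d = j"
proof -
  have "(i - 1) * d + j < (i - 1) * d + d" using assms by simp
  also have "\<dots> = i * d" using assms by (cases i) auto
  also have "\<dots> \<le> n * d" using assms by simp
  finally show "(i - 1) * d + j < n * d" .
qed (use assms in auto)

lemma slice_power_chart:
  assumes "i \<in> {1..n}" "\<phi> i (s i) \<in> EE d"
  shows "slice ((i - 1) * d) d (power_chart n d \<phi> s) = \<phi> i (s i)"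
  by (rule EE_eqI[OF slice_EE assms(2)]) (use block_index[OF assms(1)] in \<open>simp add: slice_def power_chart_def\<close>)

lemma block_less: "k < n * d \<Longrightarrow> k mod d < d \<and> Suc (k div d) \<in> {1..n} \<and> (k div d) * d + k mod d = k"
  by (cases "d = 0") (auto simp: Suc_le_eq less_mult_imp_div_less)

lemma power_chart_slice:
  assumes "z \<in> EE (n * d)" "\<And>i. i \<in> {1..n} \<Longrightarrow> \<phi> i (s i) = slice ((i - 1) * d) d z"
  shows "power_chart n d \<phi> s = z"
proof (rule EE_eqI[OF power_chart_EE assms(1)])
  fix k assume k: "k < n * d"
  note b = block_less[OF k]
  show "power_chart n d \<phi> s k = z k" using k b assms(2)[of "Suc (k div d)"] by (simp add: power_chart_def slice_def)
qed

lemma Ck_power_chart: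
  assumes W: "openin (Euclidean_space l) W"
    and "\<And>i j. i \<in> {1..n} \<Longrightarrow> j < d \<Longrightarrow> Ck_on l k W (\<lambda>x. \<phi> i (f x i) j)"
  shows "Ck_on l k W (\<lambda>x. power_chart n d \<phi> (f x) r)"
proof (cases "r < n * d")
  case True
  with block_less[OF True] show ?thesis using assms(2)[of "Suc (r div d)" "r mod d"] by (simp add: power_chart_def)
qed (simp add: power_chart_def Ck_const[OF W])

lemma power_chart_chart:
  assumes M: "charted M" and U': "\<forall>i\<in>{1..n}. (U i, \<phi> i) \<in> atlas M"
  defines "d \<equiv> mdim M"
  shows "openin (product_topology (\<lambda>_. mtop M) {1..n}) (PiE {1..n} U)"
    "openin (Euclidean_space (n * d)) (power_chart n d \<phi> ` PiE {1..n} U)"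
    "homeomorphic_map (subtopology (product_topology (\<lambda>_. mtop M) {1..n}) (PiE {1..n} U))
       (subtopology (Euclidean_space (n * d)) (power_chart n d \<phi> ` PiE {1..n} U)) (power_chart n d \<phi>)"
    "\<And>z. z \<in> power_chart n d \<phi> ` PiE {1..n} U \<Longrightarrow>
       inv_into (PiE {1..n} U) (power_chart n d \<phi>) z = (\<lambda>i\<in>{1..n}. inv_into (U i) (\<phi> i) (slice ((i - 1) * d) d z))"
proof -
  note U = U'[rule_format]
  let ?P = "PiE {1..n} U" and ?\<Phi> = "power_chart n d \<phi>" and ?X = "product_topology (\<lambda>_. mtop M) {1..n}"
  have sl: "slice ((i - 1) * d) d (?\<Phi> s) = \<phi> i (s i)" if "i \<in> {1..n}" "s i \<in> U i" for i s
    by (rule slice_power_chart[OF that(1)]) (use chart_EE[OF M U[OF that(1)] that(2)] in \<open>simp add: d_def\<close>)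
  show op: "openin ?X ?P"
    by (rule openin_PiE_gen[THEN iffD2]) (use chart_open[OF M U] in \<open>auto\<close>)
  define B where "B = (\<Inter>i\<in>{1..n}. {z \<in> EE (n * d). slice ((i - 1) * d) d z \<in> \<phi> i ` U i}) \<inter> EE (n * d)"
  have B: "openin (Euclidean_space (n * d)) B"
    unfolding B_def
    by (rule openin_INT) (use chart_image_open'[OF M U] openin_continuous_map_preimage[OF slice_cont] in \<open>auto simp: d_def\<close>)
  let ?\<Psi> = "\<lambda>z. \<lambda>i\<in>{1..n}. inv_into (U i) (\<phi> i) (slice ((i - 1) * d) d z)"
  have c: "continuous_map (subtopology ?X ?P) (Euclidean_space (n * d)) ?\<Phi>"
  proof (rule continuous_map_into_Euclidean[OF power_chart_EE])
    fix k assume k: "k < n * d"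
    note b = block_less[OF k]
    let ?i = "Suc (k div d)"
    have "continuous_map (subtopology ?X ?P) (mtop M) (\<lambda>s. s ?i)"
      using b by (intro continuous_map_from_subtopology continuous_map_product_coordinates) auto
    then have "continuous_map (subtopology ?X ?P) (subtopology (mtop M) (U ?i)) (\<lambda>s. s ?i)"
      using b by (auto simp: continuous_map_in_subtopology PiE_iff)
    from continuous_map_compose[OF continuous_map_compose[OF this chart_cont[OF M U[of ?i]]] continuous_map_coord, of "k mod d"]
    show "continuous_map (subtopology ?X ?P) euclideanreal (\<lambda>s. ?\<Phi> s k)"
      using b k by (simp add: power_chart_def o_def)
  qed
  have ci: "continuous_map (subtopology (Euclidean_space (n * d)) B) ?X ?\<Psi>"
    unfolding continuous_map_componentwise
  proof (intro conjI ballI)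
    fix i assume i: "i \<in> {1..n}"
    have "continuous_map (subtopology (Euclidean_space (n * d)) B) (subtopology (Euclidean_space (mdim M)) (\<phi> i ` U i)) (slice ((i - 1) * d) d)"
      using continuous_map_from_subtopology[OF slice_cont] i by (auto simp: continuous_map_in_subtopology B_def d_def)
    from continuous_map_compose[OF this chart_inv_cont[OF M U[OF i]]]
    show "continuous_map (subtopology (Euclidean_space (n * d)) B) (mtop M) (\<lambda>z. ?\<Psi> z i)"
      using i by (simp add: o_def)
  qed (auto simp: extensional_def)
  have f: "?\<Phi> s \<in> B \<and> ?\<Psi> (?\<Phi> s) = s" if s: "s \<in> ?P" for s
  proof
    show "?\<Phi> s \<in> B" using power_chart_EE sl s by (fastforce simp: B_def PiE_iff)
    show "?\<Psi> (?\<Phi> s) = s"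
    proof (rule extensionalityI[of _ "{1..n}"])
      fix i assume i: "i \<in> {1..n}"
      then show "?\<Psi> (?\<Phi> s) i = s i" using s sl[OF i] chart_inv[OF M U[OF i]] by (auto simp: PiE_iff)
    qed (use s in \<open>auto simp: PiE_iff\<close>)
  qed
  have g: "?\<Psi> z \<in> ?P \<and> ?\<Phi> (?\<Psi> z) = z" if z: "z \<in> B" for z
  proof
    have *: "slice ((i - 1) * d) d z \<in> \<phi> i ` U i" if "i \<in> {1..n}" for i using z that by (auto simp: B_def)
    then show "?\<Psi> z \<in> ?P" by (auto simp: PiE_iff inv_into_into)
    show "?\<Phi> (?\<Psi> z) = z"
      by (rule power_chart_slice) (use z * in \<open>auto simp: B_def f_inv_into_f\<close>)
  qed
  note X = chart_from_inverse[OF op B c ci f g]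
  show "openin (Euclidean_space (n * d)) (?\<Phi> ` ?P)"
    "homeomorphic_map (subtopology ?X ?P) (subtopology (Euclidean_space (n * d)) (?\<Phi> ` ?P)) ?\<Phi>"
    using X(2,3) by simp_all
  show "inv_into ?P ?\<Phi> z = ?\<Psi> z" if "z \<in> ?\<Phi> ` ?P" for z
  proof -
    have zB: "z \<in> B" using that X(1) by blast
    show ?thesis by (rule X(4)[OF _ _ zB])
  qed
qed

lemma charted_power:
  assumes M: "charted M"
  shows "charted (power_manifold M n)"
proof (rule chartedI)
  show "\<Union> (fst ` atlas (power_manifold M n)) = topspace (mtop (power_manifold M n))"
  proof (rule equalityI; rule subsetI)
    fix s assume "s \<in> \<Union> (fst ` atlas (power_manifold M n))"
    then obtain P \<Phi> where "(P, \<Phi>) \<in> atlas (power_manifold M n)" "s \<in> P" by auto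
    then obtain U \<phi> where "s \<in> PiE {1..n} U" "\<And>i. i \<in> {1..n} \<Longrightarrow> (U i, \<phi> i) \<in> atlas M"
      unfolding atlas_power_iff by blast
    then show "s \<in> topspace (mtop (power_manifold M n))" using chart_subset[OF M] by (fastforce simp: PiE_iff)
  next
    fix s assume s: "s \<in> topspace (mtop (power_manifold M n))"
    have "\<exists>U \<phi>. (U, \<phi>) \<in> atlas M \<and> s i \<in> U" if "i \<in> {1..n}" for i
    proof -
      have "s i \<in> topspace (mtop M)" using s that by (auto simp: PiE_iff)
      from chart_at[OF M this] show ?thesis by blast
    qed
    then obtain U \<phi> where U: "\<And>i. i \<in> {1..n} \<Longrightarrow> (U i, \<phi> i) \<in> atlas M \<and> s i \<in> U i" by metis
    then have "s \<in> PiE {1..n} U" using s by (auto simp: PiE_iff)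
    moreover have "(PiE {1..n} U, power_chart n (mdim M) \<phi>) \<in> atlas (power_manifold M n)"
      unfolding atlas_power_iff using U by blast
    ultimately show "s \<in> \<Union> (fst ` atlas (power_manifold M n))" by (metis UnionI fst_conv image_eqI)
  qed
next
  fix P \<Phi> assume "(P, \<Phi>) \<in> atlas (power_manifold M n)"
  then obtain U \<phi> where *: "P = PiE {1..n} U" "\<Phi> = power_chart n (mdim M) \<phi>"
    "\<forall>i\<in>{1..n}. (U i, \<phi> i) \<in> atlas M" unfolding atlas_power_iff by blast
  show "openin (mtop (power_manifold M n)) P \<and> openin (Euclidean_space (mdim (power_manifold M n))) (\<Phi> ` P) \<and>
     homeomorphic_map (subtopology (mtop (power_manifold M n)) P) (subtopology (Euclidean_space (mdim (power_manifold M n))) (\<Phi> ` P)) \<Phi>"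
    unfolding *(1,2) power_manifold_simps using power_chart_chart(1-3)[OF M *(3)] by blast
next
  fix P \<Phi> P' \<Phi>' assume "(P, \<Phi>) \<in> atlas (power_manifold M n)" "(P', \<Phi>') \<in> atlas (power_manifold M n)"
  then obtain U \<phi> U' \<phi>' where *: "P = PiE {1..n} U" "\<Phi> = power_chart n (mdim M) \<phi>"
      "P' = PiE {1..n} U'" "\<Phi>' = power_chart n (mdim M) \<phi>'"
    and U: "\<And>i. i \<in> {1..n} \<Longrightarrow> (U i, \<phi> i) \<in> atlas M" and U': "\<And>i. i \<in> {1..n} \<Longrightarrow> (U' i, \<phi>' i) \<in> atlas M"
    unfolding atlas_power_iff by blast
  let ?d = "mdim M"
  have "\<forall>i\<in>{1..n}. (U i, \<phi> i) \<in> atlas M" "\<forall>i\<in>{1..n}. (U' i, \<phi>' i) \<in> atlas M" using U U' by auto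
  note C = power_chart_chart[OF M this(1)] and C' = power_chart_chart[OF M this(2)]
  let ?X = "product_topology (\<lambda>_. mtop M) {1..n}"
  have sl: "slice ((i - 1) * ?d) ?d (\<Phi> s) = \<phi> i (s i)" if "i \<in> {1..n}" "s i \<in> U i" for i s
    unfolding * by (rule slice_power_chart[OF that(1)]) (rule chart_EE[OF M U[OF that(1)] that(2)])
  let ?W = "\<Phi> ` (P \<inter> P')"
  have PP: "openin ?X (P \<inter> P')" using C(1) C'(1) * by auto
  have ow: "openin (Euclidean_space (n * ?d)) ?W"
  proof -
    have "openin (subtopology ?X P) (P \<inter> P')"
      using PP C(1) unfolding * by (subst openin_open_subtopology) auto
    then have "openin (subtopology (Euclidean_space (n * ?d)) (\<Phi> ` P)) ?W"
      using homeomorphic_imp_open_map[OF C(3)] unfolding open_map_def *(1,2) by blast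
    then show ?thesis using C(2) unfolding *(1,2) by (rule openin_trans_full)
  qed
  have "smooth_euclidean (n * ?d) (n * ?d) ?W
     (\<lambda>z. \<Phi>' (\<lambda>i\<in>{1..n}. inv_into (U i) (\<phi> i) (slice ((i - 1) * ?d) ?d z)))"
    unfolding smooth_euclidean_def *(4)
  proof (intro allI impI Ck_power_chart[OF ow])
    fix k i j assume i: "i \<in> {1..n}" and j: "j < ?d"
    have o: "openin (Euclidean_space ?d) (\<phi> i ` (U i \<inter> U' i))"
      by (rule chart_image_open[OF M U[OF i]]) (use chart_open[OF M U[OF i]] chart_open[OF M U'[OF i]] in auto)
    have "Ck_on (n * ?d) k ?W (\<lambda>z. (\<phi>' i \<circ> inv_into (U i) (\<phi> i)) (slice ((i - 1) * ?d) ?d z) j)"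
    proof (rule Ck_comp[OF ow o _ slice_Ck[OF ow] smooth_euclideanD[OF charted_compat[OF M U[OF i] U'[OF i]] j]])
      show "slice ((i - 1) * ?d) ?d ` ?W \<subseteq> \<phi> i ` (U i \<inter> U' i)"
        using sl[OF i] i by (auto simp: *(1,3) PiE_iff)
    qed
    then show "Ck_on (n * ?d) k ?W (\<lambda>z. \<phi>' i ((\<lambda>i\<in>{1..n}. inv_into (U i) (\<phi> i) (slice ((i - 1) * ?d) ?d z)) i) j)"
      using i by simp
  qed
  then show "smooth_euclidean (mdim (power_manifold M n)) (mdim (power_manifold M n)) (\<Phi> ` (P \<inter> P')) (\<Phi>' \<circ> inv_into P \<Phi>)"
    unfolding power_manifold_simps
  proof (rule smooth_euclidean_cong[OF ow, rotated])
    fix z j assume "z \<in> ?W"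
    then have "z \<in> power_chart n ?d \<phi> ` PiE {1..n} U" unfolding * by blast
    from C(4)[OF this] show "\<Phi>' (\<lambda>i\<in>{1..n}. inv_into (U i) (\<phi> i) (slice ((i - 1) * ?d) ?d z)) j = (\<Phi>' \<circ> inv_into P \<Phi>) z j"
      by (simp add: *)
  qed
qed

lemma smooth_near_eval:
  assumes M: "charted M" and p: "p \<in> topspace (mtop (power_manifold M n))" and i: "i \<in> {1..n}"
  shows "smooth_near (power_manifold M n) M p (\<lambda>s. s i)"
proof -
  have "p \<in> \<Union> (fst ` atlas (power_manifold M n))" using charted_power[OF M, of n] p by (simp add: charted_def)
  then obtain P \<Phi> where P: "(P, \<Phi>) \<in> atlas (power_manifold M n)" "p \<in> P" by auto
  then obtain U \<phi> where *: "P = PiE {1..n} U" "\<Phi> = power_chart n (mdim M) \<phi>"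
    and U: "\<And>i. i \<in> {1..n} \<Longrightarrow> (U i, \<phi> i) \<in> atlas M" unfolding atlas_power_iff by blast
  let ?d = "mdim M"
  have "\<forall>i\<in>{1..n}. (U i, \<phi> i) \<in> atlas M" using U by auto
  note C = power_chart_chart[OF M this]
  have o: "openin (Euclidean_space (n * ?d)) (\<Phi> ` P)" using C(2) by (simp add: *)
  show ?thesis
  proof (rule smooth_near_chartI[OF charted_power[OF M] M _ P(2,1) subset_refl U[OF i]])
    show "openin (mtop (power_manifold M n)) P" using C(1) by (simp add: *)
    show "(\<lambda>s. s i) ` P \<subseteq> U i" using i by (auto simp: *)
    have "smooth_euclidean (n * ?d) ?d (\<Phi> ` P) (slice ((i - 1) * ?d) ?d)"
      unfolding smooth_euclidean_def using slice_Ck[OF o] by blast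
    then show "smooth_euclidean (mdim (power_manifold M n)) ?d (\<Phi> ` P) (\<phi> i \<circ> (\<lambda>s. s i) \<circ> inv_into P \<Phi>)"
      unfolding power_manifold_simps
    proof (rule smooth_euclidean_cong[OF o, rotated])
      fix z j assume z: "z \<in> \<Phi> ` P"
      then obtain s where s: "s \<in> P" "z = \<Phi> s" by auto
      have "s i \<in> U i" using s i by (auto simp: *)
      then have "slice ((i - 1) * ?d) ?d z = \<phi> i (s i)"
        unfolding s * by (intro slice_power_chart[OF i] chart_EE[OF M U[OF i]])
      then have "slice ((i - 1) * ?d) ?d z \<in> \<phi> i ` U i" using \<open>s i \<in> U i\<close> by simp
      then have "\<phi> i (inv_into (U i) (\<phi> i) (slice ((i - 1) * ?d) ?d z)) = slice ((i - 1) * ?d) ?d z" by (rule f_inv_into_f)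
      then show "slice ((i - 1) * ?d) ?d z j = (\<phi> i \<circ> (\<lambda>s. s i) \<circ> inv_into P \<Phi>) z j"
        using C(4)[of z] z i by (simp add: *)
    qed
  qed
qed

text \<open>The points of a power are extensional families, so componentwise smoothness has to be
  complemented by extensionality of the values. The domains of the finitely many components are
  intersected.\<close>

lemma smooth_near_tuple:
  assumes L: "charted L" and M: "charted M" and p: "p \<in> topspace (mtop L)"
    and f: "\<And>i. i \<in> {1..n} \<Longrightarrow> smooth_near L M p (\<lambda>x. f x i)"
    and ext: "\<And>x. x \<in> topspace (mtop L) \<Longrightarrow> f x \<in> extensional {1..n}"
  shows "smooth_near L (power_manifold M n) p f"
proof -
  obtain Q \<xi> where Q: "(Q, \<xi>) \<in> atlas L" "p \<in> Q" using chart_at[OF L p] .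
  have "\<exists>U \<phi> D. (U, \<phi>) \<in> atlas M \<and> openin (mtop L) D \<and> p \<in> D \<and> D \<subseteq> Q \<and> (\<lambda>x. f x i) ` D \<subseteq> U \<and>
    smooth_euclidean (mdim L) (mdim M) (\<xi> ` D) (\<phi> \<circ> (\<lambda>x. f x i) \<circ> inv_into Q \<xi>)" if i: "i \<in> {1..n}" for i
  proof -
    note fp = smooth_near_into[OF f[OF i]]
    obtain U \<phi> where U: "(U, \<phi>) \<in> atlas M" "f p i \<in> U" using chart_at[OF M fp(2)] .
    obtain D where "openin (mtop L) D" "p \<in> D" "D \<subseteq> Q \<inter> topspace (mtop L)" "(\<lambda>x. f x i) ` D \<subseteq> U \<inter> topspace (mtop M)"
      "smooth_euclidean (mdim L) (mdim M) (\<xi> ` D) (\<phi> \<circ> (\<lambda>x. f x i) \<circ> inv_into Q \<xi>)"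
      by (rule smooth_near_chartD[OF L M f[OF i] Q U openin_topspace p openin_topspace fp(2)])
    then show ?thesis using U by blast
  qed
  then obtain U \<phi> D where U: "\<And>i. i \<in> {1..n} \<Longrightarrow> (U i, \<phi> i) \<in> atlas M"
    and D: "\<And>i. i \<in> {1..n} \<Longrightarrow> openin (mtop L) (D i) \<and> p \<in> D i \<and> D i \<subseteq> Q \<and> (\<lambda>x. f x i) ` D i \<subseteq> U i \<and>
      smooth_euclidean (mdim L) (mdim M) (\<xi> ` D i) (\<phi> i \<circ> (\<lambda>x. f x i) \<circ> inv_into Q \<xi>)" by metis
  define T where "T = (\<Inter>i\<in>{1..n}. D i) \<inter> topspace (mtop L) \<inter> Q"
  have T: "openin (mtop L) T" "p \<in> T" "T \<subseteq> Q" "\<And>i. i \<in> {1..n} \<Longrightarrow> T \<subseteq> D i" "T \<subseteq> topspace (mtop L)"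
    unfolding T_def using D p Q by (auto intro!: openin_Int[OF openin_INT chart_open[OF L Q(1)]])
  have o: "openin (Euclidean_space (mdim L)) (\<xi> ` T)" by (rule chart_image_open[OF L Q(1) T(1,3)])
  show ?thesis
  proof (rule smooth_near_chartI[OF L charted_power[OF M] T(1,2) Q(1) T(3)])
    show "(PiE {1..n} U, power_chart n (mdim M) \<phi>) \<in> atlas (power_manifold M n)" unfolding atlas_power_iff using U by blast
    show "f ` T \<subseteq> PiE {1..n} U"
    proof
      fix s assume "s \<in> f ` T"
      then obtain x where x: "x \<in> T" "s = f x" by blast
      have "f x i \<in> U i" if "i \<in> {1..n}" for i using D[OF that] T(4)[OF that] x by blast
      then show "s \<in> PiE {1..n} U" using ext[of x] x T(5) by (auto simp: PiE_iff)
    qed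
    show "smooth_euclidean (mdim L) (mdim (power_manifold M n)) (\<xi> ` T) (power_chart n (mdim M) \<phi> \<circ> f \<circ> inv_into Q \<xi>)"
      unfolding smooth_euclidean_def o_def
    proof (intro allI impI Ck_power_chart[OF o])
      fix k i j assume i: "i \<in> {1..n}" and j: "j < mdim M"
      have "\<xi> ` T \<subseteq> \<xi> ` D i" using T(4)[OF i] by blast
      then have "smooth_euclidean (mdim L) (mdim M) (\<xi> ` T) (\<phi> i \<circ> (\<lambda>x. f x i) \<circ> inv_into Q \<xi>)"
        using D[OF i] smooth_euclidean_subset by blast
      from smooth_euclideanD[OF this j] show "Ck_on (mdim L) k (\<xi> ` T) (\<lambda>x. \<phi> i (f (inv_into Q \<xi> x) i) j)" by (simp add: o_def)
    qed
  qed
qed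

section \<open>Groups that are smooth near the identity\<close>

text \<open>Brings a smooth map of two variables into the form that the estimates use: a Euclidean
  map \<open>F\<close> of the concatenated coordinates, and one radius \<open>r\<close> within which
  all points of both charts are admissible.\<close>

lemma smooth_near_two_var_chart:
  assumes M: "charted M" and M': "charted M'" and N: "charted N"
    and f: "smooth_near (prod_manifold M M') N (p, p') f"
    and U: "(U, \<phi>) \<in> atlas M" "p \<in> U" and U': "(U', \<phi>') \<in> atlas M'" "p' \<in> U'" and V: "(V, \<psi>) \<in> atlas N" "f (p, p') \<in> V"
  obtains Z F r where "openin (Euclidean_space (mdim M + mdim M')) Z" "smooth_euclidean (mdim M + mdim M') (mdim N) Z F"
    "r > 0" "\<And>x y. x \<in> U \<Longrightarrow> y \<in> U' \<Longrightarrow> l1dist (mdim M) (\<phi> p) (\<phi> x) < r \<Longrightarrow> l1dist (mdim M') (\<phi>' p') (\<phi>' y) < r \<Longrightarrow>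
      cat (mdim M) (\<phi> x) (\<phi>' y) \<in> Z \<and> f (x, y) \<in> V \<and> F (cat (mdim M) (\<phi> x) (\<phi>' y)) = \<psi> (f (x, y))"
proof -
  let ?m = "mdim M" and ?m' = "mdim M'"
  let ?\<Phi> = "\<lambda>(x, y). cat ?m (\<phi> x) (\<phi>' y)"
  have chart: "(U \<times> U', ?\<Phi>) \<in> atlas (prod_manifold M M')" using U U' unfolding atlas_prod_iff by blast
  have pU: "(p, p') \<in> U \<times> U'" using U U' by simp
  note fp = smooth_near_into[OF f]
  note PM = charted_prod[OF M M']
  obtain D where D: "openin (mtop (prod_manifold M M')) D" "(p, p') \<in> D" "D \<subseteq> (U \<times> U') \<inter> topspace (mtop (prod_manifold M M'))"
    "f ` D \<subseteq> V \<inter> topspace (mtop N)"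
    "smooth_euclidean (mdim (prod_manifold M M')) (mdim N) (?\<Phi> ` D) (\<psi> \<circ> f \<circ> inv_into (U \<times> U') ?\<Phi>)"
    by (rule smooth_near_chartD[OF PM N f chart pU V openin_topspace fp(1) openin_topspace fp(2)])
  have DU: "D \<subseteq> U \<times> U'" using D(3) by auto
  have oZ: "openin (Euclidean_space (?m + ?m')) (?\<Phi> ` D)" using chart_image_open[OF PM chart D(1) DU] by simp
  have "cat ?m (\<phi> p) (\<phi>' p') \<in> ?\<Phi> ` D" using D(2) by force
  then obtain r where r: "r > 0" "\<And>z. z \<in> EE (?m + ?m') \<Longrightarrow> l1dist (?m + ?m') (cat ?m (\<phi> p) (\<phi>' p')) z < r \<Longrightarrow> z \<in> ?\<Phi> ` D"
    by (rule openin_EuclideanE[OF oZ]) (rule that)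
  show thesis
  \<comment> \<open>Half the radius, because \<open>l1dist_cat\<close> adds the distances of the two
    components.\<close>
  proof (rule that[of "?\<Phi> ` D" "\<psi> \<circ> f \<circ> inv_into (U \<times> U') ?\<Phi>" "r / 2"])
    show "smooth_euclidean (?m + ?m') (mdim N) (?\<Phi> ` D) (\<psi> \<circ> f \<circ> inv_into (U \<times> U') ?\<Phi>)" using D(5) by simp
    fix x y assume x: "x \<in> U" and y: "y \<in> U'" and d: "l1dist ?m (\<phi> p) (\<phi> x) < r / 2" "l1dist ?m' (\<phi>' p') (\<phi>' y) < r / 2"
    have xE: "\<phi> x \<in> EE ?m" "\<phi>' y \<in> EE ?m'" using chart_EE[OF M U(1) x] chart_EE[OF M' U'(1) y] by auto
    have Z: "cat ?m (\<phi> x) (\<phi>' y) \<in> ?\<Phi> ` D"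
      by (rule r(2)) (use d cat_EE[OF xE] in \<open>auto simp: l1dist_cat\<close>)
    have inv: "inv_into (U \<times> U') ?\<Phi> (cat ?m (\<phi> x) (\<phi>' y)) = (x, y)"
      using chart_inv[OF PM chart, of "(x, y)"] x y by simp
    from Z obtain q where "q \<in> D" "cat ?m (\<phi> x) (\<phi>' y) = ?\<Phi> q" by blast
    moreover from this have "q = (x, y)" using inv chart_inv[OF PM chart, of q] DU by auto
    ultimately have "(x, y) \<in> D" by simp
    then show "cat ?m (\<phi> x) (\<phi>' y) \<in> ?\<Phi> ` D \<and> f (x, y) \<in> V \<and> (\<psi> \<circ> f \<circ> inv_into (U \<times> U') ?\<Phi>) (cat ?m (\<phi> x) (\<phi>' y)) = \<psi> (f (x, y))"
      using Z D(4) inv by auto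
  qed (use oZ r in auto)
qed

text \<open>
  The hypotheses under which homomorphisms can be differentiated; continuity of right translations
  away from the identity is not among them, so that they also apply to an extension before its
  conjugations are known to be continuous.
\<close>

definition left_lie_group :: "'a lie_struct \<Rightarrow> bool" where
  "left_lie_group G \<longleftrightarrow>
     group G \<and> charted (mfd G) \<and> topspace (mtop (mfd G)) = carrier G \<and>
     (\<forall>g\<in>carrier G. \<forall>x\<in>carrier G. smooth_near (mfd G) (mfd G) x (\<lambda>y. g \<otimes>\<^bsub>G\<^esub> y)) \<and>
     smooth_near (prod_manifold (mfd G) (mfd G)) (mfd G) (\<one>\<^bsub>G\<^esub>, \<one>\<^bsub>G\<^esub>) (\<lambda>(x, y). x \<otimes>\<^bsub>G\<^esub> y) \<and>
     smooth_near (mfd G) (mfd G) \<one>\<^bsub>G\<^esub> (\<lambda>x. inv\<^bsub>G\<^esub> x)"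

context
  fixes G :: "'a lie_struct" (structure)
  assumes G: "left_lie_group G"
begin

lemma left_lie_group_simps:
  shows left_lie_is_group: "group G"
    and left_lie_charted: "charted (mfd G)"
    and left_lie_topspace: "topspace (mtop (mfd G)) = carrier G"
    and left_lie_translation: "g \<in> carrier G \<Longrightarrow> x \<in> carrier G \<Longrightarrow> smooth_near (mfd G) (mfd G) x (\<lambda>y. g \<otimes> y)"
    and left_lie_mult: "smooth_near (prod_manifold (mfd G) (mfd G)) (mfd G) (\<one>, \<one>) (\<lambda>(x, y). x \<otimes> y)"
    and left_lie_inv: "smooth_near (mfd G) (mfd G) \<one> (\<lambda>x. inv x)"
  using G by (auto simp: left_lie_group_def)

lemma left_lie_one: "\<one> \<in> topspace (mtop (mfd G))"
  using left_lie_topspace left_lie_is_group by (simp add: group.is_monoid)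

lemma smooth_near_mult_one:
  assumes "charted M" "smooth_near M (mfd G) p f" "smooth_near M (mfd G) p g" "f p = \<one>" "g p = \<one>"
  shows "smooth_near M (mfd G) p (\<lambda>x. f x \<otimes> g x)"
proof -
  have "smooth_near (prod_manifold (mfd G) (mfd G)) (mfd G) (f p, g p) (\<lambda>(x, y). x \<otimes> y)"
    using left_lie_mult assms by simp
  from smooth_near_comp[OF assms(1) charted_prod[OF left_lie_charted left_lie_charted] left_lie_charted
      smooth_near_pair[OF assms(1) left_lie_charted left_lie_charted assms(2,3)] this]
  show ?thesis by simp
qed

lemma smooth_near_inv_one:
  assumes "charted M" "smooth_near M (mfd G) p f" "f p = \<one>"
  shows "smooth_near M (mfd G) p (\<lambda>x. inv (f x))"
  using smooth_near_comp[OF assms(1) left_lie_charted left_lie_charted assms(2)] left_lie_inv assms(3) by simp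

lemma smooth_near_left_mult:
  assumes "charted M" "smooth_near M (mfd G) p f" "g \<in> carrier G"
  shows "smooth_near M (mfd G) p (\<lambda>x. g \<otimes> f x)"
  using smooth_near_comp[OF assms(1) left_lie_charted left_lie_charted assms(2)]
    left_lie_translation[OF assms(3)] smooth_near_into(2)[OF assms(2)] left_lie_topspace by auto

lemma smooth_near_division:
  "smooth_near (prod_manifold (mfd G) (mfd G)) (mfd G) (\<one>, \<one>) (\<lambda>(x, y). inv x \<otimes> y)"
proof -
  interpret group G by (rule left_lie_is_group)
  let ?P = "prod_manifold (mfd G) (mfd G)"
  have P: "charted ?P" by (rule charted_prod[OF left_lie_charted left_lie_charted])
  have p: "(\<one>, \<one>) \<in> topspace (prod_topology (mtop (mfd G)) (mtop (mfd G)))" using left_lie_one by simp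
  have "smooth_near ?P (mfd G) (\<one>, \<one>) (\<lambda>z. inv (fst z) \<otimes> snd z)"
    by (intro smooth_near_mult_one[OF P] smooth_near_inv_one[OF P] smooth_near_fst smooth_near_snd left_lie_charted p) auto
  then show ?thesis by (simp add: case_prod_unfold)
qed

section \<open>Multiplication and division in a chart at the identity\<close>

context
  fixes U \<phi>
  assumes U: "(U, \<phi>) \<in> atlas (mfd G)" "\<one> \<in> U"
begin

abbreviation (input) "nu x \<equiv> l1dist (mdim (mfd G)) (\<phi> \<one>) (\<phi> x)"

text \<open>When one factor is the identity, \<open>F\<close> returns the coordinates of the other.
  The deviation of multiplication from addition is therefore a mixed second difference, which
  \<open>smooth_bilinear\<close> bounds by \<open>nu x * nu y\<close>. The last estimate is
  Lipschitz continuity in the second factor.\<close>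

lemma mult_estimates:
  obtains C r where "C \<ge> 0" "r > 0"
    "\<And>x y. x \<in> U \<Longrightarrow> y \<in> U \<Longrightarrow> nu x < r \<Longrightarrow> nu y < r \<Longrightarrow> x \<otimes> y \<in> U"
    "\<And>x y. x \<in> U \<Longrightarrow> y \<in> U \<Longrightarrow> nu x < r \<Longrightarrow> nu y < r \<Longrightarrow>
       l1dist (mdim (mfd G)) (\<phi> (x \<otimes> y)) (\<lambda>j. \<phi> x j + \<phi> y j - \<phi> \<one> j) \<le> C * nu x * nu y"
    "\<And>x y. x \<in> U \<Longrightarrow> y \<in> U \<Longrightarrow> nu x < r \<Longrightarrow> nu y < r \<Longrightarrow> l1dist (mdim (mfd G)) (\<phi> (x \<otimes> y)) (\<phi> x) \<le> C * nu y"
proof -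
  interpret group G by (rule left_lie_is_group)
  let ?n = "mdim (mfd G)" let ?p = "\<phi> \<one>"
  have oneU: "(\<lambda>(x, y). x \<otimes> y) (\<one>, \<one>) \<in> U" using U by simp
  note ch = left_lie_charted
  have pE: "?p \<in> EE ?n" by (rule chart_EE[OF ch U])
  have UG: "x \<in> carrier G" if "x \<in> U" for x using chart_subset[OF ch U(1)] left_lie_topspace that by auto
  obtain Z F r0 where Z: "openin (Euclidean_space (?n + ?n)) Z" and F: "smooth_euclidean (?n + ?n) ?n Z F" and r0: "r0 > 0"
    and ZF: "\<And>x y. x \<in> U \<Longrightarrow> y \<in> U \<Longrightarrow> nu x < r0 \<Longrightarrow> nu y < r0 \<Longrightarrow>
      cat ?n (\<phi> x) (\<phi> y) \<in> Z \<and> (\<lambda>(x, y). x \<otimes> y) (x, y) \<in> U \<and> F (cat ?n (\<phi> x) (\<phi> y)) = \<phi> ((\<lambda>(x, y). x \<otimes> y) (x, y))"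
    by (rule smooth_near_two_var_chart[OF ch ch ch left_lie_mult U U U(1) oneU]) (rule that)
  have pZ: "cat ?n ?p ?p \<in> Z" using ZF[OF U(2) U(2)] r0 by simp
  obtain C1 r1 where 1: "C1 \<ge> 0" "r1 > 0" "\<And>x y. x \<in> EE ?n \<Longrightarrow> y \<in> EE ?n \<Longrightarrow> l1dist ?n ?p x < r1 \<Longrightarrow> l1dist ?n ?p y < r1 \<Longrightarrow>
      (\<Sum>j<?n. \<bar>F (cat ?n x y) j - F (cat ?n x ?p) j - F (cat ?n ?p y) j + F (cat ?n ?p ?p) j\<bar>)
        \<le> C1 * l1dist ?n ?p x * l1dist ?n ?p y"
    by (rule smooth_bilinear[OF Z F pZ pE pE]) (rule that)
  obtain C2 r2 where 2: "C2 \<ge> 0" "r2 > 0" "\<And>y z. y \<in> EE (?n + ?n) \<Longrightarrow> z \<in> EE (?n + ?n) \<Longrightarrow>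
      l1dist (?n + ?n) (cat ?n ?p ?p) y < r2 \<Longrightarrow> l1dist (?n + ?n) (cat ?n ?p ?p) z < r2 \<Longrightarrow>
      l1dist ?n (F y) (F z) \<le> C2 * l1dist (?n + ?n) y z"
    by (rule smooth_Lipschitz[OF Z F pZ]) (rule that)
  define r where "r = min r0 (min r1 (r2 / 2))"
  show thesis
  proof (rule that[of "C1 + C2" r])
    fix x y assume xy: "x \<in> U" "y \<in> U" "nu x < r" "nu y < r"
    have xr: "nu x < r0" "nu x < r1" "nu x < r2 / 2" "nu y < r0" "nu y < r1" "nu y < r2 / 2" using xy by (auto simp: r_def)
    have xE: "\<phi> x \<in> EE ?n" "\<phi> y \<in> EE ?n" using chart_EE[OF ch U(1)] xy by auto
    have Fxy: "F (cat ?n (\<phi> x) (\<phi> y)) = \<phi> (x \<otimes> y)" using ZF xy xr by auto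
    have F1: "F (cat ?n (\<phi> x) ?p) = \<phi> x" "F (cat ?n ?p (\<phi> y)) = \<phi> y" "F (cat ?n ?p ?p) = ?p"
      using ZF[of x \<one>] ZF[of \<one> y] ZF[of \<one> \<one>] xy xr U UG r0 by auto
    show "x \<otimes> y \<in> U" using ZF xy xr by auto
    have "l1dist ?n (\<phi> (x \<otimes> y)) (\<lambda>j. \<phi> x j + \<phi> y j - ?p j) \<le> C1 * nu x * nu y"
      using 1(3)[OF xE xr(2,5)] unfolding Fxy F1 l1dist_def[of _ "\<phi> (x \<otimes> y)"] by (simp add: algebra_simps)
    also have "\<dots> \<le> (C1 + C2) * nu x * nu y" using 2(1) by (intro mult_right_mono) auto
    finally show "l1dist ?n (\<phi> (x \<otimes> y)) (\<lambda>j. \<phi> x j + \<phi> y j - ?p j) \<le> (C1 + C2) * nu x * nu y" .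
    have "l1dist ?n (F (cat ?n (\<phi> x) (\<phi> y))) (F (cat ?n (\<phi> x) ?p)) \<le> C2 * l1dist (?n + ?n) (cat ?n (\<phi> x) (\<phi> y)) (cat ?n (\<phi> x) ?p)"
      by (rule 2(3)) (use xE pE xr 2 in \<open>auto intro: cat_EE simp: l1dist_cat\<close>)
    then have "l1dist ?n (\<phi> (x \<otimes> y)) (\<phi> x) \<le> C2 * nu y"
      unfolding Fxy F1 by (simp add: l1dist_cat l1dist_commute)
    also have "\<dots> \<le> (C1 + C2) * nu y" using 1(1) by (intro mult_right_mono) auto
    finally show "l1dist ?n (\<phi> (x \<otimes> y)) (\<phi> x) \<le> (C1 + C2) * nu y" .
  qed (use 1 2 r0 in \<open>auto simp: r_def\<close>)
qed

text \<open>The quotient is the identity for \<open>x = y\<close>, so a Lipschitz estimate for the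
  division map compares \<open>inv x \<otimes> y\<close> with
  \<open>inv x \<otimes> x\<close>.\<close>

lemma division_estimate:
  obtains C r where "C \<ge> 0" "r > 0"
    "\<And>x y. x \<in> U \<Longrightarrow> y \<in> U \<Longrightarrow> nu x < r \<Longrightarrow> nu y < r \<Longrightarrow> inv x \<otimes> y \<in> U"
    "\<And>x y. x \<in> U \<Longrightarrow> y \<in> U \<Longrightarrow> nu x < r \<Longrightarrow> nu y < r \<Longrightarrow> nu (inv x \<otimes> y) \<le> C * l1dist (mdim (mfd G)) (\<phi> x) (\<phi> y)"
proof -
  interpret group G by (rule left_lie_is_group)
  let ?n = "mdim (mfd G)" let ?p = "\<phi> \<one>" let ?f = "\<lambda>(x, y). inv x \<otimes> y"
  have oneU: "?f (\<one>, \<one>) \<in> U" using U by simp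
  note ch = left_lie_charted
  have UG: "x \<in> carrier G" if "x \<in> U" for x using chart_subset[OF ch U(1)] left_lie_topspace that by auto
  obtain Z F r0 where Z: "openin (Euclidean_space (?n + ?n)) Z" and F: "smooth_euclidean (?n + ?n) ?n Z F" and r0: "r0 > 0"
    and ZF: "\<And>x y. x \<in> U \<Longrightarrow> y \<in> U \<Longrightarrow> nu x < r0 \<Longrightarrow> nu y < r0 \<Longrightarrow>
      cat ?n (\<phi> x) (\<phi> y) \<in> Z \<and> ?f (x, y) \<in> U \<and> F (cat ?n (\<phi> x) (\<phi> y)) = \<phi> (?f (x, y))"
    by (rule smooth_near_two_var_chart[OF ch ch ch smooth_near_division U U U(1) oneU]) (rule that)
  have pZ: "cat ?n ?p ?p \<in> Z" using ZF[OF U(2) U(2)] r0 by simp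
  obtain C2 r2 where 2: "C2 \<ge> 0" "r2 > 0" "\<And>y z. y \<in> EE (?n + ?n) \<Longrightarrow> z \<in> EE (?n + ?n) \<Longrightarrow>
      l1dist (?n + ?n) (cat ?n ?p ?p) y < r2 \<Longrightarrow> l1dist (?n + ?n) (cat ?n ?p ?p) z < r2 \<Longrightarrow>
      l1dist ?n (F y) (F z) \<le> C2 * l1dist (?n + ?n) y z"
    by (rule smooth_Lipschitz[OF Z F pZ]) (rule that)
  define r where "r = min r0 (r2 / 2)"
  show thesis
  proof (rule that[of C2 r])
    fix x y assume xy: "x \<in> U" "y \<in> U" "nu x < r" "nu y < r"
    have xr: "nu x < r0" "nu x < r2 / 2" "nu y < r0" "nu y < r2 / 2" using xy by (auto simp: r_def)
    have xE: "\<phi> x \<in> EE ?n" "\<phi> y \<in> EE ?n" using chart_EE[OF ch U(1)] xy by auto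
    have Fxy: "F (cat ?n (\<phi> x) (\<phi> y)) = \<phi> (inv x \<otimes> y)" using ZF xy xr by auto
    have F1: "F (cat ?n (\<phi> x) (\<phi> x)) = ?p" using ZF[of x x] xy xr UG by auto
    show "inv x \<otimes> y \<in> U" using ZF xy xr by auto
    have "l1dist ?n (F (cat ?n (\<phi> x) (\<phi> x))) (F (cat ?n (\<phi> x) (\<phi> y))) \<le> C2 * l1dist (?n + ?n) (cat ?n (\<phi> x) (\<phi> x)) (cat ?n (\<phi> x) (\<phi> y))"
      by (rule 2(3)) (use xE xr 2 in \<open>auto intro: cat_EE simp: l1dist_cat\<close>)
    then show "nu (inv x \<otimes> y) \<le> C2 * l1dist ?n (\<phi> x) (\<phi> y)"
      unfolding Fxy F1 by (simp add: l1dist_cat)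
  qed (use 2 r0 in \<open>auto simp: r_def\<close>)
qed

end

end

text \<open>Put \<open>u w = \<theta> (h w)\<close> and let \<open>z\<close> be
  \<open>\<theta>\<close> of the quotient of \<open>h w\<close> and \<open>h w'\<close>.
  Multiplicativity makes \<open>u w'\<close> the product of \<open>u w\<close> and \<open>z\<close>,
  and \<open>est\<close> makes \<open>z\<close> linear up to a quadratic error, which is the
  situation of \<open>smooth_bootstrap\<close>. Since \<open>\<theta>\<close> is multiplicative on a
  subgroup \<open>S\<close>, the lemma applies to the inverse of an embedding as well as to
  homomorphisms of the whole group.\<close>

lemma smooth_near_of_linear_approximation:
  fixes H :: "'h lie_struct" and K :: "'k lie_struct" and \<theta> :: "'h \<Rightarrow> 'k"
  assumes H: "left_lie_group H" and K: "left_lie_group K" and M: "charted M"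
    and U: "(U, \<phi>) \<in> atlas (mfd H)" "\<one>\<^bsub>H\<^esub> \<in> U" and V: "(V, \<psi>) \<in> atlas (mfd K)" "\<one>\<^bsub>K\<^esub> \<in> V"
    and S: "subgroup S H" and hom: "\<And>x y. x \<in> S \<Longrightarrow> y \<in> S \<Longrightarrow> \<theta> (x \<otimes>\<^bsub>H\<^esub> y) = \<theta> x \<otimes>\<^bsub>K\<^esub> \<theta> y"
    and h: "smooth_near M (mfd H) p h" "h p = \<one>\<^bsub>H\<^esub>" and P: "openin (mtop M) P" "p \<in> P" "\<And>w. w \<in> P \<Longrightarrow> h w \<in> S"
    and r: "r > 0"
    and est: "\<And>y. y \<in> S \<Longrightarrow> y \<in> U \<Longrightarrow> l1dist (mdim (mfd H)) (\<phi> \<one>\<^bsub>H\<^esub>) (\<phi> y) < r \<Longrightarrow> \<theta> y \<in> V"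
      "\<And>y j. y \<in> S \<Longrightarrow> y \<in> U \<Longrightarrow> l1dist (mdim (mfd H)) (\<phi> \<one>\<^bsub>H\<^esub>) (\<phi> y) < r \<Longrightarrow> j < mdim (mfd K) \<Longrightarrow>
         \<bar>\<psi> (\<theta> y) j - \<psi> \<one>\<^bsub>K\<^esub> j - (\<Sum>l<mdim (mfd H). T j l * (\<phi> y l - \<phi> \<one>\<^bsub>H\<^esub> l))\<bar>
           \<le> C * (l1dist (mdim (mfd H)) (\<phi> \<one>\<^bsub>H\<^esub>) (\<phi> y))\<^sup>2"
  shows "smooth_near M (mfd K) p (\<lambda>w. \<theta> (h w))"
proof -
  interpret H: group H by (rule left_lie_is_group[OF H])
  interpret K: group K by (rule left_lie_is_group[OF K])
  note cH = left_lie_charted[OF H] and cK = left_lie_charted[OF K]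
  let ?m = "mdim M" and ?n = "mdim (mfd H)" and ?a = "mdim (mfd K)"
  let ?nu = "\<lambda>y. l1dist ?n (\<phi> \<one>\<^bsub>H\<^esub>) (\<phi> y)" and ?nuK = "\<lambda>y. l1dist ?a (\<psi> \<one>\<^bsub>K\<^esub>) (\<psi> y)"
  note pM = smooth_near_into(1)[OF h(1)]
  obtain X \<xi> where X: "(X, \<xi>) \<in> atlas M" "p \<in> X" using chart_at[OF M pM] .
  have SH: "x \<in> carrier H" if "x \<in> S" for x using subgroup.subset[OF S] that by auto
  \<comment> \<open>A Lipschitz bound for \<open>\<theta>\<close> at the identity, read off the
    approximation: the linear part contributes the entries of \<open>T\<close>, and the quadratic
    error at most \<open>\<bar>C\<bar>\<close> per coordinate as long as
    \<open>?nu y \<le> 1\<close>.\<close>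
  define B where "B = (\<Sum>j<?a. (\<Sum>l<?n. \<bar>T j l\<bar>) + \<bar>C\<bar>)"
  have B0: "B \<ge> 0" unfolding B_def by (intro sum_nonneg add_nonneg_nonneg) auto
  have bd: "?nuK (\<theta> y) \<le> B * ?nu y" if y: "y \<in> S" "y \<in> U" "?nu y < r" "?nu y \<le> 1" for y
  proof -
    have "\<bar>\<psi> \<one>\<^bsub>K\<^esub> j - \<psi> (\<theta> y) j\<bar> \<le> ((\<Sum>l<?n. \<bar>T j l\<bar>) + \<bar>C\<bar>) * ?nu y" if j: "j < ?a" for j
    proof -
      have "\<bar>\<Sum>l<?n. T j l * (\<phi> y l - \<phi> \<one>\<^bsub>H\<^esub> l)\<bar> \<le> (\<Sum>l<?n. \<bar>T j l\<bar> * ?nu y)"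
        by (rule order_trans[OF sum_abs], rule sum_mono)
          (use l1dist_coord[of _ ?n "\<phi> \<one>\<^bsub>H\<^esub>" "\<phi> y"] in \<open>auto simp: abs_mult abs_minus_commute intro!: mult_left_mono\<close>)
      moreover have "C * (?nu y)\<^sup>2 \<le> \<bar>C\<bar> * ?nu y"
      proof -
        have "C * (?nu y)\<^sup>2 \<le> \<bar>C\<bar> * (?nu y)\<^sup>2" by (intro mult_right_mono) auto
        also have "\<dots> \<le> \<bar>C\<bar> * ?nu y" using y(4) by (intro mult_left_mono) (auto simp: power2_eq_square mult_left_le)
        finally show ?thesis .
      qed
      ultimately show ?thesis using est(2)[OF y(1,2,3) j] unfolding distrib_right sum_distrib_right by linarith
    qed
    then show ?thesis unfolding B_def l1dist_def[of ?a] sum_distrib_right by (intro sum_mono) auto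
  qed
  let ?f = "\<lambda>(w, w'). inv\<^bsub>H\<^esub> (h w) \<otimes>\<^bsub>H\<^esub> h w'"
  have f: "smooth_near (prod_manifold M M) (mfd H) (p, p) ?f"
  proof -
    have pp: "(p, p) \<in> topspace (prod_topology (mtop M) (mtop M))" using pM by simp
    have "smooth_near (prod_manifold M M) (mfd H) (p, p) (\<lambda>z. h (fst z))"
      by (rule smooth_near_comp[OF charted_prod[OF M M] M cH smooth_near_fst[OF M M pp]]) (use h in simp)
    moreover have "smooth_near (prod_manifold M M) (mfd H) (p, p) (\<lambda>z. h (snd z))"
      by (rule smooth_near_comp[OF charted_prod[OF M M] M cH smooth_near_snd[OF M M pp]]) (use h in simp)
    ultimately have "smooth_near (prod_manifold M M) (mfd H) (p, p) (\<lambda>z. inv\<^bsub>H\<^esub> (h (fst z)) \<otimes>\<^bsub>H\<^esub> h (snd z))"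
      using h by (intro smooth_near_mult_one[OF H charted_prod[OF M M]] smooth_near_inv_one[OF H charted_prod[OF M M]]) auto
    then show ?thesis by (simp add: case_prod_unfold)
  qed
  have f1: "?f (p, p) \<in> U" using h U by simp
  obtain Om F r1 where Om: "openin (Euclidean_space (?m + ?m)) Om" and F: "smooth_euclidean (?m + ?m) ?n Om F" and r1: "r1 > 0"
    and OmF: "\<And>w w'. w \<in> X \<Longrightarrow> w' \<in> X \<Longrightarrow> l1dist ?m (\<xi> p) (\<xi> w) < r1 \<Longrightarrow> l1dist ?m (\<xi> p) (\<xi> w') < r1 \<Longrightarrow>
      cat ?m (\<xi> w) (\<xi> w') \<in> Om \<and> ?f (w, w') \<in> U \<and> F (cat ?m (\<xi> w) (\<xi> w')) = \<phi> (?f (w, w'))"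
    by (rule smooth_near_two_var_chart[OF M M cH f X X U(1) f1]) (rule that)
  have m1: "(\<lambda>(x, y). x \<otimes>\<^bsub>K\<^esub> y) (\<one>\<^bsub>K\<^esub>, \<one>\<^bsub>K\<^esub>) \<in> V" using V by simp
  obtain Z mu r2 where Z: "openin (Euclidean_space (?a + ?a)) Z" and mu: "smooth_euclidean (?a + ?a) ?a Z mu" and r2: "r2 > 0"
    and Zm: "\<And>x y. x \<in> V \<Longrightarrow> y \<in> V \<Longrightarrow> ?nuK x < r2 \<Longrightarrow> ?nuK y < r2 \<Longrightarrow>
      cat ?a (\<psi> x) (\<psi> y) \<in> Z \<and> (\<lambda>(x, y). x \<otimes>\<^bsub>K\<^esub> y) (x, y) \<in> V \<and> mu (cat ?a (\<psi> x) (\<psi> y)) = \<psi> ((\<lambda>(x, y). x \<otimes>\<^bsub>K\<^esub> y) (x, y))"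
    by (rule smooth_near_two_var_chart[OF cK cK cK left_lie_mult[OF K] V V V(1) m1]) (rule that)
  have pO: "cat ?m (\<xi> p) (\<xi> p) \<in> Om" using OmF[OF X(2) X(2)] r1 by simp
  obtain L r3 where L: "L \<ge> 0" "r3 > 0" "\<And>y z. y \<in> EE (?m + ?m) \<Longrightarrow> z \<in> EE (?m + ?m) \<Longrightarrow>
      l1dist (?m + ?m) (cat ?m (\<xi> p) (\<xi> p)) y < r3 \<Longrightarrow> l1dist (?m + ?m) (cat ?m (\<xi> p) (\<xi> p)) z < r3 \<Longrightarrow>
      l1dist ?n (F y) (F z) \<le> L * l1dist (?m + ?m) y z"
    by (rule smooth_Lipschitz[OF Om F pO]) (rule that)
  \<comment> \<open>\<open>\<theta>\<close> expands distances from the identity by at most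
    \<open>B\<close>, so below \<open>e\<close> its values stay within \<open>r2\<close>, where
    \<open>mu\<close> describes the multiplication of \<open>K\<close>. Dividing by
    \<open>B + 1\<close> allows \<open>B = 0\<close>.\<close>
  define e where "e = min (min r 1) (r2 / (B + 1))"
  have e: "e > 0" "e \<le> r" "e \<le> 1" "B * e < r2"
  proof -
    show "e > 0" "e \<le> r" "e \<le> 1" using r r2 B0 by (auto simp: e_def)
    have "B * e \<le> B * (r2 / (B + 1))" using B0 by (intro mult_left_mono) (auto simp: e_def)
    also have "\<dots> < r2" using B0 r2 by (simp add: field_simps)
    finally show "B * e < r2" .
  qed
  have oe: "openin (mtop (mfd H)) {y \<in> U. \<phi> y \<in> {v \<in> EE ?n. l1dist ?n (\<phi> \<one>\<^bsub>H\<^esub>) v < e}}" (is "openin _ ?Ue")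
    by (rule chart_preimage_open[OF cH U(1) openin_l1ball])
  have hUe: "h p \<in> ?Ue" using h U e chart_EE[OF cH U] by simp
  obtain D0 where D0: "openin (mtop M) D0" "p \<in> D0" "h ` D0 \<subseteq> ?Ue"
    by (rule smooth_near_open[OF h(1) oe hUe])
  \<comment> \<open>Two points within \<open>\<rho>\<close> of \<open>\<xi> p\<close> are at most
    \<open>2 * \<rho>\<close> apart, so \<open>L * (2 * \<rho>) < e\<close> confines the quotients
    of their images under \<open>h\<close> to the \<open>e\<close>-ball.\<close>
  define \<rho> where "\<rho> = min (min r1 (r3 / 2)) (e / (2 * L + 1))"
  have \<rho>: "\<rho> > 0" "\<rho> \<le> r1" "\<rho> \<le> r3 / 2" "L * (2 * \<rho>) < e"
  proof -
    show "\<rho> > 0" using r1 L(1,2) e(1) by (simp add: \<rho>_def)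
    show "\<rho> \<le> r1" "\<rho> \<le> r3 / 2"
      unfolding \<rho>_def by (meson min.cobounded1 min.cobounded2 order_trans)+
    have "L * (2 * \<rho>) \<le> L * (2 * (e / (2 * L + 1)))" using L by (intro mult_left_mono) (auto simp: \<rho>_def)
    also have "\<dots> < e" using L e by (simp add: field_simps)
    finally show "L * (2 * \<rho>) < e" .
  qed
  have o\<rho>: "openin (mtop M) {w \<in> X. \<xi> w \<in> {v \<in> EE ?m. l1dist ?m (\<xi> p) v < \<rho>}}" (is "openin _ ?Xr")
    by (rule chart_preimage_open[OF M X(1) openin_l1ball])
  define D where "D = D0 \<inter> P \<inter> ?Xr"
  have D: "openin (mtop M) D" "p \<in> D" "D \<subseteq> X"
    using D0 P o\<rho> X \<rho>(1) chart_EE[OF M X] by (auto simp: D_def)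
  have DX: "w \<in> X" "l1dist ?m (\<xi> p) (\<xi> w) < \<rho>" "h w \<in> S" "h w \<in> U" "?nu (h w) < e" "\<xi> w \<in> EE ?m" if "w \<in> D" for w
    using that D0(3) P(3) by (auto simp: D_def)
  let ?y = "\<lambda>w w'. inv\<^bsub>H\<^esub> (h w) \<otimes>\<^bsub>H\<^esub> h w'"
  have y: "?y w w' \<in> S" "?y w w' \<in> U" "cat ?m (\<xi> w) (\<xi> w') \<in> Om" "F (cat ?m (\<xi> w) (\<xi> w')) = \<phi> (?y w w')"
      "?nu (?y w w') \<le> L * l1dist ?m (\<xi> w) (\<xi> w')" "?nu (?y w w') < e" if w: "w \<in> D" "w' \<in> D" for w w'
  proof -
    note dw = DX[OF w(1)] and dw' = DX[OF w(2)]
    show "?y w w' \<in> S" using dw dw' S by (simp add: subgroup.m_closed subgroup.m_inv_closed)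
    show "?y w w' \<in> U" "cat ?m (\<xi> w) (\<xi> w') \<in> Om" and F1: "F (cat ?m (\<xi> w) (\<xi> w')) = \<phi> (?y w w')"
      using OmF[of w w'] dw dw' \<rho> by auto
    have F2: "F (cat ?m (\<xi> w) (\<xi> w)) = \<phi> \<one>\<^bsub>H\<^esub>"
      using OmF[of w w] dw \<rho> SH[OF dw(3)] by auto
    have "l1dist ?n (F (cat ?m (\<xi> w) (\<xi> w))) (F (cat ?m (\<xi> w) (\<xi> w')))
        \<le> L * l1dist (?m + ?m) (cat ?m (\<xi> w) (\<xi> w)) (cat ?m (\<xi> w) (\<xi> w'))"
      by (rule L(3)) (use dw dw' \<rho> in \<open>auto intro: cat_EE simp: l1dist_cat\<close>)
    then show le: "?nu (?y w w') \<le> L * l1dist ?m (\<xi> w) (\<xi> w')"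
      unfolding F1 F2 by (simp add: l1dist_cat)
    have "l1dist ?m (\<xi> w) (\<xi> w') \<le> 2 * \<rho>"
      using l1dist_triangle[of ?m "\<xi> w" "\<xi> w'" "\<xi> p"] dw dw' by (simp add: l1dist_commute)
    then have "L * l1dist ?m (\<xi> w) (\<xi> w') \<le> L * (2 * \<rho>)" using L by (intro mult_left_mono)
    then show "?nu (?y w w') < e" using le \<rho> by linarith
  qed
  have \<theta>V: "\<theta> x \<in> V" "?nuK (\<theta> x) < r2" if "x \<in> S" "x \<in> U" "?nu x < e" for x
  proof -
    show "\<theta> x \<in> V" using est(1) that e by auto
    have "?nuK (\<theta> x) \<le> B * ?nu x" using bd that e by auto
    also have "\<dots> \<le> B * e" using that B0 by (intro mult_left_mono) auto
    finally show "?nuK (\<theta> x) < r2" using e by linarith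
  qed
  let ?w = "inv_into X \<xi>"
  note iX = chart_inv[OF M X(1)]
  define u where "u x = \<psi> (\<theta> (h (?w x)))" for x
  define z where "z x x' = \<psi> (\<theta> (?y (?w x) (?w x')))" for x x'
  have oW: "openin (Euclidean_space ?m) (\<xi> ` D)" by (rule chart_image_open[OF M X(1) D(1,3)])
  have wD: "?w x \<in> D" "\<xi> (?w x) = x" if xD: "x \<in> \<xi> ` D" for x
  proof -
    obtain w where w: "w \<in> D" "x = \<xi> w" using xD by blast
    then have "?w x = w" using iX D(3) by auto
    with w show "?w x \<in> D" "\<xi> (?w x) = x" by auto
  qed
  have EV: "\<psi> v \<in> EE ?a" if "v \<in> V" for v by (rule chart_EE[OF cK V(1) that])
  have "smooth_euclidean ?m ?a (\<xi> ` D) u"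
  proof (rule smooth_bootstrap[OF oW Om Z F mu EV[OF V(2)], where z = z and T = T and C = "\<bar>C\<bar> * L\<^sup>2"])
    fix x assume x: "x \<in> \<xi> ` D"
    note w = wD[OF x]
    show "u x \<in> EE ?a" unfolding u_def using DX[OF w(1)] \<theta>V EV by auto
    fix x' assume x': "x' \<in> \<xi> ` D"
    note w' = wD[OF x']
    note yy = y[OF w(1) w'(1)]
    have t1: "\<theta> (h (?w x)) \<in> V" "?nuK (\<theta> (h (?w x))) < r2" using DX[OF w(1)] \<theta>V by auto
    have t2: "\<theta> (?y (?w x) (?w x')) \<in> V" "?nuK (\<theta> (?y (?w x) (?w x'))) < r2" using yy \<theta>V by auto
    show "z x x' \<in> EE ?a" unfolding z_def using t2 EV by auto
    show "cat ?a (u x) (z x x') \<in> Z" unfolding u_def z_def using Zm t1 t2 by auto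
    show "cat ?m x x' \<in> Om" using yy(3) w w' by simp
    have hc: "h (?w x) \<in> carrier H" "h (?w x') \<in> carrier H" using SH DX w(1) w'(1) by auto
    have "h (?w x) \<otimes>\<^bsub>H\<^esub> ?y (?w x) (?w x') = h (?w x')"
      using hc by (simp add: H.m_assoc[symmetric])
    then have "\<theta> (h (?w x')) = \<theta> (h (?w x)) \<otimes>\<^bsub>K\<^esub> \<theta> (?y (?w x) (?w x'))"
      using hom[OF DX(3)[OF w(1)] yy(1)] by simp
    then show "u x' j = mu (cat ?a (u x) (z x x')) j" for j
      unfolding u_def z_def using Zm[OF t1(1) t2(1) t1(2) t2(2)] by simp
    fix j assume j: "j < ?a"
    have F1: "F (cat ?m x x') = \<phi> (?y (?w x) (?w x'))" using yy(4) w w' by simp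
    have F2: "F (cat ?m x x) = \<phi> \<one>\<^bsub>H\<^esub>" using y(4)[OF w(1) w(1)] w hc by simp
    have "\<bar>z x x' j - \<psi> \<one>\<^bsub>K\<^esub> j - (\<Sum>l<?n. T j l * (F (cat ?m x x') l - F (cat ?m x x) l))\<bar>
       \<le> C * (?nu (?y (?w x) (?w x')))\<^sup>2"
      unfolding F1 F2 z_def using est(2)[OF yy(1,2) _ j] yy(6) e by simp
    also have "\<dots> \<le> \<bar>C\<bar> * (L * l1dist ?m x x')\<^sup>2"
      using yy(5) w w' by (intro mult_mono power_mono) auto
    finally show "\<bar>z x x' j - \<psi> \<one>\<^bsub>K\<^esub> j - (\<Sum>l<?n. T j l * (F (cat ?m x x') l - F (cat ?m x x) l))\<bar>
        \<le> \<bar>C\<bar> * L\<^sup>2 * (l1dist ?m x x')\<^sup>2" by (simp add: power_mult_distrib mult.assoc)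
  qed
  then have "smooth_euclidean ?m ?a (\<xi> ` D) (\<psi> \<circ> (\<lambda>w. \<theta> (h w)) \<circ> ?w)" by (simp add: u_def[abs_def] o_def)
  then show ?thesis
    by (rule smooth_near_chartI[OF M cK D(1,2) X(1) D(3) V(1), rotated]) (use DX \<theta>V in auto)
qed

text \<open>Left translation by the inverse of \<open>h p\<close> moves the base value to the
  identity, and left translation by \<open>\<theta> (h p)\<close> moves the result back; both are
  smooth in a \<open>left_lie_group\<close>.\<close>

lemma smooth_near_of_linear_approximation':
  fixes H :: "'h lie_struct" and K :: "'k lie_struct" and \<theta> :: "'h \<Rightarrow> 'k"
  assumes H: "left_lie_group H" and K: "left_lie_group K" and M: "charted M"
    and U: "(U, \<phi>) \<in> atlas (mfd H)" "\<one>\<^bsub>H\<^esub> \<in> U" and V: "(V, \<psi>) \<in> atlas (mfd K)" "\<one>\<^bsub>K\<^esub> \<in> V"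
    and S: "subgroup S H" and hom: "\<And>x y. x \<in> S \<Longrightarrow> y \<in> S \<Longrightarrow> \<theta> (x \<otimes>\<^bsub>H\<^esub> y) = \<theta> x \<otimes>\<^bsub>K\<^esub> \<theta> y"
    and \<theta>: "\<And>x. x \<in> S \<Longrightarrow> \<theta> x \<in> carrier K"
    and h: "smooth_near M (mfd H) p h" and P: "openin (mtop M) P" "p \<in> P" "\<And>w. w \<in> P \<Longrightarrow> h w \<in> S"
    and r: "r > 0"
    and est: "\<And>y. y \<in> S \<Longrightarrow> y \<in> U \<Longrightarrow> l1dist (mdim (mfd H)) (\<phi> \<one>\<^bsub>H\<^esub>) (\<phi> y) < r \<Longrightarrow> \<theta> y \<in> V"
      "\<And>y j. y \<in> S \<Longrightarrow> y \<in> U \<Longrightarrow> l1dist (mdim (mfd H)) (\<phi> \<one>\<^bsub>H\<^esub>) (\<phi> y) < r \<Longrightarrow> j < mdim (mfd K) \<Longrightarrow>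
         \<bar>\<psi> (\<theta> y) j - \<psi> \<one>\<^bsub>K\<^esub> j - (\<Sum>l<mdim (mfd H). T j l * (\<phi> y l - \<phi> \<one>\<^bsub>H\<^esub> l))\<bar>
           \<le> C * (l1dist (mdim (mfd H)) (\<phi> \<one>\<^bsub>H\<^esub>) (\<phi> y))\<^sup>2"
  shows "smooth_near M (mfd K) p (\<lambda>w. \<theta> (h w))"
proof -
  interpret H: group H by (rule left_lie_is_group[OF H])
  interpret K: group K by (rule left_lie_is_group[OF K])
  note cH = left_lie_charted[OF H] and cK = left_lie_charted[OF K]
  have hS: "h p \<in> S" using P by simp
  have SH: "x \<in> carrier H" if "x \<in> S" for x using subgroup.subset[OF S] that by auto
  let ?k = "\<lambda>w. inv\<^bsub>H\<^esub> (h p) \<otimes>\<^bsub>H\<^esub> h w"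
  have k: "smooth_near M (mfd H) p ?k" using smooth_near_left_mult[OF H M h] SH[OF hS] by simp
  have k1: "?k p = \<one>\<^bsub>H\<^esub>" using SH[OF hS] by simp
  have kS: "?k w \<in> S" if "w \<in> P" for w using P(3)[OF that] hS S by (simp add: subgroup.m_closed subgroup.m_inv_closed)
  have "smooth_near M (mfd K) p (\<lambda>w. \<theta> (?k w))"
    by (rule smooth_near_of_linear_approximation[OF H K M U V S hom k k1 P(1,2) kS r est])
  then have "smooth_near M (mfd K) p (\<lambda>w. \<theta> (h p) \<otimes>\<^bsub>K\<^esub> \<theta> (?k w))"
    using smooth_near_left_mult[OF K M] \<theta>[OF hS] by blast
  then show ?thesis
  proof (rule smooth_near_cong[OF M cK _ P(1,2)])
    fix w assume "w \<in> P"
    have "h p \<otimes>\<^bsub>H\<^esub> ?k w = h w" using SH[OF hS] SH[OF P(3)[OF \<open>w \<in> P\<close>]] by (simp add: H.m_assoc[symmetric])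
    then show "\<theta> (h p) \<otimes>\<^bsub>K\<^esub> \<theta> (?k w) = \<theta> (h w)" using hom[OF hS kS[OF \<open>w \<in> P\<close>]] by simp
  qed
qed

section \<open>Smoothness of continuous homomorphisms\<close>

text \<open>By \<open>mult_estimates\<close> squaring doubles the centred coordinates up to a
  quadratic error, in \<open>H\<close> and in \<open>K\<close>, so \<open>doubling_Lipschitz\<close>
  compares the distance of \<open>\<theta> x\<close> from the identity with that of
  \<open>x\<close>. Continuity at the identity brings \<open>\<theta> x\<close> into the range where
  the error is harmless.\<close>

lemma hom_Lipschitz:
  fixes H :: "'h lie_struct" and K :: "'k lie_struct" and \<theta> :: "'h \<Rightarrow> 'k"
  assumes H: "left_lie_group H" and K: "left_lie_group K"
    and U: "(U, \<phi>) \<in> atlas (mfd H)" "\<one>\<^bsub>H\<^esub> \<in> U" and V: "(V, \<psi>) \<in> atlas (mfd K)" "\<one>\<^bsub>K\<^esub> \<in> V"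
    and S: "subgroup S H" and hom: "\<And>x y. x \<in> S \<Longrightarrow> y \<in> S \<Longrightarrow> \<theta> (x \<otimes>\<^bsub>H\<^esub> y) = \<theta> x \<otimes>\<^bsub>K\<^esub> \<theta> y"
    and cont: "\<And>Q. openin (mtop (mfd K)) Q \<Longrightarrow> \<one>\<^bsub>K\<^esub> \<in> Q \<Longrightarrow>
        \<exists>P. openin (mtop (mfd H)) P \<and> \<one>\<^bsub>H\<^esub> \<in> P \<and> (\<forall>x\<in>S \<inter> P. \<theta> x \<in> Q)"
  obtains L r where "L \<ge> 0" "r > 0"
    "\<And>y. y \<in> S \<Longrightarrow> y \<in> U \<Longrightarrow> l1dist (mdim (mfd H)) (\<phi> \<one>\<^bsub>H\<^esub>) (\<phi> y) < r \<Longrightarrow> \<theta> y \<in> V"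
    "\<And>y. y \<in> S \<Longrightarrow> y \<in> U \<Longrightarrow> l1dist (mdim (mfd H)) (\<phi> \<one>\<^bsub>H\<^esub>) (\<phi> y) < r \<Longrightarrow>
       l1dist (mdim (mfd K)) (\<psi> \<one>\<^bsub>K\<^esub>) (\<psi> (\<theta> y)) \<le> L * l1dist (mdim (mfd H)) (\<phi> \<one>\<^bsub>H\<^esub>) (\<phi> y)"
proof -
  note cH = left_lie_charted[OF H] and cK = left_lie_charted[OF K]
  let ?n = "mdim (mfd H)" and ?a = "mdim (mfd K)"
  let ?nu = "\<lambda>y. l1dist ?n (\<phi> \<one>\<^bsub>H\<^esub>) (\<phi> y)" and ?nuK = "\<lambda>y. l1dist ?a (\<psi> \<one>\<^bsub>K\<^esub>) (\<psi> y)"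
  obtain C1 r1 where 1: "C1 \<ge> 0" "r1 > 0"
    "\<And>x y. x \<in> U \<Longrightarrow> y \<in> U \<Longrightarrow> ?nu x < r1 \<Longrightarrow> ?nu y < r1 \<Longrightarrow> x \<otimes>\<^bsub>H\<^esub> y \<in> U"
    "\<And>x y. x \<in> U \<Longrightarrow> y \<in> U \<Longrightarrow> ?nu x < r1 \<Longrightarrow> ?nu y < r1 \<Longrightarrow>
       l1dist ?n (\<phi> (x \<otimes>\<^bsub>H\<^esub> y)) (\<lambda>j. \<phi> x j + \<phi> y j - \<phi> \<one>\<^bsub>H\<^esub> j) \<le> C1 * ?nu x * ?nu y"
    by (rule mult_estimates[OF H U]) (rule that)
  obtain C2 r2 where 2: "C2 \<ge> 0" "r2 > 0"
    "\<And>x y. x \<in> V \<Longrightarrow> y \<in> V \<Longrightarrow> ?nuK x < r2 \<Longrightarrow> ?nuK y < r2 \<Longrightarrow>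
       l1dist ?a (\<psi> (x \<otimes>\<^bsub>K\<^esub> y)) (\<lambda>j. \<psi> x j + \<psi> y j - \<psi> \<one>\<^bsub>K\<^esub> j) \<le> C2 * ?nuK x * ?nuK y"
    by (rule mult_estimates[OF K V]) (rule that)
  define C where "C = C1 + C2 + 1"
  have C: "C > 0" "C1 \<le> C" "C2 \<le> C" using 1 2 by (auto simp: C_def)
  \<comment> \<open>\<open>doubling_Lipschitz\<close> asks for \<open>C * b x \<le> 1/2\<close>. The
    summand 1 in \<open>C\<close> makes the division legitimate.\<close>
  define e where "e = min r2 (1 / (2 * C))"
  have e: "e > 0" "e \<le> r2" "C * e \<le> 1/2"
  proof -
    show "e > 0" "e \<le> r2" using 2 C by (auto simp: e_def)
    have "C * e \<le> C * (1 / (2 * C))" using C by (intro mult_left_mono) (auto simp: e_def)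
    then show "C * e \<le> 1/2" using C by simp
  qed
  have oQ: "openin (mtop (mfd K)) {y \<in> V. \<psi> y \<in> {v \<in> EE ?a. l1dist ?a (\<psi> \<one>\<^bsub>K\<^esub>) v < e}}" (is "openin _ ?Q")
    by (rule chart_preimage_open[OF cK V(1) openin_l1ball])
  have "\<one>\<^bsub>K\<^esub> \<in> ?Q" using V e chart_EE[OF cK V] by simp
  then obtain P where P: "openin (mtop (mfd H)) P" "\<one>\<^bsub>H\<^esub> \<in> P" "\<And>x. x \<in> S \<Longrightarrow> x \<in> P \<Longrightarrow> \<theta> x \<in> ?Q"
    using cont[OF oQ] by blast
  obtain r0 where r0: "r0 > 0" "\<And>x. x \<in> U \<Longrightarrow> ?nu x < r0 \<Longrightarrow> x \<in> P"
    by (rule chart_nbhd[OF cH U(1) P(1,2) U(2)]) (rule that)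
  define r where "r = min r0 r1"
  have r: "r > 0" "r \<le> r0" "r \<le> r1" using r0 1 by (auto simp: r_def)
  have tQ: "\<theta> y \<in> V" "?nuK (\<theta> y) < e" if "y \<in> S" "y \<in> U" "?nu y < r" for y
    using P(3)[OF that(1) r0(2)[OF that(2)]] that r by auto
  have dbl: "l1dist n p (\<lambda>j. x j + x j - p j) = 2 * l1dist n p x" for n p x
  proof -
    have "p j - (x j + x j - p j) = 2 * (p j - x j)" for j by simp
    then show ?thesis unfolding l1dist_def sum_distrib_left by (simp only: abs_mult abs_numeral)
  qed
  obtain L where L: "L \<ge> 0" "\<And>x. x \<in> S \<inter> U \<Longrightarrow> ?nu x < r \<Longrightarrow> ?nuK (\<theta> x) \<le> L * ?nu x"
  proof (rule doubling_Lipschitz[OF C(1) r(1), of "S \<inter> U" ?nu "\<lambda>x. x \<otimes>\<^bsub>H\<^esub> x" "\<lambda>x. ?nuK (\<theta> x)"])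
    fix x assume x: "x \<in> S \<inter> U" "?nu x < r"
    show "x \<otimes>\<^bsub>H\<^esub> x \<in> S \<inter> U" using x 1(3)[of x x] r S by (auto simp: subgroup.m_closed)
    have "?nu (x \<otimes>\<^bsub>H\<^esub> x) \<le> 2 * ?nu x + C1 * ?nu x * ?nu x"
      using l1dist_triangle[of ?n "\<phi> \<one>\<^bsub>H\<^esub>" "\<phi> (x \<otimes>\<^bsub>H\<^esub> x)" "\<lambda>j. \<phi> x j + \<phi> x j - \<phi> \<one>\<^bsub>H\<^esub> j"] 1(4)[of x x] x r
      unfolding dbl by (simp add: l1dist_commute)
    moreover have "C1 * ?nu x * ?nu x \<le> C * (?nu x)\<^sup>2"
      using C(2) by (simp add: power2_eq_square mult.assoc mult_right_mono)
    ultimately show "?nu (x \<otimes>\<^bsub>H\<^esub> x) \<le> 2 * ?nu x + C * (?nu x)\<^sup>2" by linarith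
    have t: "\<theta> x \<in> V" "?nuK (\<theta> x) < e" using tQ x by auto
    have "C * ?nuK (\<theta> x) \<le> C * e" using t C by (intro mult_left_mono) auto
    then show "0 \<le> ?nuK (\<theta> x) \<and> C * ?nuK (\<theta> x) \<le> 1/2" using e by simp
    have "2 * ?nuK (\<theta> x) \<le> ?nuK (\<theta> x \<otimes>\<^bsub>K\<^esub> \<theta> x) + C2 * ?nuK (\<theta> x) * ?nuK (\<theta> x)"
      using l1dist_triangle[of ?a "\<psi> \<one>\<^bsub>K\<^esub>" "\<lambda>j. \<psi> (\<theta> x) j + \<psi> (\<theta> x) j - \<psi> \<one>\<^bsub>K\<^esub> j" "\<psi> (\<theta> x \<otimes>\<^bsub>K\<^esub> \<theta> x)"] 2(3)[of "\<theta> x" "\<theta> x"] t e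
      unfolding dbl by (simp add: l1dist_commute)
    moreover have "C2 * ?nuK (\<theta> x) * ?nuK (\<theta> x) \<le> C * (?nuK (\<theta> x))\<^sup>2"
      using C(3) by (simp add: power2_eq_square mult.assoc mult_right_mono)
    ultimately show "2 * ?nuK (\<theta> x) - C * (?nuK (\<theta> x))\<^sup>2 \<le> ?nuK (\<theta> (x \<otimes>\<^bsub>H\<^esub> x))"
      using hom[of x x] x by auto
  qed auto
  show thesis by (rule that[OF L(1) r(1)]) (use tQ L in auto)
qed

text \<open>Let \<open>s\<close> be the point whose centred coordinates are the sum of those of
  \<open>x\<close> and \<open>y\<close>. By \<open>mult_estimates\<close> and
  \<open>division_estimate\<close> it is the product of \<open>x\<close>, \<open>y\<close> and an
  element \<open>z\<close> of size \<open>?nu x * ?nu y\<close>, and the Lipschitz bound transports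
  this to \<open>\<theta> s\<close>. So each coordinate of \<open>\<theta>\<close> is additive up to
  a bilinear error, and \<open>approximately_additive\<close> supplies its linear part.\<close>

lemma hom_linear_approximation:
  fixes H :: "'h lie_struct" and K :: "'k lie_struct" and \<theta> :: "'h \<Rightarrow> 'k"
  assumes H: "left_lie_group H" and K: "left_lie_group K"
    and U: "(U, \<phi>) \<in> atlas (mfd H)" "\<one>\<^bsub>H\<^esub> \<in> U" and V: "(V, \<psi>) \<in> atlas (mfd K)" "\<one>\<^bsub>K\<^esub> \<in> V"
    and hom: "\<theta> \<in> hom H K"
    and cont: "\<And>Q. openin (mtop (mfd K)) Q \<Longrightarrow> \<one>\<^bsub>K\<^esub> \<in> Q \<Longrightarrow>
        \<exists>P. openin (mtop (mfd H)) P \<and> \<one>\<^bsub>H\<^esub> \<in> P \<and> (\<forall>x\<in>P. \<theta> x \<in> Q)"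
  obtains T C r where "r > 0"
    "\<And>y. y \<in> U \<Longrightarrow> l1dist (mdim (mfd H)) (\<phi> \<one>\<^bsub>H\<^esub>) (\<phi> y) < r \<Longrightarrow> \<theta> y \<in> V"
    "\<And>y j. y \<in> U \<Longrightarrow> l1dist (mdim (mfd H)) (\<phi> \<one>\<^bsub>H\<^esub>) (\<phi> y) < r \<Longrightarrow> j < mdim (mfd K) \<Longrightarrow>
         \<bar>\<psi> (\<theta> y) j - \<psi> \<one>\<^bsub>K\<^esub> j - (\<Sum>l<mdim (mfd H). T j l * (\<phi> y l - \<phi> \<one>\<^bsub>H\<^esub> l))\<bar>
           \<le> C * (l1dist (mdim (mfd H)) (\<phi> \<one>\<^bsub>H\<^esub>) (\<phi> y))\<^sup>2"
proof -
  interpret H: group H by (rule left_lie_is_group[OF H])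
  interpret K: group K by (rule left_lie_is_group[OF K])
  note cH = left_lie_charted[OF H] and cK = left_lie_charted[OF K]
  let ?n = "mdim (mfd H)" and ?a = "mdim (mfd K)"
  let ?nu = "\<lambda>y. l1dist ?n (\<phi> \<one>\<^bsub>H\<^esub>) (\<phi> y)" and ?nuK = "\<lambda>y. l1dist ?a (\<psi> \<one>\<^bsub>K\<^esub>) (\<psi> y)"
  have UH: "x \<in> carrier H" if "x \<in> U" for x using chart_subset[OF cH U(1)] left_lie_topspace[OF H] that by auto
  obtain C1 r1 where 1: "C1 \<ge> 0" "r1 > 0"
    "\<And>x y. x \<in> U \<Longrightarrow> y \<in> U \<Longrightarrow> ?nu x < r1 \<Longrightarrow> ?nu y < r1 \<Longrightarrow> x \<otimes>\<^bsub>H\<^esub> y \<in> U"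
    "\<And>x y. x \<in> U \<Longrightarrow> y \<in> U \<Longrightarrow> ?nu x < r1 \<Longrightarrow> ?nu y < r1 \<Longrightarrow>
       l1dist ?n (\<phi> (x \<otimes>\<^bsub>H\<^esub> y)) (\<lambda>j. \<phi> x j + \<phi> y j - \<phi> \<one>\<^bsub>H\<^esub> j) \<le> C1 * ?nu x * ?nu y"
    "\<And>x y. x \<in> U \<Longrightarrow> y \<in> U \<Longrightarrow> ?nu x < r1 \<Longrightarrow> ?nu y < r1 \<Longrightarrow> l1dist ?n (\<phi> (x \<otimes>\<^bsub>H\<^esub> y)) (\<phi> x) \<le> C1 * ?nu y"
    by (rule mult_estimates[OF H U]) (rule that)
  obtain C2 r2 where 2: "C2 \<ge> 0" "r2 > 0"
    "\<And>x y. x \<in> V \<Longrightarrow> y \<in> V \<Longrightarrow> ?nuK x < r2 \<Longrightarrow> ?nuK y < r2 \<Longrightarrow> x \<otimes>\<^bsub>K\<^esub> y \<in> V"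
    "\<And>x y. x \<in> V \<Longrightarrow> y \<in> V \<Longrightarrow> ?nuK x < r2 \<Longrightarrow> ?nuK y < r2 \<Longrightarrow>
       l1dist ?a (\<psi> (x \<otimes>\<^bsub>K\<^esub> y)) (\<lambda>j. \<psi> x j + \<psi> y j - \<psi> \<one>\<^bsub>K\<^esub> j) \<le> C2 * ?nuK x * ?nuK y"
    "\<And>x y. x \<in> V \<Longrightarrow> y \<in> V \<Longrightarrow> ?nuK x < r2 \<Longrightarrow> ?nuK y < r2 \<Longrightarrow> l1dist ?a (\<psi> (x \<otimes>\<^bsub>K\<^esub> y)) (\<psi> x) \<le> C2 * ?nuK y"
    by (rule mult_estimates[OF K V]) (rule that)
  obtain C3 r3 where 3: "C3 \<ge> 0" "r3 > 0"
    "\<And>x y. x \<in> U \<Longrightarrow> y \<in> U \<Longrightarrow> ?nu x < r3 \<Longrightarrow> ?nu y < r3 \<Longrightarrow> inv\<^bsub>H\<^esub> x \<otimes>\<^bsub>H\<^esub> y \<in> U"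
    "\<And>x y. x \<in> U \<Longrightarrow> y \<in> U \<Longrightarrow> ?nu x < r3 \<Longrightarrow> ?nu y < r3 \<Longrightarrow> ?nu (inv\<^bsub>H\<^esub> x \<otimes>\<^bsub>H\<^esub> y) \<le> C3 * l1dist ?n (\<phi> x) (\<phi> y)"
    by (rule division_estimate[OF H U]) (rule that)
  obtain L r4 where 4: "L \<ge> 0" "r4 > 0"
    "\<And>y. y \<in> U \<Longrightarrow> ?nu y < r4 \<Longrightarrow> \<theta> y \<in> V" "\<And>y. y \<in> U \<Longrightarrow> ?nu y < r4 \<Longrightarrow> ?nuK (\<theta> y) \<le> L * ?nu y"
  proof (rule hom_Lipschitz[OF H K U V H.subgroup_self, of \<theta>])
    show "\<theta> (x \<otimes>\<^bsub>H\<^esub> y) = \<theta> x \<otimes>\<^bsub>K\<^esub> \<theta> y" if "x \<in> carrier H" "y \<in> carrier H" for x y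
      using hom that by (simp add: hom_def)
    show "\<exists>P. openin (mtop (mfd H)) P \<and> \<one>\<^bsub>H\<^esub> \<in> P \<and> (\<forall>x\<in>carrier H \<inter> P. \<theta> x \<in> Q)"
      if "openin (mtop (mfd K)) Q" "\<one>\<^bsub>K\<^esub> \<in> Q" for Q using cont[OF that] by blast
  qed (use UH that in blast)
  define e where "e = min (min r1 r2) (min r3 r4)"
  have e: "e > 0" "e \<le> r1" "e \<le> r2" "e \<le> r3" "e \<le> r4" using 1 2 3 4 by (auto simp: e_def)
  obtain r5 where r5: "r5 > 0" "\<And>v. v \<in> EE ?n \<Longrightarrow> l1dist ?n (\<phi> \<one>\<^bsub>H\<^esub>) v < r5 \<Longrightarrow> \<exists>x\<in>U \<inter> topspace (mtop (mfd H)). \<phi> x = v"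
    by (rule chart_nbhd[OF cH U(1) openin_topspace _ U(2)]) (use left_lie_one[OF H] that in auto)
  \<comment> \<open>A common bound for the factors by which products, quotients and images under
    \<open>\<theta>\<close> can exceed \<open>r\<close>; with \<open>K0 * r < e\<close> every point
    that occurs stays in the range of all estimates.\<close>
  define K0 where "K0 = 1 + C1 + L + C2 * L + C3 * C1 + L * (C3 * C1) + 1"
  have K0: "K0 \<ge> 1" "1 + C1 \<le> K0" "L \<le> K0" "L + C2 * L \<le> K0" "C3 * C1 \<le> K0" "L * (C3 * C1) \<le> K0"
    using 1 2 3 4 by (auto simp: K0_def)
  define r where "r = min (min 1 r5) (e / (2 * K0))"
  have r: "r > 0" "r \<le> 1" "r \<le> r5" "K0 * r < e"
  proof -
    show "r > 0" "r \<le> 1" "r \<le> r5" using r5 e K0 by (auto simp: r_def)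
    have "K0 * r \<le> K0 * (e / (2 * K0))" using K0 by (intro mult_left_mono) (auto simp: r_def)
    also have "\<dots> < e" using K0 e by (simp add: field_simps)
    finally show "K0 * r < e" .
  qed
  have lt: "q < e" if "q \<le> c * s" "c \<le> K0" "0 \<le> s" "s \<le> r" for q c s :: real
  proof -
    have "c * s \<le> K0 * s" using that by (intro mult_right_mono) auto
    also have "\<dots> \<le> K0 * r" using that K0 by (intro mult_left_mono) auto
    finally show ?thesis using that r by linarith
  qed
  define C where "C = C2 * (L * (C3 * C1)) + C2 * (L * L)"
  have C0: "C \<ge> 0" using 1 2 3 4 by (simp add: C_def)
  have additive: "l1dist ?a (\<psi> (\<theta> s)) (\<lambda>j. \<psi> (\<theta> x) j + \<psi> (\<theta> y) j - \<psi> \<one>\<^bsub>K\<^esub> j) \<le> C * ?nu x * ?nu y"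
    if U': "x \<in> U" "y \<in> U" "s \<in> U" and n: "?nu x < r" "?nu y < r" "?nu s < r"
      and s: "\<And>j. \<phi> s j = \<phi> x j + \<phi> y j - \<phi> \<one>\<^bsub>H\<^esub> j" for x y s
  proof -
    have xe: "?nu x < e" "?nu y < e" "?nu s < e"
      using lt[of "?nu x" 1 "?nu x"] lt[of "?nu y" 1 "?nu y"] lt[of "?nu s" 1 "?nu s"] n K0 by auto
    have xy: "x \<otimes>\<^bsub>H\<^esub> y \<in> U" "?nu (x \<otimes>\<^bsub>H\<^esub> y) < e"
    proof -
      show "x \<otimes>\<^bsub>H\<^esub> y \<in> U" using 1(3) U' xe e by auto
      have "l1dist ?n (\<phi> (x \<otimes>\<^bsub>H\<^esub> y)) (\<phi> x) \<le> C1 * ?nu y" using 1(5) U' xe e by auto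
      then have "?nu (x \<otimes>\<^bsub>H\<^esub> y) \<le> ?nu x + C1 * ?nu y"
        using l1dist_triangle[of ?n "\<phi> \<one>\<^bsub>H\<^esub>" "\<phi> (x \<otimes>\<^bsub>H\<^esub> y)" "\<phi> x"] by (simp add: l1dist_commute)
      also have "\<dots> \<le> r + C1 * r" using n 1(1) by (intro add_mono mult_left_mono) auto
      also have "\<dots> = (1 + C1) * r" by (simp add: algebra_simps)
      finally show "?nu (x \<otimes>\<^bsub>H\<^esub> y) < e" by (rule lt) (use K0 r in auto)
    qed
    define z where "z = inv\<^bsub>H\<^esub> (x \<otimes>\<^bsub>H\<^esub> y) \<otimes>\<^bsub>H\<^esub> s"
    have zU: "z \<in> U" using 3(3) xy U' xe e by (auto simp: z_def)
    have phs: "\<phi> s = (\<lambda>j. \<phi> x j + \<phi> y j - \<phi> \<one>\<^bsub>H\<^esub> j)" using s by auto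
    have "?nu z \<le> C3 * l1dist ?n (\<phi> (x \<otimes>\<^bsub>H\<^esub> y)) (\<phi> s)" unfolding z_def using 3(4) xy U' xe e by auto
    also have "\<dots> \<le> C3 * (C1 * ?nu x * ?nu y)"
      unfolding phs using 1(4) U' xe e 3(1) by (intro mult_left_mono) auto
    finally have nz: "?nu z \<le> C3 * C1 * ?nu x * ?nu y" by (simp add: mult.assoc)
    have xyr: "?nu x * ?nu y \<le> r" using n r mult_mono[of "?nu x" 1 "?nu y" r] by auto
    have nze: "?nu z < e" by (rule lt[of _ "C3 * C1" "?nu x * ?nu y"]) (use nz xyr K0 in \<open>auto simp: mult.assoc\<close>)
    have tx: "\<theta> x \<in> V" "?nuK (\<theta> x) \<le> L * ?nu x" "\<theta> y \<in> V" "?nuK (\<theta> y) \<le> L * ?nu y" "\<theta> z \<in> V" "?nuK (\<theta> z) \<le> L * ?nu z"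
      using 4(3,4) U' zU xe nze e by auto
    have nzK: "?nuK (\<theta> z) \<le> L * (C3 * C1) * (?nu x * ?nu y)"
      using tx(6) mult_left_mono[OF nz 4(1)] by (simp add: mult.assoc)
    have txe: "?nuK (\<theta> x) < e" "?nuK (\<theta> y) < e" "?nuK (\<theta> z) < e"
      using lt[OF tx(2)] lt[OF tx(4)] lt[OF nzK] n xyr K0 by auto
    have txy: "\<theta> x \<otimes>\<^bsub>K\<^esub> \<theta> y \<in> V" "?nuK (\<theta> x \<otimes>\<^bsub>K\<^esub> \<theta> y) < e"
    proof -
      show "\<theta> x \<otimes>\<^bsub>K\<^esub> \<theta> y \<in> V" using 2(3) tx txe e by auto
      have "l1dist ?a (\<psi> (\<theta> x \<otimes>\<^bsub>K\<^esub> \<theta> y)) (\<psi> (\<theta> x)) \<le> C2 * ?nuK (\<theta> y)" using 2(5) tx txe e by auto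
      then have "?nuK (\<theta> x \<otimes>\<^bsub>K\<^esub> \<theta> y) \<le> ?nuK (\<theta> x) + C2 * ?nuK (\<theta> y)"
        using l1dist_triangle[of ?a "\<psi> \<one>\<^bsub>K\<^esub>" "\<psi> (\<theta> x \<otimes>\<^bsub>K\<^esub> \<theta> y)" "\<psi> (\<theta> x)"] by (simp add: l1dist_commute)
      also have "\<dots> \<le> L * r + C2 * (L * r)"
        using tx n 2(1) 4(1) by (intro add_mono mult_left_mono) (meson mult_left_mono less_imp_le order_trans)+
      also have "\<dots> = (L + C2 * L) * r" by (simp add: algebra_simps)
      finally show "?nuK (\<theta> x \<otimes>\<^bsub>K\<^esub> \<theta> y) < e" by (rule lt) (use K0 r in auto)
    qed
    have car: "x \<in> carrier H" "y \<in> carrier H" "s \<in> carrier H" "z \<in> carrier H" using UH U' zU by auto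
    have "s = (x \<otimes>\<^bsub>H\<^esub> y) \<otimes>\<^bsub>H\<^esub> z" unfolding z_def using car by (simp add: H.m_assoc[symmetric])
    then have ts: "\<theta> s = (\<theta> x \<otimes>\<^bsub>K\<^esub> \<theta> y) \<otimes>\<^bsub>K\<^esub> \<theta> z" using hom car by (simp add: hom_def)
    have "l1dist ?a (\<psi> (\<theta> s)) (\<psi> (\<theta> x \<otimes>\<^bsub>K\<^esub> \<theta> y)) \<le> C2 * ?nuK (\<theta> z)"
      unfolding ts using 2(5) txy txe tx e by auto
    also have "\<dots> \<le> C2 * (L * (C3 * C1) * (?nu x * ?nu y))" using nzK 2(1) by (rule mult_left_mono)
    finally have A: "l1dist ?a (\<psi> (\<theta> s)) (\<psi> (\<theta> x \<otimes>\<^bsub>K\<^esub> \<theta> y)) \<le> C2 * (L * (C3 * C1)) * (?nu x * ?nu y)" by (simp add: mult.assoc)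
    have "l1dist ?a (\<psi> (\<theta> x \<otimes>\<^bsub>K\<^esub> \<theta> y)) (\<lambda>j. \<psi> (\<theta> x) j + \<psi> (\<theta> y) j - \<psi> \<one>\<^bsub>K\<^esub> j) \<le> C2 * ?nuK (\<theta> x) * ?nuK (\<theta> y)"
      using 2(4) tx txe e by auto
    also have "\<dots> \<le> C2 * (L * ?nu x) * (L * ?nu y)" using tx 2(1) 4(1) by (intro mult_mono) auto
    finally have B: "l1dist ?a (\<psi> (\<theta> x \<otimes>\<^bsub>K\<^esub> \<theta> y)) (\<lambda>j. \<psi> (\<theta> x) j + \<psi> (\<theta> y) j - \<psi> \<one>\<^bsub>K\<^esub> j) \<le> C2 * (L * L) * (?nu x * ?nu y)"
      by (simp add: mult_ac)
    have "l1dist ?a (\<psi> (\<theta> s)) (\<lambda>j. \<psi> (\<theta> x) j + \<psi> (\<theta> y) j - \<psi> \<one>\<^bsub>K\<^esub> j) \<le> C * (?nu x * ?nu y)"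
      using l1dist_triangle[of ?a "\<psi> (\<theta> s)" "\<lambda>j. \<psi> (\<theta> x) j + \<psi> (\<theta> y) j - \<psi> \<one>\<^bsub>K\<^esub> j" "\<psi> (\<theta> x \<otimes>\<^bsub>K\<^esub> \<theta> y)"] A B
      unfolding C_def distrib_right by linarith
    then show ?thesis by (simp add: mult.assoc)
  qed
  \<comment> \<open>The inverse chart, with the coordinates centred at the identity as
    \<open>approximately_additive\<close> expects.\<close>
  define X where "X v = inv_into U \<phi> (\<lambda>i. \<phi> \<one>\<^bsub>H\<^esub> i + v i)" for v
  have pE: "\<phi> \<one>\<^bsub>H\<^esub> \<in> EE ?n" by (rule chart_EE[OF cH U])
  have X: "X v \<in> U" "\<phi> (X v) = (\<lambda>i. \<phi> \<one>\<^bsub>H\<^esub> i + v i)" "?nu (X v) = l1dist ?n (\<lambda>_. 0) v"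
    if v: "v \<in> EE ?n" "l1dist ?n (\<lambda>_. 0) v < r" for v
  proof -
    have d: "l1dist ?n (\<phi> \<one>\<^bsub>H\<^esub>) (\<lambda>i. \<phi> \<one>\<^bsub>H\<^esub> i + v i) = l1dist ?n (\<lambda>_. 0) v" by (simp add: l1dist_def)
    have E: "(\<lambda>i. \<phi> \<one>\<^bsub>H\<^esub> i + v i) \<in> EE ?n" using pE v by (auto simp: topspace_Euclidean_space)
    have "l1dist ?n (\<phi> \<one>\<^bsub>H\<^esub>) (\<lambda>i. \<phi> \<one>\<^bsub>H\<^esub> i + v i) < r5" using d v r by simp
    then obtain x where x: "x \<in> U" "\<phi> x = (\<lambda>i. \<phi> \<one>\<^bsub>H\<^esub> i + v i)" using r5(2)[OF E] by blast
    moreover from x have "X v = x" unfolding X_def using chart_inv[OF cH U(1)] by metis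
    ultimately show "X v \<in> U" "\<phi> (X v) = (\<lambda>i. \<phi> \<one>\<^bsub>H\<^esub> i + v i)" "?nu (X v) = l1dist ?n (\<lambda>_. 0) v" using d by auto
  qed
  have re: "r \<le> e"
  proof -
    have "1 * r \<le> K0 * r" using K0 r by (intro mult_right_mono) auto
    then show ?thesis using r by linarith
  qed
  define Q where "Q j T C \<longleftrightarrow> (\<forall>v\<in>EE ?n. l1dist ?n (\<lambda>_. 0) v < r \<longrightarrow>
      \<bar>(\<psi> (\<theta> (X v)) j - \<psi> \<one>\<^bsub>K\<^esub> j) - (\<Sum>i<?n. T i * v i)\<bar> \<le> C * (l1dist ?n (\<lambda>_. 0) v)\<^sup>2)" for j T C
  \<comment> \<open>The radius \<open>r\<close> is already common to all coordinates. What remains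
    to be made uniform is \<open>C'\<close>, while the linear form \<open>T\<close> may depend on
    \<open>j\<close>.\<close>
  have ex: "\<exists>C' d. 0 \<le> C' \<and> 0 < (d :: real) \<and> (\<exists>T. Q j T C')" if j: "j < ?a" for j
  proof -
    obtain d C' where "C' \<ge> 0"
      "\<And>v. v \<in> EE ?n \<Longrightarrow> l1dist ?n (\<lambda>_. 0) v < r \<Longrightarrow>
        \<bar>(\<psi> (\<theta> (X v)) j - \<psi> \<one>\<^bsub>K\<^esub> j) - (\<Sum>i<?n. d i * v i)\<bar> \<le> C' * (l1dist ?n (\<lambda>_. 0) v)\<^sup>2"
    proof (rule approximately_additive[OF r(1) C0, of ?n "\<lambda>v. \<psi> (\<theta> (X v)) j - \<psi> \<one>\<^bsub>K\<^esub> j" L])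
      fix v w assume v: "v \<in> EE ?n" "w \<in> EE ?n" "l1dist ?n (\<lambda>_. 0) v < r" "l1dist ?n (\<lambda>_. 0) w < r"
        "l1dist ?n (\<lambda>_. 0) (\<lambda>i. v i + w i) < r"
      have vw: "(\<lambda>i. v i + w i) \<in> EE ?n" using v by (auto simp: topspace_Euclidean_space)
      have "l1dist ?a (\<psi> (\<theta> (X (\<lambda>i. v i + w i)))) (\<lambda>j. \<psi> (\<theta> (X v)) j + \<psi> (\<theta> (X w)) j - \<psi> \<one>\<^bsub>K\<^esub> j)
         \<le> C * ?nu (X v) * ?nu (X w)"
        by (rule additive) (use v vw X in auto)
      then show "\<bar>\<psi> (\<theta> (X (\<lambda>i. v i + w i))) j - \<psi> \<one>\<^bsub>K\<^esub> j - (\<psi> (\<theta> (X v)) j - \<psi> \<one>\<^bsub>K\<^esub> j) - (\<psi> (\<theta> (X w)) j - \<psi> \<one>\<^bsub>K\<^esub> j)\<bar>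
         \<le> C * l1dist ?n (\<lambda>_. 0) v * l1dist ?n (\<lambda>_. 0) w"
        using l1dist_coord[OF j, of "\<psi> (\<theta> (X (\<lambda>i. v i + w i)))" "\<lambda>j. \<psi> (\<theta> (X v)) j + \<psi> (\<theta> (X w)) j - \<psi> \<one>\<^bsub>K\<^esub> j"] v X by auto
    next
      fix v assume v: "v \<in> EE ?n" "l1dist ?n (\<lambda>_. 0) v < r"
      have "?nuK (\<theta> (X v)) \<le> L * ?nu (X v)" using 4(4)[OF X(1)[OF v]] X(3)[OF v] v re e by simp
      then show "\<bar>\<psi> (\<theta> (X v)) j - \<psi> \<one>\<^bsub>K\<^esub> j\<bar> \<le> L * l1dist ?n (\<lambda>_. 0) v"
        using l1dist_coord[OF j, of "\<psi> \<one>\<^bsub>K\<^esub>" "\<psi> (\<theta> (X v))"] X[OF v] by (simp add: abs_minus_commute)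
    qed (rule that)
    then have "Q j d C'" unfolding Q_def by blast
    then show ?thesis using r(1) \<open>C' \<ge> 0\<close> by blast
  qed
  obtain C' d where C': "0 \<le> C'" "0 < (d :: real)" "\<And>j. j < ?a \<Longrightarrow> \<exists>T. Q j T C'"
  proof (rule uniform_constants[OF ex])
    show "\<exists>T. Q j T C'" if "\<exists>T. Q j T C" "C \<le> C'" for j C C'
      using that unfolding Q_def by (meson mult_right_mono order_trans zero_le_power2)
  qed auto
  then obtain T where "\<And>j. j < ?a \<Longrightarrow> Q j (T j) C'" by metis
  then have T: "\<bar>(\<psi> (\<theta> (X v)) j - \<psi> \<one>\<^bsub>K\<^esub> j) - (\<Sum>i<?n. T j i * v i)\<bar> \<le> C' * (l1dist ?n (\<lambda>_. 0) v)\<^sup>2"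
    if "j < ?a" "v \<in> EE ?n" "l1dist ?n (\<lambda>_. 0) v < r" for j v
    using that unfolding Q_def by blast
  show thesis
  proof (rule that[of r T C'])
    fix y assume y: "y \<in> U" "?nu y < r"
    then show "\<theta> y \<in> V" using 4(3) re e by auto
    fix j assume j: "j < ?a"
    define v where "v i = \<phi> y i - \<phi> \<one>\<^bsub>H\<^esub> i" for i
    have vE: "v \<in> EE ?n" using pE chart_EE[OF cH U(1) y(1)] by (auto simp: v_def topspace_Euclidean_space)
    have vn: "l1dist ?n (\<lambda>_. 0) v = ?nu y" by (simp add: v_def l1dist_def abs_minus_commute)
    have "X v = y" unfolding X_def v_def using chart_inv[OF cH U(1) y(1)] by simp
    then show "\<bar>\<psi> (\<theta> y) j - \<psi> \<one>\<^bsub>K\<^esub> j - (\<Sum>l<?n. T j l * (\<phi> y l - \<phi> \<one>\<^bsub>H\<^esub> l))\<bar> \<le> C' * (?nu y)\<^sup>2"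
      using T[OF j vE] vn y by (simp add: v_def)
  qed (rule r)
qed

text \<open>The linear approximation at the identity holds on the whole group, so the subgroup in
  the differentiability lemma is \<open>carrier H\<close> and the auxiliary map \<open>h\<close> is
  the identity map.\<close>

theorem continuous_hom_smooth:
  fixes H :: "'h lie_struct" and K :: "'k lie_struct"
  assumes H: "left_lie_group H" and K: "left_lie_group K" and hom: "\<theta> \<in> hom H K"
    and cont: "\<And>Q. openin (mtop (mfd K)) Q \<Longrightarrow> \<one>\<^bsub>K\<^esub> \<in> Q \<Longrightarrow>
        \<exists>P. openin (mtop (mfd H)) P \<and> \<one>\<^bsub>H\<^esub> \<in> P \<and> (\<forall>x\<in>P. \<theta> x \<in> Q)"
    and p: "p \<in> carrier H"
  shows "smooth_near (mfd H) (mfd K) p \<theta>"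
proof -
  interpret H: group H by (rule left_lie_is_group[OF H])
  note cH = left_lie_charted[OF H] and cK = left_lie_charted[OF K]
  obtain U \<phi> where U: "(U, \<phi>) \<in> atlas (mfd H)" "\<one>\<^bsub>H\<^esub> \<in> U" using chart_at[OF cH left_lie_one[OF H]] .
  obtain V \<psi> where V: "(V, \<psi>) \<in> atlas (mfd K)" "\<one>\<^bsub>K\<^esub> \<in> V" using chart_at[OF cK left_lie_one[OF K]] .
  obtain T C r where est: "r > 0"
    "\<And>y. y \<in> U \<Longrightarrow> l1dist (mdim (mfd H)) (\<phi> \<one>\<^bsub>H\<^esub>) (\<phi> y) < r \<Longrightarrow> \<theta> y \<in> V"
    "\<And>y j. y \<in> U \<Longrightarrow> l1dist (mdim (mfd H)) (\<phi> \<one>\<^bsub>H\<^esub>) (\<phi> y) < r \<Longrightarrow> j < mdim (mfd K) \<Longrightarrow>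
         \<bar>\<psi> (\<theta> y) j - \<psi> \<one>\<^bsub>K\<^esub> j - (\<Sum>l<mdim (mfd H). T j l * (\<phi> y l - \<phi> \<one>\<^bsub>H\<^esub> l))\<bar>
           \<le> C * (l1dist (mdim (mfd H)) (\<phi> \<one>\<^bsub>H\<^esub>) (\<phi> y))\<^sup>2"
    by (rule hom_linear_approximation[OF H K U V hom cont]) (assumption | rule that)+
  have pt: "p \<in> topspace (mtop (mfd H))" using p left_lie_topspace[OF H] by simp
  show ?thesis
    by (rule smooth_near_of_linear_approximation'[OF H K cH U V H.subgroup_self _ _ smooth_near_id[OF cH pt] openin_topspace pt _ est(1)])
      (use hom est left_lie_topspace[OF H] in \<open>auto simp: hom_def\<close>)
qed

text \<open>
  The inverse of \<open>\<iota>\<close> on its image is continuous, hence Lipschitz at the identity, so the differential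
  of \<open>\<iota>\<close> there is injective; a left inverse of it is the linear approximation of the inverse of \<open>\<iota>\<close>.
\<close>

theorem smooth_lift_through_embedding:
  fixes A :: "'h lie_struct" and E :: "'k lie_struct"
  assumes A: "left_lie_group A" and E: "left_lie_group E" and hom: "\<iota> \<in> hom A E"
    and inj: "inj_on \<iota> (carrier A)" and closed: "closed_map (mtop (mfd A)) (mtop (mfd E)) \<iota>"
    and smooth: "smooth_near (mfd A) (mfd E) \<one>\<^bsub>A\<^esub> \<iota>"
    and M: "charted M" and h: "smooth_near M (mfd E) p h"
    and P: "openin (mtop M) P" "p \<in> P" "\<And>w. w \<in> P \<Longrightarrow> h w \<in> \<iota> ` carrier A"
  shows "smooth_near M (mfd A) p (\<lambda>w. inv_into (carrier A) \<iota> (h w))"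
proof -
  interpret A: group A by (rule left_lie_is_group[OF A])
  interpret E: group E by (rule left_lie_is_group[OF E])
  interpret h: group_hom A E \<iota> by unfold_locales (rule hom)
  note cA = left_lie_charted[OF A] and cE = left_lie_charted[OF E]
  let ?\<theta> = "inv_into (carrier A) \<iota>" and ?S = "\<iota> ` carrier A"
  obtain V \<psi> where V: "(V, \<psi>) \<in> atlas (mfd A)" "\<one>\<^bsub>A\<^esub> \<in> V" using chart_at[OF cA left_lie_one[OF A]] .
  obtain U \<phi> where U: "(U, \<phi>) \<in> atlas (mfd E)" "\<one>\<^bsub>E\<^esub> \<in> U" using chart_at[OF cE left_lie_one[OF E]] .
  let ?N = "mdim (mfd E)" and ?a = "mdim (mfd A)"
  let ?nu = "\<lambda>y. l1dist ?N (\<phi> \<one>\<^bsub>E\<^esub>) (\<phi> y)" and ?nuA = "\<lambda>y. l1dist ?a (\<psi> \<one>\<^bsub>A\<^esub>) (\<psi> y)"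
  have th: "?\<theta> (\<iota> x) = x" if "x \<in> carrier A" for x using inv_into_f_f[OF inj that] .
  have S: "subgroup ?S E" by (rule h.img_is_subgroup)
  have thom: "?\<theta> (x \<otimes>\<^bsub>E\<^esub> y) = ?\<theta> x \<otimes>\<^bsub>A\<^esub> ?\<theta> y" if "x \<in> ?S" "y \<in> ?S" for x y
    using that by (auto simp: th h.hom_mult[symmetric] simp del: h.hom_mult)
  have tS: "?\<theta> x \<in> carrier A" if "x \<in> ?S" for x using that by (auto simp: th)
  obtain L r1 where L: "L \<ge> 0" "r1 > 0" "\<And>y. y \<in> ?S \<Longrightarrow> y \<in> U \<Longrightarrow> ?nu y < r1 \<Longrightarrow> ?\<theta> y \<in> V"
    "\<And>y. y \<in> ?S \<Longrightarrow> y \<in> U \<Longrightarrow> ?nu y < r1 \<Longrightarrow> ?nuA (?\<theta> y) \<le> L * ?nu y"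
  proof (rule hom_Lipschitz[OF E A U V S thom])
    fix Q assume Q: "openin (mtop (mfd A)) Q" "\<one>\<^bsub>A\<^esub> \<in> Q"
    \<comment> \<open>Closedness of \<open>\<iota>\<close> gives continuity of its inverse at the
      identity: removing the closed image of \<open>carrier A - Q\<close> leaves a neighbourhood
      whose points in the image of \<open>\<iota>\<close> come from \<open>Q\<close>.\<close>
    have cl: "closedin (mtop (mfd E)) (\<iota> ` (carrier A - Q))"
      using closed Q(1) left_lie_topspace[OF A] unfolding closed_map_def by (metis closedin_diff closedin_topspace)
    show "\<exists>P. openin (mtop (mfd E)) P \<and> \<one>\<^bsub>E\<^esub> \<in> P \<and> (\<forall>x\<in>?S \<inter> P. ?\<theta> x \<in> Q)"
    proof (intro exI conjI ballI)
      show "openin (mtop (mfd E)) (topspace (mtop (mfd E)) - \<iota> ` (carrier A - Q))" using cl by blast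
      show "\<one>\<^bsub>E\<^esub> \<in> topspace (mtop (mfd E)) - \<iota> ` (carrier A - Q)"
      proof -
        have "\<one>\<^bsub>E\<^esub> \<noteq> \<iota> x" if "x \<in> carrier A - Q" for x
          using inj_onD[OF inj, of x "\<one>\<^bsub>A\<^esub>"] that Q by auto
        then show ?thesis using left_lie_one[OF E] by blast
      qed
      show "?\<theta> x \<in> Q" if "x \<in> ?S \<inter> (topspace (mtop (mfd E)) - \<iota> ` (carrier A - Q))" for x
        using that th by auto
    qed
  qed (assumption | rule that)+
  have i1: "\<iota> \<one>\<^bsub>A\<^esub> \<in> U" using U by simp
  have i1': "\<iota> \<one>\<^bsub>A\<^esub> \<in> topspace (mtop (mfd E))" using left_lie_one[OF E] by simp
  obtain D where D: "openin (mtop (mfd A)) D" "\<one>\<^bsub>A\<^esub> \<in> D" "D \<subseteq> V \<inter> topspace (mtop (mfd A))" "\<iota> ` D \<subseteq> U \<inter> topspace (mtop (mfd E))"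
    "smooth_euclidean ?a ?N (\<psi> ` D) (\<phi> \<circ> \<iota> \<circ> inv_into V \<psi>)"
    by (rule smooth_near_chartD[OF cA cE smooth V U(1) i1 openin_topspace left_lie_one[OF A] openin_topspace i1'])
  have DV: "D \<subseteq> V" using D by auto
  have oD: "openin (Euclidean_space ?a) (\<psi> ` D)" by (rule chart_image_open[OF cA V(1) D(1) DV])
  define I where "I = \<phi> \<circ> \<iota> \<circ> inv_into V \<psi>"
  have I: "I (\<psi> x) = \<phi> (\<iota> x)" if "x \<in> V" for x using chart_inv[OF cA V(1) that] by (simp add: I_def)
  define Mt where "Mt i j = pdv i (\<lambda>x. I x j) (\<psi> \<one>\<^bsub>A\<^esub>)" for i j
  have pD: "\<psi> \<one>\<^bsub>A\<^esub> \<in> \<psi> ` D" using D by blast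
  have pE: "\<psi> \<one>\<^bsub>A\<^esub> \<in> EE ?a" by (rule chart_EE[OF cA V])
  obtain C r2 where C: "C \<ge> 0" "r2 > 0" "\<And>y j. y \<in> EE ?a \<Longrightarrow> l1dist ?a (\<psi> \<one>\<^bsub>A\<^esub>) y < r2 \<Longrightarrow> j < ?N \<Longrightarrow>
      \<bar>I y j - I (\<psi> \<one>\<^bsub>A\<^esub>) j - (\<Sum>i<?a. Mt i j * (y i - \<psi> \<one>\<^bsub>A\<^esub> i))\<bar> \<le> C * (l1dist ?a (\<psi> \<one>\<^bsub>A\<^esub>) y)\<^sup>2"
    by (rule smooth_second_order[OF oD D(5)[folded I_def] pD, folded Mt_def]) (rule that)
  have exp: "\<bar>\<phi> (\<iota> x) j - \<phi> \<one>\<^bsub>E\<^esub> j - (\<Sum>i<?a. Mt i j * (\<psi> x i - \<psi> \<one>\<^bsub>A\<^esub> i))\<bar> \<le> C * (?nuA x)\<^sup>2"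
    if "x \<in> V" "?nuA x < r2" "j < ?N" for x j
    using C(3)[OF chart_EE[OF cA V(1) that(1)] that(2,3)] I[OF that(1)] I[OF V(2)] by simp
  obtain r3 where r3: "r3 > 0" "\<And>v. v \<in> EE ?a \<Longrightarrow> l1dist ?a (\<psi> \<one>\<^bsub>A\<^esub>) v < r3 \<Longrightarrow> \<exists>x\<in>V \<inter> D. \<psi> x = v"
    by (rule chart_nbhd[OF cA V(1) D(1,2) V(2)]) (rule that)
  have UA: "x \<in> carrier A" if "x \<in> V" for x using chart_subset[OF cA V(1)] left_lie_topspace[OF A] that by auto
  obtain Tm where Tm: "\<And>i k. i < ?a \<Longrightarrow> k < ?a \<Longrightarrow> (\<Sum>j<?N. Tm i j * Mt k j) = (if i = k then 1 else 0)"
  proof (rule left_inverse_matrix[where N = ?N and a = ?a and M = Mt])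
    fix v k assume v: "\<And>j. j < ?N \<Longrightarrow> (\<Sum>k<?a. v k * Mt k j) = 0" and k: "k < ?a"
    define w where "w = slice 0 ?a v"
    define n where "n = l1dist ?a (\<lambda>_. 0) w"
    have wE: "w \<in> EE ?a" by (simp add: w_def slice_EE)
    have n0: "n \<ge> 0" by (simp add: n_def)
    \<comment> \<open>For \<open>v\<close> in the kernel of the differential, moving by
      \<open>t * w\<close> in the chart of \<open>A\<close> moves the image by order
      \<open>t\<^sup>2\<close> only, whereas the Lipschitz bound on the inverse demands a move of
      order \<open>t\<close>. Letting \<open>t\<close> tend to 0 forces
      \<open>n = 0\<close>.\<close>
    have bound: "n \<le> L * (real ?N * C) * n\<^sup>2 * t" if t: "0 < t" "t * n < r2" "t * n < r3" "real ?N * C * (t * n)\<^sup>2 < r1" for t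
    proof -
      have vE: "(\<lambda>i. \<psi> \<one>\<^bsub>A\<^esub> i + t * w i) \<in> EE ?a" using pE wE by (auto simp: topspace_Euclidean_space)
      have dn: "l1dist ?a (\<psi> \<one>\<^bsub>A\<^esub>) (\<lambda>i. \<psi> \<one>\<^bsub>A\<^esub> i + t * w i) = t * n"
        using t(1) by (simp add: l1dist_def n_def sum_distrib_left abs_mult)
      obtain x where x: "x \<in> V" "x \<in> D" "\<psi> x = (\<lambda>i. \<psi> \<one>\<^bsub>A\<^esub> i + t * w i)" using r3(2)[OF vE] dn t by auto
      have nx: "?nuA x = t * n" using dn x by simp
      have "?nu (\<iota> x) \<le> (\<Sum>j<?N. C * (t * n)\<^sup>2)"
        unfolding l1dist_def[of ?N]
      proof (rule sum_mono)
        fix j assume "j \<in> {..<?N}"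
        then have j: "j < ?N" by simp
        have "(\<Sum>i<?a. Mt i j * (\<psi> x i - \<psi> \<one>\<^bsub>A\<^esub> i)) = t * (\<Sum>k<?a. v k * Mt k j)"
          unfolding x sum_distrib_left by (rule sum.cong) (auto simp: w_def slice_def)
        then have "(\<Sum>i<?a. Mt i j * (\<psi> x i - \<psi> \<one>\<^bsub>A\<^esub> i)) = 0" using v[OF j] by simp
        then show "\<bar>\<phi> \<one>\<^bsub>E\<^esub> j - \<phi> (\<iota> x) j\<bar> \<le> C * (t * n)\<^sup>2" using exp[OF x(1) _ j] nx t by (simp add: abs_minus_commute)
      qed
      then have ni: "?nu (\<iota> x) \<le> real ?N * C * (t * n)\<^sup>2" by simp
      have "\<iota> x \<in> U" using D(4) x(2) by auto
      moreover have "\<iota> x \<in> ?S" using UA[OF x(1)] by auto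
      ultimately have "?nuA (?\<theta> (\<iota> x)) \<le> L * ?nu (\<iota> x)" using L(4) ni t by auto
      then have "t * n \<le> L * ?nu (\<iota> x)" using th[OF UA[OF x(1)]] nx by simp
      also have "\<dots> \<le> L * (real ?N * C * (t * n)\<^sup>2)" using ni L(1) by (rule mult_left_mono)
      finally have "t * n \<le> t * (L * (real ?N * C) * n\<^sup>2 * t)" by (simp add: power2_eq_square mult_ac)
      then show ?thesis using t(1) by simp
    qed
    have lim: "((\<lambda>t. t * n) \<longlongrightarrow> 0) (at_right 0)" "((\<lambda>t. real ?N * C * (t * n)\<^sup>2) \<longlongrightarrow> 0) (at_right 0)"
      "((\<lambda>t. L * (real ?N * C) * n\<^sup>2 * t) \<longlongrightarrow> 0) (at_right 0)"
      by (rule tendsto_eq_intros refl | simp)+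
    have "\<forall>\<^sub>F t in at_right (0::real). n \<le> L * (real ?N * C) * n\<^sup>2 * t"
      using order_tendstoD(2)[OF lim(1) C(2)] order_tendstoD(2)[OF lim(1) r3(1)] order_tendstoD(2)[OF lim(2) L(2)]
        eventually_at_right_less[of 0]
      by eventually_elim (rule bound)
    then have "n \<le> 0" by (rule tendsto_lowerbound[OF lim(3)]) simp
    then have "n = 0" using n0 by simp
    then have "\<bar>0 - w k\<bar> \<le> 0" using l1dist_coord[OF k, of "\<lambda>_. 0" w] by (simp add: n_def)
    then show "v k = 0" using k by (simp add: w_def slice_def)
  qed (rule that)
  define r where "r = min r1 (r2 / (L + 1))"
  have r: "r > 0" "r \<le> r1" "L * r < r2"
  proof -
    show "r > 0" "r \<le> r1" using L C by (auto simp: r_def)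
    have "L * r \<le> L * (r2 / (L + 1))" using L by (intro mult_left_mono) (auto simp: r_def)
    also have "\<dots> < r2" using L C by (simp add: field_simps)
    finally show "L * r < r2" .
  qed
  define B where "B = (\<Sum>j<?a. \<Sum>l<?N. \<bar>Tm j l\<bar>)"
  have B: "(\<Sum>l<?N. \<bar>Tm j l\<bar>) \<le> B" if "j < ?a" for j
    unfolding B_def by (rule member_le_sum) (use that in \<open>auto intro: sum_nonneg\<close>)
  show ?thesis
  proof (rule smooth_near_of_linear_approximation'[OF E A M U V S thom tS h P r(1), where T = Tm and C = "B * (C * L\<^sup>2)"])
    fix y assume y: "y \<in> ?S" "y \<in> U" "?nu y < r"
    show tV: "?\<theta> y \<in> V" using L(3) y r by auto
    fix k assume k: "k < ?a"
    let ?x = "?\<theta> y"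
    have ix: "\<iota> ?x = y" using y(1) by (rule f_inv_into_f)
    have nx: "?nuA ?x \<le> L * ?nu y" using L(4) y r by auto
    also have "\<dots> \<le> L * r" using y L by (intro mult_left_mono) auto
    finally have nxr: "?nuA ?x < r2" using r by linarith
    \<comment> \<open>The Taylor remainder of \<open>\<iota>\<close> at \<open>?x\<close>. Applying
      the left inverse \<open>Tm\<close> to the expansion of \<open>\<iota> ?x = y\<close> solves it
      for the coordinates of \<open>?x\<close>.\<close>
    define e where "e j = \<phi> y j - \<phi> \<one>\<^bsub>E\<^esub> j - (\<Sum>i<?a. Mt i j * (\<psi> ?x i - \<psi> \<one>\<^bsub>A\<^esub> i))" for j
    have e: "\<bar>e j\<bar> \<le> C * L\<^sup>2 * (?nu y)\<^sup>2" if j: "j < ?N" for j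
    proof -
      have "\<bar>e j\<bar> \<le> C * (?nuA ?x)\<^sup>2" using exp[OF tV nxr j] ix by (simp add: e_def)
      also have "\<dots> \<le> C * (L * ?nu y)\<^sup>2" using nx C by (intro mult_left_mono power_mono) auto
      finally show ?thesis by (simp add: power_mult_distrib mult.assoc)
    qed
    have "(\<Sum>l<?N. Tm k l * (\<Sum>i<?a. Mt i l * (\<psi> ?x i - \<psi> \<one>\<^bsub>A\<^esub> i)))
        = (\<Sum>i<?a. (\<Sum>l<?N. Tm k l * Mt i l) * (\<psi> ?x i - \<psi> \<one>\<^bsub>A\<^esub> i))"
      unfolding sum_distrib_left sum_distrib_right by (subst sum.swap) (simp add: mult.assoc)
    also have "\<dots> = (\<Sum>i<?a. (if k = i then \<psi> ?x i - \<psi> \<one>\<^bsub>A\<^esub> i else 0))"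
      by (rule sum.cong) (use Tm k in auto)
    also have "\<dots> = \<psi> ?x k - \<psi> \<one>\<^bsub>A\<^esub> k" using k by simp
    finally have lin: "(\<Sum>l<?N. Tm k l * (\<Sum>i<?a. Mt i l * (\<psi> ?x i - \<psi> \<one>\<^bsub>A\<^esub> i))) = \<psi> ?x k - \<psi> \<one>\<^bsub>A\<^esub> k" .
    have "\<psi> ?x k - \<psi> \<one>\<^bsub>A\<^esub> k - (\<Sum>l<?N. Tm k l * (\<phi> y l - \<phi> \<one>\<^bsub>E\<^esub> l)) = - (\<Sum>l<?N. Tm k l * e l)"
      unfolding e_def right_diff_distrib[of "Tm k _" "\<phi> y _ - \<phi> \<one>\<^bsub>E\<^esub> _"] sum_subtractf[of "\<lambda>l. Tm k l * (\<phi> y l - \<phi> \<one>\<^bsub>E\<^esub> l)"] lin by simp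
    also have "\<bar>\<dots>\<bar> \<le> (\<Sum>l<?N. \<bar>Tm k l\<bar> * (C * L\<^sup>2 * (?nu y)\<^sup>2))"
      unfolding abs_minus_cancel
      by (rule order_trans[OF sum_abs], rule sum_mono) (use e in \<open>auto simp: abs_mult intro: mult_left_mono\<close>)
    also have "\<dots> = (\<Sum>l<?N. \<bar>Tm k l\<bar>) * (C * L\<^sup>2 * (?nu y)\<^sup>2)" by (simp add: sum_distrib_right)
    also have "\<dots> \<le> B * (C * L\<^sup>2 * (?nu y)\<^sup>2)" using B[OF k] C by (intro mult_right_mono) auto
    finally show "\<bar>\<psi> ?x k - \<psi> \<one>\<^bsub>A\<^esub> k - (\<Sum>l<?N. Tm k l * (\<phi> y l - \<phi> \<one>\<^bsub>E\<^esub> l))\<bar> \<le> B * (C * L\<^sup>2) * (?nu y)\<^sup>2"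
      by (simp add: mult.assoc)
  qed
qed

section \<open>Borel homomorphisms are continuous\<close>

lemma space_borel_of [simp]: "space (borel_of T) = topspace T"
  unfolding borel_of_def by (rule space_measure_of) (auto dest: openin_subset)

lemma sets_borel_of: "sets (borel_of T) = sigma_sets (topspace T) {U. openin T U}"
  unfolding borel_of_def by (rule sets_measure_of) (auto dest: openin_subset)

lemma borel_of_open: "openin T U \<Longrightarrow> U \<in> sets (borel_of T)"
  by (auto simp: sets_borel_of)

lemma borel_of_closed:
  assumes "closedin T C" shows "C \<in> sets (borel_of T)"
proof -
  have "topspace T - (topspace T - C) \<in> sets (borel_of T)"
    using sets.compl_sets[OF borel_of_open[of T "topspace T - C"]] assms by (simp add: openin_diff)
  moreover have "topspace T - (topspace T - C) = C" using closedin_subset[OF assms] by blast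
  ultimately show ?thesis by simp
qed

lemma measurable_borel_ofI:
  assumes "f \<in> space M \<rightarrow> topspace T" "\<And>U. openin T U \<Longrightarrow> f -` U \<inter> space M \<in> sets M"
  shows "f \<in> measurable M (borel_of T)"
  unfolding borel_of_def by (rule measurable_sigma_sets[OF sets_measure_of])
    (use assms in \<open>auto dest: openin_subset simp: space_measure_of_conv\<close>)

text \<open>For the inverse of a closed injection it is the preimages of closed sets that are
  accessible, being images under the injection.\<close>

lemma measurable_borel_of_closedI:
  assumes f: "f \<in> space M \<rightarrow> topspace T" and C: "\<And>C. closedin T C \<Longrightarrow> f -` C \<inter> space M \<in> sets M"
  shows "f \<in> measurable M (borel_of T)"
proof (rule measurable_borel_ofI[OF f])
  fix U assume U: "openin T U"
  have "f -` U \<inter> space M = space M - (f -` (topspace T - U) \<inter> space M)" using f by auto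
  then show "f -` U \<inter> space M \<in> sets M" using C[of "topspace T - U"] U by auto
qed

lemma continuous_map_borel_of:
  assumes "continuous_map X Y f" shows "f \<in> measurable (borel_of X) (borel_of Y)"
proof (rule measurable_borel_ofI)
  show "f \<in> space (borel_of X) \<rightarrow> topspace Y" using assms by (auto simp: continuous_map_def)
  fix U assume "openin Y U"
  then have "openin X {x \<in> topspace X. f x \<in> U}" using assms by (simp add: continuous_map_def)
  moreover have "f -` U \<inter> space (borel_of X) = {x \<in> topspace X. f x \<in> U}" by auto
  ultimately show "f -` U \<inter> space (borel_of X) \<in> sets (borel_of X)" using borel_of_open by metis
qed

lemma second_countableE:
  assumes "second_countable X"
  obtains B where "countable B" "\<And>V. V \<in> B \<Longrightarrow> openin X V"
    "\<And>V x. openin X V \<Longrightarrow> x \<in> V \<Longrightarrow> \<exists>b\<in>B. x \<in> b \<and> b \<subseteq> V"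
proof -
  from assms obtain B where "countable B \<and> (\<forall>V\<in>B. openin X V) \<and>
      (\<forall>U x. openin X U \<and> x \<in> U \<longrightarrow> (\<exists>V\<in>B. x \<in> V \<and> V \<subseteq> U))"
    unfolding second_countable_def by (elim exE)
  then show thesis by (intro that[of B]) auto
qed

lemma openin_prodE:
  assumes "openin (prod_topology X Y) D" "(x, y) \<in> D"
  obtains P Q where "openin X P" "openin Y Q" "x \<in> P" "y \<in> Q" "P \<times> Q \<subseteq> D"
  using assms unfolding openin_prod_topology_alt by metis

text \<open>The Lindelof property: one index is chosen for each basic set contained in a member of
  the family.\<close>

lemma second_countable_subcover:
  assumes "second_countable X" "\<And>i. i \<in> I \<Longrightarrow> openin X (U i)"
  obtains C where "C \<subseteq> I" "countable C" "(\<Union>i\<in>I. U i) = (\<Union>i\<in>C. U i)"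
proof -
  obtain B where B: "countable B" "\<And>V x. openin X V \<Longrightarrow> x \<in> V \<Longrightarrow> \<exists>b\<in>B. x \<in> b \<and> b \<subseteq> V"
    by (rule second_countableE[OF assms(1)]) (rule that)
  define B' where "B' = {b \<in> B. \<exists>i\<in>I. b \<subseteq> U i}"
  have "\<forall>b\<in>B'. \<exists>i. i \<in> I \<and> b \<subseteq> U i" by (auto simp: B'_def)
  then obtain g where g: "\<And>b. b \<in> B' \<Longrightarrow> g b \<in> I \<and> b \<subseteq> U (g b)" by metis
  show thesis
  proof (rule that[of "g ` B'"])
    show "g ` B' \<subseteq> I" using g by auto
    show "countable (g ` B')" using B(1) by (auto simp: B'_def)
    show "(\<Union>i\<in>I. U i) = (\<Union>i\<in>g ` B'. U i)"
    proof
      show "(\<Union>i\<in>I. U i) \<subseteq> (\<Union>i\<in>g ` B'. U i)"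
      proof
        fix x assume "x \<in> (\<Union>i\<in>I. U i)"
        then obtain i where i: "i \<in> I" "x \<in> U i" by blast
        then obtain b where "b \<in> B" "x \<in> b" "b \<subseteq> U i" using B(2)[OF assms(2)] by blast
        then have "b \<in> B'" using i by (auto simp: B'_def)
        then show "x \<in> (\<Union>i\<in>g ` B'. U i)" using g \<open>x \<in> b\<close> by blast
      qed
    qed (use g in blast)
  qed
qed

lemma countable_rectangle_base:
  assumes "second_countable X" "second_countable Y"
  obtains B where "countable B" "\<And>U. openin (prod_topology X Y) U \<Longrightarrow>
     \<exists>C\<subseteq>B. U = (\<Union>(S, T)\<in>C. S \<times> T)" "\<And>S T. (S, T) \<in> B \<Longrightarrow> openin X S \<and> openin Y T"
proof -
  obtain B1 where B1: "countable B1" "\<And>V. V \<in> B1 \<Longrightarrow> openin X V" "\<And>V x. openin X V \<Longrightarrow> x \<in> V \<Longrightarrow> \<exists>b\<in>B1. x \<in> b \<and> b \<subseteq> V"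
    by (rule second_countableE[OF assms(1)]) (rule that)
  obtain B2 where B2: "countable B2" "\<And>V. V \<in> B2 \<Longrightarrow> openin Y V" "\<And>V x. openin Y V \<Longrightarrow> x \<in> V \<Longrightarrow> \<exists>b\<in>B2. x \<in> b \<and> b \<subseteq> V"
    by (rule second_countableE[OF assms(2)]) (rule that)
  show thesis
  proof (rule that[of "B1 \<times> B2"])
    fix U assume U: "openin (prod_topology X Y) U"
    let ?C = "{(S, T) \<in> B1 \<times> B2. S \<times> T \<subseteq> U}"
    have "U \<subseteq> (\<Union>(S, T)\<in>?C. S \<times> T)"
    proof
      fix p assume "p \<in> U"
      then obtain x y where p: "p = (x, y)" "(x, y) \<in> U" by (cases p) auto
      then obtain S T where "openin X S" "openin Y T" "x \<in> S" "y \<in> T" "S \<times> T \<subseteq> U"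
        using openin_prodE[OF U] by metis
      then obtain b c where "b \<in> B1" "c \<in> B2" "x \<in> b" "y \<in> c" "b \<times> c \<subseteq> U"
        using B1(3)[of S x] B2(3)[of T y] by blast
      then show "p \<in> (\<Union>(S, T)\<in>?C. S \<times> T)" using p by blast
    qed
    then show "\<exists>C\<subseteq>B1 \<times> B2. U = (\<Union>(S, T)\<in>C. S \<times> T)" by (intro exI[of _ ?C]) auto
  qed (use B1 B2 in auto)
qed

lemma second_countable_prod:
  assumes "second_countable X" "second_countable Y"
  shows "second_countable (prod_topology X Y)"
proof -
  obtain B where B: "countable B" "\<And>U. openin (prod_topology X Y) U \<Longrightarrow> \<exists>C\<subseteq>B. U = (\<Union>(S, T)\<in>C. S \<times> T)"
    "\<And>S T. (S, T) \<in> B \<Longrightarrow> openin X S \<and> openin Y T"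
    by (rule countable_rectangle_base[OF assms]) (rule that)
  let ?B = "(\<lambda>(S, T). S \<times> T) ` B"
  have "countable ?B" "\<forall>V\<in>?B. openin (prod_topology X Y) V" using B(1,3) by (auto simp: openin_prod_Times_iff)
  moreover have "\<exists>V\<in>?B. x \<in> V \<and> V \<subseteq> U" if U: "openin (prod_topology X Y) U" "x \<in> U" for U x
  proof -
    from B(2)[OF U(1)] obtain C where C: "C \<subseteq> B" "U = (\<Union>(S, T)\<in>C. S \<times> T)" by (elim exE conjE)
    then obtain p where "p \<in> C" "x \<in> (case p of (S, T) \<Rightarrow> S \<times> T)" using U(2) by blast
    then show ?thesis using C by (intro bexI[of _ "case p of (S, T) \<Rightarrow> S \<times> T"]) auto
  qed
  ultimately show ?thesis unfolding second_countable_def by (intro exI[of _ ?B] conjI allI impI) auto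
qed

text \<open>An open set of the product is a countable union of open rectangles. Without second
  countability the Borel sets of the product could exceed the product sigma-algebra.\<close>

lemma measurable_borel_of_Pair:
  assumes X: "second_countable X" and Y: "second_countable Y"
    and f: "f \<in> measurable M (borel_of X)" and g: "g \<in> measurable M (borel_of Y)"
  shows "(\<lambda>x. (f x, g x)) \<in> measurable M (borel_of (prod_topology X Y))"
proof (rule measurable_borel_ofI)
  show "(\<lambda>x. (f x, g x)) \<in> space M \<rightarrow> topspace (prod_topology X Y)"
    using measurable_space[OF f] measurable_space[OF g] by auto
  fix U assume U: "openin (prod_topology X Y) U"
  obtain B where B: "countable B" "\<And>U. openin (prod_topology X Y) U \<Longrightarrow> \<exists>C\<subseteq>B. U = (\<Union>(S, T)\<in>C. S \<times> T)"
    "\<And>S T. (S, T) \<in> B \<Longrightarrow> openin X S \<and> openin Y T"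
    by (rule countable_rectangle_base[OF X Y]) (rule that)
  obtain C where C: "C \<subseteq> B" "U = (\<Union>(S, T)\<in>C. S \<times> T)" using B(2)[OF U] by blast
  have "(\<lambda>x. (f x, g x)) -` U \<inter> space M = (\<Union>p\<in>C. (f -` fst p \<inter> space M) \<inter> (g -` snd p \<inter> space M))"
    unfolding C(2) by (auto simp: case_prod_unfold)
  also have "\<dots> \<in> sets M"
  proof (rule sets.countable_UN'')
    show "countable C" using B(1) C(1) countable_subset by blast
    fix p assume "p \<in> C"
    then have "openin X (fst p)" "openin Y (snd p)" using B(3)[of "fst p" "snd p"] C(1) by auto
    then show "(f -` fst p \<inter> space M) \<inter> (g -` snd p \<inter> space M) \<in> sets M"
      by (intro sets.Int measurable_sets[OF f] measurable_sets[OF g] borel_of_open)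
  qed
  finally show "(\<lambda>x. (f x, g x)) -` U \<inter> space M \<in> sets M" .
qed

section \<open>Baire category\<close>

definition meager :: "'a topology \<Rightarrow> 'a set \<Rightarrow> bool" where
  "meager X M \<longleftrightarrow> (\<exists>\<G>. countable \<G> \<and> (\<forall>T\<in>\<G>. closedin X T \<and> X interior_of T = {}) \<and> M \<subseteq> \<Union>\<G>)"

lemma meager_subset: "meager X M \<Longrightarrow> N \<subseteq> M \<Longrightarrow> meager X N"
  unfolding meager_def by (meson order_trans)

lemma meager_Union:
  assumes "countable I" "\<And>i. i \<in> I \<Longrightarrow> meager X (M i)"
  shows "meager X (\<Union>i\<in>I. M i)"
proof -
  have "\<exists>\<G>. countable \<G> \<and> (\<forall>T\<in>\<G>. closedin X T \<and> X interior_of T = {}) \<and> M i \<subseteq> \<Union>\<G>" if "i \<in> I" for i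
    using assms(2)[OF that] by (simp add: meager_def)
  then obtain \<G> where G: "\<And>i. i \<in> I \<Longrightarrow> countable (\<G> i) \<and> (\<forall>T\<in>\<G> i. closedin X T \<and> X interior_of T = {}) \<and> M i \<subseteq> \<Union>(\<G> i)"
    by metis
  show ?thesis unfolding meager_def
  proof (intro exI[of _ "\<Union>i\<in>I. \<G> i"] conjI)
    show "countable (\<Union>i\<in>I. \<G> i)" using G assms(1) by (intro countable_UN) auto
    show "\<forall>T\<in>\<Union>i\<in>I. \<G> i. closedin X T \<and> X interior_of T = {}" using G by blast
    show "(\<Union>i\<in>I. M i) \<subseteq> \<Union> (\<Union>i\<in>I. \<G> i)"
    proof
      fix x assume "x \<in> (\<Union>i\<in>I. M i)"
      then obtain i where "i \<in> I" "x \<in> M i" by blast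
      then obtain T where "T \<in> \<G> i" "x \<in> T" using G[of i] by (meson UnionE subsetD)
      then show "x \<in> \<Union> (\<Union>i\<in>I. \<G> i)" using UN_I[OF \<open>i \<in> I\<close>] by (metis UnionI)
    qed
  qed
qed

lemma meager_Un: "meager X M \<Longrightarrow> meager X N \<Longrightarrow> meager X (M \<union> N)"
  using meager_Union[of "{True, False}" X "\<lambda>b. if b then M else N"] by (simp add: Un_commute)

text \<open>If a nonempty open \<open>P\<close> lay in the closure of the preimage of a closed
  \<open>T\<close>, then \<open>P \<inter> V\<close> would be mapped into \<open>T\<close>, and its
  image, being open, would be interior to \<open>T\<close>. The map lives on an open set
  \<open>V\<close> because right translations are at first known to be continuous only near the
  identity.\<close>

lemma meager_preimage:
  assumes V: "openin X V" and c: "continuous_map (subtopology X V) Y f"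
    and op: "\<And>P. openin X P \<Longrightarrow> P \<subseteq> V \<Longrightarrow> openin Y (f ` P)" and M: "meager Y M"
  shows "meager X {x \<in> V. f x \<in> M}"
proof -
  obtain \<G> where G: "countable \<G>" "\<And>T. T \<in> \<G> \<Longrightarrow> closedin Y T \<and> Y interior_of T = {}" "M \<subseteq> \<Union>\<G>"
    using M unfolding meager_def by blast
  define F where "F T = X closure_of {x \<in> V. f x \<in> T}" for T
  have "closedin X (F T) \<and> X interior_of (F T) = {}" if T: "T \<in> \<G>" for T
  proof
    show "closedin X (F T)" by (simp add: F_def)
    have oc: "openin X {x \<in> V. f x \<in> topspace Y - T}"
      by (rule openin_preimage_on[OF V c]) (use G(2)[OF T] in blast)
    show "X interior_of (F T) = {}"
    proof (rule ccontr)
      assume "X interior_of (F T) \<noteq> {}"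
      define P where "P = X interior_of (F T)"
      have P: "openin X P" "P \<subseteq> F T" "P \<noteq> {}" using \<open>X interior_of (F T) \<noteq> {}\<close> by (simp_all add: P_def interior_of_subset)
      have ne: "P \<inter> {x \<in> V. f x \<in> T} \<noteq> {}"
      proof
        assume "P \<inter> {x \<in> V. f x \<in> T} = {}"
        then have "P \<inter> F T = {}" using P(1) openin_Int_closure_of_eq_empty unfolding F_def by blast
        then show False using P by blast
      qed
      have "P \<inter> V \<subseteq> {x \<in> V. f x \<in> T}"
      proof
        fix x assume x: "x \<in> P \<inter> V"
        show "x \<in> {x \<in> V. f x \<in> T}"
        proof (rule ccontr)
          assume "x \<notin> {x \<in> V. f x \<in> T}"
          then have xc: "x \<in> {x \<in> V. f x \<in> topspace Y - T}" using x continuous_map_on_into[OF V c] by auto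
          have "{x \<in> V. f x \<in> topspace Y - T} \<inter> {x \<in> V. f x \<in> T} = {}" by auto
          then have "{x \<in> V. f x \<in> topspace Y - T} \<inter> F T = {}"
            using oc openin_Int_closure_of_eq_empty unfolding F_def by blast
          then show False using xc x P(2) by blast
        qed
      qed
      then have "f ` (P \<inter> V) \<subseteq> T" by blast
      moreover have "openin Y (f ` (P \<inter> V))" using P(1) V by (intro op) auto
      ultimately have "f ` (P \<inter> V) \<subseteq> Y interior_of T" by (simp add: interior_of_maximal)
      then show False using G(2)[OF T] ne by blast
    qed
  qed
  moreover have "{x \<in> V. f x \<in> M} \<subseteq> \<Union>(F ` \<G>)"
  proof
    fix x assume x: "x \<in> {x \<in> V. f x \<in> M}"
    then obtain T where T: "T \<in> \<G>" "f x \<in> T" using G(3) by blast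
    have "{x \<in> V. f x \<in> T} \<subseteq> F T" unfolding F_def by (rule closure_of_subset) (use openin_subset[OF V] in auto)
    then show "x \<in> \<Union>(F ` \<G>)" using T x by blast
  qed
  ultimately show ?thesis unfolding meager_def using G(1) by (intro exI[of _ "F ` \<G>"]) auto
qed

definition baire_property :: "'a topology \<Rightarrow> 'a set \<Rightarrow> bool" where
  "baire_property X B \<longleftrightarrow> (\<exists>P. openin X P \<and> meager X ((B - P) \<union> (P - B)))"

text \<open>The sets that are open up to a meager set form a sigma-algebra. For complements, the
  open set is the complement of the closure of \<open>P\<close>, and the boundary of an open set is
  closed without interior.\<close>

lemma borel_baire_property:
  assumes "B \<in> sets (borel_of X)" shows "baire_property X B"
  using assms unfolding sets_borel_of
proof (induction B rule: sigma_sets.induct)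
  case (Basic a)
  then show ?case unfolding baire_property_def meager_def by (intro exI[of _ a] conjI) auto
next
  case Empty
  then show ?case unfolding baire_property_def meager_def by (intro exI[of _ "{}"] conjI) auto
next
  case (Compl a)
  then obtain P where P: "openin X P" "meager X ((a - P) \<union> (P - a))" unfolding baire_property_def by blast
  let ?Q = "topspace X - X closure_of P"
  have PX: "P \<subseteq> topspace X" using openin_subset[OF P(1)] .
  have Pc: "P \<subseteq> X closure_of P" by (rule closure_of_subset[OF PX])
  have "closedin X (X closure_of P - P) \<and> X interior_of (X closure_of P - P) = {}"
  proof
    show "closedin X (X closure_of P - P)" using P(1) by (simp add: closedin_diff)
    show "X interior_of (X closure_of P - P) = {}"
    proof (rule ccontr)
      let ?R = "X interior_of (X closure_of P - P)"
      assume "?R \<noteq> {}"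
      moreover have R: "?R \<subseteq> X closure_of P - P" by (rule interior_of_subset)
      moreover have "?R \<inter> P = {}" using R by blast
      then have "?R \<inter> X closure_of P = {}" by (subst openin_Int_closure_of_eq_empty[OF openin_interior_of])
      ultimately show False by blast
    qed
  qed
  then have "meager X (X closure_of P - P)" unfolding meager_def by (intro exI[of _ "{X closure_of P - P}"]) auto
  from meager_Un[OF P(2) this] have "meager X ((topspace X - a - ?Q) \<union> (?Q - (topspace X - a)))"
    by (rule meager_subset) (use Pc in blast)
  then show ?case unfolding baire_property_def by (intro exI[of _ ?Q]) (simp add: openin_diff)
next
  case (Union a)
  then have "\<forall>i. \<exists>P. openin X P \<and> meager X ((a i - P) \<union> (P - a i))" by (simp add: baire_property_def)
  then obtain P where P: "\<And>i. openin X (P i)" "\<And>i. meager X ((a i - P i) \<union> (P i - a i))" by metis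
  have "meager X (\<Union>i\<in>UNIV. (a i - P i) \<union> (P i - a i))" by (rule meager_Union) (use P in auto)
  then have "meager X (((\<Union>i. a i) - (\<Union>i. P i)) \<union> ((\<Union>i. P i) - (\<Union>i. a i)))"
    by (rule meager_subset) blast
  then show ?case unfolding baire_property_def using P(1) by (intro exI[of _ "\<Union>i. P i"]) auto
qed

lemma locally_compact_Euclidean_space: "locally_compact_space (Euclidean_space n)"
proof -
  have "locally_compact_space (product_topology (\<lambda>i. euclideanreal) {..<n})"
    unfolding locally_compact_space_product_topology by (auto simp: locally_compact_space_euclidean)
  then show ?thesis
    using homeomorphic_locally_compact_space[OF homeomorphic_Euclidean_space_product_topology] by blast
qed

lemma charted_locally_compact:
  assumes M: "charted M" shows "locally_compact_space (mtop M)"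
  unfolding locally_compact_space_def
proof
  fix p assume "p \<in> topspace (mtop M)"
  then obtain U \<phi> where U: "(U, \<phi>) \<in> atlas M" "p \<in> U" using chart_at[OF M] by blast
  let ?E = "subtopology (Euclidean_space (mdim M)) (\<phi> ` U)"
  have "locally_compact_space ?E"
    by (rule locally_compact_space_open_subset)
      (use locally_compact_Euclidean_space Hausdorff_Euclidean_space chart_image_open'[OF M U(1)] in auto)
  moreover have "subtopology (mtop M) U homeomorphic_space ?E"
    using chart_homeo[OF M U(1)] homeomorphic_space by blast
  ultimately have "locally_compact_space (subtopology (mtop M) U)"
    using homeomorphic_locally_compact_space by blast
  moreover have "p \<in> topspace (subtopology (mtop M) U)" using U chart_subset[OF M U(1)] by auto
  ultimately obtain P K where "openin (subtopology (mtop M) U) P" "compactin (subtopology (mtop M) U) K" "p \<in> P" "P \<subseteq> K"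
    unfolding locally_compact_space_def by blast
  then show "\<exists>P K. openin (mtop M) P \<and> compactin (mtop M) K \<and> p \<in> P \<and> P \<subseteq> K"
    using openin_trans_full[OF _ chart_open[OF M U(1)]] unfolding compactin_subtopology by metis
qed

text \<open>Charts make the space locally compact, and a locally compact Hausdorff space is regular,
  so the Baire category theorem applies.\<close>

lemma manifold_Baire:
  assumes M: "charted M" "Hausdorff_space (mtop M)" and P: "openin (mtop M) P" "meager (mtop M) P"
  shows "P = {}"
proof -
  obtain \<G> where G: "countable \<G>" "\<And>T. T \<in> \<G> \<Longrightarrow> closedin (mtop M) T \<and> mtop M interior_of T = {}" "P \<subseteq> \<Union>\<G>"
    using P(2) unfolding meager_def by blast
  have "mtop M interior_of \<Union>\<G> = {}"
    by (rule Baire_category_alt[OF _ G(1,2)])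
      (use charted_locally_compact[OF M(1)] locally_compact_Hausdorff_imp_regular_space[OF _ M(2)] in auto)
  then show ?thesis using interior_of_maximal[OF G(3) P(1)] by blast
qed

section \<open>Translations in groups that are smooth near the identity\<close>

context
  fixes G :: "'a lie_struct" (structure)
  assumes G: "left_lie_group G"
begin

interpretation group G by (rule left_lie_is_group[OF G])

lemma left_lie_mult_nbhd:
  assumes "openin (mtop (mfd G)) Q" "\<one> \<in> Q"
  obtains P where "openin (mtop (mfd G)) P" "\<one> \<in> P" "\<And>x y. x \<in> P \<Longrightarrow> y \<in> P \<Longrightarrow> x \<otimes> y \<in> Q"
proof -
  have "(\<lambda>(x, y). x \<otimes> y) (\<one>, \<one>) \<in> Q" using assms by simp
  then obtain D where D: "openin (prod_topology (mtop (mfd G)) (mtop (mfd G))) D" "(\<one>, \<one>) \<in> D" "(\<lambda>(x, y). x \<otimes> y) ` D \<subseteq> Q"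
    using smooth_near_open[OF left_lie_mult[OF G] assms(1)] by auto
  obtain P1 P2 where "openin (mtop (mfd G)) P1" "openin (mtop (mfd G)) P2" "\<one> \<in> P1" "\<one> \<in> P2" "P1 \<times> P2 \<subseteq> D"
    by (rule openin_prodE[OF D(1,2)]) (rule that)
  with D(3) show thesis by (intro that[of "P1 \<inter> P2"]) auto
qed

lemma left_lie_inv_nbhd:
  assumes "openin (mtop (mfd G)) Q" "\<one> \<in> Q"
  obtains P where "openin (mtop (mfd G)) P" "\<one> \<in> P" "\<And>x. x \<in> P \<Longrightarrow> inv x \<in> Q"
proof -
  have "inv \<one> \<in> Q" using assms by simp
  then obtain D where "openin (mtop (mfd G)) D" "\<one> \<in> D" "(\<lambda>x. inv x) ` D \<subseteq> Q"
    using smooth_near_open[OF left_lie_inv[OF G] assms(1)] by auto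
  then show thesis by (intro that[of D]) auto
qed

text \<open>Fixing the second argument of the multiplication near \<open>(\<one>, \<one>)\<close>
  gives right translations by small elements on a neighbourhood of the identity. Pettis' argument
  below is arranged to use no others.\<close>

lemma left_lie_right_translation:
  obtains W where "openin (mtop (mfd G)) W" "\<one> \<in> W"
    "\<And>u. u \<in> W \<Longrightarrow> continuous_map (subtopology (mtop (mfd G)) W) (mtop (mfd G)) (\<lambda>x. x \<otimes> u)"
proof -
  let ?T = "mtop (mfd G)"
  obtain D where D: "(\<one>, \<one>) \<in> D" "smooth_map_on (prod_manifold (mfd G) (mfd G)) (mfd G) D (\<lambda>(x, y). x \<otimes> y)"
    using left_lie_mult[OF G] by (rule smooth_nearD)
  note D' = smooth_map_onD(1,2)[OF D(2), simplified]
  obtain P1 P2 where P: "openin ?T P1" "openin ?T P2" "\<one> \<in> P1" "\<one> \<in> P2" "P1 \<times> P2 \<subseteq> D"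
    by (rule openin_prodE[OF D'(1) D(1)]) (rule that)
  show thesis
  proof (rule that[of "P1 \<inter> P2"])
    fix u assume u: "u \<in> P1 \<inter> P2"
    have "continuous_map (subtopology ?T (P1 \<inter> P2)) (prod_topology ?T ?T) (\<lambda>x. (x, u))"
      using u openin_subset[OF P(1)] by (intro continuous_map_pairedI continuous_map_from_subtopology) auto
    then have "continuous_map (subtopology ?T (P1 \<inter> P2)) (subtopology (prod_topology ?T ?T) D) (\<lambda>x. (x, u))"
      using u P(5) by (auto simp: continuous_map_in_subtopology)
    from continuous_map_compose[OF this D'(2)]
    show "continuous_map (subtopology ?T (P1 \<inter> P2)) ?T (\<lambda>x. x \<otimes> u)" by (simp add: o_def)
  qed (use P in auto)
qed

lemma left_translation_continuous:
  assumes "g \<in> carrier G" shows "continuous_map (mtop (mfd G)) (mtop (mfd G)) (\<lambda>x. g \<otimes> x)"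
proof -
  have "smooth_map (mfd G) (mfd G) (\<lambda>x. g \<otimes> x)"
    unfolding smooth_map_on_iff[OF left_lie_charted[OF G] left_lie_charted[OF G]]
    using left_lie_translation[OF G assms] left_lie_topspace[OF G] openin_topspace by metis
  from smooth_map_onD(2)[OF this] show ?thesis by simp
qed

lemma left_translation_open:
  assumes "g \<in> carrier G" "openin (mtop (mfd G)) P"
  shows "openin (mtop (mfd G)) {x \<in> carrier G. g \<otimes> x \<in> P}"
  using left_translation_continuous[OF assms(1)] assms(2) left_lie_topspace[OF G]
  by (simp add: continuous_map_def)

lemma left_translation_meager:
  assumes g: "g \<in> carrier G" and M: "meager (mtop (mfd G)) M"
  shows "meager (mtop (mfd G)) {x \<in> carrier G. g \<otimes> x \<in> M}"
proof (rule meager_preimage[OF _ _ _ M])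
  show "openin (mtop (mfd G)) (carrier G)" using left_lie_topspace[OF G] openin_topspace by metis
  show "continuous_map (subtopology (mtop (mfd G)) (carrier G)) (mtop (mfd G)) (\<lambda>x. g \<otimes> x)"
    using left_translation_continuous[OF g] by (rule continuous_map_from_subtopology)
  fix P assume P: "openin (mtop (mfd G)) P" "P \<subseteq> carrier G"
  have "(\<lambda>x. g \<otimes> x) ` P = {x \<in> carrier G. inv g \<otimes> x \<in> P}"
  proof (rule equalityI; rule subsetI)
    fix x assume "x \<in> (\<lambda>x. g \<otimes> x) ` P"
    then show "x \<in> {x \<in> carrier G. inv g \<otimes> x \<in> P}" using P g by (auto simp: m_assoc[symmetric])
  next
    fix x assume "x \<in> {x \<in> carrier G. inv g \<otimes> x \<in> P}"
    then have "x = g \<otimes> (inv g \<otimes> x)" "inv g \<otimes> x \<in> P" using g by (auto simp: m_assoc[symmetric])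
    then show "x \<in> (\<lambda>x. g \<otimes> x) ` P" by blast
  qed
  then show "openin (mtop (mfd G)) ((\<lambda>x. g \<otimes> x) ` P)" using left_translation_open[of "inv g" P] g P by simp
qed

end

text \<open>
  Pettis' argument: the preimage of a small neighbourhood of the identity is not meager, and a
  non-meager set \<open>B\<close> with the Baire property has \<open>B\<inverse> B\<close> a neighbourhood of the identity.
\<close>

theorem borel_hom_continuous:
  fixes H :: "'h lie_struct" and K :: "'k lie_struct"
  assumes H: "left_lie_group H" and K: "left_lie_group K" and hom: "\<theta> \<in> hom H K"
    and T2: "Hausdorff_space (mtop (mfd H))" and sc: "second_countable (mtop (mfd K))"
    and meas: "\<theta> \<in> measurable (borel_of (mtop (mfd H))) (borel_of (mtop (mfd K)))"
    and Q: "openin (mtop (mfd K)) Q" "\<one>\<^bsub>K\<^esub> \<in> Q"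
  obtains P where "openin (mtop (mfd H)) P" "\<one>\<^bsub>H\<^esub> \<in> P" "\<And>x. x \<in> P \<Longrightarrow> \<theta> x \<in> Q"
proof -
  interpret H: group H by (rule left_lie_is_group[OF H])
  interpret K: group K by (rule left_lie_is_group[OF K])
  interpret \<theta>: group_hom H K \<theta> by unfold_locales (rule hom)
  note tH = left_lie_topspace[OF H] and tK = left_lie_topspace[OF K]
  let ?TH = "mtop (mfd H)" and ?TK = "mtop (mfd K)"
  obtain Q1 where Q1: "openin ?TK Q1" "\<one>\<^bsub>K\<^esub> \<in> Q1" "\<And>x y. x \<in> Q1 \<Longrightarrow> y \<in> Q1 \<Longrightarrow> x \<otimes>\<^bsub>K\<^esub> y \<in> Q"
    using left_lie_mult_nbhd[OF K Q] by blast
  obtain Q2 where Q2: "openin ?TK Q2" "\<one>\<^bsub>K\<^esub> \<in> Q2" "\<And>x. x \<in> Q2 \<Longrightarrow> inv\<^bsub>K\<^esub> x \<in> Q1"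
    using left_lie_inv_nbhd[OF K Q1(1,2)] by blast
  define R where "R = Q1 \<inter> Q2"
  have R: "openin ?TK R" "\<one>\<^bsub>K\<^esub> \<in> R" "\<And>x y. x \<in> R \<Longrightarrow> y \<in> R \<Longrightarrow> inv\<^bsub>K\<^esub> x \<otimes>\<^bsub>K\<^esub> y \<in> Q"
    using Q1 Q2 by (auto simp: R_def)
  define B where "B = \<theta> -` R \<inter> carrier H"
  have BB: "B \<in> sets (borel_of ?TH)" using measurable_sets[OF meas borel_of_open[OF R(1)]] tH by (simp add: B_def)
  \<comment> \<open>By the Lindelof property countably many left translates of \<open>R\<close> by
    values of \<open>\<theta>\<close> cover the image of \<open>\<theta>\<close>, so countably many
    left translates of \<open>B\<close> cover \<open>H\<close>. If \<open>B\<close> were meager, so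
    would be \<open>H\<close>.\<close>
  have nonmeager: "\<not> meager ?TH B"
  proof
    assume mB: "meager ?TH B"
    have "openin ?TK {y \<in> carrier K. inv\<^bsub>K\<^esub> \<theta> h \<otimes>\<^bsub>K\<^esub> y \<in> R}" if "h \<in> carrier H" for h
      by (rule left_translation_open[OF K _ R(1)]) (use that in simp)
    then obtain C where C: "C \<subseteq> carrier H" "countable C"
      "(\<Union>h\<in>carrier H. {y \<in> carrier K. inv\<^bsub>K\<^esub> \<theta> h \<otimes>\<^bsub>K\<^esub> y \<in> R}) = (\<Union>h\<in>C. {y \<in> carrier K. inv\<^bsub>K\<^esub> \<theta> h \<otimes>\<^bsub>K\<^esub> y \<in> R})"
      by (rule second_countable_subcover[OF sc, of "carrier H" "\<lambda>h. {y \<in> carrier K. inv\<^bsub>K\<^esub> \<theta> h \<otimes>\<^bsub>K\<^esub> y \<in> R}"])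
        (assumption | rule that)+
    have "meager ?TH (\<Union>h\<in>C. {x \<in> carrier H. inv\<^bsub>H\<^esub> h \<otimes>\<^bsub>H\<^esub> x \<in> B})"
      using C by (intro meager_Union left_translation_meager[OF H _ mB]) auto
    moreover have "carrier H \<subseteq> (\<Union>h\<in>C. {x \<in> carrier H. inv\<^bsub>H\<^esub> h \<otimes>\<^bsub>H\<^esub> x \<in> B})"
    proof
      fix x assume x: "x \<in> carrier H"
      then have "\<theta> x \<in> (\<Union>h\<in>carrier H. {y \<in> carrier K. inv\<^bsub>K\<^esub> \<theta> h \<otimes>\<^bsub>K\<^esub> y \<in> R})" using R(2) by force
      then obtain h where h: "h \<in> C" "inv\<^bsub>K\<^esub> \<theta> h \<otimes>\<^bsub>K\<^esub> \<theta> x \<in> R" unfolding C(3) by blast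
      then have "inv\<^bsub>H\<^esub> h \<otimes>\<^bsub>H\<^esub> x \<in> B" using C(1) x by (auto simp: B_def)
      then show "x \<in> (\<Union>h\<in>C. {x \<in> carrier H. inv\<^bsub>H\<^esub> h \<otimes>\<^bsub>H\<^esub> x \<in> B})" using h x by blast
    qed
    ultimately have "meager ?TH (carrier H)" by (rule meager_subset)
    then have "carrier H = {}"
      using manifold_Baire[OF left_lie_charted[OF H] T2] openin_topspace[of ?TH] tH by simp
    then show False using H.one_closed by blast
  qed
  obtain Om where Om: "openin ?TH Om" "meager ?TH ((B - Om) \<union> (Om - B))"
    using borel_baire_property[OF BB] unfolding baire_property_def by blast
  have "Om \<noteq> {}"
  proof
    assume "Om = {}"
    then have "meager ?TH B" using meager_subset[OF Om(2), of B] by blast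
    then show False using nonmeager by simp
  qed
  then obtain h where h: "h \<in> Om" by blast
  have hH: "h \<in> carrier H" using h openin_subset[OF Om(1)] tH by auto
  \<comment> \<open>Pulling \<open>Om\<close> back along left translation by \<open>h\<close> gives
    a neighbourhood of the identity, where right translations by small elements are
    available.\<close>
  define O1 where "O1 = {x \<in> carrier H. h \<otimes>\<^bsub>H\<^esub> x \<in> Om}"
  define M1 where "M1 = {x \<in> carrier H. h \<otimes>\<^bsub>H\<^esub> x \<in> Om - B}"
  have O1: "openin ?TH O1" "\<one>\<^bsub>H\<^esub> \<in> O1"
    using left_translation_open[OF H hH Om(1)] h hH by (auto simp: O1_def)
  have M1: "meager ?TH M1"
    unfolding M1_def by (rule left_translation_meager[OF H hH]) (rule meager_subset[OF Om(2)], blast)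
  obtain W where W: "openin ?TH W" "\<one>\<^bsub>H\<^esub> \<in> W"
    "\<And>u. u \<in> W \<Longrightarrow> continuous_map (subtopology ?TH W) ?TH (\<lambda>x. x \<otimes>\<^bsub>H\<^esub> u)"
    using left_lie_right_translation[OF H] by blast
  obtain P1 where P1: "openin ?TH P1" "\<one>\<^bsub>H\<^esub> \<in> P1" "\<And>x y. x \<in> P1 \<Longrightarrow> y \<in> P1 \<Longrightarrow> x \<otimes>\<^bsub>H\<^esub> y \<in> O1 \<inter> W"
    using left_lie_mult_nbhd[OF H, of "O1 \<inter> W"] O1 W by auto
  obtain P2 where P2: "openin ?TH P2" "\<one>\<^bsub>H\<^esub> \<in> P2" "\<And>x. x \<in> P2 \<Longrightarrow> inv\<^bsub>H\<^esub> x \<in> W"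
    using left_lie_inv_nbhd[OF H W(1,2)] by blast
  define D where "D = P1 \<inter> W \<inter> O1"
  have D: "openin ?TH D" "\<one>\<^bsub>H\<^esub> \<in> D" using P1 W O1 by (auto simp: D_def)
  have DH: "x \<in> carrier H" if "x \<in> D" for x using openin_subset[OF D(1)] tH that by auto
  show thesis
  proof (rule that[of "P1 \<inter> P2 \<inter> W"])
    fix u assume u: "u \<in> P1 \<inter> P2 \<inter> W"
    have uH: "u \<in> carrier H" using u openin_subset[OF P1(1)] tH by auto
    have "meager ?TH {s \<in> D. s \<otimes>\<^bsub>H\<^esub> u \<in> M1}"
    proof (rule meager_preimage[OF D(1) _ _ M1])
      show "continuous_map (subtopology ?TH D) ?TH (\<lambda>x. x \<otimes>\<^bsub>H\<^esub> u)"
        by (rule continuous_map_from_subtopology_mono[OF W(3)]) (use u in \<open>auto simp: D_def\<close>)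
      fix P assume P: "openin ?TH P" "P \<subseteq> D"
      \<comment> \<open>The right translate of an open set is the preimage under right translation
        by the inverse of \<open>u\<close>, which is continuous on \<open>W\<close> because
        \<open>u\<close> lies in \<open>P2\<close>.\<close>
      have "(\<lambda>x. x \<otimes>\<^bsub>H\<^esub> u) ` P = {x \<in> W. x \<otimes>\<^bsub>H\<^esub> inv\<^bsub>H\<^esub> u \<in> P}"
      proof (rule equalityI; rule subsetI)
        fix x assume "x \<in> (\<lambda>x. x \<otimes>\<^bsub>H\<^esub> u) ` P"
        then obtain y where y: "y \<in> P" "x = y \<otimes>\<^bsub>H\<^esub> u" by blast
        then have "y \<in> carrier H" "y \<in> P1" using P DH by (auto simp: D_def)
        then show "x \<in> {x \<in> W. x \<otimes>\<^bsub>H\<^esub> inv\<^bsub>H\<^esub> u \<in> P}" using y P1(3)[of y u] u uH by (auto simp: H.m_assoc)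
      next
        fix x assume x: "x \<in> {x \<in> W. x \<otimes>\<^bsub>H\<^esub> inv\<^bsub>H\<^esub> u \<in> P}"
        then have "x \<in> carrier H" using openin_subset[OF W(1)] tH by auto
        then have "x = (x \<otimes>\<^bsub>H\<^esub> inv\<^bsub>H\<^esub> u) \<otimes>\<^bsub>H\<^esub> u" using uH by (simp add: H.m_assoc)
        then show "x \<in> (\<lambda>x. x \<otimes>\<^bsub>H\<^esub> u) ` P" using x by blast
      qed
      moreover have "openin ?TH {x \<in> W. x \<otimes>\<^bsub>H\<^esub> inv\<^bsub>H\<^esub> u \<in> P}"
        by (rule openin_preimage_on[OF W(1) W(3) P(1)]) (use P2(3) u in blast)
      ultimately show "openin ?TH ((\<lambda>x. x \<otimes>\<^bsub>H\<^esub> u) ` P)" by simp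
    qed
    then have m: "meager ?TH (M1 \<union> {s \<in> D. s \<otimes>\<^bsub>H\<^esub> u \<in> M1})" by (rule meager_Un[OF M1])
    \<comment> \<open>\<open>D\<close> is open and nonempty, hence not meager. So some
      \<open>s\<close> in \<open>D\<close> avoids \<open>M1\<close> together with its right
      translate by \<open>u\<close>; this puts the left translates of both by \<open>h\<close> into
      \<open>B\<close>, and \<open>\<theta> u\<close> is the quotient of their images.\<close>
    have "\<not> D \<subseteq> M1 \<union> {s \<in> D. s \<otimes>\<^bsub>H\<^esub> u \<in> M1}"
      using manifold_Baire[OF left_lie_charted[OF H] T2 D(1)] meager_subset[OF m] D(2) by blast
    then obtain s where s: "s \<in> D" "s \<notin> M1" "s \<otimes>\<^bsub>H\<^esub> u \<notin> M1" by blast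
    have sH: "s \<in> carrier H" by (rule DH[OF s(1)])
    have "s \<in> O1" "s \<otimes>\<^bsub>H\<^esub> u \<in> O1" using s(1) P1(3)[of s u] u by (auto simp: D_def)
    then have "h \<otimes>\<^bsub>H\<^esub> s \<in> B" "h \<otimes>\<^bsub>H\<^esub> (s \<otimes>\<^bsub>H\<^esub> u) \<in> B" using s by (auto simp: O1_def M1_def)
    then have q: "inv\<^bsub>K\<^esub> (\<theta> (h \<otimes>\<^bsub>H\<^esub> s)) \<otimes>\<^bsub>K\<^esub> \<theta> (h \<otimes>\<^bsub>H\<^esub> (s \<otimes>\<^bsub>H\<^esub> u)) \<in> Q" using R(3) by (auto simp: B_def)
    have "\<theta> (h \<otimes>\<^bsub>H\<^esub> (s \<otimes>\<^bsub>H\<^esub> u)) = \<theta> (h \<otimes>\<^bsub>H\<^esub> s) \<otimes>\<^bsub>K\<^esub> \<theta> u"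
      using hH sH uH by (simp add: K.m_assoc)
    then show "\<theta> u \<in> Q" using q hH sH uH by (simp add: K.m_assoc[symmetric] del: \<theta>.hom_mult)
  qed (use P1 P2 W in auto)
qed

section \<open>Lie groups and smooth modules\<close>

lemma smooth_map_continuous: "smooth_map M N f \<Longrightarrow> continuous_map (mtop M) (mtop N) f"
  using smooth_map_onD(2)[of M N "topspace (mtop M)" f] by (simp only: subtopology_topspace)

lemmas smooth_map_measurable = continuous_map_borel_of[OF smooth_map_continuous]

lemma lie_groupD:
  assumes "lie_group G"
  shows "group G" "charted (mfd G)" "topspace (mtop (mfd G)) = carrier G"
    "Hausdorff_space (mtop (mfd G))" "second_countable (mtop (mfd G))"
    "x \<in> carrier G \<Longrightarrow> y \<in> carrier G \<Longrightarrow> smooth_near (prod_manifold (mfd G) (mfd G)) (mfd G) (x, y) (\<lambda>(x, y). x \<otimes>\<^bsub>G\<^esub> y)"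
    "x \<in> carrier G \<Longrightarrow> smooth_near (mfd G) (mfd G) x (\<lambda>x. inv\<^bsub>G\<^esub> x)"
proof -
  show *: "group G" "charted (mfd G)" "topspace (mtop (mfd G)) = carrier G"
    "Hausdorff_space (mtop (mfd G))" "second_countable (mtop (mfd G))"
    using assms by (auto simp: lie_group_def smooth_manifold_charted)
  have "smooth_map (prod_manifold (mfd G) (mfd G)) (mfd G) (\<lambda>(x, y). x \<otimes>\<^bsub>G\<^esub> y)" "smooth_map (mfd G) (mfd G) (\<lambda>x. inv\<^bsub>G\<^esub> x)"
    using assms by (auto simp: lie_group_def)
  then show "x \<in> carrier G \<Longrightarrow> y \<in> carrier G \<Longrightarrow> smooth_near (prod_manifold (mfd G) (mfd G)) (mfd G) (x, y) (\<lambda>(x, y). x \<otimes>\<^bsub>G\<^esub> y)"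
    "x \<in> carrier G \<Longrightarrow> smooth_near (mfd G) (mfd G) x (\<lambda>x. inv\<^bsub>G\<^esub> x)"
    using * by (auto simp: smooth_map_on_iff charted_prod)
qed

lemma smooth_near_mult:
  assumes G: "lie_group G" and M: "charted M" and f: "smooth_near M (mfd G) p f" and g: "smooth_near M (mfd G) p g"
  shows "smooth_near M (mfd G) p (\<lambda>x. f x \<otimes>\<^bsub>G\<^esub> g x)"
proof -
  note * = lie_groupD[OF G]
  have "smooth_near (prod_manifold (mfd G) (mfd G)) (mfd G) (f p, g p) (\<lambda>(x, y). x \<otimes>\<^bsub>G\<^esub> y)"
    using *(6) smooth_near_into(2)[OF f] smooth_near_into(2)[OF g] *(3) by simp
  from smooth_near_comp[OF M charted_prod[OF *(2,2)] *(2) smooth_near_pair[OF M *(2,2) f g] this] show ?thesis by simp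
qed

lemma smooth_near_inv:
  assumes G: "lie_group G" and M: "charted M" and f: "smooth_near M (mfd G) p f"
  shows "smooth_near M (mfd G) p (\<lambda>x. inv\<^bsub>G\<^esub> (f x))"
  using smooth_near_comp[OF M lie_groupD(2,2)[OF G] f] lie_groupD(3,7)[OF G] smooth_near_into(2)[OF f] by simp

lemma lie_group_left_lie:
  assumes G: "lie_group G" shows "left_lie_group G"
proof -
  note * = lie_groupD[OF G]
  interpret group G by (rule *(1))
  have "smooth_near (mfd G) (mfd G) x (\<lambda>y. g \<otimes>\<^bsub>G\<^esub> y)" if "g \<in> carrier G" "x \<in> carrier G" for g x
    by (intro smooth_near_mult[OF G *(2)] smooth_near_const smooth_near_id *) (use that *(3) in auto)
  then show ?thesis unfolding left_lie_group_def using * by auto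
qed

text \<open>Left translations by the inverse of \<open>p\<close> in \<open>H\<close> and by
  \<open>\<theta> p\<close> in \<open>K\<close> carry smoothness at the identity to
  \<open>p\<close>.\<close>

lemma smooth_map_hom:
  fixes H :: "'h lie_struct" and K :: "'k lie_struct"
  assumes H: "left_lie_group H" and K: "left_lie_group K" and hom: "\<theta> \<in> hom H K"
    and sm: "smooth_near (mfd H) (mfd K) \<one>\<^bsub>H\<^esub> \<theta>"
  shows "smooth_map (mfd H) (mfd K) \<theta>"
proof -
  interpret H: group H by (rule left_lie_is_group[OF H])
  note cH = left_lie_charted[OF H] and cK = left_lie_charted[OF K]
  note tH = left_lie_topspace[OF H]
  have "smooth_near (mfd H) (mfd K) p \<theta>" if p: "p \<in> carrier H" for p
  proof -
    have tp: "\<theta> p \<in> carrier K" using hom p by (auto simp: hom_def)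
    have 1: "smooth_near (mfd H) (mfd H) p (\<lambda>x. inv\<^bsub>H\<^esub> p \<otimes>\<^bsub>H\<^esub> x)"
      using left_lie_translation[OF H] p by simp
    have 2: "smooth_near (mfd H) (mfd K) (inv\<^bsub>H\<^esub> p \<otimes>\<^bsub>H\<^esub> p) \<theta>" using sm p by simp
    have "smooth_near (mfd H) (mfd K) p (\<lambda>x. \<theta> p \<otimes>\<^bsub>K\<^esub> \<theta> (inv\<^bsub>H\<^esub> p \<otimes>\<^bsub>H\<^esub> x))"
      by (rule smooth_near_left_mult[OF K cH smooth_near_comp[OF cH cH cK 1 2] tp])
    then show ?thesis
    proof (rule smooth_near_cong[OF cH cK _ openin_topspace])
      fix x assume "x \<in> topspace (mtop (mfd H))"
      then have x: "x \<in> carrier H" using tH by simp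
      then have "\<theta> p \<otimes>\<^bsub>K\<^esub> \<theta> (inv\<^bsub>H\<^esub> p \<otimes>\<^bsub>H\<^esub> x) = \<theta> (p \<otimes>\<^bsub>H\<^esub> (inv\<^bsub>H\<^esub> p \<otimes>\<^bsub>H\<^esub> x))"
        using hom p by (simp add: hom_def)
      then show "\<theta> p \<otimes>\<^bsub>K\<^esub> \<theta> (inv\<^bsub>H\<^esub> p \<otimes>\<^bsub>H\<^esub> x) = \<theta> x" using p x by (simp add: H.m_assoc[symmetric])
    qed (use p tH in simp)
  qed
  then show ?thesis using tH smooth_map_on_iff[OF cH cK] openin_topspace by metis
qed

text \<open>With \<open>u = inv g \<otimes> x\<close> and \<open>v = inv h \<otimes> y\<close> one
  has \<open>x \<otimes> y = (g \<otimes> h) \<otimes> ((inv h \<otimes> u \<otimes> h) \<otimes>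
  v)\<close>. So away from the identity multiplication is made of left translations, the
  multiplication near the identity and one conjugation at the identity. Inversion is treated
  likewise.\<close>

lemma lie_groupI:
  fixes G :: "'a lie_struct" (structure)
  assumes G: "left_lie_group G" and T: "Hausdorff_space (mtop (mfd G))" "second_countable (mtop (mfd G))"
    and conj: "\<And>g. g \<in> carrier G \<Longrightarrow> smooth_near (mfd G) (mfd G) \<one> (\<lambda>x. inv g \<otimes> x \<otimes> g)"
  shows "lie_group G"
proof -
  interpret group G by (rule left_lie_is_group[OF G])
  let ?M = "mfd G" let ?P = "prod_manifold ?M ?M"
  note c = left_lie_charted[OF G] and t = left_lie_topspace[OF G]
  have cP: "charted ?P" by (rule charted_prod[OF c c])
  have conj': "smooth_near M ?M p (\<lambda>x. inv g \<otimes> f x \<otimes> g)"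
    if "charted M" "smooth_near M ?M p f" "f p = \<one>" "g \<in> carrier G" for M :: "'b manifold" and p f g
    using smooth_near_comp[OF that(1) c c that(2)] conj[OF that(4)] that(3) by simp
  have mult: "smooth_near ?P ?M (g, h) (\<lambda>(x, y). x \<otimes> y)" if gh: "g \<in> carrier G" "h \<in> carrier G" for g h
  proof -
    have p: "(g, h) \<in> topspace (prod_topology (mtop ?M) (mtop ?M))" using gh t by simp
    let ?u = "\<lambda>z. inv g \<otimes> fst z" and ?v = "\<lambda>z. inv h \<otimes> snd z"
    have u: "smooth_near ?P ?M (g, h) ?u" "smooth_near ?P ?M (g, h) ?v"
      by (rule smooth_near_left_mult[OF G cP smooth_near_fst[OF c c p]] smooth_near_left_mult[OF G cP smooth_near_snd[OF c c p]];
          use gh in simp)+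
    have c1: "smooth_near ?P ?M (g, h) (\<lambda>z. inv h \<otimes> ?u z \<otimes> h)" by (rule conj'[OF cP u(1)]) (use gh in auto)
    have "smooth_near ?P ?M (g, h) (\<lambda>z. (g \<otimes> h) \<otimes> ((inv h \<otimes> ?u z \<otimes> h) \<otimes> ?v z))"
      by (rule smooth_near_left_mult[OF G cP smooth_near_mult_one[OF G cP c1 u(2)]]) (use gh in \<open>auto simp: m_assoc\<close>)
    then show ?thesis
    proof (rule smooth_near_cong[OF cP c _ openin_topspace])
      fix z assume "z \<in> topspace (mtop ?P)"
      then obtain x y where "z = (x, y)" "x \<in> carrier G" "y \<in> carrier G" using t by (cases z) auto
      moreover have "g \<otimes> h \<otimes> (inv h \<otimes> (inv g \<otimes> x) \<otimes> h \<otimes> (inv h \<otimes> y)) = x \<otimes> y" if "x \<in> carrier G" "y \<in> carrier G" for x y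
        using that gh by (simp add: m_assoc inv_solve_left) (simp add: m_assoc[symmetric])
      ultimately show "g \<otimes> h \<otimes> (inv h \<otimes> ?u z \<otimes> h \<otimes> ?v z) = (\<lambda>(x, y). x \<otimes> y) z" by simp
    qed (use p in simp)
  qed
  have inv: "smooth_near ?M ?M g (\<lambda>x. inv x)" if g: "g \<in> carrier G" for g
  proof -
    let ?u = "\<lambda>x. inv g \<otimes> x"
    have u: "smooth_near ?M ?M g ?u" using left_lie_translation[OF G] g by simp
    have "smooth_near ?M ?M g (\<lambda>x. inv (?u x))" by (rule smooth_near_inv_one[OF G c u]) (use g in simp)
    then have "smooth_near ?M ?M g (\<lambda>x. inv (inv g) \<otimes> inv (?u x) \<otimes> inv g)" by (rule conj'[OF c]) (use g in auto)
    then have "smooth_near ?M ?M g (\<lambda>x. inv g \<otimes> (inv (inv g) \<otimes> inv (?u x) \<otimes> inv g))"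
      by (rule smooth_near_left_mult[OF G c]) (use g in simp)
    then show ?thesis
    proof (rule smooth_near_cong[OF c c _ openin_topspace])
      fix x assume "x \<in> topspace (mtop ?M)"
      then have "x \<in> carrier G" using t by simp
      then show "inv g \<otimes> (inv (inv g) \<otimes> inv (?u x) \<otimes> inv g) = inv x"
        using g by (simp add: inv_mult_group m_assoc) (simp add: m_assoc[symmetric])
    qed (use g t in simp)
  qed
  have "smooth_map ?P ?M (\<lambda>(x, y). x \<otimes> y)" "smooth_map ?M ?M (\<lambda>x. inv x)"
    unfolding smooth_map_on_iff[OF cP c] smooth_map_on_iff[OF c c]
    using mult inv t openin_topspace[of "mtop ?P"] openin_topspace[of "mtop ?M"] by auto
  then show ?thesis unfolding lie_group_def smooth_manifold_charted using group_axioms T c t by simp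
qed

lemma lie_mult_measurable:
  assumes G: "lie_group G" and "f \<in> measurable M (borel_of (mtop (mfd G)))" "g \<in> measurable M (borel_of (mtop (mfd G)))"
  shows "(\<lambda>x. f x \<otimes>\<^bsub>G\<^esub> g x) \<in> measurable M (borel_of (mtop (mfd G)))"
proof -
  note * = lie_groupD[OF G]
  have "smooth_map (prod_manifold (mfd G) (mfd G)) (mfd G) (\<lambda>(x, y). x \<otimes>\<^bsub>G\<^esub> y)" using G unfolding lie_group_def by blast
  from smooth_map_measurable[OF this]
  have "(\<lambda>(x, y). x \<otimes>\<^bsub>G\<^esub> y) \<in> measurable (borel_of (prod_topology (mtop (mfd G)) (mtop (mfd G)))) (borel_of (mtop (mfd G)))" by simp
  from measurable_compose[OF measurable_borel_of_Pair[OF *(5,5) assms(2,3)] this] show ?thesis by simp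
qed

lemma lie_inv_measurable:
  assumes G: "lie_group G" and "f \<in> measurable M (borel_of (mtop (mfd G)))"
  shows "(\<lambda>x. inv\<^bsub>G\<^esub> (f x)) \<in> measurable M (borel_of (mtop (mfd G)))"
proof -
  have "smooth_map (mfd G) (mfd G) (\<lambda>x. inv\<^bsub>G\<^esub> x)" using G unfolding lie_group_def by blast
  from measurable_compose[OF assms(2) smooth_map_measurable[OF this]] show ?thesis .
qed

section \<open>Smooth modules\<close>

locale lie_module =
  fixes G :: "'g lie_struct" and A :: "'a lie_struct" and act :: "'g \<Rightarrow> 'a \<Rightarrow> 'a"
  assumes G: "lie_group G" and module: "smooth_module G A act"
begin

abbreviation g_mult (infixl "\<star>" 70) where "x \<star> y \<equiv> x \<otimes>\<^bsub>G\<^esub> y"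
abbreviation a_mult (infixl "\<boxplus>" 70) where "x \<boxplus> y \<equiv> x \<otimes>\<^bsub>A\<^esub> y"
abbreviation "eG \<equiv> \<one>\<^bsub>G\<^esub>"
abbreviation "eA \<equiv> \<one>\<^bsub>A\<^esub>"
abbreviation "iG x \<equiv> inv\<^bsub>G\<^esub> x"
abbreviation "iA x \<equiv> inv\<^bsub>A\<^esub> x"
abbreviation "cG \<equiv> carrier G"
abbreviation "cA \<equiv> carrier A"
abbreviation "MG \<equiv> mfd G"
abbreviation "MA \<equiv> mfd A"
abbreviation "BG \<equiv> borel_of (mtop MG)"
abbreviation "BA \<equiv> borel_of (mtop MA)"
abbreviation "BGG \<equiv> borel_of (prod_topology (mtop MG) (mtop MG))"

lemma A: "lie_group A" using module by (simp add: smooth_module_def)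

sublocale G: group G by (rule lie_groupD(1)[OF G])
sublocale A: comm_group A using module by (simp add: smooth_module_def)

lemmas cMG = lie_groupD(2)[OF G] and cMA = lie_groupD(2)[OF A]
lemmas tG = lie_groupD(3)[OF G] and tA = lie_groupD(3)[OF A]
lemmas scG = lie_groupD(5)[OF G] and scA = lie_groupD(5)[OF A]
lemmas cGG = charted_prod[OF cMG cMG]

lemma act_auto: "s \<in> cG \<Longrightarrow> act s \<in> hom A A \<inter> Bij cA"
  using module by (auto simp: smooth_module_def hom_def AutoGroup_def auto_def)

lemma act_closed [simp]: "s \<in> cG \<Longrightarrow> a \<in> cA \<Longrightarrow> act s a \<in> cA"
  using act_auto[of s] by (auto simp: hom_def)

lemma act_mult [simp]: "s \<in> cG \<Longrightarrow> a \<in> cA \<Longrightarrow> b \<in> cA \<Longrightarrow> act s (a \<boxplus> b) = act s a \<boxplus> act s b"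
  using act_auto[of s] by (auto simp: hom_def)

lemma act_one [simp]: "s \<in> cG \<Longrightarrow> act s eA = eA"
  using act_auto[of s] A.group_axioms by (intro hom_one[of _ A A]) auto

lemma act_inv [simp]: "s \<in> cG \<Longrightarrow> a \<in> cA \<Longrightarrow> act s (iA a) = iA (act s a)"
  by (metis A.inv_closed A.inv_equality A.l_inv act_closed act_mult act_one)

lemma act_comp: "s \<in> cG \<Longrightarrow> t \<in> cG \<Longrightarrow> a \<in> cA \<Longrightarrow> act (s \<star> t) a = act s (act t a)"
proof -
  assume st: "s \<in> cG" "t \<in> cG" "a \<in> cA"
  have "act (s \<star> t) = act s \<otimes>\<^bsub>AutoGroup A\<^esub> act t" using module st by (simp add: smooth_module_def hom_def)
  then have "act (s \<star> t) = compose cA (act s) (act t)"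
    using act_auto[OF st(1)] act_auto[OF st(2)] by (simp add: AutoGroup_def BijGroup_def)
  then show ?thesis using st by (simp add: compose_def)
qed

lemma act_eG [simp]: "a \<in> cA \<Longrightarrow> act eG a = a"
proof -
  assume a: "a \<in> cA"
  have "act eG (act eG a) = act eG a" using act_comp[of eG eG a] a by simp
  moreover have "inj_on (act eG) cA" using act_auto[of eG] by (simp add: Bij_def bij_betw_def)
  ultimately show "act eG a = a" using a by (metis G.one_closed act_closed inj_onD)
qed

lemma smooth_near_act:
  assumes M: "charted M" and f: "smooth_near M MG p f" and g: "smooth_near M MA p g"
  shows "smooth_near M MA p (\<lambda>x. act (f x) (g x))"
proof -
  have "smooth_map (prod_manifold MG MA) MA (\<lambda>(g, a). act g a)" using module by (simp add: smooth_module_def)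
  then have "smooth_near (prod_manifold MG MA) MA (f p, g p) (\<lambda>(g, a). act g a)"
    using smooth_near_into(2)[OF f] smooth_near_into(2)[OF g] by (simp add: smooth_map_on_iff charted_prod cMG cMA)
  from smooth_near_comp[OF M charted_prod[OF cMG cMA] cMA smooth_near_pair[OF M cMG cMA f g] this] show ?thesis by simp
qed

lemma act_measurable:
  assumes "f \<in> measurable M BG" "g \<in> measurable M BA"
  shows "(\<lambda>x. act (f x) (g x)) \<in> measurable M BA"
proof -
  have "smooth_map (prod_manifold MG MA) MA (\<lambda>(g, a). act g a)" using module by (simp add: smooth_module_def)
  from smooth_map_measurable[OF this]
  have "(\<lambda>(g, a). act g a) \<in> measurable (borel_of (prod_topology (mtop MG) (mtop MA))) BA" by simp
  from measurable_compose[OF measurable_borel_of_Pair[OF scG scA assms] this] show ?thesis by simp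
qed

end

section \<open>Two-cocycles\<close>

context lie_module
begin

text \<open>Curried forms of the cochains of degree 1 and 2 are easier to compute with;
  \<open>fam2\<close> and \<open>pair2\<close> pass between them and the families indexed by
  \<open>{1..2}\<close>.\<close>

definition lsm1 :: "('g \<Rightarrow> 'a) \<Rightarrow> bool" where
  "lsm1 c \<longleftrightarrow> c \<in> cG \<rightarrow> cA \<and> c \<in> measurable BG BA \<and> smooth_near MG MA eG c"

definition lsm2 :: "('g \<Rightarrow> 'g \<Rightarrow> 'a) \<Rightarrow> bool" where
  "lsm2 f \<longleftrightarrow> (\<forall>s\<in>cG. \<forall>t\<in>cG. f s t \<in> cA) \<and> (\<lambda>(s, t). f s t) \<in> measurable BGG BA \<and>
     smooth_near (prod_manifold MG MG) MA (eG, eG) (\<lambda>(s, t). f s t)"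

definition fam2 :: "('g \<Rightarrow> 'g \<Rightarrow> 'a) \<Rightarrow> (nat \<Rightarrow> 'g) \<Rightarrow> 'a" where
  "fam2 f = (\<lambda>s\<in>power_carrier G 2. f (s 1) (s 2))"

definition pair2 :: "'g \<Rightarrow> 'g \<Rightarrow> nat \<Rightarrow> 'g" where
  "pair2 s t = (\<lambda>i\<in>{1..2}. if i = 1 then s else t)"

definition cob :: "('g \<Rightarrow> 'a) \<Rightarrow> 'g \<Rightarrow> 'g \<Rightarrow> 'a" where
  "cob c s t = act s (c t) \<boxplus> iA (c (s \<star> t)) \<boxplus> c s"

text \<open>The vanishing of \<open>coboundary\<close> in degree 2, with the negative terms moved to
  the right so that no inverses appear.\<close>

definition cocycle :: "('g \<Rightarrow> 'g \<Rightarrow> 'a) \<Rightarrow> bool" where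
  "cocycle f \<longleftrightarrow> lsm2 f \<and> (\<forall>s\<in>cG. \<forall>t\<in>cG. \<forall>r\<in>cG. act s (f t r) \<boxplus> f s (t \<star> r) = f (s \<star> t) r \<boxplus> f s t)"

lemma pair2_simps [simp]: "pair2 s t 1 = s" "pair2 s t (Suc 0) = s" "pair2 s t 2 = t"
  by (auto simp: pair2_def)

lemma pair2_carrier: "s \<in> cG \<Longrightarrow> t \<in> cG \<Longrightarrow> pair2 s t \<in> power_carrier G 2"
  by (auto simp: pair2_def)

lemma pair2_eta:
  assumes "s \<in> power_carrier G 2" shows "pair2 (s 1) (s 2) = s"
proof (rule extensionalityI[of _ "{1..2}"])
  fix i :: nat assume "i \<in> {1..2}"
  then have "i = 1 \<or> i = 2" by auto
  then show "pair2 (s 1) (s 2) i = s i" by auto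
qed (use assms in \<open>auto simp: pair2_def PiE_iff\<close>)

lemma fam2_pair2 [simp]: "s \<in> cG \<Longrightarrow> t \<in> cG \<Longrightarrow> fam2 f (pair2 s t) = f s t"
  using pair2_carrier by (simp add: fam2_def)

lemma fam2_cong: "(\<And>s t. s \<in> cG \<Longrightarrow> t \<in> cG \<Longrightarrow> f s t = f' s t) \<Longrightarrow> fam2 f = fam2 f'"
  unfolding fam2_def by (rule restrict_ext) (auto simp: PiE_iff)

lemma fam2_eqD: "fam2 f = fam2 f' \<Longrightarrow> s \<in> cG \<Longrightarrow> t \<in> cG \<Longrightarrow> f s t = f' s t"
  using fam2_pair2 by metis

lemma top_power: "topspace (mtop (power_manifold MG n)) = power_carrier G n"
  by (simp add: tG)

lemma one_power: "(\<lambda>i\<in>{1..n}. eG) \<in> power_carrier G n"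
  by auto

section \<open>Cochains as families and as curried functions\<close>

lemma lsm_cochain1D:
  assumes "c \<in> carrier (lsm_cochains G A 1)"
  shows "lsm1 (\<lambda>s. c (\<lambda>i\<in>{1..1}. s))"
  unfolding lsm1_def
proof (intro conjI)
  let ?f = "\<lambda>s. \<lambda>i\<in>{1..1::nat}. s" let ?P = "power_manifold MG 1"
  have c: "c \<in> power_carrier G 1 \<rightarrow> cA" "c \<in> measurable (borel_of (mtop ?P)) BA" "smooth_near ?P MA (\<lambda>i\<in>{1..1}. eG) c"
    using assms by (auto simp: lsm_cochains_def)
  show "(\<lambda>s. c (?f s)) \<in> cG \<rightarrow> cA" by (intro funcsetI funcset_mem[OF c(1)]) auto
  have "continuous_map (mtop MG) (mtop ?P) ?f"
    by (auto simp: continuous_map_componentwise)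
  from measurable_compose[OF continuous_map_borel_of[OF this] c(2)] show "(\<lambda>s. c (?f s)) \<in> measurable BG BA" .
  have "smooth_near MG ?P eG ?f"
    by (rule smooth_near_tuple[OF cMG cMG]) (use tG smooth_near_id[OF cMG, of eG] in auto)
  from smooth_near_comp[OF cMG charted_power[OF cMG] cMA this c(3)] show "smooth_near MG MA eG (\<lambda>s. c (?f s))" .
qed

lemma lsm_cochain1I:
  assumes c: "lsm1 c"
  shows "(\<lambda>s\<in>power_carrier G 1. c (s 1)) \<in> carrier (lsm_cochains G A 1)"
proof -
  let ?P = "power_manifold MG 1" let ?F = "\<lambda>s\<in>power_carrier G 1. c (s 1)"
  have o: "(\<lambda>i\<in>{1..1}. eG) \<in> topspace (mtop ?P)" unfolding top_power by (rule one_power)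
  have "continuous_map (mtop ?P) (mtop MG) (\<lambda>s. s 1)" by (auto intro: continuous_map_product_projection)
  then have "(\<lambda>s. c (s 1)) \<in> measurable (borel_of (mtop ?P)) BA"
    by (rule measurable_compose[OF continuous_map_borel_of]) (use c in \<open>simp add: lsm1_def\<close>)
  then have m: "?F \<in> measurable (borel_of (mtop ?P)) BA"
    by (rule measurable_cong[THEN iffD1, rotated]) (use top_power[of 1] in simp)
  have "smooth_near ?P MA (\<lambda>i\<in>{1..1}. eG) (\<lambda>s. c (s 1))"
    by (rule smooth_near_comp[OF charted_power[OF cMG] cMG cMA smooth_near_eval[OF cMG o]]) (use c in \<open>auto simp: lsm1_def\<close>)
  then have "smooth_near ?P MA (\<lambda>i\<in>{1..1}. eG) ?F"
    by (rule smooth_near_cong[OF charted_power[OF cMG] cMA _ openin_topspace o]) (use top_power[of 1] in simp)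
  then show ?thesis using m c by (auto simp: lsm_cochains_def lsm1_def PiE_iff)
qed

lemma pair2_smooth:
  assumes "charted M" "smooth_near M MG p f" "smooth_near M MG p g"
  shows "smooth_near M (power_manifold MG 2) p (\<lambda>x. pair2 (f x) (g x))"
proof (rule smooth_near_tuple[OF assms(1) cMG smooth_near_into(1)[OF assms(2)]])
  fix i :: nat assume "i \<in> {1..2}"
  then have "i = 1 \<or> i = 2" by auto
  then show "smooth_near M MG p (\<lambda>x. pair2 (f x) (g x) i)" using assms by auto
qed (auto simp: pair2_def)

lemma smooth_near_GG:
  "x \<in> cG \<Longrightarrow> y \<in> cG \<Longrightarrow> smooth_near (prod_manifold MG MG) MG (x, y) fst"
  "x \<in> cG \<Longrightarrow> y \<in> cG \<Longrightarrow> smooth_near (prod_manifold MG MG) MG (x, y) snd"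
  using smooth_near_fst[OF cMG cMG, of "(x, y)"] smooth_near_snd[OF cMG cMG, of "(x, y)"] tG by auto

lemma lsm_cochain2D:
  assumes F: "F \<in> carrier (lsm_cochains G A 2)"
  shows "lsm2 (\<lambda>s t. F (pair2 s t))" "fam2 (\<lambda>s t. F (pair2 s t)) = F"
proof -
  let ?P = "power_manifold MG 2" let ?f = "\<lambda>(s, t). pair2 s t"
  have c: "F \<in> power_carrier G 2 \<rightarrow>\<^sub>E cA" "F \<in> measurable (borel_of (mtop ?P)) BA" "smooth_near ?P MA (\<lambda>i\<in>{1..2}. eG) F"
    using F by (auto simp: lsm_cochains_def)
  have cont: "continuous_map (prod_topology (mtop MG) (mtop MG)) (mtop ?P) ?f"
    unfolding power_manifold_simps continuous_map_componentwise
  proof (intro conjI ballI)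
    fix i :: nat assume "i \<in> {1..2}"
    then have "i = 1 \<or> i = 2" by auto
    then show "continuous_map (prod_topology (mtop MG) (mtop MG)) (mtop MG) (\<lambda>x. ?f x i)"
      using continuous_map_fst[of "mtop MG" "mtop MG"] continuous_map_snd[of "mtop MG" "mtop MG"]
      by (auto simp: case_prod_unfold)
  qed (auto simp: pair2_def)
  have "(\<lambda>i\<in>{1..2}. eG) = pair2 eG eG" by (auto simp: pair2_def)
  then have s: "smooth_near ?P MA (pair2 (fst (eG, eG)) (snd (eG, eG))) F" using c(3) by simp
  have "smooth_near (prod_manifold MG MG) MA (eG, eG) (\<lambda>x. F (pair2 (fst x) (snd x)))"
    by (rule smooth_near_comp[OF cGG charted_power[OF cMG] cMA pair2_smooth[OF cGG smooth_near_GG] s]) simp_all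
  then show "lsm2 (\<lambda>s t. F (pair2 s t))"
    unfolding lsm2_def using PiE_mem[OF c(1) pair2_carrier] measurable_compose[OF continuous_map_borel_of[OF cont] c(2)]
    by (auto simp: case_prod_unfold)
  show "fam2 (\<lambda>s t. F (pair2 s t)) = F"
  proof
    fix s show "fam2 (\<lambda>s t. F (pair2 s t)) s = F s"
      using pair2_eta[of s] PiE_arb[OF c(1), of s] by (simp only: fam2_def restrict_def) simp
  qed
qed

lemma lsm_cochain2I:
  assumes f: "lsm2 f"
  shows "fam2 f \<in> carrier (lsm_cochains G A 2)"
proof -
  let ?P = "power_manifold MG 2"
  have o: "(\<lambda>i\<in>{1..2}. eG) \<in> topspace (mtop ?P)" unfolding top_power by (rule one_power)
  have f': "(\<lambda>(s, t). f s t) \<in> measurable BGG BA" "smooth_near (prod_manifold MG MG) MA (eG, eG) (\<lambda>(s, t). f s t)"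
    using f by (auto simp: lsm2_def)
  have "continuous_map (mtop ?P) (prod_topology (mtop MG) (mtop MG)) (\<lambda>s. (s 1, s 2))"
    by (intro continuous_map_pairedI) (auto intro: continuous_map_product_projection)
  from measurable_compose[OF continuous_map_borel_of[OF this] f'(1)]
  have "(\<lambda>s. f (s 1) (s 2)) \<in> measurable (borel_of (mtop ?P)) BA" by simp
  then have m: "fam2 f \<in> measurable (borel_of (mtop ?P)) BA"
    by (rule measurable_cong[THEN iffD1, rotated]) (use top_power[of 2] in \<open>simp add: fam2_def\<close>)
  have "smooth_near ?P (prod_manifold MG MG) (\<lambda>i\<in>{1..2}. eG) (\<lambda>s. (s 1, s 2))"
    by (intro smooth_near_pair[OF charted_power[OF cMG]] cMG smooth_near_eval o) auto
  from smooth_near_comp[OF charted_power[OF cMG] cGG cMA this, of "\<lambda>(s, t). f s t"] f'(2)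
  have "smooth_near ?P MA (\<lambda>i\<in>{1..2}. eG) (\<lambda>s. f (s 1) (s 2))" by simp
  then have "smooth_near ?P MA (\<lambda>i\<in>{1..2}. eG) (fam2 f)"
    by (rule smooth_near_cong[OF charted_power[OF cMG] cMA _ openin_topspace o])
      (use top_power[of 2] in \<open>simp add: fam2_def\<close>)
  then show ?thesis using m f by (auto simp: lsm_cochains_def lsm2_def PiE_iff fam2_def)
qed

section \<open>The coboundary in degrees one and two\<close>

lemma int_pow_simps: "a \<in> cA \<Longrightarrow> a [^]\<^bsub>A\<^esub> (- 1 :: int) = iA a" "a \<in> cA \<Longrightarrow> a [^]\<^bsub>A\<^esub> (1 :: int) = a"
  using A.int_pow_neg[of a 1] A.int_pow_1[of a] by auto

text \<open>The hypothesis on \<open>F\<close> fits both a given cochain on families and one that is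
  built from a function \<open>c\<close> on the group, as the two inclusions for the coboundaries
  require.\<close>

lemma coboundary1:
  assumes c: "c \<in> cG \<rightarrow> cA" and F: "\<And>s. s \<in> cG \<Longrightarrow> F (\<lambda>i\<in>{1..1}. s) = c s"
  shows "coboundary G A act 1 F = fam2 (cob c)"
proof -
  have P: "power_carrier G (Suc 1) = power_carrier G 2" by (simp only: numeral_2_eq_2 One_nat_def)
  show ?thesis unfolding coboundary_def fam2_def P
proof (rule restrict_ext)
  fix s assume "s \<in> power_carrier G 2"
  then have s: "s 1 \<in> cG" "s 2 \<in> cG" by (auto simp: PiE_iff)
  have 1: "merge_at G 1 1 s = (\<lambda>i\<in>{1..1}. s 1 \<star> s 2)" "(\<lambda>i\<in>{1..1}. s (Suc i)) = (\<lambda>i\<in>{1..1}. s 2)"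
    "restrict s {1..1} = (\<lambda>i\<in>{1..1}. s 1)"
    by (auto simp: merge_at_def numeral_2_eq_2 restrict_def)
  have cc: "c (s 1 \<star> s 2) \<in> cA" "c (s 1) \<in> cA" "c (s 2) \<in> cA" using s c by (auto simp: Pi_iff)
  have I: "{1..1} = {1::nat}" by auto
  have "(\<Otimes>\<^bsub>A\<^esub>i\<in>{1..1}. F (merge_at G 1 i s) [^]\<^bsub>A\<^esub> ((-1) ^ i :: int)) = iA (c (s 1 \<star> s 2))"
    unfolding I using s cc 1 F[of "s 1 \<star> s 2"] by (subst A.finprod_insert) (auto simp: int_pow_simps)
  then show "act (s 1) (F (\<lambda>i\<in>{1..1}. s (Suc i))) \<boxplus>
         (\<Otimes>\<^bsub>A\<^esub>i\<in>{1..1}. F (merge_at G 1 i s) [^]\<^bsub>A\<^esub> ((-1) ^ i :: int)) \<boxplus>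
         F (restrict s {1..1}) [^]\<^bsub>A\<^esub> ((-1) ^ Suc 1 :: int) = cob c (s 1) (s 2)"
    unfolding 1 F[OF s(1)] F[OF s(2)] using s cc by (auto simp: cob_def int_pow_simps)
qed
qed

lemma coboundary2:
  assumes f: "\<And>s t. s \<in> cG \<Longrightarrow> t \<in> cG \<Longrightarrow> f s t \<in> cA" and s: "s \<in> power_carrier G 3"
  shows "coboundary G A act 2 (fam2 f) s = act (s 1) (f (s 2) (s 3)) \<boxplus> (iA (f (s 1 \<star> s 2) (s 3)) \<boxplus> f (s 1) (s 2 \<star> s 3)) \<boxplus> iA (f (s 1) (s 2))"
proof -
  have S: "Suc 2 = 3" "Suc 1 = (2::nat)" by auto
  have s': "s 1 \<in> cG" "s 2 \<in> cG" "s 3 \<in> cG" using s by (auto simp: PiE_iff)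
  have 1: "merge_at G 2 1 s = pair2 (s 1 \<star> s 2) (s 3)" "merge_at G 2 2 s = pair2 (s 1) (s 2 \<star> s 3)"
     "(\<lambda>i\<in>{1..2}. s (Suc i)) = pair2 (s 2) (s 3)" "restrict s {1..2} = pair2 (s 1) (s 2)"
    unfolding merge_at_def pair2_def by (auto intro!: restrict_ext simp: numeral_2_eq_2 numeral_3_eq_3 le_Suc_eq)
  have I: "{1..2} = {1, 2::nat}" by auto
  have "(\<Otimes>\<^bsub>A\<^esub>i\<in>{1..2}. fam2 f (merge_at G 2 i s) [^]\<^bsub>A\<^esub> ((-1) ^ i :: int))
     = (\<Otimes>\<^bsub>A\<^esub>i\<in>{1, 2::nat}. if i = 1 then iA (f (s 1 \<star> s 2) (s 3)) else f (s 1) (s 2 \<star> s 3))"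
    unfolding I by (rule A.finprod_cong') (use 1 f s' in \<open>auto simp: int_pow_simps\<close>)
  also have "\<dots> = iA (f (s 1 \<star> s 2) (s 3)) \<boxplus> f (s 1) (s 2 \<star> s 3)"
    using f s' by (subst A.finprod_insert; simp)+
  finally show ?thesis
    unfolding coboundary_def S(1) using s s' 1 f by (simp add: int_pow_simps)
qed

lemma lsm_cocycles_iff:
  "F \<in> carrier (lsm_cocycles G A act 2) \<longleftrightarrow> (\<exists>f. cocycle f \<and> F = fam2 f)"
proof -
  have key: "coboundary G A act 2 (fam2 f) = \<one>\<^bsub>lsm_cochains G A (Suc 2)\<^esub> \<longleftrightarrow>
     (\<forall>s\<in>cG. \<forall>t\<in>cG. \<forall>r\<in>cG. act s (f t r) \<boxplus> f s (t \<star> r) = f (s \<star> t) r \<boxplus> f s t)" if f: "lsm2 f" for f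
  proof -
    have fc: "f s t \<in> cA" if "s \<in> cG" "t \<in> cG" for s t using f that by (simp add: lsm2_def)
    have S: "Suc 2 = 3" by simp
    have eq: "act s (f t r) \<boxplus> (iA (f (s \<star> t) r) \<boxplus> f s (t \<star> r)) \<boxplus> iA (f s t) = eA \<longleftrightarrow>
        act s (f t r) \<boxplus> f s (t \<star> r) = f (s \<star> t) r \<boxplus> f s t" if "s \<in> cG" "t \<in> cG" "r \<in> cG" for s t r
    proof -
      have c: "act s (f t r) \<in> cA" "f (s \<star> t) r \<in> cA" "f s (t \<star> r) \<in> cA" "f s t \<in> cA" using that fc by auto
      then have "act s (f t r) \<boxplus> (iA (f (s \<star> t) r) \<boxplus> f s (t \<star> r)) \<boxplus> iA (f s t) =
         (act s (f t r) \<boxplus> f s (t \<star> r)) \<boxplus> iA (f (s \<star> t) r \<boxplus> f s t)"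
        by (simp add: A.inv_mult A.m_ac)
      then show ?thesis using c by (metis A.inv_equality A.inv_inv A.m_closed A.inv_closed A.r_inv)
    qed
    have "coboundary G A act 2 (fam2 f) = \<one>\<^bsub>lsm_cochains G A (Suc 2)\<^esub> \<longleftrightarrow>
        (\<forall>s\<in>power_carrier G 3. coboundary G A act 2 (fam2 f) s = eA)"
      unfolding coboundary_def lsm_cochains_def S by (auto simp: fun_eq_iff restrict_def)
    also have "\<dots> \<longleftrightarrow> (\<forall>s\<in>power_carrier G 3. act (s 1) (f (s 2) (s 3)) \<boxplus> f (s 1) (s 2 \<star> s 3) = f (s 1 \<star> s 2) (s 3) \<boxplus> f (s 1) (s 2))"
    proof (rule ball_cong[OF refl])
      fix s assume s: "s \<in> power_carrier G 3"
      then have "s 1 \<in> cG" "s 2 \<in> cG" "s 3 \<in> cG" by (auto simp: PiE_iff)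
      from eq[OF this] show "coboundary G A act 2 (fam2 f) s = eA \<longleftrightarrow>
          act (s 1) (f (s 2) (s 3)) \<boxplus> f (s 1) (s 2 \<star> s 3) = f (s 1 \<star> s 2) (s 3) \<boxplus> f (s 1) (s 2)"
        using coboundary2[OF fc s] by simp
    qed
    also have "\<dots> \<longleftrightarrow> (\<forall>s\<in>cG. \<forall>t\<in>cG. \<forall>r\<in>cG. act s (f t r) \<boxplus> f s (t \<star> r) = f (s \<star> t) r \<boxplus> f s t)"
    proof (intro iffI ballI)
      fix s t r assume *: "\<forall>s\<in>power_carrier G 3. act (s 1) (f (s 2) (s 3)) \<boxplus> f (s 1) (s 2 \<star> s 3) = f (s 1 \<star> s 2) (s 3) \<boxplus> f (s 1) (s 2)"
        "s \<in> cG" "t \<in> cG" "r \<in> cG"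
      have "(\<lambda>i\<in>{1..3::nat}. if i = 1 then s else if i = 2 then t else r) \<in> power_carrier G 3" using * by auto
      from bspec[OF *(1) this] show "act s (f t r) \<boxplus> f s (t \<star> r) = f (s \<star> t) r \<boxplus> f s t" by simp
    qed (auto simp: PiE_iff)
    finally show ?thesis .
  qed
  have iff: "F \<in> carrier (lsm_cocycles G A act 2) \<longleftrightarrow> F \<in> carrier (lsm_cochains G A 2) \<and>
     coboundary G A act 2 F = \<one>\<^bsub>lsm_cochains G A (Suc 2)\<^esub>" by (simp add: lsm_cocycles_def kernel_def)
  show ?thesis
  proof
    assume "F \<in> carrier (lsm_cocycles G A act 2)"
    then have F: "F \<in> carrier (lsm_cochains G A 2)" "coboundary G A act 2 F = \<one>\<^bsub>lsm_cochains G A (Suc 2)\<^esub>" using iff by auto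
    note F2 = lsm_cochain2D[OF F(1)]
    have "cocycle (\<lambda>s t. F (pair2 s t))" unfolding cocycle_def
      using key[OF F2(1)] F2 F(2) by simp
    then show "\<exists>f. cocycle f \<and> F = fam2 f" using F2(2) by metis
  next
    assume "\<exists>f. cocycle f \<and> F = fam2 f"
    then show "F \<in> carrier (lsm_cocycles G A act 2)" unfolding iff using key lsm_cochain2I by (auto simp: cocycle_def)
  qed
qed

lemma lsm_coboundaries_eq: "lsm_coboundaries G A act 2 = (\<lambda>c. fam2 (cob c)) ` {c. lsm1 c}"
proof -
  have n: "2 - 1 = (1::nat)" by simp
  show ?thesis unfolding lsm_coboundaries_def n
  proof (rule equalityI; rule subsetI)
    fix F assume "F \<in> coboundary G A act 1 ` carrier (lsm_cochains G A 1)"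
    then obtain c where c: "c \<in> carrier (lsm_cochains G A 1)" "F = coboundary G A act 1 c" by blast
    note l = lsm_cochain1D[OF c(1)]
    have "F = fam2 (cob (\<lambda>s. c (\<lambda>i\<in>{1..1}. s)))"
      unfolding c(2) by (rule coboundary1) (use l in \<open>auto simp: lsm1_def\<close>)
    then show "F \<in> (\<lambda>c. fam2 (cob c)) ` {c. lsm1 c}" using l by blast
  next
    fix F assume "F \<in> (\<lambda>c. fam2 (cob c)) ` {c. lsm1 c}"
    then obtain c where c: "lsm1 c" "F = fam2 (cob c)" by blast
    have "coboundary G A act 1 (\<lambda>s\<in>power_carrier G 1. c (s 1)) = fam2 (cob c)"
      by (rule coboundary1) (use c in \<open>auto simp: lsm1_def\<close>)
    then show "F \<in> coboundary G A act 1 ` carrier (lsm_cochains G A 1)"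
      using lsm_cochain1I[OF c(1)] c(2) by (metis imageI)
  qed
qed

section \<open>Cohomology classes in degree two\<close>

lemma fam2_mult: "fam2 f \<otimes>\<^bsub>lsm_cocycles G A act 2\<^esub> fam2 h = fam2 (\<lambda>s t. f s t \<boxplus> h s t)"
  unfolding lsm_cocycles_def lsm_cochains_def fam2_def by (auto simp: fun_eq_iff restrict_def)

lemma lsm1_one: "lsm1 (\<lambda>_. eA)"
  unfolding lsm1_def using smooth_near_const[OF cMG cMA, of eG eA] tG tA by simp

lemma lsm1_mult: "lsm1 c \<Longrightarrow> lsm1 d \<Longrightarrow> lsm1 (\<lambda>s. c s \<boxplus> d s)"
  unfolding lsm1_def by (auto intro!: smooth_near_mult[OF A cMG] lie_mult_measurable[OF A])

lemma lsm1_inv: "lsm1 c \<Longrightarrow> lsm1 (\<lambda>s. iA (c s))"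
  unfolding lsm1_def by (auto intro!: smooth_near_inv[OF A cMG] lie_inv_measurable[OF A])

lemma cob_mult:
  assumes "c \<in> cG \<rightarrow> cA" "d \<in> cG \<rightarrow> cA" "s \<in> cG" "t \<in> cG"
  shows "cob (\<lambda>s. c s \<boxplus> d s) s t = cob c s t \<boxplus> cob d s t"
proof -
  have "act s (c t) \<in> cA" "act s (d t) \<in> cA" "c (s \<star> t) \<in> cA" "d (s \<star> t) \<in> cA" "c s \<in> cA" "d s \<in> cA" "c t \<in> cA" "d t \<in> cA"
    using assms by (auto simp: Pi_iff)
  then show ?thesis using assms(3) by (simp add: cob_def A.inv_mult A.m_ac)
qed

lemma cob_closed: "c \<in> cG \<rightarrow> cA \<Longrightarrow> s \<in> cG \<Longrightarrow> t \<in> cG \<Longrightarrow> cob c s t \<in> cA"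
  by (auto simp: cob_def Pi_iff)

lemma lsm_class_fam2: "lsm_class G A act 2 (fam2 f) = {fam2 (\<lambda>s t. cob c s t \<boxplus> f s t) | c. lsm1 c}"
  unfolding lsm_class_def r_coset_def lsm_coboundaries_eq by (auto simp: fam2_mult)

text \<open>Classes are cosets of the coboundaries. One direction uses that \<open>h\<close> lies in
  its own class, through the trivial cochain; the other is an inclusion of cosets applied twice,
  with \<open>c\<close> and with its inverse.\<close>

lemma lsm_class_eq_iff:
  assumes f: "lsm2 f" and h: "lsm2 h"
  shows "lsm_class G A act 2 (fam2 f) = lsm_class G A act 2 (fam2 h) \<longleftrightarrow>
     (\<exists>c. lsm1 c \<and> (\<forall>s\<in>cG. \<forall>t\<in>cG. h s t = cob c s t \<boxplus> f s t))"
proof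
  have fc: "f s t \<in> cA" "h s t \<in> cA" if "s \<in> cG" "t \<in> cG" for s t using f h that by (auto simp: lsm2_def)
  assume eq: "lsm_class G A act 2 (fam2 f) = lsm_class G A act 2 (fam2 h)"
  have "fam2 h = fam2 (\<lambda>s t. cob (\<lambda>_. eA) s t \<boxplus> h s t)"
    by (rule fam2_cong) (use fc in \<open>auto simp: cob_def\<close>)
  then have "fam2 h \<in> lsm_class G A act 2 (fam2 f)" unfolding eq unfolding lsm_class_fam2 using lsm1_one by blast
  then obtain c where c: "lsm1 c" "fam2 h = fam2 (\<lambda>s t. cob c s t \<boxplus> f s t)" unfolding lsm_class_fam2 by blast
  then show "\<exists>c. lsm1 c \<and> (\<forall>s\<in>cG. \<forall>t\<in>cG. h s t = cob c s t \<boxplus> f s t)" using fam2_eqD[OF c(2)] by blast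
next
  have fc: "f s t \<in> cA" "h s t \<in> cA" if "s \<in> cG" "t \<in> cG" for s t using f h that by (auto simp: lsm2_def)
  assume "\<exists>c. lsm1 c \<and> (\<forall>s\<in>cG. \<forall>t\<in>cG. h s t = cob c s t \<boxplus> f s t)"
  then obtain c where c: "lsm1 c" "\<And>s t. s \<in> cG \<Longrightarrow> t \<in> cG \<Longrightarrow> h s t = cob c s t \<boxplus> f s t" by blast
  have sub: "{fam2 (\<lambda>s t. cob d s t \<boxplus> h s t) | d. lsm1 d} \<subseteq> {fam2 (\<lambda>s t. cob d s t \<boxplus> f s t) | d. lsm1 d}"
    if c: "lsm1 c" "\<And>s t. s \<in> cG \<Longrightarrow> t \<in> cG \<Longrightarrow> h s t = cob c s t \<boxplus> f s t"
      and fc: "\<And>s t. s \<in> cG \<Longrightarrow> t \<in> cG \<Longrightarrow> f s t \<in> cA" for c f h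
  proof (clarify)
    fix d assume d: "lsm1 d"
    have "fam2 (\<lambda>s t. cob d s t \<boxplus> h s t) = fam2 (\<lambda>s t. cob (\<lambda>s. d s \<boxplus> c s) s t \<boxplus> f s t)"
    proof (rule fam2_cong)
      fix s t assume st: "s \<in> cG" "t \<in> cG"
      have "c \<in> cG \<rightarrow> cA" "d \<in> cG \<rightarrow> cA" using c d by (auto simp: lsm1_def)
      then show "cob d s t \<boxplus> h s t = cob (\<lambda>s. d s \<boxplus> c s) s t \<boxplus> f s t"
        using st fc[OF st] cob_closed by (simp add: c(2)[OF st] cob_mult A.m_assoc)
    qed
    then show "\<exists>e. fam2 (\<lambda>s t. cob d s t \<boxplus> h s t) = fam2 (\<lambda>s t. cob e s t \<boxplus> f s t) \<and> lsm1 e" using lsm1_mult[OF d c(1)] by blast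
  qed
  have inv: "f s t = cob (\<lambda>s. iA (c s)) s t \<boxplus> h s t" if st: "s \<in> cG" "t \<in> cG" for s t
  proof -
    have cc: "c \<in> cG \<rightarrow> cA" "(\<lambda>s. iA (c s)) \<in> cG \<rightarrow> cA" using c by (auto simp: lsm1_def)
    have "cob (\<lambda>s. iA (c s)) s t \<boxplus> cob c s t = cob (\<lambda>s. iA (c s) \<boxplus> c s) s t" by (rule cob_mult[OF cc(2,1) st, symmetric])
    also have "\<dots> = eA" using cc st by (simp add: cob_def Pi_iff)
    finally show ?thesis using st cob_closed[OF cc(1) st] cob_closed[OF cc(2) st] fc[OF st] by (simp add: c(2)[OF st] A.m_assoc[symmetric])
  qed
  show "lsm_class G A act 2 (fam2 f) = lsm_class G A act 2 (fam2 h)"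
    unfolding lsm_class_fam2
    by (rule equalityI; rule sub) (use c fc inv lsm1_inv[OF c(1)] in auto)
qed

lemma carrier_lsm_cohomology: "carrier (lsm_cohomology G A act 2) = {lsm_class G A act 2 (fam2 f) | f. cocycle f}"
  unfolding lsm_cohomology_def FactGroup_def RCOSETS_def lsm_class_def[symmetric]
  using lsm_cocycles_iff by auto

end

section \<open>Factor sets of extensions\<close>

lemma smooth_map_near_iff:
  "charted M \<Longrightarrow> charted N \<Longrightarrow> smooth_map M N f \<longleftrightarrow> (\<forall>p\<in>topspace (mtop M). smooth_near M N p f)"
  by (simp add: smooth_map_on_iff)

lemma smooth_map_nearD:
  "smooth_map M N f \<Longrightarrow> charted M \<Longrightarrow> charted N \<Longrightarrow> p \<in> topspace (mtop M) \<Longrightarrow> smooth_near M N p f"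
  using smooth_map_near_iff by blast

lemma smooth_map_cong:
  assumes "charted M" "charted N" "smooth_map M N f" "\<And>x. x \<in> topspace (mtop M) \<Longrightarrow> f x = g x"
  shows "smooth_map M N g"
  using assms(3) smooth_near_cong[OF assms(1,2) _ openin_topspace _ assms(4)] by (auto simp: smooth_map_near_iff assms(1,2))

lemma smooth_map_comp:
  assumes "charted L" "charted M" "charted N" "smooth_map L M f" "smooth_map M N g"
  shows "smooth_map L N (\<lambda>x. g (f x))"
  using assms(4,5) smooth_near_comp[OF assms(1-3)] smooth_near_into(2)
  unfolding smooth_map_near_iff[OF assms(1,2)] smooth_map_near_iff[OF assms(2,3)] smooth_map_near_iff[OF assms(1,3)] by metis

section \<open>Extensions and their sections\<close>

locale lie_extension = lie_module G A act
  for G :: "'g lie_struct" and A :: "'a lie_struct" and act :: "'g \<Rightarrow> 'a \<Rightarrow> 'a" +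
  fixes X :: "('g, 'a, 'e) extension"
  assumes X: "locally_split_extension G A act X"
begin

abbreviation e_mult (infixl "\<odot>" 70) where "x \<odot> y \<equiv> x \<otimes>\<^bsub>ext X\<^esub> y"
abbreviation "iE x \<equiv> inv\<^bsub>ext X\<^esub> x"
abbreviation "cE \<equiv> carrier (ext X)"
abbreviation "eE \<equiv> \<one>\<^bsub>ext X\<^esub>"
abbreviation "ME \<equiv> mfd (ext X)"
abbreviation "BE \<equiv> borel_of (mtop ME)"
abbreviation "\<iota> \<equiv> incl X"
abbreviation "\<pi> \<equiv> proj X"
abbreviation "jA \<equiv> inv_into cA \<iota>"

lemma E: "lie_group (ext X)" using X by (simp add: locally_split_extension_def)

sublocale E: group "ext X" by (rule lie_groupD(1)[OF E])

lemmas cME = lie_groupD(2)[OF E] and tE = lie_groupD(3)[OF E]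

lemma incl_hom: "\<iota> \<in> hom A (ext X)" and proj_hom: "\<pi> \<in> hom (ext X) G" and incl_inj: "inj_on \<iota> cA"
  and incl_closed: "closed_map (mtop MA) (mtop ME) \<iota>"
  and incl_smooth: "smooth_map MA ME \<iota>" and proj_smooth: "smooth_map ME MG \<pi>"
  using X unfolding locally_split_extension_def by blast+

lemma incl_near: "a \<in> cA \<Longrightarrow> smooth_near MA ME a \<iota>" and proj_near: "e \<in> cE \<Longrightarrow> smooth_near ME MG e \<pi>"
  using smooth_map_nearD[OF incl_smooth cMA cME] smooth_map_nearD[OF proj_smooth cME cMG] tA tE by auto

lemma incl_in [simp]: "a \<in> cA \<Longrightarrow> \<iota> a \<in> cE" and incl_mult: "a \<in> cA \<Longrightarrow> b \<in> cA \<Longrightarrow> \<iota> (a \<boxplus> b) = \<iota> a \<odot> \<iota> b"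
  and proj_in [simp]: "e \<in> cE \<Longrightarrow> \<pi> e \<in> cG" and proj_mult [simp]: "e \<in> cE \<Longrightarrow> d \<in> cE \<Longrightarrow> \<pi> (e \<odot> d) = \<pi> e \<star> \<pi> d"
  using incl_hom proj_hom by (auto simp: hom_def)

lemma incl_one [simp]: "\<iota> eA = eE" and proj_one [simp]: "\<pi> eE = eG"
  using hom_one[OF incl_hom] hom_one[OF proj_hom] by auto

lemma proj_inv [simp]: "e \<in> cE \<Longrightarrow> \<pi> (iE e) = iG (\<pi> e)"
  using group_hom.hom_inv[of "ext X" G \<pi> e] proj_hom by (simp add: group_hom_def group_hom_axioms_def)

lemma incl_inv: "a \<in> cA \<Longrightarrow> \<iota> (iA a) = iE (\<iota> a)"
  using group_hom.hom_inv[of A "ext X" \<iota> a] incl_hom by (simp add: group_hom_def group_hom_axioms_def)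

lemma kernel_proj: "\<iota> ` cA = {e \<in> cE. \<pi> e = eG}"
  using X by (simp add: locally_split_extension_def kernel_def)

lemma proj_incl [simp]: "a \<in> cA \<Longrightarrow> \<pi> (\<iota> a) = eG" using kernel_proj by blast

lemma in_incl: "e \<in> cE \<Longrightarrow> \<pi> e = eG \<Longrightarrow> e \<in> \<iota> ` cA" using kernel_proj by blast

lemma jA [simp]: "a \<in> cA \<Longrightarrow> jA (\<iota> a) = a" by (rule inv_into_f_f[OF incl_inj])

lemma incl_jA: "e \<in> cE \<Longrightarrow> \<pi> e = eG \<Longrightarrow> \<iota> (jA e) = e" "e \<in> cE \<Longrightarrow> \<pi> e = eG \<Longrightarrow> jA e \<in> cA"
  using f_inv_into_f[OF in_incl] inv_into_into[OF in_incl] by auto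

lemma conj_incl: "e \<in> cE \<Longrightarrow> a \<in> cA \<Longrightarrow> e \<odot> \<iota> a = \<iota> (act (\<pi> e) a) \<odot> e"
proof -
  assume e: "e \<in> cE" "a \<in> cA"
  then have "e \<odot> \<iota> a \<odot> iE e = \<iota> (act (\<pi> e) a)" using X by (simp add: locally_split_extension_def)
  then show ?thesis using e by (metis E.inv_solve_right E.inv_closed E.inv_inv E.m_closed incl_in)
qed

text \<open>\<open>\<iota>\<close> is injective and closed, so the preimage of a closed
  \<open>C\<close> under \<open>jA\<close> composed with \<open>h\<close> is the preimage of a
  closed set under \<open>h\<close>.\<close>

lemma lift_measurable:
  assumes h: "h \<in> measurable M BE" and k: "\<And>w. w \<in> space M \<Longrightarrow> \<pi> (h w) = eG"
  shows "(\<lambda>w. jA (h w)) \<in> measurable M BA"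
proof (rule measurable_borel_of_closedI)
  have hE: "h w \<in> cE" if "w \<in> space M" for w using measurable_space[OF h that] tE by simp
  show "(\<lambda>w. jA (h w)) \<in> space M \<rightarrow> topspace (mtop MA)" using incl_jA(2)[OF hE k] tA by auto
  fix C assume C: "closedin (mtop MA) C"
  have CA: "C \<subseteq> cA" using closedin_subset[OF C] tA by simp
  have "(\<lambda>w. jA (h w)) -` C \<inter> space M = h -` (\<iota> ` C) \<inter> space M"
  proof (rule equalityI; rule subsetI)
    fix w assume "w \<in> (\<lambda>w. jA (h w)) -` C \<inter> space M"
    then show "w \<in> h -` (\<iota> ` C) \<inter> space M" using incl_jA(1)[OF hE k] by (metis IntE IntI image_eqI vimage_eq)
  qed (use CA in auto)
  moreover have "closedin (mtop ME) (\<iota> ` C)" using incl_closed C by (simp add: closed_map_def)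
  ultimately show "(\<lambda>w. jA (h w)) -` C \<inter> space M \<in> sets M"
    using measurable_sets[OF h borel_of_closed] by metis
qed

lemma lift_smooth:
  assumes M: "charted M" and h: "smooth_near M ME p h" and P: "openin (mtop M) P" "p \<in> P" "\<And>w. w \<in> P \<Longrightarrow> h w \<in> cE \<and> \<pi> (h w) = eG"
  shows "smooth_near M MA p (\<lambda>w. jA (h w))"
proof (rule smooth_lift_through_embedding[OF lie_group_left_lie[OF A] lie_group_left_lie[OF E] incl_hom incl_inj incl_closed _ M h P(1,2)])
  show "smooth_near MA ME eA \<iota>" by (rule incl_near) simp
qed (use P(3) in_incl in blast)

definition fs :: "('g \<Rightarrow> 'e) \<Rightarrow> 'g \<Rightarrow> 'g \<Rightarrow> 'a" where
  "fs \<sigma> s t = jA (\<sigma> s \<odot> \<sigma> t \<odot> iE (\<sigma> (s \<star> t)))"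

lemma factor_set_fam2: "factor_set G A X \<sigma> = fam2 (fs \<sigma>)"
  unfolding factor_set_def fam2_def fs_def ..

context
  fixes \<sigma> assumes \<sigma>: "lsm_section G X \<sigma>"
begin

lemma section_in [simp]: "s \<in> cG \<Longrightarrow> \<sigma> s \<in> cE" and proj_section [simp]: "s \<in> cG \<Longrightarrow> \<pi> (\<sigma> s) = s"
  and section_measurable: "\<sigma> \<in> measurable BG BE" and section_smooth: "smooth_near MG ME eG \<sigma>"
  using \<sigma> measurable_space[of \<sigma> BG BE] tG tE by (auto simp: lsm_section_def)

lemma incl_fs: "s \<in> cG \<Longrightarrow> t \<in> cG \<Longrightarrow> \<iota> (fs \<sigma> s t) = \<sigma> s \<odot> \<sigma> t \<odot> iE (\<sigma> (s \<star> t))"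
  and fs_closed: "s \<in> cG \<Longrightarrow> t \<in> cG \<Longrightarrow> fs \<sigma> s t \<in> cA"
  unfolding fs_def by (rule incl_jA; simp)+

lemma section_mult: "s \<in> cG \<Longrightarrow> t \<in> cG \<Longrightarrow> \<sigma> s \<odot> \<sigma> t = \<iota> (fs \<sigma> s t) \<odot> \<sigma> (s \<star> t)"
  by (simp add: incl_fs E.m_assoc)

text \<open>Every element is uniquely of the form \<open>\<iota> a \<odot> \<sigma> s\<close>, so
  this multiplication table determines the group from \<open>act\<close> and
  \<open>fs \<sigma>\<close>. It serves to compare two extensions and is the model for the group
  built from a cocycle.\<close>

lemma mult_formula:
  assumes "s \<in> cG" "t \<in> cG" "a \<in> cA" "b \<in> cA"
  shows "(\<iota> a \<odot> \<sigma> s) \<odot> (\<iota> b \<odot> \<sigma> t) = \<iota> (a \<boxplus> act s b \<boxplus> fs \<sigma> s t) \<odot> \<sigma> (s \<star> t)"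
proof -
  have "(\<iota> a \<odot> \<sigma> s) \<odot> (\<iota> b \<odot> \<sigma> t) = \<iota> a \<odot> (\<sigma> s \<odot> \<iota> b) \<odot> \<sigma> t" using assms by (simp add: E.m_assoc)
  also have "\<dots> = \<iota> a \<odot> \<iota> (act s b) \<odot> (\<sigma> s \<odot> \<sigma> t)" using assms conj_incl[of "\<sigma> s" b] by (simp add: E.m_assoc)
  also have "\<dots> = \<iota> a \<odot> \<iota> (act s b) \<odot> \<iota> (fs \<sigma> s t) \<odot> \<sigma> (s \<star> t)" using assms section_mult fs_closed by (simp add: E.m_assoc)
  finally show ?thesis using assms fs_closed by (simp add: incl_mult)
qed

lemma incl_section_inj:
  assumes "a \<in> cA" "b \<in> cA" "s \<in> cG" "t \<in> cG"
  shows "\<iota> a \<odot> \<sigma> s = \<iota> b \<odot> \<sigma> t \<longleftrightarrow> a = b \<and> s = t"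
proof
  assume eq: "\<iota> a \<odot> \<sigma> s = \<iota> b \<odot> \<sigma> t"
  have "\<pi> (\<iota> a \<odot> \<sigma> s) = s" "\<pi> (\<iota> b \<odot> \<sigma> t) = t" using assms by simp_all
  then have st: "s = t" using eq by simp
  then have "\<iota> a = \<iota> b" using eq assms by simp
  then show "a = b \<and> s = t" using st inj_onD[OF incl_inj] assms by blast
qed simp

definition coord :: "'e \<Rightarrow> 'a" where "coord e = jA (e \<odot> iE (\<sigma> (\<pi> e)))"

lemma coord: "e \<in> cE \<Longrightarrow> coord e \<in> cA" "e \<in> cE \<Longrightarrow> \<iota> (coord e) \<odot> \<sigma> (\<pi> e) = e"
  "a \<in> cA \<Longrightarrow> s \<in> cG \<Longrightarrow> coord (\<iota> a \<odot> \<sigma> s) = a"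
proof -
  assume e: "e \<in> cE"
  have 1: "e \<odot> iE (\<sigma> (\<pi> e)) \<in> cE" "\<pi> (e \<odot> iE (\<sigma> (\<pi> e))) = eG" using e by simp_all
  show "coord e \<in> cA" unfolding coord_def by (rule incl_jA(2)[OF 1])
  have "\<iota> (coord e) = e \<odot> iE (\<sigma> (\<pi> e))" unfolding coord_def by (rule incl_jA(1)[OF 1])
  then show "\<iota> (coord e) \<odot> \<sigma> (\<pi> e) = e" using e by (simp add: E.m_assoc)
next
  assume "a \<in> cA" "s \<in> cG"
  then show "coord (\<iota> a \<odot> \<sigma> s) = a" by (simp add: coord_def E.m_assoc)
qed

text \<open>The section is smooth near the identity only, and \<open>s\<close>, \<open>t\<close> and
  \<open>s \<star> t\<close> approach \<open>eG\<close> together, so smoothness survives near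
  \<open>(eG, eG)\<close>. The expression has values in the kernel of \<open>\<pi>\<close>, hence
  both smoothness and measurability descend to \<open>A\<close>.\<close>

lemma fs_lsm2: "lsm2 (fs \<sigma>)"
  unfolding lsm2_def
proof (intro conjI ballI)
  let ?h = "\<lambda>z. \<sigma> (fst z) \<odot> \<sigma> (snd z) \<odot> iE (\<sigma> (fst z \<star> snd z))"
  have eq: "(\<lambda>(s, t). fs \<sigma> s t) = (\<lambda>z. jA (?h z))" by (auto simp: fs_def)
  have c: "fst \<in> measurable BGG BG" "snd \<in> measurable BGG BG"
    by (rule continuous_map_borel_of continuous_map_fst continuous_map_snd)+
  have "?h \<in> measurable BGG BE"
    by (intro lie_mult_measurable[OF E] lie_inv_measurable[OF E] measurable_compose[OF _ section_measurable] lie_mult_measurable[OF G] c)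
  then show "(\<lambda>(s, t). fs \<sigma> s t) \<in> measurable BGG BA" unfolding eq by (rule lift_measurable) (auto simp: tG)
  have sn: "smooth_near (prod_manifold MG MG) ME (eG, eG) (\<lambda>z. \<sigma> (f z))"
    if "smooth_near (prod_manifold MG MG) MG (eG, eG) f" "f (eG, eG) = eG" for f
    by (rule smooth_near_comp[OF cGG cMG cME that(1)]) (use that section_smooth in simp)
  have "smooth_near (prod_manifold MG MG) ME (eG, eG) ?h"
    by (intro smooth_near_mult[OF E cGG] smooth_near_inv[OF E cGG] sn smooth_near_mult[OF G cGG] smooth_near_GG) auto
  then show "smooth_near (prod_manifold MG MG) MA (eG, eG) (\<lambda>(s, t). fs \<sigma> s t)"
    unfolding eq by (rule lift_smooth[OF cGG _ openin_topspace]) (auto simp: tG)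
qed (rule fs_closed)

text \<open>Both sides are the component in \<open>A\<close> of the product of
  \<open>\<sigma> s\<close>, \<open>\<sigma> t\<close> and \<open>\<sigma> r\<close>, computed with
  the two bracketings.\<close>

lemma fs_cocycle: "cocycle (fs \<sigma>)"
  unfolding cocycle_def
proof (intro conjI ballI fs_lsm2)
  fix s t r assume str: "s \<in> cG" "t \<in> cG" "r \<in> cG"
  have c: "fs \<sigma> s t \<in> cA" "fs \<sigma> t r \<in> cA" "fs \<sigma> (s \<star> t) r \<in> cA" "fs \<sigma> s (t \<star> r) \<in> cA" using str fs_closed by auto
  have "\<iota> (act s (fs \<sigma> t r) \<boxplus> fs \<sigma> s (t \<star> r)) \<odot> \<sigma> (s \<star> (t \<star> r)) = \<sigma> s \<odot> (\<sigma> t \<odot> \<sigma> r)"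
  proof -
    have "\<sigma> s \<odot> (\<sigma> t \<odot> \<sigma> r) = (\<sigma> s \<odot> \<iota> (fs \<sigma> t r)) \<odot> \<sigma> (t \<star> r)" using str c section_mult by (simp add: E.m_assoc)
    also have "\<dots> = \<iota> (act s (fs \<sigma> t r)) \<odot> (\<sigma> s \<odot> \<sigma> (t \<star> r))" using str c conj_incl[of "\<sigma> s"] by (simp add: E.m_assoc)
    finally show ?thesis using str c section_mult by (simp add: incl_mult E.m_assoc)
  qed
  moreover have "\<iota> (fs \<sigma> (s \<star> t) r \<boxplus> fs \<sigma> s t) \<odot> \<sigma> (s \<star> t \<star> r) = (\<sigma> s \<odot> \<sigma> t) \<odot> \<sigma> r"
    using str c section_mult by (simp add: incl_mult E.m_assoc A.m_comm[of "fs \<sigma> (s \<star> t) r"])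
  ultimately show "act s (fs \<sigma> t r) \<boxplus> fs \<sigma> s (t \<star> r) = fs \<sigma> (s \<star> t) r \<boxplus> fs \<sigma> s t"
    using str c by (simp add: E.m_assoc G.m_assoc) (metis A.m_closed G.m_closed act_closed incl_section_inj)
qed

text \<open>The multiplication table brings \<open>c s\<close>, \<open>act s (c t)\<close> and the
  old factor set together; dividing by the new value at \<open>s \<star> t\<close> contributes the
  inverse of \<open>c (s \<star> t)\<close>, which completes \<open>cob c\<close>.\<close>

lemma section_change:
  assumes c: "lsm1 c"
  shows "lsm_section G X (\<lambda>s. \<iota> (c s) \<odot> \<sigma> s)"
    and "s \<in> cG \<Longrightarrow> t \<in> cG \<Longrightarrow> fs (\<lambda>s. \<iota> (c s) \<odot> \<sigma> s) s t = cob c s t \<boxplus> fs \<sigma> s t"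
proof -
  have cA: "c s \<in> cA" if "s \<in> cG" for s using c that by (auto simp: lsm1_def)
  have c': "smooth_near MG MA eG c" "c \<in> measurable BG BA" using c by (auto simp: lsm1_def)
  have 1: "smooth_near MG ME eG (\<lambda>s. \<iota> (c s))"
    by (rule smooth_near_comp[OF cMG cMA cME c'(1) incl_near[OF cA]]) simp
  have 2: "(\<lambda>s. \<iota> (c s)) \<in> measurable BG BE"
    by (rule measurable_compose[OF c'(2) smooth_map_measurable[OF incl_smooth]])
  show "lsm_section G X (\<lambda>s. \<iota> (c s) \<odot> \<sigma> s)" unfolding lsm_section_def
    using smooth_near_mult[OF E cMG 1 section_smooth] lie_mult_measurable[OF E 2 section_measurable] cA by simp
  assume st: "s \<in> cG" "t \<in> cG"
  note cc = cA[OF st(1)] cA[OF st(2)] cA[OF G.m_closed[OF st]] fs_closed[OF st]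
  have "(\<iota> (c s) \<odot> \<sigma> s) \<odot> (\<iota> (c t) \<odot> \<sigma> t) \<odot> iE (\<iota> (c (s \<star> t)) \<odot> \<sigma> (s \<star> t))
      = \<iota> (c s \<boxplus> act s (c t) \<boxplus> fs \<sigma> s t) \<odot> \<iota> (iA (c (s \<star> t)))"
    using mult_formula[OF st cc(1,2)] st cc by (simp add: E.inv_mult_group E.m_assoc incl_inv) (simp add: E.m_assoc[symmetric])
  also have "\<dots> = \<iota> (cob c s t \<boxplus> fs \<sigma> s t)"
    using st cc by (simp add: incl_mult[symmetric] cob_def A.m_ac)
  finally show "fs (\<lambda>s. \<iota> (c s) \<odot> \<sigma> s) s t = cob c s t \<boxplus> fs \<sigma> s t"
    unfolding fs_def[of "\<lambda>s. \<iota> (c s) \<odot> \<sigma> s"] using st cc by (simp add: cob_def)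
qed

lemma coord_smooth: "smooth_near ME MA eE coord"
proof -
  have p: "smooth_near ME MG eE \<pi>" by (rule proj_near) simp
  have i: "smooth_near ME ME eE (\<lambda>e. e)" by (rule smooth_near_id[OF cME]) (use tE in simp)
  have "smooth_near ME ME eE (\<lambda>e. e \<odot> iE (\<sigma> (\<pi> e)))"
    by (intro smooth_near_mult[OF E cME] smooth_near_inv[OF E cME] i smooth_near_comp[OF cME cMG cME p]) (use section_smooth in simp)
  then show ?thesis unfolding coord_def[abs_def]
    by (rule lift_smooth[OF cME _ openin_topspace]) (auto simp: tE)
qed

end

text \<open>\<open>lift_measurable\<close> and \<open>lift_smooth\<close> make the quotient of the
  sections a cochain \<open>c\<close>, and \<open>section_change\<close> identifies the change of
  the factor set with \<open>cob c\<close>.\<close>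

lemma sections_cohomologous:
  assumes \<sigma>: "lsm_section G X \<sigma>" and \<tau>: "lsm_section G X \<tau>"
  shows "lsm_class G A act 2 (fam2 (fs \<sigma>)) = lsm_class G A act 2 (fam2 (fs \<tau>))"
proof -
  let ?h = "\<lambda>s. \<tau> s \<odot> iE (\<sigma> s)"
  define c where "c s = jA (?h s)" for s
  have h: "?h s \<in> cE" "\<pi> (?h s) = eG" if "s \<in> cG" for s using that \<sigma> \<tau> section_in proj_section by auto
  have "?h \<in> measurable BG BE"
    by (intro lie_mult_measurable[OF E] lie_inv_measurable[OF E] section_measurable \<sigma> \<tau>)
  then have 1: "c \<in> measurable BG BA" unfolding c_def[abs_def] by (rule lift_measurable) (use h tG in auto)
  have "smooth_near MG ME eG ?h"
    by (intro smooth_near_mult[OF E cMG] smooth_near_inv[OF E cMG] section_smooth \<sigma> \<tau>)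
  then have "smooth_near MG MA eG c"
    unfolding c_def[abs_def] by (rule lift_smooth[OF cMG _ openin_topspace]) (use h tG in auto)
  then have c: "lsm1 c" unfolding lsm1_def using 1 incl_jA(2)[OF h] by (simp add: c_def)
  have eq: "\<iota> (c s) \<odot> \<sigma> s = \<tau> s" if "s \<in> cG" for s
    using incl_jA(1)[OF h[OF that]] that section_in[OF \<sigma>] section_in[OF \<tau>] by (simp add: c_def E.m_assoc)
  have "fs \<tau> s t = cob c s t \<boxplus> fs \<sigma> s t" if "s \<in> cG" "t \<in> cG" for s t
    using section_change(2)[OF \<sigma> c that] eq that by (simp add: fs_def)
  then show ?thesis unfolding lsm_class_eq_iff[OF fs_lsm2[OF \<sigma>] fs_lsm2[OF \<tau>]] using c by blast
qed

lemma section_exists: "\<exists>\<sigma>. lsm_section G X \<sigma>"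
  using X by (simp add: locally_split_extension_def)

end

section \<open>Isomorphisms of Lie groups and equivalence of extensions\<close>

lemma lie_iso_id: "lie_group G \<Longrightarrow> lie_iso G G (\<lambda>x. x)"
proof -
  assume G: "lie_group G"
  note c = lie_groupD(2)[OF G]
  have s: "smooth_map (mfd G) (mfd G) (\<lambda>x. x)" using smooth_near_id[OF c] by (simp add: smooth_map_near_iff c)
  have "inv_into (carrier G) (\<lambda>x. x) x = x" if "x \<in> carrier G" for x using f_inv_into_f[of x "\<lambda>x. x"] that by simp
  then have "smooth_map (mfd G) (mfd G) (inv_into (carrier G) (\<lambda>x. x))"
    using lie_groupD(3)[OF G] by (intro smooth_map_cong[OF c c s]) simp
  then show ?thesis unfolding lie_iso_def using s by (auto simp: iso_def hom_def bij_betw_def)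
qed

lemma lie_iso_inv:
  assumes G: "lie_group G" and H: "lie_group H" and t: "lie_iso G H \<theta>"
  shows "lie_iso H G (inv_into (carrier G) \<theta>)"
proof -
  have iso: "\<theta> \<in> iso G H" and s: "smooth_map (mfd G) (mfd H) \<theta>" "smooth_map (mfd H) (mfd G) (inv_into (carrier G) \<theta>)"
    using t by (auto simp: lie_iso_def)
  have b: "bij_betw \<theta> (carrier G) (carrier H)" using iso by (simp add: iso_def)
  have "inv_into (carrier H) (inv_into (carrier G) \<theta>) x = \<theta> x" if "x \<in> carrier G" for x
    by (rule inv_into_inv_into_eq[OF b that])
  then have "smooth_map (mfd G) (mfd H) (inv_into (carrier H) (inv_into (carrier G) \<theta>))"
    using lie_groupD(3)[OF G] by (intro smooth_map_cong[OF lie_groupD(2)[OF G] lie_groupD(2)[OF H] s(1)]) simp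
  then show ?thesis unfolding lie_iso_def using s(2) group.iso_set_sym[OF lie_groupD(1)[OF G] iso] by blast
qed

lemma lie_iso_trans:
  assumes G: "lie_group G" and H: "lie_group H" and K: "lie_group K" and t: "lie_iso G H \<theta>" and u: "lie_iso H K \<eta>"
  shows "lie_iso G K (\<lambda>x. \<eta> (\<theta> x))"
proof -
  note cG = lie_groupD(2)[OF G] and cH = lie_groupD(2)[OF H] and cK = lie_groupD(2)[OF K]
  have iso: "\<theta> \<in> iso G H" "\<eta> \<in> iso H K" and s: "smooth_map (mfd G) (mfd H) \<theta>" "smooth_map (mfd H) (mfd G) (inv_into (carrier G) \<theta>)"
     "smooth_map (mfd H) (mfd K) \<eta>" "smooth_map (mfd K) (mfd H) (inv_into (carrier H) \<eta>)"
    using t u by (auto simp: lie_iso_def)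
  have b: "bij_betw \<theta> (carrier G) (carrier H)" "bij_betw \<eta> (carrier H) (carrier K)" using iso by (auto simp: iso_def)
  have b2: "bij_betw (\<lambda>x. \<eta> (\<theta> x)) (carrier G) (carrier K)" using bij_betw_trans[OF b] by (simp add: o_def)
  have "inv_into (carrier G) \<theta> (inv_into (carrier H) \<eta> y) = inv_into (carrier G) (\<lambda>x. \<eta> (\<theta> x)) y" if y: "y \<in> carrier K" for y
  proof -
    define x where "x = inv_into (carrier G) (\<lambda>x. \<eta> (\<theta> x)) y"
    have x: "x \<in> carrier G" "\<eta> (\<theta> x) = y" unfolding x_def
      using bij_betw_inv_into_right[OF b2 y] bij_betw_apply[OF bij_betw_inv_into[OF b2] y] by auto
    have "inv_into (carrier H) \<eta> y = \<theta> x" using x b by (metis bij_betw_apply bij_betw_inv_into_left)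
    then show ?thesis using x b(1) by (simp add: bij_betw_inv_into_left x_def[symmetric])
  qed
  then have "smooth_map (mfd K) (mfd G) (inv_into (carrier G) (\<lambda>x. \<eta> (\<theta> x)))"
    using lie_groupD(3)[OF K] by (intro smooth_map_cong[OF cK cG smooth_map_comp[OF cK cH cG s(4,2)]]) simp
  then show ?thesis unfolding lie_iso_def
    using iso_set_trans[OF iso] smooth_map_comp[OF cG cH cK s(1,3)] by (simp add: compose_def o_def)
qed

context lie_module
begin

lemma lie_extension_iff: "X \<in> locally_split_extensions G A act \<longleftrightarrow> lie_extension G A act X"
  unfolding locally_split_extensions_def lie_extension_def lie_extension_axioms_def using lie_module_axioms by simp

lemma ext_equivI:
  assumes "lie_extension G A act X" "lie_extension G A act Y" "lie_iso (ext X) (ext Y) \<theta>"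
    "\<And>a. a \<in> cA \<Longrightarrow> \<theta> (incl X a) = incl Y a" "\<And>e. e \<in> carrier (ext X) \<Longrightarrow> proj Y (\<theta> e) = proj X e"
  shows "(X, Y) \<in> extension_equivalence G A act"
  unfolding extension_equivalence_def using assms lie_extension_iff by blast

lemma ext_equivE:
  assumes "(X, Y) \<in> extension_equivalence G A act"
  obtains \<theta> where "lie_extension G A act X" "lie_extension G A act Y" "lie_iso (ext X) (ext Y) \<theta>"
    "\<And>a. a \<in> cA \<Longrightarrow> \<theta> (incl X a) = incl Y a" "\<And>e. e \<in> carrier (ext X) \<Longrightarrow> proj Y (\<theta> e) = proj X e"
  using assms unfolding extension_equivalence_def lie_extension_iff by blast

lemma equiv_extensions:
  "equiv (locally_split_extensions G A act :: ('g, 'a, 'e) extension set) (extension_equivalence G A act)"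
proof (rule equivI)
  show "extension_equivalence G A act \<subseteq> (locally_split_extensions G A act \<times> locally_split_extensions G A act :: ('g, 'a, 'e) extension rel)"
    unfolding extension_equivalence_def by blast
  show "refl_on (locally_split_extensions G A act) (extension_equivalence G A act :: ('g, 'a, 'e) extension rel)"
  proof (rule refl_onI)
    fix X :: "('g, 'a, 'e) extension" assume "X \<in> locally_split_extensions G A act"
    then have X: "lie_extension G A act X" by (simp add: lie_extension_iff)
    show "(X, X) \<in> extension_equivalence G A act"
      by (rule ext_equivI[OF X X lie_iso_id[OF lie_extension.E[OF X]]]) auto
  qed
  show "sym (extension_equivalence G A act :: ('g, 'a, 'e) extension rel)"
  proof (rule symI)
    fix X Y :: "('g, 'a, 'e) extension" assume "(X, Y) \<in> extension_equivalence G A act"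
    then obtain \<theta> where X: "lie_extension G A act X" and Y: "lie_extension G A act Y" and t: "lie_iso (ext X) (ext Y) \<theta>"
      "\<And>a. a \<in> cA \<Longrightarrow> \<theta> (incl X a) = incl Y a" "\<And>e. e \<in> carrier (ext X) \<Longrightarrow> proj Y (\<theta> e) = proj X e"
      by (rule ext_equivE) (rule that)
    interpret X: lie_extension G A act X by (rule X)
    interpret Y: lie_extension G A act Y by (rule Y)
    have b: "bij_betw \<theta> X.cE Y.cE" using t(1) by (simp add: lie_iso_def iso_def)
    show "(Y, X) \<in> extension_equivalence G A act"
    proof (rule ext_equivI[OF Y X lie_iso_inv[OF X.E Y.E t(1)]])
      show "inv_into X.cE \<theta> (incl Y a) = incl X a" if "a \<in> cA" for a
        using bij_betw_inv_into_left[OF b, of "incl X a"] t(2)[OF that] that by simp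
      show "proj X (inv_into X.cE \<theta> e) = proj Y e" if "e \<in> Y.cE" for e
        using t(3)[of "inv_into X.cE \<theta> e"] bij_betw_inv_into_right[OF b that] bij_betw_apply[OF bij_betw_inv_into[OF b] that] by simp
    qed
  qed
  show "trans (extension_equivalence G A act :: ('g, 'a, 'e) extension rel)"
  proof (rule transI)
    fix X Y Z :: "('g, 'a, 'e) extension" assume *: "(X, Y) \<in> extension_equivalence G A act" "(Y, Z) \<in> extension_equivalence G A act"
    obtain \<theta> where X: "lie_extension G A act X" and Y: "lie_extension G A act Y" and t: "lie_iso (ext X) (ext Y) \<theta>"
      "\<And>a. a \<in> cA \<Longrightarrow> \<theta> (incl X a) = incl Y a" "\<And>e. e \<in> carrier (ext X) \<Longrightarrow> proj Y (\<theta> e) = proj X e"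
      by (rule ext_equivE[OF *(1)]) (rule that)
    obtain \<eta> where Z: "lie_extension G A act Z" and u: "lie_iso (ext Y) (ext Z) \<eta>"
      "\<And>a. a \<in> cA \<Longrightarrow> \<eta> (incl Y a) = incl Z a" "\<And>e. e \<in> carrier (ext Y) \<Longrightarrow> proj Z (\<eta> e) = proj Y e"
      by (rule ext_equivE[OF *(2)]) (rule that)
    have b: "bij_betw \<theta> (carrier (ext X)) (carrier (ext Y))" using t(1) by (simp add: lie_iso_def iso_def)
    show "(X, Z) \<in> extension_equivalence G A act"
      by (rule ext_equivI[OF X Z lie_iso_trans[OF lie_extension.E[OF X] lie_extension.E[OF Y] lie_extension.E[OF Z] t(1) u(1)]])
        (use t u bij_betw_apply[OF b] in auto)
  qed
qed

text \<open>Composing \<open>\<sigma>\<close> with the isomorphism gives a section of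
  \<open>Y\<close> with the same factor set as \<open>\<sigma>\<close>, which reduces the claim to
  two sections of one extension.\<close>

lemma equivalent_same_class:
  assumes "(X, Y) \<in> extension_equivalence G A act" and \<sigma>: "lsm_section G X \<sigma>" and \<tau>: "lsm_section G Y \<tau>"
  shows "lsm_class G A act 2 (factor_set G A X \<sigma>) = lsm_class G A act 2 (factor_set G A Y \<tau>)"
proof -
  obtain \<theta> where X: "lie_extension G A act X" and Y: "lie_extension G A act Y" and t: "lie_iso (ext X) (ext Y) \<theta>"
      "\<And>a. a \<in> cA \<Longrightarrow> \<theta> (incl X a) = incl Y a" "\<And>e. e \<in> carrier (ext X) \<Longrightarrow> proj Y (\<theta> e) = proj X e"
    by (rule ext_equivE[OF assms(1)]) (rule that)
  interpret X: lie_extension G A act X by (rule X)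
  interpret Y: lie_extension G A act Y by (rule Y)
  have s: "smooth_map X.ME Y.ME \<theta>" and hom: "\<theta> \<in> hom (ext X) (ext Y)" using t(1) by (auto simp: lie_iso_def iso_def)
  interpret \<theta>: group_hom "ext X" "ext Y" \<theta> by unfold_locales (rule hom)
  note Xs = X.section_in[OF \<sigma>] X.proj_section[OF \<sigma>]
  have sec: "lsm_section G Y (\<lambda>s. \<theta> (\<sigma> s))"
    unfolding lsm_section_def
  proof (intro conjI ballI)
    show "(\<lambda>s. \<theta> (\<sigma> s)) \<in> measurable BG Y.BE"
      by (rule measurable_compose[OF X.section_measurable[OF \<sigma>] smooth_map_measurable[OF s]])
    have "smooth_near X.ME Y.ME (\<sigma> eG) \<theta>" by (rule smooth_map_nearD[OF s X.cME Y.cME]) (use Xs(1)[of eG] X.tE in simp)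
    from smooth_near_comp[OF cMG X.cME Y.cME X.section_smooth[OF \<sigma>] this]
    show "smooth_near MG Y.ME eG (\<lambda>s. \<theta> (\<sigma> s))" .
  qed (use t(3) Xs in simp)
  have "Y.fs (\<lambda>s. \<theta> (\<sigma> s)) s u = X.fs \<sigma> s u" if "s \<in> cG" "u \<in> cG" for s u
  proof -
    have "\<theta> (\<sigma> s) \<otimes>\<^bsub>ext Y\<^esub> \<theta> (\<sigma> u) \<otimes>\<^bsub>ext Y\<^esub> inv\<^bsub>ext Y\<^esub> \<theta> (\<sigma> (s \<star> u)) = \<theta> (incl X (X.fs \<sigma> s u))"
      unfolding X.incl_fs[OF \<sigma> that] using that Xs by simp
    then show ?thesis unfolding Y.fs_def using t(2) X.fs_closed[OF \<sigma> that] by simp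
  qed
  then have "fam2 (Y.fs (\<lambda>s. \<theta> (\<sigma> s))) = fam2 (X.fs \<sigma>)" by (rule fam2_cong)
  then show ?thesis unfolding X.factor_set_fam2 Y.factor_set_fam2 using Y.sections_cohomologous[OF sec \<tau>] by simp
qed

lemma same_class_equivalent:
  assumes X: "lie_extension G A act X" and Y: "lie_extension G A act Y"
    and \<sigma>: "lsm_section G X \<sigma>" and \<tau>: "lsm_section G Y \<tau>"
    and eq: "lsm_class G A act 2 (factor_set G A X \<sigma>) = lsm_class G A act 2 (factor_set G A Y \<tau>)"
  shows "(X, Y) \<in> extension_equivalence G A act"
proof -
  interpret X: lie_extension G A act X by (rule X)
  interpret Y: lie_extension G A act Y by (rule Y)
  obtain c where c: "lsm1 c" "\<And>s t. s \<in> cG \<Longrightarrow> t \<in> cG \<Longrightarrow> Y.fs \<tau> s t = cob c s t \<boxplus> X.fs \<sigma> s t"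
    using eq unfolding X.factor_set_fam2 Y.factor_set_fam2 lsm_class_eq_iff[OF X.fs_lsm2[OF \<sigma>] Y.fs_lsm2[OF \<tau>]] by blast
  \<comment> \<open>Changing \<open>\<sigma>\<close> by the cochain \<open>c\<close> adds
    \<open>cob c\<close> to its factor set, so \<open>\<rho>\<close> and \<open>\<tau>\<close> have
    the same factor set and the two groups the same multiplication table.\<close>
  define \<rho> where "\<rho> s = incl X (c s) \<otimes>\<^bsub>ext X\<^esub> \<sigma> s" for s
  have \<rho>: "lsm_section G X \<rho>" "\<And>s t. s \<in> cG \<Longrightarrow> t \<in> cG \<Longrightarrow> X.fs \<rho> s t = Y.fs \<tau> s t"
    using X.section_change[OF \<sigma> c(1)] c(2) by (simp_all add: \<rho>_def[abs_def])
  note Xs = X.section_in[OF \<rho>(1)] X.proj_section[OF \<rho>(1)] and Ys = Y.section_in[OF \<tau>] Y.proj_section[OF \<tau>]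
  define xc where "xc = X.coord \<rho>" define yc where "yc = Y.coord \<tau>"
  note Xc = X.coord[OF \<rho>(1), folded xc_def] and Yc = Y.coord[OF \<tau>, folded yc_def]
  define \<theta> where "\<theta> e = incl Y (xc e) \<otimes>\<^bsub>ext Y\<^esub> \<tau> (proj X e)" for e
  define \<eta> where "\<eta> e = incl X (yc e) \<otimes>\<^bsub>ext X\<^esub> \<rho> (proj Y e)" for e
  have tf: "\<theta> (incl X a \<otimes>\<^bsub>ext X\<^esub> \<rho> s) = incl Y a \<otimes>\<^bsub>ext Y\<^esub> \<tau> s" if "a \<in> cA" "s \<in> cG" for a s
    using that Xs Xc(3) by (simp add: \<theta>_def)
  have ef: "\<eta> (incl Y a \<otimes>\<^bsub>ext Y\<^esub> \<tau> s) = incl X a \<otimes>\<^bsub>ext X\<^esub> \<rho> s" if "a \<in> cA" "s \<in> cG" for a s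
    using that Ys Yc(3) by (simp add: \<eta>_def)
  have te: "\<theta> e \<in> Y.cE" "proj Y (\<theta> e) = proj X e" "\<eta> (\<theta> e) = e" if "e \<in> X.cE" for e
    using that Xc Ys ef[of "xc e" "proj X e"] by (simp_all add: \<theta>_def)
  have ee: "\<eta> e \<in> X.cE" "\<theta> (\<eta> e) = e" if "e \<in> Y.cE" for e
    using that Yc Xs tf[of "yc e" "proj Y e"] by (simp_all add: \<eta>_def)
  have hom: "\<theta> (e \<otimes>\<^bsub>ext X\<^esub> d) = \<theta> e \<otimes>\<^bsub>ext Y\<^esub> \<theta> d" if "e \<in> X.cE" "d \<in> X.cE" for e d
  proof -
    let ?a = "xc e" and ?b = "xc d" and ?s = "proj X e" and ?t = "proj X d"
    have ab: "?a \<in> cA" "?b \<in> cA" "?s \<in> cG" "?t \<in> cG" using that Xc by auto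
    have "e \<otimes>\<^bsub>ext X\<^esub> d = (incl X ?a \<otimes>\<^bsub>ext X\<^esub> \<rho> ?s) \<otimes>\<^bsub>ext X\<^esub> (incl X ?b \<otimes>\<^bsub>ext X\<^esub> \<rho> ?t)" using Xc(2) that by simp
    also have "\<dots> = incl X (?a \<boxplus> act ?s ?b \<boxplus> X.fs \<rho> ?s ?t) \<otimes>\<^bsub>ext X\<^esub> \<rho> (?s \<star> ?t)" by (rule X.mult_formula[OF \<rho>(1) ab(3,4,1,2)])
    finally have "\<theta> (e \<otimes>\<^bsub>ext X\<^esub> d) = incl Y (?a \<boxplus> act ?s ?b \<boxplus> Y.fs \<tau> ?s ?t) \<otimes>\<^bsub>ext Y\<^esub> \<tau> (?s \<star> ?t)"
      using tf ab X.fs_closed[OF \<rho>(1) ab(3,4)] \<rho>(2)[OF ab(3,4)] by simp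
    also have "\<dots> = \<theta> e \<otimes>\<^bsub>ext Y\<^esub> \<theta> d" unfolding \<theta>_def by (rule Y.mult_formula[OF \<tau> ab(3,4,1,2), symmetric])
    finally show ?thesis .
  qed
  have bij: "bij_betw \<theta> X.cE Y.cE" by (rule bij_betw_byWitness[where f' = \<eta>]) (use te ee in auto)
  have homt: "\<theta> \<in> hom (ext X) (ext Y)" using hom te by (auto simp: hom_def)
  have \<eta>inv: "inv_into X.cE \<theta> e = \<eta> e" if "e \<in> Y.cE" for e
    using bij_betw_inv_into_left[OF bij ee(1)[OF that]] ee(2)[OF that] by simp
  have "\<eta> (e \<otimes>\<^bsub>ext Y\<^esub> d) = \<eta> e \<otimes>\<^bsub>ext X\<^esub> \<eta> d" if "e \<in> Y.cE" "d \<in> Y.cE" for e d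
    using hom[of "\<eta> e" "\<eta> d"] ee that te(3)[of "\<eta> e \<otimes>\<^bsub>ext X\<^esub> \<eta> d"] by simp
  then have home: "\<eta> \<in> hom (ext Y) (ext X)" using ee by (auto simp: hom_def)
  \<comment> \<open>Stated for arbitrary manifolds, because it is applied to \<open>\<theta>\<close>
    and, with the roles of the extensions exchanged, to \<open>\<eta>\<close>.\<close>
  have near: "smooth_near M N p (\<lambda>e. i (k e) \<otimes>\<^bsub>N'\<^esub> \<tau> (q e))"
    if "charted M" "lie_group N'" "N = mfd N'" "smooth_near M MA p k" "smooth_near MA N (k p) i" "smooth_near M MG p q" "q p = eG" "smooth_near MG N eG \<tau>"
    for M :: "'m manifold" and N :: "'n manifold" and N' p i k \<tau> q
    using that lie_groupD(2)[OF that(2)]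
    by (auto intro!: smooth_near_mult[OF that(2,1)] smooth_near_comp[OF that(1) cMA _ that(4)] smooth_near_comp[OF that(1) cMG _ that(6)])
  have "smooth_near X.ME Y.ME X.eE \<theta>" unfolding \<theta>_def[abs_def]
    by (rule near[OF X.cME Y.E refl _ Y.incl_near X.proj_near[OF X.E.one_closed]])
      (use X.coord_smooth[OF \<rho>(1)] Y.section_smooth[OF \<tau>] Xc(1) in \<open>auto simp: xc_def\<close>)
  then have st: "smooth_map X.ME Y.ME \<theta>"
    by (rule smooth_map_hom[OF lie_group_left_lie[OF X.E] lie_group_left_lie[OF Y.E] homt])
  have "smooth_near Y.ME X.ME Y.eE \<eta>" unfolding \<eta>_def[abs_def]
    by (rule near[OF Y.cME X.E refl _ X.incl_near Y.proj_near[OF Y.E.one_closed]])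
      (use Y.coord_smooth[OF \<tau>] X.section_smooth[OF \<rho>(1)] Yc(1) in \<open>auto simp: yc_def\<close>)
  then have se: "smooth_map Y.ME X.ME \<eta>"
    by (rule smooth_map_hom[OF lie_group_left_lie[OF Y.E] lie_group_left_lie[OF X.E] home])
  have "smooth_map Y.ME X.ME (inv_into X.cE \<theta>)"
    by (rule smooth_map_cong[OF Y.cME X.cME se]) (use \<eta>inv Y.tE in simp)
  then have iso: "lie_iso (ext X) (ext Y) \<theta>" unfolding lie_iso_def iso_def using homt bij st by simp
  show ?thesis
  proof (rule ext_equivI[OF X Y iso])
    fix a assume a: "a \<in> cA"
    \<comment> \<open>Sections need not take the identity to the identity: the value at
      \<open>eG\<close> is the image of the factor set at \<open>(eG, eG)\<close>. Writing
      \<open>incl X a\<close> in normal form therefore shifts \<open>a\<close> by the inverse of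
      that element, which is the same in both extensions.\<close>
    have r1: "\<rho> eG = incl X (X.fs \<rho> eG eG)"
      using X.incl_fs[OF \<rho>(1), of eG eG] Xs by (simp add: X.E.m_assoc)
    have t1: "\<tau> eG = incl Y (Y.fs \<tau> eG eG)"
      using Y.incl_fs[OF \<tau>, of eG eG] Ys by (simp add: Y.E.m_assoc)
    let ?f = "X.fs \<rho> eG eG"
    have f: "?f \<in> cA" "Y.fs \<tau> eG eG = ?f" using X.fs_closed[OF \<rho>(1)] \<rho>(2) by auto
    have "incl X a = incl X (a \<boxplus> iA ?f) \<otimes>\<^bsub>ext X\<^esub> \<rho> eG" using r1 a f by (simp add: X.incl_mult[symmetric] A.m_assoc)
    then have "\<theta> (incl X a) = incl Y (a \<boxplus> iA ?f) \<otimes>\<^bsub>ext Y\<^esub> \<tau> eG" using tf a f by simp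
    also have "\<dots> = incl Y a" using t1 a f by (simp add: Y.incl_mult[symmetric] A.m_assoc)
    finally show "\<theta> (incl X a) = incl Y a" .
  qed (rule te(2))
qed

end

section \<open>Groups charted by the translates of one chart\<close>

text \<open>The final topology for the maps taking \<open>q\<close> in \<open>Q\<close> to
  \<open>m g (\<kappa> q)\<close>, one for each \<open>g\<close> in \<open>C\<close>. When
  \<open>m\<close> is a group multiplication, left translations permute these maps and are
  continuous by construction.\<close>

definition translated_topology :: "'e set \<Rightarrow> ('e \<Rightarrow> 'e \<Rightarrow> 'e) \<Rightarrow> 'p topology \<Rightarrow> 'p set \<Rightarrow> ('p \<Rightarrow> 'e) \<Rightarrow> 'e topology" where
  "translated_topology C m T Q \<kappa> = topology (\<lambda>W. W \<subseteq> C \<and> (\<forall>g\<in>C. openin T {q \<in> Q. m g (\<kappa> q) \<in> W}))"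

definition translated_manifold :: "'e set \<Rightarrow> ('e \<Rightarrow> 'e \<Rightarrow> 'e) \<Rightarrow> 'p manifold \<Rightarrow> 'p set \<Rightarrow> ('p \<Rightarrow> 'e) \<Rightarrow> 'e manifold" where
  "translated_manifold C m P Q \<kappa> = \<lparr>mtop = translated_topology C m (mtop P) Q \<kappa>, mdim = mdim P,
     atlas = {((\<lambda>q. m g (\<kappa> q)) ` (U \<inter> Q), \<lambda>y. \<phi> (inv_into Q (\<lambda>q. m g (\<kappa> q)) y)) | g U \<phi>. g \<in> C \<and> (U, \<phi>) \<in> atlas P}\<rparr>"

lemma openin_translated:
  assumes "openin T Q"
  shows "openin (translated_topology C m T Q \<kappa>) W \<longleftrightarrow> W \<subseteq> C \<and> (\<forall>g\<in>C. openin T {q \<in> Q. m g (\<kappa> q) \<in> W})"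
proof -
  have "istopology (\<lambda>W. W \<subseteq> C \<and> (\<forall>g\<in>C. openin T {q \<in> Q. m g (\<kappa> q) \<in> W}))"
    unfolding istopology_def
  proof (intro conjI allI impI ballI)
    fix S R g assume "S \<subseteq> C \<and> (\<forall>g\<in>C. openin T {q \<in> Q. m g (\<kappa> q) \<in> S})" "R \<subseteq> C \<and> (\<forall>g\<in>C. openin T {q \<in> Q. m g (\<kappa> q) \<in> R})" "g \<in> C"
    then have "openin T ({q \<in> Q. m g (\<kappa> q) \<in> S} \<inter> {q \<in> Q. m g (\<kappa> q) \<in> R})" by blast
    moreover have "{q \<in> Q. m g (\<kappa> q) \<in> S} \<inter> {q \<in> Q. m g (\<kappa> q) \<in> R} = {q \<in> Q. m g (\<kappa> q) \<in> S \<inter> R}" by blast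
    ultimately show "openin T {q \<in> Q. m g (\<kappa> q) \<in> S \<inter> R}" by simp
  next
    fix K g assume "\<forall>S\<in>K. S \<subseteq> C \<and> (\<forall>g\<in>C. openin T {q \<in> Q. m g (\<kappa> q) \<in> S})" "g \<in> C"
    then have "openin T (\<Union>S\<in>K. {q \<in> Q. m g (\<kappa> q) \<in> S})" by blast
    moreover have "(\<Union>S\<in>K. {q \<in> Q. m g (\<kappa> q) \<in> S}) = {q \<in> Q. m g (\<kappa> q) \<in> \<Union>K}" by blast
    ultimately show "openin T {q \<in> Q. m g (\<kappa> q) \<in> \<Union>K}" by simp
  qed blast+
  then show ?thesis unfolding translated_topology_def by simp
qed

text \<open>\<open>\<kappa>\<close> identifies all of \<open>P\<close> with \<open>E\<close> as a
  set, but the smooth structure of \<open>P\<close> is transported from \<open>Q\<close> only, by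
  left translates. By \<open>trans\<close> two translates are compatible where they overlap. Off
  \<open>Q\<close> the map \<open>\<kappa>\<close> is merely shown to be Borel, under further
  hypotheses.\<close>

locale translated_group =
  fixes E :: "'e lie_struct" (structure) and P :: "'p manifold" and Q :: "'p set" and \<kappa> :: "'p \<Rightarrow> 'e" and k :: "'e \<Rightarrow> 'p"
  assumes grp: "group E" and mfd: "mfd E = translated_manifold (carrier E) (mult E) P Q \<kappa>"
    and cP: "charted P" and Q: "openin (mtop P) Q" and k1: "k \<one> \<in> Q"
    and \<kappa>k: "\<And>x. x \<in> topspace (mtop P) \<Longrightarrow> \<kappa> x \<in> carrier E \<and> k (\<kappa> x) = x"
    and k\<kappa>: "\<And>e. e \<in> carrier E \<Longrightarrow> k e \<in> topspace (mtop P) \<and> \<kappa> (k e) = e"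
    and trans: "\<And>g q. g \<in> carrier E \<Longrightarrow> q \<in> Q \<Longrightarrow> k (g \<otimes> \<kappa> q) \<in> Q \<Longrightarrow> smooth_near P P q (\<lambda>x. k (g \<otimes> \<kappa> x))"
    and smooth_mult: "smooth_near (prod_manifold P P) P (k \<one>, k \<one>) (\<lambda>z. k (\<kappa> (fst z) \<otimes> \<kappa> (snd z)))"
    and smooth_inv: "smooth_near P P (k \<one>) (\<lambda>x. k (inv (\<kappa> x)))"
begin

sublocale group E by (rule grp)

abbreviation "T \<equiv> mtop (mfd E)"
abbreviation "e g q \<equiv> g \<otimes> \<kappa> q"
abbreviation "r g \<equiv> inv_into Q (e g)"

lemma Q_sub: "q \<in> Q \<Longrightarrow> q \<in> topspace (mtop P)" using openin_subset[OF Q] by blast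

lemma mtop_E: "T = translated_topology (carrier E) (mult E) (mtop P) Q \<kappa>"
  and mdim_E: "mdim (mfd E) = mdim P"
  and atlas_E: "(W, \<xi>) \<in> atlas (mfd E) \<longleftrightarrow> (\<exists>g U \<phi>. g \<in> carrier E \<and> (U, \<phi>) \<in> atlas P \<and> W = e g ` (U \<inter> Q) \<and> \<xi> = (\<lambda>y. \<phi> (r g y)))"
  by (auto simp: mfd translated_manifold_def)

lemma e_in [simp]: "g \<in> carrier E \<Longrightarrow> q \<in> Q \<Longrightarrow> e g q \<in> carrier E"
  using \<kappa>k Q_sub by simp

lemma ke: "g \<in> carrier E \<Longrightarrow> q \<in> Q \<Longrightarrow> k (inv g \<otimes> e g q) = q"
  using \<kappa>k Q_sub by (simp add: m_assoc[symmetric])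

lemma ek: "g \<in> carrier E \<Longrightarrow> y \<in> carrier E \<Longrightarrow> e g (k (inv g \<otimes> y)) = y"
  using k\<kappa> by (simp add: m_assoc[symmetric])

lemma e_image_iff: "g \<in> carrier E \<Longrightarrow> D \<subseteq> Q \<Longrightarrow> y \<in> e g ` D \<longleftrightarrow> y \<in> carrier E \<and> k (inv g \<otimes> y) \<in> D"
  using ke ek by (auto simp: image_iff) (metis subsetD)+

lemma inj_e: "g \<in> carrier E \<Longrightarrow> inj_on (e g) Q"
  by (rule inj_on_inverseI[of Q "\<lambda>y. k (inv g \<otimes> y)"]) (rule ke)

lemma re [simp]: "g \<in> carrier E \<Longrightarrow> q \<in> Q \<Longrightarrow> r g (e g q) = q"
  by (rule inv_into_f_f[OF inj_e])

lemma rk: "g \<in> carrier E \<Longrightarrow> y \<in> e g ` Q \<Longrightarrow> r g y = k (inv g \<otimes> y)"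
  using ke by auto

lemma openin_E: "openin T W \<longleftrightarrow> W \<subseteq> carrier E \<and> (\<forall>g\<in>carrier E. openin (mtop P) {q \<in> Q. e g q \<in> W})"
  unfolding mtop_E by (rule openin_translated[OF Q])

lemma topspace_E: "topspace T = carrier E"
proof -
  have "{q \<in> Q. e g q \<in> carrier E} = Q" if "g \<in> carrier E" for g using that by auto
  then have "openin T (carrier E)" unfolding openin_E using Q by simp
  moreover have "topspace T \<subseteq> carrier E" using openin_topspace openin_E by metis
  ultimately show ?thesis using openin_subset by blast
qed

text \<open>Openness of the domain comes with smoothness: near a point of the domain the map is
  continuous and its value lies in the open set \<open>Q\<close>.\<close>

lemma transition_on:
  assumes "g \<in> carrier E" shows "smooth_map_on P P {q \<in> Q. k (g \<otimes> \<kappa> q) \<in> Q} (\<lambda>x. k (g \<otimes> \<kappa> x))"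
proof -
  have "openin (mtop P) {q \<in> Q. k (g \<otimes> \<kappa> q) \<in> Q}"
  proof (subst openin_subopen, intro ballI)
    fix q assume "q \<in> {q \<in> Q. k (g \<otimes> \<kappa> q) \<in> Q}"
    then have q: "q \<in> Q" "k (g \<otimes> \<kappa> q) \<in> Q" by auto
    obtain D where D: "openin (mtop P) D" "q \<in> D" "(\<lambda>x. k (g \<otimes> \<kappa> x)) ` D \<subseteq> Q"
      using smooth_near_open[OF trans[OF assms q] Q q(2)] by blast
    show "\<exists>T. openin (mtop P) T \<and> q \<in> T \<and> T \<subseteq> {q \<in> Q. k (g \<otimes> \<kappa> q) \<in> Q}"
      by (intro exI[of _ "D \<inter> Q"]) (use D Q q in blast)
  qed
  then show ?thesis unfolding smooth_map_on_iff[OF cP cP] using trans[OF assms] by simp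
qed

text \<open>Seen from the translate by \<open>h\<close>, the set is the preimage of \<open>D\<close>
  under a transition map, which is continuous on an open domain.\<close>

lemma open_translate:
  assumes g: "g \<in> carrier E" and D: "openin (mtop P) D" "D \<subseteq> Q"
  shows "openin T (e g ` D)"
  unfolding openin_E
proof (intro conjI ballI)
  show "e g ` D \<subseteq> carrier E" using g D by auto
  fix h assume h: "h \<in> carrier E"
  then have gh: "inv g \<otimes> h \<in> carrier E" using g by simp
  have "{q \<in> Q. e h q \<in> e g ` D} = {q \<in> {q \<in> Q. k (inv g \<otimes> h \<otimes> \<kappa> q) \<in> Q}. k (inv g \<otimes> h \<otimes> \<kappa> q) \<in> D}"
    using h g D Q_sub \<kappa>k by (auto simp: e_image_iff[OF g D(2)] m_assoc)
  then show "openin (mtop P) {q \<in> Q. e h q \<in> e g ` D}"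
    using openin_preimage_on[OF smooth_map_onD(1,2)[OF transition_on[OF gh]] D(1)] by simp
qed

lemma cont_e: "g \<in> carrier E \<Longrightarrow> continuous_map (subtopology (mtop P) Q) T (e g)"
  unfolding continuous_map_def using openin_open_subtopology[OF Q] openin_subset[OF Q]
  by (auto simp: topspace_E openin_E Int_absorb1)

lemma cont_r: assumes g: "g \<in> carrier E" shows "continuous_map (subtopology T (e g ` Q)) (mtop P) (r g)"
proof -
  have o: "openin T (e g ` Q)" by (rule open_translate[OF g Q subset_refl])
  have "openin T {y \<in> e g ` Q. r g y \<in> D}" if D: "openin (mtop P) D" for D
  proof -
    have "{y \<in> e g ` Q. r g y \<in> D} = e g ` (D \<inter> Q)" using g by auto
    then show ?thesis using open_translate[OF g, of "D \<inter> Q"] D Q by auto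
  qed
  then show ?thesis unfolding continuous_map_def
    using openin_open_subtopology[OF o] openin_subset[OF o] Q_sub g by (auto simp: Int_absorb1)
qed

context
  fixes g U \<phi> assumes g: "g \<in> carrier E" and U: "(U, \<phi>) \<in> atlas P"
begin

lemma chart_E:
  shows "openin T (e g ` (U \<inter> Q))" "(\<lambda>y. \<phi> (r g y)) ` e g ` (U \<inter> Q) = \<phi> ` (U \<inter> Q)"
    "openin (Euclidean_space (mdim P)) ((\<lambda>y. \<phi> (r g y)) ` e g ` (U \<inter> Q))"
    "homeomorphic_map (subtopology T (e g ` (U \<inter> Q)))
       (subtopology (Euclidean_space (mdim P)) ((\<lambda>y. \<phi> (r g y)) ` e g ` (U \<inter> Q))) (\<lambda>y. \<phi> (r g y))"
    "\<And>z. z \<in> \<phi> ` (U \<inter> Q) \<Longrightarrow> inv_into (e g ` (U \<inter> Q)) (\<lambda>y. \<phi> (r g y)) z = e g (inv_into U \<phi> z)"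
proof -
  note oU = chart_open[OF cP U]
  have UQ: "openin (mtop P) (U \<inter> Q)" using oU Q by auto
  show o: "openin T (e g ` (U \<inter> Q))" by (rule open_translate[OF g UQ]) simp
  have B: "openin (Euclidean_space (mdim P)) (\<phi> ` (U \<inter> Q))" by (rule chart_image_open[OF cP U UQ]) simp
  have c: "continuous_map (subtopology T (e g ` (U \<inter> Q))) (Euclidean_space (mdim P)) (\<lambda>y. \<phi> (r g y))"
  proof (rule continuous_map_compose[of _ "subtopology (mtop P) U" "r g", unfolded o_def])
    show "continuous_map (subtopology T (e g ` (U \<inter> Q))) (subtopology (mtop P) U) (r g)"
      unfolding continuous_map_in_subtopology
      using continuous_map_from_subtopology_mono[OF cont_r[OF g], of "e g ` (U \<inter> Q)"] g by auto
  qed (rule chart_cont[OF cP U])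
  have i: "inv_into U \<phi> z \<in> U \<inter> Q" "\<phi> (inv_into U \<phi> z) = z" if "z \<in> \<phi> ` (U \<inter> Q)" for z
    using that chart_inv[OF cP U] by auto
  have ci: "continuous_map (subtopology (Euclidean_space (mdim P)) (\<phi> ` (U \<inter> Q))) T (\<lambda>z. e g (inv_into U \<phi> z))"
  proof (rule continuous_map_compose[of _ "subtopology (mtop P) Q" "inv_into U \<phi>", unfolded o_def])
    show "continuous_map (subtopology (Euclidean_space (mdim P)) (\<phi> ` (U \<inter> Q))) (subtopology (mtop P) Q) (inv_into U \<phi>)"
      unfolding continuous_map_in_subtopology
      using continuous_map_from_subtopology_mono[OF chart_inv_cont[OF cP U], of "\<phi> ` (U \<inter> Q)"] i(1) by auto
  qed (rule cont_e[OF g])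
  show "(\<lambda>y. \<phi> (r g y)) ` e g ` (U \<inter> Q) = \<phi> ` (U \<inter> Q)" using g by (auto simp: image_image)
  have f: "\<phi> (r g x) \<in> \<phi> ` (U \<inter> Q) \<and> e g (inv_into U \<phi> (\<phi> (r g x))) = x" if "x \<in> e g ` (U \<inter> Q)" for x
    using that g chart_inv[OF cP U] by auto
  have f': "e g (inv_into U \<phi> z) \<in> e g ` (U \<inter> Q) \<and> \<phi> (r g (e g (inv_into U \<phi> z))) = z" if "z \<in> \<phi> ` (U \<inter> Q)" for z
    using i[OF that] g by auto
  show "openin (Euclidean_space (mdim P)) ((\<lambda>y. \<phi> (r g y)) ` e g ` (U \<inter> Q))"
    "homeomorphic_map (subtopology T (e g ` (U \<inter> Q)))
       (subtopology (Euclidean_space (mdim P)) ((\<lambda>y. \<phi> (r g y)) ` e g ` (U \<inter> Q))) (\<lambda>y. \<phi> (r g y))"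
    "\<And>z. z \<in> \<phi> ` (U \<inter> Q) \<Longrightarrow> inv_into (e g ` (U \<inter> Q)) (\<lambda>y. \<phi> (r g y)) z = e g (inv_into U \<phi> z)"
    by (rule chart_from_inverse[OF o B c ci]; use f f' in simp)+
qed

end

lemma charted_E: "charted (mfd E)"
proof (rule chartedI)
  show "\<Union> (fst ` atlas (mfd E)) = topspace T"
  proof (rule equalityI; rule subsetI)
    fix y assume "y \<in> \<Union> (fst ` atlas (mfd E))"
    then show "y \<in> topspace T" using topspace_E e_in by (force simp: mfd translated_manifold_def)
  next
    fix y assume "y \<in> topspace T"
    then have y: "y \<in> carrier E" using topspace_E by simp
    obtain U \<phi> where U: "(U, \<phi>) \<in> atlas P" "k \<one> \<in> U" using chart_at[OF cP Q_sub[OF k1]] .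
    have "y = e y (k \<one>)" using y k\<kappa> by simp
    then have "y \<in> e y ` (U \<inter> Q)" using U k1 by blast
    then show "y \<in> \<Union> (fst ` atlas (mfd E))" using atlas_E[of "e y ` (U \<inter> Q)" "\<lambda>z. \<phi> (r y z)"] U y by (force simp: image_iff)
  qed
next
  fix W \<xi> assume "(W, \<xi>) \<in> atlas (mfd E)"
  then obtain g U \<phi> where g: "g \<in> carrier E" "(U, \<phi>) \<in> atlas P" "W = e g ` (U \<inter> Q)" "\<xi> = (\<lambda>y. \<phi> (r g y))"
    unfolding atlas_E by blast
  show "openin T W \<and> openin (Euclidean_space (mdim (mfd E))) (\<xi> ` W) \<and>
        homeomorphic_map (subtopology T W) (subtopology (Euclidean_space (mdim (mfd E))) (\<xi> ` W)) \<xi>"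
    unfolding g(3,4) mdim_E using chart_E[OF g(1,2)] by blast
next
  fix W \<xi> W' \<xi>' assume "(W, \<xi>) \<in> atlas (mfd E)" "(W', \<xi>') \<in> atlas (mfd E)"
  then obtain g U \<phi> h V \<psi> where g: "g \<in> carrier E" "(U, \<phi>) \<in> atlas P" "W = e g ` (U \<inter> Q)" "\<xi> = (\<lambda>y. \<phi> (r g y))"
     and h: "h \<in> carrier E" "(V, \<psi>) \<in> atlas P" "W' = e h ` (V \<inter> Q)" "\<xi>' = (\<lambda>y. \<psi> (r h y))"
    unfolding atlas_E by blast
  \<comment> \<open>In the coordinates of \<open>P\<close>, passing from the translate by
    \<open>g\<close> to the translate by \<open>h\<close> is left multiplication by
    \<open>inv h \<otimes> g\<close>.\<close>
  let ?T = "\<lambda>x. k (inv h \<otimes> g \<otimes> \<kappa> x)"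
  have hg: "inv h \<otimes> g \<in> carrier E" using g h by simp
  let ?D = "{q \<in> Q. ?T q \<in> Q} \<inter> U \<inter> ?T -` V"
  have mem: "e g x \<in> e h ` (V \<inter> Q) \<longleftrightarrow> ?T x \<in> V \<inter> Q" if "x \<in> Q" for x
    using e_image_iff[OF h(1), of "V \<inter> Q" "e g x"] g h that \<kappa>k Q_sub by (auto simp: m_assoc)
  have "\<xi> ` (W \<inter> W') = \<phi> ` ?D"
  proof -
    have "W \<inter> W' = e g ` ?D" unfolding g(3) h(3) using mem by blast
    then show ?thesis using g(1) by (auto simp: g(4) image_image)
  qed
  moreover have "smooth_euclidean (mdim P) (mdim P) (\<phi> ` ?D) (\<xi>' \<circ> inv_into W \<xi>)"
  proof (rule smooth_euclidean_cong[OF chart_image_open[OF cP g(2)] _ smooth_map_onD(3)[OF transition_on[OF hg] g(2) h(2)]])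
    have "openin (mtop P) {x \<in> {q \<in> Q. ?T q \<in> Q}. ?T x \<in> V}"
      by (rule openin_preimage_on[OF smooth_map_onD(1,2)[OF transition_on[OF hg]] chart_open[OF cP h(2)]])
    then have "openin (mtop P) ({x \<in> {q \<in> Q. ?T q \<in> Q}. ?T x \<in> V} \<inter> U)" using chart_open[OF cP g(2)] by blast
    moreover have "{x \<in> {q \<in> Q. ?T q \<in> Q}. ?T x \<in> V} \<inter> U = ?D" by blast
    ultimately show "openin (mtop P) ?D" by simp
    show "?D \<subseteq> U" by blast
    fix z j assume "z \<in> \<phi> ` ?D"
    then obtain x where x: "x \<in> ?D" "z = \<phi> x" by blast
    have i: "inv_into U \<phi> z = x" using chart_inv[OF cP g(2)] x by auto
    have "inv_into W \<xi> z = e g x"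
      using chart_E(5)[OF g(1,2), of z] x i by (auto simp: g(3,4))
    moreover have "r h (e g x) = ?T x"
      using rk[OF h(1), of "e g x"] mem[of x] x g h \<kappa>k Q_sub by (auto simp: m_assoc)
    ultimately show "(\<psi> \<circ> ?T \<circ> inv_into U \<phi>) z j = (\<xi>' \<circ> inv_into W \<xi>) z j"
      using i by (simp add: h(4))
  qed
  ultimately show "smooth_euclidean (mdim (mfd E)) (mdim (mfd E)) (\<xi> ` (W \<inter> W')) (\<xi>' \<circ> inv_into W \<xi>)"
    by (simp add: mdim_E)
qed

lemma smooth_near_e:
  assumes g: "g \<in> carrier E" and q: "q \<in> Q"
  shows "smooth_near P (mfd E) q (e g)" "smooth_near (mfd E) P (e g q) (\<lambda>y. k (inv g \<otimes> y))"
proof -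
  obtain U \<phi> where U: "(U, \<phi>) \<in> atlas P" "q \<in> U" using chart_at[OF cP Q_sub[OF q]] .
  have UQ: "openin (mtop P) (U \<inter> Q)" using chart_open[OF cP U(1)] Q by auto
  have a: "(e g ` (U \<inter> Q), \<lambda>y. \<phi> (r g y)) \<in> atlas (mfd E)" unfolding atlas_E using g U by blast
  note C = chart_E[OF g U(1)]
  have B: "openin (Euclidean_space (mdim P)) (\<phi> ` (U \<inter> Q))" by (rule chart_image_open[OF cP U(1) UQ]) simp
  have id: "smooth_euclidean (mdim P) (mdim P) (\<phi> ` (U \<inter> Q)) (\<lambda>z. z)"
    unfolding smooth_euclidean_def using Ck_coord[OF B] by blast
  have "smooth_euclidean (mdim P) (mdim P) (\<phi> ` (U \<inter> Q)) ((\<lambda>y. \<phi> (r g y)) \<circ> e g \<circ> inv_into U \<phi>)"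
    by (rule smooth_euclidean_cong[OF B _ id]) (use g chart_inv[OF cP U(1)] in auto)
  then show "smooth_near P (mfd E) q (e g)"
    by (intro smooth_near_chartI[OF cP charted_E UQ _ U(1) _ a]) (use U q mdim_E in auto)
  have "smooth_euclidean (mdim P) (mdim P) (\<phi> ` (U \<inter> Q)) (\<phi> \<circ> r g \<circ> inv_into (e g ` (U \<inter> Q)) (\<lambda>y. \<phi> (r g y)))"
    by (rule smooth_euclidean_cong[OF B _ id]) (use C(5) g chart_inv[OF cP U(1)] in auto)
  then have "smooth_near (mfd E) P (e g q) (r g)"
    by (intro smooth_near_chartI[OF charted_E cP C(1) _ a _ U(1)]) (use U q mdim_E C(2) g in auto)
  then show "smooth_near (mfd E) P (e g q) (\<lambda>y. k (inv g \<otimes> y))"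
    by (rule smooth_near_cong[OF charted_E cP _ open_translate[OF g Q subset_refl]]) (use q rk[OF g] in auto)
qed

lemma smooth_near_\<kappa>: "q \<in> Q \<Longrightarrow> smooth_near P (mfd E) q \<kappa>"
proof -
  assume q: "q \<in> Q"
  show ?thesis by (rule smooth_near_cong[OF cP charted_E smooth_near_e(1)[OF one_closed q] Q q]) (use \<kappa>k Q_sub in auto)
qed

lemma smooth_near_k: "y \<in> carrier E \<Longrightarrow> k y \<in> Q \<Longrightarrow> smooth_near (mfd E) P y k"
proof -
  assume y: "y \<in> carrier E" "k y \<in> Q"
  have "smooth_near (mfd E) P y (\<lambda>y. k (inv \<one> \<otimes> y))" using smooth_near_e(2)[OF one_closed y(2)] k\<kappa> y by simp
  then show ?thesis by (rule smooth_near_cong[OF charted_E cP _ openin_topspace]) (use topspace_E y in auto)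
qed

text \<open>Left multiplication by \<open>g\<close> takes the chart at \<open>x\<close> to the chart
  at \<open>g \<otimes> x\<close> and is the identity in these coordinates. Near the identity,
  multiplication and inversion are those given on \<open>P\<close>.\<close>

lemma left_lie_E: "left_lie_group E"
  unfolding left_lie_group_def
proof (intro conjI ballI grp charted_E topspace_E)
  fix g x assume g: "g \<in> carrier E" "x \<in> carrier E"
  have "smooth_near (mfd E) P (e x (k \<one>)) (\<lambda>y. k (inv x \<otimes> y))" by (rule smooth_near_e(2)[OF g(2) k1])
  then have 1: "smooth_near (mfd E) P x (\<lambda>y. k (inv x \<otimes> y))" using k\<kappa> g by simp
  have "smooth_near (mfd E) (mfd E) x (\<lambda>y. e (g \<otimes> x) (k (inv x \<otimes> y)))"
    by (rule smooth_near_comp[OF charted_E cP charted_E 1 smooth_near_e(1)]) (use g k1 in auto)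
  then show "smooth_near (mfd E) (mfd E) x (\<lambda>y. g \<otimes> y)"
  proof (rule smooth_near_cong[OF charted_E charted_E _ openin_topspace])
    fix y assume "y \<in> topspace T"
    then have y: "y \<in> carrier E" using topspace_E by simp
    then have "e (g \<otimes> x) (k (inv x \<otimes> y)) = g \<otimes> e x (k (inv x \<otimes> y))" using g k\<kappa> by (simp add: m_assoc)
    then show "e (g \<otimes> x) (k (inv x \<otimes> y)) = g \<otimes> y" using ek g y by simp
  qed (use g topspace_E in simp)
next
  let ?EE = "prod_manifold (mfd E) (mfd E)"
  note cEE = charted_prod[OF charted_E charted_E]
  have o: "(\<one>, \<one>) \<in> topspace (prod_topology T T)" using topspace_E by simp
  have k: "smooth_near (mfd E) P \<one> k" by (rule smooth_near_k[OF one_closed k1])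
  have "smooth_near ?EE P (\<one>, \<one>) (\<lambda>z. k (fst z))" "smooth_near ?EE P (\<one>, \<one>) (\<lambda>z. k (snd z))"
    by (rule smooth_near_comp[OF cEE charted_E cP smooth_near_fst[OF charted_E charted_E o]]
        smooth_near_comp[OF cEE charted_E cP smooth_near_snd[OF charted_E charted_E o]]; use k in simp)+
  note p = smooth_near_pair[OF cEE cP cP this]
  have "smooth_near ?EE P (\<one>, \<one>) (\<lambda>z. k (\<kappa> (k (fst z)) \<otimes> \<kappa> (k (snd z))))"
    using smooth_near_comp[OF cEE charted_prod[OF cP cP] cP p, of "\<lambda>z. k (\<kappa> (fst z) \<otimes> \<kappa> (snd z))"] smooth_mult by simp
  from smooth_near_comp[OF cEE cP charted_E this smooth_near_\<kappa>]
  have "smooth_near ?EE (mfd E) (\<one>, \<one>) (\<lambda>z. \<kappa> (k (\<kappa> (k (fst z)) \<otimes> \<kappa> (k (snd z)))))" using k\<kappa> k1 by simp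
  then show "smooth_near ?EE (mfd E) (\<one>, \<one>) (\<lambda>(x, y). x \<otimes> y)"
    by (rule smooth_near_cong[OF cEE charted_E _ openin_topspace]) (use k\<kappa> topspace_E in auto)
  have "smooth_near (mfd E) P \<one> (\<lambda>x. k (inv (\<kappa> (k x))))"
    by (rule smooth_near_comp[OF charted_E cP cP k smooth_inv])
  from smooth_near_comp[OF charted_E cP charted_E this smooth_near_\<kappa>]
  have "smooth_near (mfd E) (mfd E) \<one> (\<lambda>x. \<kappa> (k (inv (\<kappa> (k x)))))" using k\<kappa> k1 by simp
  then show "smooth_near (mfd E) (mfd E) \<one> (\<lambda>x. inv x)"
    by (rule smooth_near_cong[OF charted_E charted_E _ openin_topspace]) (use k\<kappa> topspace_E in auto)
qed

text \<open>If the quotient of two points corresponds to a point of \<open>Q\<close>, they share a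
  translate of \<open>Q\<close> and are separated inside it; \<open>sep\<close> provides the
  separation in the remaining case.\<close>

lemma Hausdorff_E:
  assumes P: "Hausdorff_space (mtop P)"
    and sep: "\<And>x y. x \<in> carrier E \<Longrightarrow> y \<in> carrier E \<Longrightarrow> k (inv x \<otimes> y) \<in> Q \<or> (\<exists>U V. openin T U \<and> openin T V \<and> x \<in> U \<and> y \<in> V \<and> disjnt U V)"
  shows "Hausdorff_space T"
  unfolding Hausdorff_space_def
proof (intro allI impI)
  fix x y assume "x \<in> topspace T \<and> y \<in> topspace T \<and> x \<noteq> y"
  then have xy: "x \<in> carrier E" "y \<in> carrier E" "x \<noteq> y" using topspace_E by auto
  show "\<exists>U V. openin T U \<and> openin T V \<and> x \<in> U \<and> y \<in> V \<and> disjnt U V"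
  proof (cases "k (inv x \<otimes> y) \<in> Q")
    case True
    let ?p = "k \<one>" and ?q = "k (inv x \<otimes> y)"
    have e: "e x ?p = x" "e x ?q = y" using xy k\<kappa> ek by auto
    then have "?p \<noteq> ?q" using xy(3) by auto
    then obtain U V where U: "openin (mtop P) U" "openin (mtop P) V" "?p \<in> U" "?q \<in> V" "disjnt U V"
      using P Q_sub[OF k1] Q_sub[OF True] unfolding Hausdorff_space_def by blast
    have "openin T (e x ` (U \<inter> Q))" "openin T (e x ` (V \<inter> Q))"
      by (rule open_translate[OF xy(1)]; use U Q in auto)+
    moreover have "x \<in> e x ` (U \<inter> Q)" "y \<in> e x ` (V \<inter> Q)" using e U k1 True by (metis IntI image_eqI)+
    moreover have "disjnt (e x ` (U \<inter> Q)) (e x ` (V \<inter> Q))"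
      using U(5) inj_e[OF xy(1)] unfolding disjnt_def by (auto dest: inj_onD)
    ultimately show ?thesis by blast
  qed (use sep xy in blast)
qed

lemma second_countable_E:
  assumes P: "second_countable (mtop P)" and C: "countable C" "C \<subseteq> carrier E" "carrier E \<subseteq> (\<Union>g\<in>C. e g ` Q)"
  shows "second_countable T"
proof -
  obtain B where B: "countable B" "\<And>V. V \<in> B \<Longrightarrow> openin (mtop P) V"
    "\<And>V x. openin (mtop P) V \<Longrightarrow> x \<in> V \<Longrightarrow> \<exists>b\<in>B. x \<in> b \<and> b \<subseteq> V"
    by (rule second_countableE[OF P]) (rule that)
  let ?B = "(\<lambda>(g, b). e g ` (b \<inter> Q)) ` (C \<times> B)"
  have "\<forall>V\<in>?B. openin T V" using B(2) C(2) Q by (auto intro!: open_translate)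
  moreover have "\<exists>V\<in>?B. y \<in> V \<and> V \<subseteq> W" if W: "openin T W" "y \<in> W" for W y
  proof -
    have "y \<in> carrier E" using W openin_E by blast
    then obtain g q where g: "g \<in> C" "q \<in> Q" "y = e g q" using C(3) by auto
    have "openin (mtop P) {q \<in> Q. e g q \<in> W}" using W(1) g(1) C(2) openin_E by blast
    then obtain b where b: "b \<in> B" "q \<in> b" "b \<subseteq> {q \<in> Q. e g q \<in> W}" using B(3) g W(2) by blast
    show ?thesis
      by (rule bexI[of _ "e g ` (b \<inter> Q)"]) (use b g in auto)
  qed
  ultimately show ?thesis unfolding second_countable_def using B(1) C(1) by (intro exI[of _ ?B]) auto
qed

section \<open>Borel structure and the Lie group property\<close>

context
  fixes C
  assumes C: "countable C" "C \<subseteq> carrier E" "carrier E \<subseteq> (\<Union>g\<in>C. e g ` Q)"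
    and left: "\<And>g. g \<in> carrier E \<Longrightarrow> (\<lambda>x. k (g \<otimes> \<kappa> x)) \<in> measurable (borel_of (mtop P)) (borel_of (mtop P))"
begin

lemma C_in: "g \<in> C \<Longrightarrow> g \<in> carrier E" using C(2) by blast

text \<open>\<open>\<kappa>\<close> need not be continuous off \<open>Q\<close>. On the part of
  \<open>P\<close> that it maps into the translate by \<open>g\<close>, it is the Borel map
  \<open>\<lambda>x. k (inv g \<otimes> \<kappa> x)\<close> followed by the continuous map
  \<open>e g\<close>, and countably many \<open>g\<close> cover everything.\<close>

lemma measurable_\<kappa>: "\<kappa> \<in> measurable (borel_of (mtop P)) (borel_of T)"
proof (rule measurable_borel_ofI)
  fix W assume W: "openin T W"
  let ?S = "\<lambda>g. (\<lambda>x. k (inv g \<otimes> \<kappa> x)) -` {q \<in> Q. e g q \<in> W} \<inter> topspace (mtop P)"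
  have eq: "\<kappa> -` W \<inter> space (borel_of (mtop P)) = (\<Union>g\<in>C. ?S g)"
  proof (rule equalityI; rule subsetI)
    fix x assume "x \<in> \<kappa> -` W \<inter> space (borel_of (mtop P))"
    then have x: "x \<in> topspace (mtop P)" "\<kappa> x \<in> W" by auto
    then obtain g where g: "g \<in> C" "\<kappa> x \<in> e g ` Q" using C(3) \<kappa>k by blast
    then have "k (inv g \<otimes> \<kappa> x) \<in> Q" using e_image_iff[OF C_in[OF g(1)] subset_refl] by simp
    then show "x \<in> (\<Union>g\<in>C. ?S g)" using x g(1) ek[OF C_in[OF g(1)]] \<kappa>k by auto
  qed (use ek C_in \<kappa>k in auto)
  have "?S g \<in> sets (borel_of (mtop P))" if g: "g \<in> C" for g
  proof -
    have "openin (mtop P) {q \<in> Q. e g q \<in> W}" using W C_in[OF g] openin_E by blast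
    from measurable_sets[OF left[OF inv_closed[OF C_in[OF g]]] borel_of_open[OF this]] show ?thesis by simp
  qed
  then show "\<kappa> -` W \<inter> space (borel_of (mtop P)) \<in> sets (borel_of (mtop P))"
    unfolding eq using C(1) by (intro sets.countable_UN') auto
qed (use \<kappa>k topspace_E in auto)

lemma measurable_k: "k \<in> measurable (borel_of T) (borel_of (mtop P))"
proof (rule measurable_borel_ofI)
  fix D assume D: "openin (mtop P) D"
  let ?B = "\<lambda>g. (\<lambda>x. k (g \<otimes> \<kappa> x)) -` D \<inter> topspace (mtop P)"
  \<comment> \<open>Extended by a constant outside the translate, so that \<open>?r g\<close> is a
    Borel map on all of \<open>E\<close>; \<open>?S g\<close> intersects with the translate
    again.\<close>
  let ?r = "\<lambda>g y. if y \<in> e g ` Q then r g y else k \<one>"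
  let ?S = "\<lambda>g. (?r g -` ?B g \<inter> carrier E) \<inter> e g ` Q"
  have eq: "k -` D \<inter> space (borel_of T) = (\<Union>g\<in>C. ?S g)"
  proof (rule equalityI; rule subsetI)
    fix y assume "y \<in> k -` D \<inter> space (borel_of T)"
    then have y: "y \<in> carrier E" "k y \<in> D" by (auto simp: topspace_E)
    then obtain g q where g: "g \<in> C" "q \<in> Q" "y = e g q" using C(3) by blast
    then show "y \<in> (\<Union>g\<in>C. ?S g)" using y C_in Q_sub by (intro UN_I[OF g(1)]) auto
  qed (use C_in in \<open>auto simp: topspace_E\<close>)
  have "?S g \<in> sets (borel_of T)" if g: "g \<in> C" for g
  proof -
    note g' = C_in[OF g]
    have o: "openin T (e g ` Q)" by (rule open_translate[OF g' Q subset_refl])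
    have "?r g \<in> measurable (borel_of T) (borel_of (mtop P))"
    proof (rule measurable_borel_ofI)
      fix U assume U: "openin (mtop P) U"
      have "?r g -` U \<inter> space (borel_of T) = {y \<in> e g ` Q. r g y \<in> U} \<union> (if k \<one> \<in> U then carrier E - e g ` Q else {})"
        using g' by (auto simp: topspace_E split: if_splits)
      moreover have "{y \<in> e g ` Q. r g y \<in> U} \<in> sets (borel_of T)"
        by (rule borel_of_open[OF openin_preimage_on[OF o cont_r[OF g'] U]])
      moreover have "carrier E - e g ` Q \<in> sets (borel_of T)"
        using sets.compl_sets[OF borel_of_open[OF o]] by (simp add: topspace_E)
      ultimately show "?r g -` U \<inter> space (borel_of T) \<in> sets (borel_of T)" by auto
    qed (use g' k1 Q_sub in auto)
    from measurable_sets[OF this measurable_sets[OF left[OF g'] borel_of_open[OF D]]]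
    have "?r g -` ?B g \<inter> carrier E \<in> sets (borel_of T)" by (simp add: topspace_E)
    then show ?thesis using borel_of_open[OF o] by (rule sets.Int)
  qed
  then show "k -` D \<inter> space (borel_of T) \<in> sets (borel_of T)"
    unfolding eq using C(1) by (intro sets.countable_UN') auto
qed (use k\<kappa> topspace_E in auto)

text \<open>Through \<open>k\<close> and \<open>\<kappa>\<close> a conjugation becomes a left and a
  right translation in the coordinates of \<open>P\<close>, both Borel. Thus
  \<open>borel_hom_continuous\<close> and \<open>continuous_hom_smooth\<close> apply to conjugations
  and deliver the hypothesis of \<open>lie_groupI\<close>.\<close>

theorem lie_group_E:
  assumes P: "second_countable (mtop P)" and T2: "Hausdorff_space T"
    and right: "\<And>g. g \<in> carrier E \<Longrightarrow> (\<lambda>x. k (\<kappa> x \<otimes> g)) \<in> measurable (borel_of (mtop P)) (borel_of (mtop P))"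
  shows "lie_group E"
proof (rule lie_groupI[OF left_lie_E T2 second_countable_E[OF P C]])
  fix g assume g: "g \<in> carrier E"
  let ?c = "\<lambda>x. inv g \<otimes> x \<otimes> g"
  have hom: "?c \<in> hom E E"
  proof (rule homI)
    fix x y assume xy: "x \<in> carrier E" "y \<in> carrier E"
    have "g \<otimes> (inv g \<otimes> (y \<otimes> g)) = y \<otimes> g" using g xy by (simp add: m_assoc[symmetric])
    then show "?c (x \<otimes> y) = ?c x \<otimes> ?c y" using g xy by (simp add: m_assoc)
  qed (use g in simp)
  have "(\<lambda>y. \<kappa> (k (\<kappa> (k (inv g \<otimes> \<kappa> (k y))) \<otimes> g))) \<in> measurable (borel_of T) (borel_of T)"
    by (rule measurable_compose[OF measurable_k measurable_compose[OF left measurable_compose[OF right measurable_\<kappa>]]]) (use g in auto)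
  then have m: "?c \<in> measurable (borel_of T) (borel_of T)"
    by (rule measurable_cong[THEN iffD1, rotated]) (use k\<kappa> g in \<open>simp add: topspace_E\<close>)
  show "smooth_near (mfd E) (mfd E) \<one> ?c"
    by (rule continuous_hom_smooth[OF left_lie_E left_lie_E hom _ one_closed])
      (use borel_hom_continuous[OF left_lie_E left_lie_E hom T2 second_countable_E[OF P C] m] in metis)
qed

end

end

section \<open>The extension defined by a cocycle\<close>

text \<open>
  The pair \<open>(a, s)\<close> stands for \<open>\<iota> a \<sigma> s\<close>. The cocycle is not normalized, so the neutral element is
  \<open>(- f 1 1, 1)\<close>, and \<open>\<iota> a = (a - f 1 1, 1)\<close>. The charts are the left translates of \<open>A \<times> V\<close>; two of
  them overlap in a map involving \<open>f s t\<close> only for \<open>t\<close> and \<open>s t\<close> in \<open>V\<close>, whence \<open>f_smooth\<close>.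
\<close>

locale cocycle_extension = lie_module G A act
  for G :: "'g lie_struct" and A :: "'a lie_struct" and act :: "'g \<Rightarrow> 'a \<Rightarrow> 'a" +
  fixes f :: "'g \<Rightarrow> 'g \<Rightarrow> 'a" and j :: "'g \<times> 'a \<Rightarrow> 'e" and V :: "'g set"
  assumes f: "cocycle f" and inj: "inj_on j (cG \<times> cA)"
    and V: "openin (mtop MG) V" "eG \<in> V"
    and f_smooth: "\<And>s t. s \<in> cG \<Longrightarrow> t \<in> V \<Longrightarrow> s \<star> t \<in> V \<Longrightarrow> smooth_near (prod_manifold MG MG) MA (s, t) (\<lambda>(s, t). f s t)"
begin

lemma f_closed [simp]: "s \<in> cG \<Longrightarrow> t \<in> cG \<Longrightarrow> f s t \<in> cA"
  and f_meas: "(\<lambda>(s, t). f s t) \<in> measurable BGG BA"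
  and f_cocycle: "s \<in> cG \<Longrightarrow> t \<in> cG \<Longrightarrow> r \<in> cG \<Longrightarrow> act s (f t r) \<boxplus> f s (t \<star> r) = f (s \<star> t) r \<boxplus> f s t"
  using f by (auto simp: cocycle_def lsm2_def)

abbreviation "f1 \<equiv> f eG eG"

text \<open>The cocycle identity at \<open>(eG, eG, t)\<close> and at
  \<open>(t, eG, eG)\<close>.\<close>

lemma f_one: "t \<in> cG \<Longrightarrow> f eG t = f1" "t \<in> cG \<Longrightarrow> f t eG = act t f1"
  using f_cocycle[of eG eG t] f_cocycle[of t eG eG] by auto

section \<open>The group law on pairs\<close>

abbreviation "P \<equiv> prod_manifold MA MG"
abbreviation "BP \<equiv> borel_of (prod_topology (mtop MA) (mtop MG))"

lemma cP: "charted P" by (rule charted_prod[OF cMA cMG])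

text \<open>Copied from \<open>mult_formula\<close>, with \<open>f\<close> for the factor
  set.\<close>

definition pm :: "'a \<times> 'g \<Rightarrow> 'a \<times> 'g \<Rightarrow> 'a \<times> 'g" where
  "pm x y = (fst x \<boxplus> act (snd x) (fst y) \<boxplus> f (snd x) (snd y), snd x \<star> snd y)"

text \<open>The first component solves \<open>pm (pinv x) x = (iA f1, eG)\<close>, whose right-hand
  side is the neutral element of the unnormalized law.\<close>

definition pinv :: "'a \<times> 'g \<Rightarrow> 'a \<times> 'g" where
  "pinv x = (iA f1 \<boxplus> iA (act (iG (snd x)) (fst x) \<boxplus> f (iG (snd x)) (snd x)), iG (snd x))"

text \<open>\<open>j\<close> takes its pairs in the order \<open>(s, a)\<close>, while
  \<open>P\<close> has \<open>A\<close> as its first factor.\<close>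

definition \<kappa> :: "'a \<times> 'g \<Rightarrow> 'e" where "\<kappa> x = j (snd x, fst x)"

definition k :: "'e \<Rightarrow> 'a \<times> 'g" where "k e = prod.swap (inv_into (cG \<times> cA) j e)"

abbreviation "Q \<equiv> cA \<times> V"

definition E :: "'e lie_struct" where
  "E = \<lparr>carrier = j ` (cG \<times> cA), mult = (\<lambda>x y. \<kappa> (pm (k x) (k y))), one = \<kappa> (iA f1, eG),
     mfd = translated_manifold (j ` (cG \<times> cA)) (\<lambda>x y. \<kappa> (pm (k x) (k y))) P Q \<kappa>\<rparr>"

abbreviation e_mult (infixl "\<odot>" 70) where "x \<odot> y \<equiv> x \<otimes>\<^bsub>E\<^esub> y"
abbreviation "cE \<equiv> carrier E"
abbreviation "ME \<equiv> mfd E"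

lemma \<kappa>_in [simp]: "x \<in> cA \<times> cG \<Longrightarrow> \<kappa> x \<in> cE" and k_\<kappa> [simp]: "x \<in> cA \<times> cG \<Longrightarrow> k (\<kappa> x) = x"
  using inv_into_f_f[OF inj] by (auto simp: \<kappa>_def k_def E_def)

lemma k_in [simp]: "e \<in> cE \<Longrightarrow> k e \<in> cA \<times> cG" and \<kappa>_k [simp]: "e \<in> cE \<Longrightarrow> \<kappa> (k e) = e"
  using inv_into_f_f[OF inj] by (auto simp: \<kappa>_def k_def E_def)

lemma k_parts [simp]: "e \<in> cE \<Longrightarrow> fst (k e) \<in> cA" "e \<in> cE \<Longrightarrow> snd (k e) \<in> cG"
  using k_in by (metis mem_Times_iff)+

lemma mult_E: "x \<odot> y = \<kappa> (pm (k x) (k y))" and one_E: "\<one>\<^bsub>E\<^esub> = \<kappa> (iA f1, eG)"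
  by (simp_all add: E_def)

lemma pm_in [simp]: "x \<in> cA \<times> cG \<Longrightarrow> y \<in> cA \<times> cG \<Longrightarrow> pm x y \<in> cA \<times> cG"
  and pinv_in [simp]: "x \<in> cA \<times> cG \<Longrightarrow> pinv x \<in> cA \<times> cG"
  by (auto simp: pm_def pinv_def)

lemma one_in [simp]: "(iA f1, eG) \<in> cA \<times> cG" by simp

text \<open>After the components in \<open>A\<close> are collected, this is the cocycle identity for
  \<open>(s, t, r)\<close>.\<close>

lemma pm_assoc:
  assumes "x \<in> cA \<times> cG" "y \<in> cA \<times> cG" "z \<in> cA \<times> cG" shows "pm (pm x y) z = pm x (pm y z)"
proof -
  obtain a s b t c r where xyz: "x = (a, s)" "y = (b, t)" "z = (c, r)" by (metis surj_pair)
  have c: "a \<in> cA" "b \<in> cA" "c \<in> cA" "s \<in> cG" "t \<in> cG" "r \<in> cG" using assms xyz by auto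
  have "a \<boxplus> act s b \<boxplus> f s t \<boxplus> act (s \<star> t) c \<boxplus> f (s \<star> t) r = a \<boxplus> (act s b \<boxplus> (act (s \<star> t) c \<boxplus> (f (s \<star> t) r \<boxplus> f s t)))"
    using c by (simp add: A.m_ac)
  also have "\<dots> = a \<boxplus> act s (b \<boxplus> act t c \<boxplus> f t r) \<boxplus> f s (t \<star> r)"
    using c by (simp add: f_cocycle[symmetric] act_comp A.m_assoc)
  finally show ?thesis unfolding xyz pm_def using c by (simp add: G.m_assoc)
qed

lemma cancel: "a \<in> cA \<Longrightarrow> b \<in> cA \<Longrightarrow> c \<in> cA \<Longrightarrow> a \<boxplus> iA c \<boxplus> b \<boxplus> c = a \<boxplus> b"
  by (simp add: A.m_assoc A.m_comm[of b c]) (simp add: A.m_assoc[symmetric])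

lemma pm_one: "x \<in> cA \<times> cG \<Longrightarrow> pm (iA f1, eG) x = x"
  using cancel[of eA "fst x" f1] f_one(1)[of "snd x"] by (auto simp: pm_def)

lemma pm_pinv: "x \<in> cA \<times> cG \<Longrightarrow> pm (pinv x) x = (iA f1, eG)"
  by (auto simp: pm_def pinv_def A.m_assoc)

lemma grp: "group E"
proof (rule groupI)
  show "\<And>x y. x \<in> cE \<Longrightarrow> y \<in> cE \<Longrightarrow> x \<odot> y \<in> cE" by (simp add: mult_E)
  show "\<one>\<^bsub>E\<^esub> \<in> cE" by (simp add: one_E)
  show "x \<odot> y \<odot> z = x \<odot> (y \<odot> z)" if "x \<in> cE" "y \<in> cE" "z \<in> cE" for x y z
    using that by (simp add: mult_E pm_assoc del: mem_Times_iff)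
  show "\<one>\<^bsub>E\<^esub> \<odot> x = x" if "x \<in> cE" for x
    using that pm_one[OF k_in[OF that]] k_\<kappa>[OF one_in] by (simp add: mult_E one_E)
  show "\<exists>y\<in>cE. y \<odot> x = \<one>\<^bsub>E\<^esub>" if "x \<in> cE" for x
    using that pm_pinv[OF k_in[OF that]] by (intro bexI[of _ "\<kappa> (pinv (k x))"]) (simp_all add: mult_E one_E)
qed

sublocale E: group E by (rule grp)

lemma mult_\<kappa>: "x \<in> cA \<times> cG \<Longrightarrow> y \<in> cA \<times> cG \<Longrightarrow> \<kappa> x \<odot> \<kappa> y = \<kappa> (pm x y)"
  by (simp add: mult_E)

lemma inv_\<kappa>: "x \<in> cA \<times> cG \<Longrightarrow> inv\<^bsub>E\<^esub> (\<kappa> x) = \<kappa> (pinv x)"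
  by (rule E.inv_equality) (simp_all add: mult_\<kappa> pm_pinv one_E)

lemma k_one: "k \<one>\<^bsub>E\<^esub> = (iA f1, eG)" using k_\<kappa>[OF one_in] by (simp add: one_E)

section \<open>Smoothness and measurability of the group law\<close>

lemma V_sub: "s \<in> V \<Longrightarrow> s \<in> cG" using openin_subset[OF V(1)] tG by auto

lemma Q_open: "openin (mtop P) Q"
  using V(1) openin_topspace[of "mtop MA"] tA by (simp add: openin_prod_Times_iff)

lemma smooth_f:
  assumes "charted M" "smooth_near M MG p u" "smooth_near M MG p v" "v p \<in> V" "u p \<star> v p \<in> V"
  shows "smooth_near M MA p (\<lambda>x. f (u x) (v x))"
proof -
  have "smooth_near (prod_manifold MG MG) MA (u p, v p) (\<lambda>(s, t). f s t)"
    by (rule f_smooth) (use assms smooth_near_into(2)[OF assms(2)] tG in auto)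
  from smooth_near_comp[OF assms(1) cGG cMA smooth_near_pair[OF assms(1) cMG cMG assms(2,3)] this] show ?thesis by simp
qed

lemma smooth_pm:
  assumes M: "charted M" and u: "smooth_near M P p u" and v: "smooth_near M P p v" and V: "snd (v p) \<in> V" "snd (u p) \<star> snd (v p) \<in> V"
  shows "smooth_near M P p (\<lambda>x. pm (u x) (v x))"
proof -
  have 1: "smooth_near M MA p (\<lambda>x. fst (w x))" "smooth_near M MG p (\<lambda>x. snd (w x))" if w: "smooth_near M P p w" for w
    using smooth_near_into(2)[OF w]
    by (auto intro!: smooth_near_comp[OF M cP cMA w smooth_near_fst] smooth_near_comp[OF M cP cMG w smooth_near_snd] cMA cMG)
  show ?thesis unfolding pm_def
    by (intro smooth_near_pair M cMA cMG smooth_near_mult[OF A] smooth_near_mult[OF G] smooth_near_act smooth_f V 1 u v)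
qed

lemma smooth_pinv:
  assumes M: "charted M" and u: "smooth_near M P p u" and V': "snd (u p) \<in> V"
  shows "smooth_near M P p (\<lambda>x. pinv (u x))"
proof -
  have up: "fst (u p) \<in> cA" "snd (u p) \<in> cG" "p \<in> topspace (mtop M)" using smooth_near_into[OF u] tA tG by auto
  have 1: "smooth_near M MA p (\<lambda>x. fst (u x))" "smooth_near M MG p (\<lambda>x. snd (u x))"
    using smooth_near_into(2)[OF u]
    by (auto intro!: smooth_near_comp[OF M cP cMA u smooth_near_fst] smooth_near_comp[OF M cP cMG u smooth_near_snd] cMA cMG)
  show ?thesis unfolding pinv_def
    by (intro smooth_near_pair M cMA cMG smooth_near_mult[OF A] smooth_near_inv[OF A] smooth_near_inv[OF G] smooth_near_act smooth_f V' 1 smooth_near_const)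
      (use up V(2) tA in auto)
qed

lemma top_P: "topspace (mtop P) = cA \<times> cG" by (simp add: tA tG)

sublocale T: translated_group E P Q \<kappa> k
proof (rule translated_group.intro[OF grp _ cP Q_open])
  show "ME = translated_manifold cE (\<odot>) P Q \<kappa>" by (simp add: E_def)
  show "k \<one>\<^bsub>E\<^esub> \<in> Q" using V(2) by (simp add: k_one)
  show "\<And>x. x \<in> topspace (mtop P) \<Longrightarrow> \<kappa> x \<in> cE \<and> k (\<kappa> x) = x"
    "\<And>e. e \<in> cE \<Longrightarrow> k e \<in> topspace (mtop P) \<and> \<kappa> (k e) = e" unfolding top_P by simp_all
next
  fix g q assume g: "g \<in> cE" and q: "q \<in> Q" "k (g \<odot> \<kappa> q) \<in> Q"
  have q': "q \<in> cA \<times> cG" using q V_sub by auto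
  \<comment> \<open>The overlap condition \<open>k (g \<odot> \<kappa> q) \<in> Q\<close> says that,
    for \<open>s = snd (k g)\<close> and \<open>t = snd q\<close>, the product
    \<open>s \<star> t\<close> lies in \<open>V\<close>; together with \<open>t \<in> V\<close> this
    is the hypothesis of \<open>f_smooth\<close>.\<close>
  then have "snd (k g) \<star> snd q \<in> V" using q(2) g pm_in[OF k_in[OF g] q'] by (simp add: mult_E) (simp add: pm_def)
  then have "smooth_near P P q (\<lambda>x. pm (k g) x)"
    using q(1) g k_in[OF g] q' by (intro smooth_pm[OF cP] smooth_near_const cP smooth_near_id) (simp_all only: top_P, auto)
  then show "smooth_near P P q (\<lambda>x. k (g \<odot> \<kappa> x))"
    by (rule smooth_near_cong[OF cP cP _ openin_topspace]) (use g q' in \<open>auto simp only: top_P mult_E k_\<kappa> pm_in k_in\<close>)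
next
  have o: "(k \<one>\<^bsub>E\<^esub>, k \<one>\<^bsub>E\<^esub>) \<in> topspace (prod_topology (mtop P) (mtop P))" using k_in[OF E.one_closed] by (simp only: topspace_prod_topology top_P) simp
  have "smooth_near (prod_manifold P P) P (k \<one>\<^bsub>E\<^esub>, k \<one>\<^bsub>E\<^esub>) (\<lambda>z. pm (fst z) (snd z))"
    by (rule smooth_pm[OF charted_prod[OF cP cP] smooth_near_fst[OF cP cP o] smooth_near_snd[OF cP cP o]]) (use V in \<open>auto simp: k_one\<close>)
  then show "smooth_near (prod_manifold P P) P (k \<one>\<^bsub>E\<^esub>, k \<one>\<^bsub>E\<^esub>) (\<lambda>z. k (\<kappa> (fst z) \<odot> \<kappa> (snd z)))"
    by (rule smooth_near_cong[OF charted_prod[OF cP cP] cP _ openin_topspace])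
      (use o in \<open>simp_all only: prod_manifold_simps(1) topspace_prod_topology tA tG mem_Times_iff[of _ "cA \<times> cG"] mult_E k_\<kappa> pm_in\<close>)
  have "smooth_near P P (k \<one>\<^bsub>E\<^esub>) (\<lambda>x. pinv x)"
    by (rule smooth_pinv[OF cP smooth_near_id[OF cP]]) (use V in \<open>simp_all add: k_one tA tG\<close>)
  then show "smooth_near P P (k \<one>\<^bsub>E\<^esub>) (\<lambda>x. k (inv\<^bsub>E\<^esub> (\<kappa> x)))"
    by (rule smooth_near_cong[OF cP cP _ openin_topspace]) (use k_in[OF E.one_closed] in \<open>auto simp only: top_P inv_\<kappa> k_\<kappa> pinv_in\<close>)
qed

lemma measurable_pm:
  assumes u: "u \<in> measurable M BP" and v: "v \<in> measurable M BP"
  shows "(\<lambda>x. pm (u x) (v x)) \<in> measurable M BP"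
proof -
  have 1: "(\<lambda>x. fst (w x)) \<in> measurable M BA" "(\<lambda>x. snd (w x)) \<in> measurable M BG" if "w \<in> measurable M BP" for w
    by (rule measurable_compose[OF that continuous_map_borel_of], simp add: continuous_map_fst continuous_map_snd)+
  have "(\<lambda>x. f (snd (u x)) (snd (v x))) \<in> measurable M BA"
    using measurable_compose[OF measurable_borel_of_Pair[OF scG scG 1(2)[OF u] 1(2)[OF v]] f_meas] by simp
  then show ?thesis unfolding pm_def
    by (intro measurable_borel_of_Pair scA scG lie_mult_measurable[OF A] lie_mult_measurable[OF G] act_measurable 1 u v)
qed

section \<open>Inclusion, projection and section\<close>

definition \<pi> :: "'e \<Rightarrow> 'g" where "\<pi> e = snd (k e)"
definition \<iota> :: "'a \<Rightarrow> 'e" where "\<iota> a = \<kappa> (a \<boxplus> iA f1, eG)"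
definition \<sigma> :: "'g \<Rightarrow> 'e" where "\<sigma> s = \<kappa> (eA, s)"

lemma pi_in [simp]: "e \<in> cE \<Longrightarrow> \<pi> e \<in> cG" and iota_in [simp]: "a \<in> cA \<Longrightarrow> \<iota> a \<in> cE"
  and sigma_in [simp]: "s \<in> cG \<Longrightarrow> \<sigma> s \<in> cE"
  by (simp_all add: \<pi>_def \<iota>_def \<sigma>_def)

lemma k_iota: "a \<in> cA \<Longrightarrow> k (\<iota> a) = (a \<boxplus> iA f1, eG)" and k_sigma: "s \<in> cG \<Longrightarrow> k (\<sigma> s) = (eA, s)"
  unfolding \<iota>_def \<sigma>_def by (rule k_\<kappa>; simp)+

lemma pi_simps [simp]: "e \<in> cE \<Longrightarrow> d \<in> cE \<Longrightarrow> \<pi> (e \<odot> d) = \<pi> e \<star> \<pi> d"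
    "a \<in> cA \<Longrightarrow> \<pi> (\<iota> a) = eG" "s \<in> cG \<Longrightarrow> \<pi> (\<sigma> s) = s" "x \<in> cA \<times> cG \<Longrightarrow> \<pi> (\<kappa> x) = snd x"
proof -
  assume "e \<in> cE" "d \<in> cE"
  then have "k (e \<odot> d) = pm (k e) (k d)" unfolding mult_E by (intro k_\<kappa> pm_in k_in)
  then show "\<pi> (e \<odot> d) = \<pi> e \<star> \<pi> d" by (simp add: \<pi>_def pm_def)
qed (unfold \<pi>_def, simp_all only: k_iota k_sigma k_\<kappa> snd_conv)

lemma pi_hom: "\<pi> \<in> hom E G" by (rule homI) simp_all

lemma pi_inv [simp]: "e \<in> cE \<Longrightarrow> \<pi> (inv\<^bsub>E\<^esub> e) = iG (\<pi> e)"
  using group_hom.hom_inv[of E G \<pi> e] pi_hom by (simp add: group_hom_def group_hom_axioms_def)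

lemma iota_hom: "\<iota> \<in> hom A E"
proof (rule homI)
  fix a b assume ab: "a \<in> cA" "b \<in> cA"
  have "pm (a \<boxplus> iA f1, eG) (b \<boxplus> iA f1, eG) = (a \<boxplus> b \<boxplus> iA f1, eG)" using ab cancel[of a "b \<boxplus> iA f1" f1] by (simp add: pm_def A.m_assoc)
  then show "\<iota> (a \<boxplus> b) = \<iota> a \<odot> \<iota> b" using ab by (simp add: \<iota>_def mult_\<kappa>)
qed simp

lemma iota_mult_\<kappa>: "a \<in> cA \<Longrightarrow> b \<in> cA \<Longrightarrow> s \<in> cG \<Longrightarrow> \<iota> a \<odot> \<kappa> (b, s) = \<kappa> (a \<boxplus> b, s)"
proof -
  assume *: "a \<in> cA" "b \<in> cA" "s \<in> cG"
  then have "pm (a \<boxplus> iA f1, eG) (b, s) = (a \<boxplus> b, s)" using cancel[of a b f1] f_one(1)[of s] by (simp add: pm_def)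
  then show ?thesis using * by (simp add: \<iota>_def mult_\<kappa>)
qed

lemma \<kappa>_mult_iota: "a \<in> cA \<Longrightarrow> b \<in> cA \<Longrightarrow> s \<in> cG \<Longrightarrow> \<kappa> (b, s) \<odot> \<iota> a = \<kappa> (act s a \<boxplus> b, s)"
proof -
  assume *: "a \<in> cA" "b \<in> cA" "s \<in> cG"
  then have "pm (b, s) (a \<boxplus> iA f1, eG) = (act s a \<boxplus> b, s)" using f_one(2)[of s] by (simp add: pm_def A.m_assoc) (simp add: A.m_comm)
  then show ?thesis using * by (simp add: \<iota>_def mult_\<kappa>)
qed

lemma iota_inj: "inj_on \<iota> cA"
  by (rule inj_on_inverseI[of cA "\<lambda>e. fst (k e) \<boxplus> f1"]) (simp add: k_iota A.m_assoc)

lemma iota_image: "\<iota> ` C = {e \<in> cE. \<pi> e = eG \<and> fst (k e) \<boxplus> f1 \<in> C}" if "C \<subseteq> cA"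
proof (rule equalityI; rule subsetI)
  fix e assume "e \<in> \<iota> ` C"
  then obtain a where a: "a \<in> C" "e = \<iota> a" by blast
  then have "a \<in> cA" using that by blast
  then show "e \<in> {e \<in> cE. \<pi> e = eG \<and> fst (k e) \<boxplus> f1 \<in> C}" using a by (simp add: k_iota A.m_assoc)
next
  fix e assume "e \<in> {e \<in> cE. \<pi> e = eG \<and> fst (k e) \<boxplus> f1 \<in> C}"
  then have e: "e \<in> cE" "snd (k e) = eG" "fst (k e) \<boxplus> f1 \<in> C" by (auto simp: \<pi>_def)
  have "\<iota> (fst (k e) \<boxplus> f1) = \<kappa> (fst (k e), snd (k e))" using e by (simp add: \<iota>_def A.m_assoc)
  also have "\<dots> = e" using e(1) by simp
  finally show "e \<in> \<iota> ` C" using e(3) by (metis image_eqI)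
qed

lemma top_E: "topspace (mtop ME) = cE" by (rule T.topspace_E)

lemma pi_smooth: "smooth_map ME MG \<pi>"
  unfolding smooth_map_near_iff[OF T.charted_E cMG]
proof
  fix y assume "y \<in> topspace (mtop ME)"
  then have y: "y \<in> cE" by (simp add: top_E)
  have "smooth_near ME P (y \<odot> \<kappa> (k \<one>\<^bsub>E\<^esub>)) (\<lambda>z. k (inv\<^bsub>E\<^esub> y \<odot> z))" by (rule T.smooth_near_e(2)[OF y T.k1])
  then have 1: "smooth_near ME P y (\<lambda>z. k (inv\<^bsub>E\<^esub> y \<odot> z))" using y by simp
  have 2: "smooth_near ME MG y (\<lambda>z. snd (k (inv\<^bsub>E\<^esub> y \<odot> z)))"
    by (rule smooth_near_comp[OF T.charted_E cP cMG 1 smooth_near_snd[OF cMA cMG]]) (use smooth_near_into(2)[OF 1] in simp)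
  have "smooth_near ME MG y (\<lambda>z. \<pi> y \<star> \<pi> (inv\<^bsub>E\<^esub> y \<odot> z))"
    unfolding \<pi>_def[of "inv\<^bsub>E\<^esub> y \<odot> _"] by (rule smooth_near_left_mult[OF lie_group_left_lie[OF G] T.charted_E 2]) (use y in simp)
  then show "smooth_near ME MG y \<pi>"
    by (rule smooth_near_cong[OF T.charted_E cMG _ openin_topspace]) (use y top_E in \<open>auto simp: G.m_assoc[symmetric]\<close>)
qed

lemma pi_preimage_open: "openin (mtop MG) S \<Longrightarrow> openin (mtop ME) {e \<in> cE. \<pi> e \<in> S}"
  using openin_continuous_map_preimage[OF smooth_map_continuous[OF pi_smooth]] by (simp add: top_E)

text \<open>Around its point \<open>y\<close>, the set \<open>W\<close> contains the translate by
  \<open>y\<close> of an open set of pairs, which \<open>\<pi>\<close> takes to the left translate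
  by \<open>\<pi> y\<close> of a projection to \<open>G\<close>; projections of products are
  open.\<close>

lemma pi_open: "open_map (mtop ME) (mtop MG) \<pi>"
  unfolding open_map_def
proof (intro allI impI)
  fix W assume W: "openin (mtop ME) W"
  show "openin (mtop MG) (\<pi> ` W)"
  proof (subst openin_subopen, intro ballI)
    fix s assume "s \<in> \<pi> ` W"
    then obtain y where y: "y \<in> W" "s = \<pi> y" "y \<in> cE" using openin_subset[OF W] top_E by auto
    let ?D = "{q \<in> Q. y \<odot> \<kappa> q \<in> W}"
    have "openin (mtop P) ?D" using W y(3) T.openin_E by blast
    then have "openin (mtop MG) (snd ` ?D)" using open_map_snd[of "mtop MA" "mtop MG"] unfolding open_map_def by simp
    from left_translation_open[OF lie_group_left_lie[OF G] _ this, of "iG s"]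
    have o: "openin (mtop MG) {x \<in> cG. iG s \<star> x \<in> snd ` ?D}" using y by simp
    have "iG s \<star> s \<in> snd ` ?D"
      by (rule image_eqI[of _ _ "k \<one>\<^bsub>E\<^esub>"]) (use y T.k1 in \<open>auto simp: k_one one_E[symmetric]\<close>)
    moreover have "{x \<in> cG. iG s \<star> x \<in> snd ` ?D} \<subseteq> \<pi> ` W"
    proof
      fix x assume "x \<in> {x \<in> cG. iG s \<star> x \<in> snd ` ?D}"
      then obtain q where q: "x \<in> cG" "q \<in> Q" "y \<odot> \<kappa> q \<in> W" "iG s \<star> x = snd q" by auto
      have "q \<in> cA \<times> cG" using q(2) V_sub by auto
      then have "\<pi> (y \<odot> \<kappa> q) = x" using y q(1) q(4)[symmetric] by (simp add: G.m_assoc[symmetric] del: mem_Times_iff)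
      then show "x \<in> \<pi> ` W" using q(3) by blast
    qed
    ultimately show "\<exists>T. openin (mtop MG) T \<and> s \<in> T \<and> T \<subseteq> \<pi> ` W" using o y by (intro exI[of _ "{x \<in> cG. iG s \<star> x \<in> snd ` ?D}"]) auto
  qed
qed

section \<open>Separation, countability and the Lie group property\<close>

lemma k_quot: "x \<in> cE \<Longrightarrow> y \<in> cE \<Longrightarrow> k (inv\<^bsub>E\<^esub> x \<odot> y) \<in> Q \<longleftrightarrow> iG (\<pi> x) \<star> \<pi> y \<in> V"
proof -
  assume xy: "x \<in> cE" "y \<in> cE"
  then have "iG (\<pi> x) \<star> \<pi> y = snd (k (inv\<^bsub>E\<^esub> x \<odot> y))" using pi_simps(1)[of "inv\<^bsub>E\<^esub> x" y] by (simp add: \<pi>_def[of "_ \<odot> _"])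
  then show ?thesis using xy by (simp add: mem_Times_iff)
qed

text \<open>Points over different elements of \<open>G\<close> are separated by
  \<open>\<pi>\<close>. Points over the same element have a quotient over \<open>eG\<close>, hence
  in the image of \<open>Q\<close>, and are covered by \<open>T.Hausdorff_E\<close>.\<close>

lemma T2: "Hausdorff_space (mtop ME)"
proof (rule T.Hausdorff_E)
  show "Hausdorff_space (mtop P)" using lie_groupD(4)[OF A] lie_groupD(4)[OF G] by (simp add: Hausdorff_space_prod_topology)
  fix x y assume xy: "x \<in> cE" "y \<in> cE"
  show "k (inv\<^bsub>E\<^esub> x \<odot> y) \<in> Q \<or> (\<exists>U V. openin (mtop ME) U \<and> openin (mtop ME) V \<and> x \<in> U \<and> y \<in> V \<and> disjnt U V)"
  proof (cases "\<pi> x = \<pi> y")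
    case True
    then show ?thesis using k_quot[OF xy] xy V(2) by simp
  next
    case False
    then obtain S R where SR: "openin (mtop MG) S" "openin (mtop MG) R" "\<pi> x \<in> S" "\<pi> y \<in> R" "disjnt S R"
      using lie_groupD(4)[OF G] xy tG unfolding Hausdorff_space_def by (metis pi_in)
    then show ?thesis using pi_preimage_open[OF SR(1)] pi_preimage_open[OF SR(2)] xy
      by (intro disjI2 exI[of _ "{e \<in> cE. \<pi> e \<in> S}"] exI[of _ "{e \<in> cE. \<pi> e \<in> R}"]) (auto simp: disjnt_def)
  qed
qed

text \<open>By the Lindelof property countably many left translates of \<open>V\<close> cover
  \<open>G\<close>. Lifting the translating elements by \<open>\<sigma>\<close> covers
  \<open>E\<close>, since \<open>Q\<close> contains all of \<open>cA\<close> over each point of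
  \<open>V\<close>.\<close>

lemma cover: obtains C where "countable C" "C \<subseteq> cE" "cE \<subseteq> (\<Union>g\<in>C. (\<lambda>q. g \<odot> \<kappa> q) ` Q)"
proof -
  let ?U = "\<lambda>s. {x \<in> cG. iG s \<star> x \<in> V}"
  have "openin (mtop MG) (?U s)" if "s \<in> cG" for s
    using left_translation_open[OF lie_group_left_lie[OF G] _ V(1)] that by simp
  then obtain C where C: "C \<subseteq> cG" "countable C" "(\<Union>s\<in>cG. ?U s) = (\<Union>s\<in>C. ?U s)"
    by (rule second_countable_subcover[OF scG, of cG ?U])
  have "cE \<subseteq> (\<Union>g\<in>\<sigma> ` C. (\<lambda>q. g \<odot> \<kappa> q) ` Q)"
  proof
    fix y assume y: "y \<in> cE"
    then have "\<pi> y \<in> (\<Union>s\<in>cG. ?U s)" using V(2) by (intro UN_I[of "\<pi> y"]) auto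
    then obtain s where s: "s \<in> C" "iG s \<star> \<pi> y \<in> V" unfolding C(3) by blast
    then have "s \<in> cG" using C(1) by blast
    then have "k (inv\<^bsub>E\<^esub> (\<sigma> s) \<odot> y) \<in> Q" using k_quot[of "\<sigma> s" y] y s by simp
    then have "y \<in> (\<lambda>q. \<sigma> s \<odot> \<kappa> q) ` Q" using T.e_image_iff[OF sigma_in subset_refl] y \<open>s \<in> cG\<close> by simp
    then show "y \<in> (\<Union>g\<in>\<sigma> ` C. (\<lambda>q. g \<odot> \<kappa> q) ` Q)" using s(1) by blast
  qed
  moreover have "countable (\<sigma> ` C)" "\<sigma> ` C \<subseteq> cE" using C(1,2) by auto
  ultimately show thesis by (intro that)
qed

text \<open>Away from the identity \<open>f\<close> is merely Borel, so these translations are Borel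
  in the coordinates of \<open>P\<close> and possibly not continuous.\<close>

lemma measurable_left: "g \<in> cE \<Longrightarrow> (\<lambda>x. k (g \<odot> \<kappa> x)) \<in> measurable (borel_of (mtop P)) (borel_of (mtop P))"
  and measurable_right: "g \<in> cE \<Longrightarrow> (\<lambda>x. k (\<kappa> x \<odot> g)) \<in> measurable (borel_of (mtop P)) (borel_of (mtop P))"
proof -
  assume g: "g \<in> cE"
  have id: "(\<lambda>x. x) \<in> measurable BP BP" and c: "(\<lambda>x. k g) \<in> measurable BP BP" using g by (auto simp: tA tG)
  show "(\<lambda>x. k (g \<odot> \<kappa> x)) \<in> measurable (borel_of (mtop P)) (borel_of (mtop P))"
    unfolding prod_manifold_simps
    by (rule measurable_cong[THEN iffD1, OF _ measurable_pm[OF c id]]) (use g in \<open>auto simp only: space_borel_of topspace_prod_topology tA tG mult_E k_\<kappa> pm_in k_in\<close>)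
  show "(\<lambda>x. k (\<kappa> x \<odot> g)) \<in> measurable (borel_of (mtop P)) (borel_of (mtop P))"
    unfolding prod_manifold_simps
    by (rule measurable_cong[THEN iffD1, OF _ measurable_pm[OF id c]]) (use g in \<open>auto simp only: space_borel_of topspace_prod_topology tA tG mult_E k_\<kappa> pm_in k_in\<close>)
qed

lemma scP: "second_countable (mtop P)"
  using second_countable_prod[OF scA scG] by simp

lemma lie_E: "lie_group E"
proof -
  obtain C where C: "countable C" "C \<subseteq> cE" "cE \<subseteq> (\<Union>g\<in>C. (\<lambda>q. g \<odot> \<kappa> q) ` Q)" by (rule cover)
  show ?thesis
    by (rule T.lie_group_E[OF C measurable_left _ T2 measurable_right]) (use scP in simp_all)
qed

lemma \<kappa>_measurable: "\<kappa> \<in> measurable BP (borel_of (mtop ME))"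
proof -
  obtain C where C: "countable C" "C \<subseteq> cE" "cE \<subseteq> (\<Union>g\<in>C. (\<lambda>q. g \<odot> \<kappa> q) ` Q)" by (rule cover)
  show ?thesis using T.measurable_\<kappa>[OF C measurable_left] by simp
qed

lemma iota_smooth: "smooth_map MA ME \<iota>"
  unfolding smooth_map_near_iff[OF cMA T.charted_E]
proof
  fix a assume "a \<in> topspace (mtop MA)"
  then have a: "a \<in> cA" by (simp add: tA)
  have "smooth_near MA P a (\<lambda>a. (a \<boxplus> iA f1, eG))"
    by (intro smooth_near_pair cMA cMG smooth_near_mult[OF A] smooth_near_id smooth_near_const) (use a tA tG in auto)
  from smooth_near_comp[OF cMA cP T.charted_E this T.smooth_near_\<kappa>]
  show "smooth_near MA ME a \<iota>" using a V(2) by (simp add: \<iota>_def[abs_def])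
qed

text \<open>The complement of the image of \<open>C\<close> is open: off the fibre over
  \<open>eG\<close> by continuity of \<open>\<pi>\<close>, and around points of that fibre inside
  the chart \<open>A \<times> V\<close>, where membership in the image is governed by
  \<open>fst q \<boxplus> f1 \<in> C\<close>.\<close>

lemma iota_closed: "closed_map (mtop MA) (mtop ME) \<iota>"
  unfolding closed_map_def
proof (intro allI impI)
  fix C assume C: "closedin (mtop MA) C"
  have CA: "C \<subseteq> cA" using closedin_subset[OF C] tA by simp
  have "continuous_map (prod_topology (mtop MA) (mtop MG)) (mtop MA) (\<lambda>q. fst q \<boxplus> f1)"
  proof -
    have "smooth_map P MA (\<lambda>q. fst q \<boxplus> f1)"
      unfolding smooth_map_near_iff[OF cP cMA]
      by (intro ballI smooth_near_mult[OF A cP] smooth_near_fst[OF cMA cMG] smooth_near_const[OF cP cMA]) (auto simp: tA)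
    from smooth_map_continuous[OF this] show ?thesis by simp
  qed
  from openin_continuous_map_preimage[OF this openin_diff[OF openin_topspace C]]
  have D: "openin (mtop P) ({q \<in> cA \<times> cG. fst q \<boxplus> f1 \<notin> C} \<inter> Q)" (is "openin _ (?D \<inter> Q)")
    using Q_open by (intro openin_Int) (auto simp: tA tG elim!: back_subst[of "openin _"])
  have "closedin (mtop MG) {eG}" using lie_groupD(4)[OF G] tG by (simp add: closedin_Hausdorff_singleton)
  then have 1: "openin (mtop ME) {e \<in> cE. \<pi> e \<in> cG - {eG}}" using tG by (intro pi_preimage_open) (metis openin_diff openin_topspace)
  have 2: "openin (mtop ME) ((\<lambda>q. \<one>\<^bsub>E\<^esub> \<odot> \<kappa> q) ` (?D \<inter> Q))" by (rule T.open_translate[OF E.one_closed D]) simp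
  have "cE - \<iota> ` C = {e \<in> cE. \<pi> e \<in> cG - {eG}} \<union> (\<lambda>q. \<one>\<^bsub>E\<^esub> \<odot> \<kappa> q) ` (?D \<inter> Q)"
  proof (rule equalityI; rule subsetI)
    fix e assume e: "e \<in> cE - \<iota> ` C"
    show "e \<in> {e \<in> cE. \<pi> e \<in> cG - {eG}} \<union> (\<lambda>q. \<one>\<^bsub>E\<^esub> \<odot> \<kappa> q) ` (?D \<inter> Q)"
    proof (cases "\<pi> e = eG")
      case True
      then have "fst (k e) \<boxplus> f1 \<notin> C" "snd (k e) \<in> V" using e V(2) iota_image[OF CA] by (auto simp: \<pi>_def)
      then have "k e \<in> ?D \<inter> Q" using e by (simp add: mem_Times_iff)
      moreover have "e = \<one>\<^bsub>E\<^esub> \<odot> \<kappa> (k e)" using e by simp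
      ultimately show ?thesis by (intro UnI2 image_eqI)
    qed (use e in auto)
  next
    fix e assume e: "e \<in> {e \<in> cE. \<pi> e \<in> cG - {eG}} \<union> (\<lambda>q. \<one>\<^bsub>E\<^esub> \<odot> \<kappa> q) ` (?D \<inter> Q)"
    have D': "\<one>\<^bsub>E\<^esub> \<odot> \<kappa> q \<in> cE - \<iota> ` C" if "q \<in> ?D" for q
    proof -
      have q: "q \<in> cA \<times> cG" "fst q \<boxplus> f1 \<notin> C" using that by auto
      have "\<one>\<^bsub>E\<^esub> \<odot> \<kappa> q = \<kappa> q" by (rule E.l_one[OF \<kappa>_in[OF q(1)]])
      then show ?thesis using iota_image[OF CA] \<kappa>_in[OF q(1)] k_\<kappa>[OF q(1)] q(2) by auto
    qed
    from e show "e \<in> cE - \<iota> ` C"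
    proof
      assume "e \<in> (\<lambda>q. \<one>\<^bsub>E\<^esub> \<odot> \<kappa> q) ` (?D \<inter> Q)"
      then show ?thesis using D' by auto
    qed (use iota_image[OF CA] in auto)
  qed
  moreover have "\<iota> ` C \<subseteq> cE" using CA by auto
  ultimately show "closedin (mtop ME) (\<iota> ` C)" using openin_Un[OF 1 2] by (simp add: closedin_def top_E)
qed

section \<open>The extension and its factor set\<close>

definition X :: "('g, 'a, 'e) extension" where "X = \<lparr>ext = E, incl = \<iota>, proj = \<pi>\<rparr>"

lemma X_simps [simp]: "ext X = E" "incl X = \<iota>" "proj X = \<pi>" by (simp_all add: X_def)

lemma section_X: "lsm_section G X \<sigma>"
  unfolding lsm_section_def X_simps
proof (intro conjI ballI)
  have "(\<lambda>s. (eA, s)) \<in> measurable BG BP"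
    by (rule continuous_map_borel_of) (simp add: continuous_map_pairedI tA)
  from measurable_compose[OF this \<kappa>_measurable] show "\<sigma> \<in> measurable BG (borel_of (mtop ME))" by (simp add: \<sigma>_def[abs_def])
  have "smooth_near MG P eG (\<lambda>s. (eA, s))"
    by (intro smooth_near_pair cMA cMG smooth_near_id smooth_near_const) (auto simp: tA tG)
  from smooth_near_comp[OF cMG cP T.charted_E this T.smooth_near_\<kappa>]
  show "smooth_near MG ME eG \<sigma>" using V(2) by (simp add: \<sigma>_def[abs_def])
qed simp

lemma extension_X: "lie_extension G A act X"
proof -
  have "\<iota> ` cA = kernel E G \<pi>" using iota_image[OF subset_refl] by (auto simp: kernel_def)
  moreover have "\<pi> ` cE = cG"
  proof (rule equalityI; rule subsetI)
    fix s assume "s \<in> cG"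
    then show "s \<in> \<pi> ` cE" by (intro image_eqI[of _ _ "\<sigma> s"]) simp_all
  qed auto
  moreover have "e \<odot> \<iota> a \<odot> inv\<^bsub>E\<^esub> e = \<iota> (act (\<pi> e) a)" if e: "e \<in> cE" and a: "a \<in> cA" for e a
  proof -
    have "\<kappa> (fst (k e), snd (k e)) \<odot> \<iota> a = \<iota> (act (\<pi> e) a) \<odot> \<kappa> (fst (k e), snd (k e))"
      using e a by (simp add: \<kappa>_mult_iota iota_mult_\<kappa> \<pi>_def del: prod.collapse)
    then have "e \<odot> \<iota> a = \<iota> (act (\<pi> e) a) \<odot> e" using e by simp
    then show ?thesis using e a by (simp add: E.m_assoc)
  qed
  ultimately have "locally_split_extension G A act X"
    unfolding locally_split_extension_def X_simps
    using lie_E iota_hom iota_smooth pi_hom pi_smooth iota_inj iota_closed pi_open section_X by blast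
  then show ?thesis by unfold_locales
qed

lemma factor_set_X: "factor_set G A X \<sigma> = fam2 f"
proof -
  interpret X: lie_extension G A act X by (rule extension_X)
  have "X.fs \<sigma> s t = f s t" if st: "s \<in> cG" "t \<in> cG" for s t
  proof -
    have "pm (eA, s) (eA, t) = (f s t, s \<star> t)" using st by (simp add: pm_def)
    then have "\<sigma> s \<odot> \<sigma> t = \<kappa> (f s t, s \<star> t)" using st mult_\<kappa>[of "(eA, s)" "(eA, t)"] by (simp add: \<sigma>_def)
    also have "\<dots> = \<iota> (f s t) \<odot> \<sigma> (s \<star> t)" using st by (simp add: \<sigma>_def iota_mult_\<kappa>)
    finally have "\<sigma> s \<odot> \<sigma> t \<odot> inv\<^bsub>E\<^esub> \<sigma> (s \<star> t) = \<iota> (f s t)" using st by (simp add: E.m_assoc)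
    then show ?thesis unfolding X.fs_def X_simps using inv_into_f_f[OF iota_inj f_closed[OF st]] by simp
  qed
  then show ?thesis unfolding X.factor_set_fam2 by (rule fam2_cong)
qed

end

text \<open>\<open>f\<close> is smooth on a neighbourhood \<open>D\<close> of
  \<open>(eG, eG)\<close>. The map taking \<open>(t, s \<star> t)\<close> to \<open>(s, t)\<close>
  is continuous and fixes \<open>(eG, eG)\<close>, so for a small neighbourhood of \<open>eG\<close>
  the conditions that it contain \<open>t\<close> and \<open>s \<star> t\<close> force
  \<open>(s, t)\<close> into \<open>D\<close>, although \<open>s\<close> is not restricted
  beforehand.\<close>

lemma (in lie_module) extension_of_cocycle:
  assumes f: "cocycle f" and j: "inj_on (j :: 'g \<times> 'a \<Rightarrow> 'e) (cG \<times> cA)"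
  obtains X :: "('g, 'a, 'e) extension" and \<sigma> where "lie_extension G A act X" "lsm_section G X \<sigma>" "factor_set G A X \<sigma> = fam2 f"
proof -
  have "smooth_near (prod_manifold MG MG) MA (eG, eG) (\<lambda>(s, t). f s t)" using f by (simp add: cocycle_def lsm2_def)
  then obtain D where D: "(eG, eG) \<in> D" "smooth_map_on (prod_manifold MG MG) MA D (\<lambda>(s, t). f s t)" by (rule smooth_nearD)
  have oD: "openin (mtop (prod_manifold MG MG)) D" by (rule smooth_map_onD(1)[OF D(2)])
  have "smooth_near (prod_manifold MG MG) (prod_manifold MG MG) (eG, eG) (\<lambda>z. (snd z \<star> iG (fst z), fst z))"
    by (intro smooth_near_pair cGG cMG smooth_near_mult[OF G] smooth_near_inv[OF G] smooth_near_GG) auto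
  then obtain N where N: "openin (mtop (prod_manifold MG MG)) N" "(eG, eG) \<in> N" "(\<lambda>z. (snd z \<star> iG (fst z), fst z)) ` N \<subseteq> D"
    by (rule smooth_near_open[OF _ oD]) (use D(1) in auto)
  obtain U W where UW: "openin (mtop MG) U" "openin (mtop MG) W" "eG \<in> U" "eG \<in> W" "U \<times> W \<subseteq> N"
    using N(1,2) unfolding prod_manifold_simps by (rule openin_prodE)
  have "smooth_near (prod_manifold MG MG) MA (s, t) (\<lambda>(s, t). f s t)"
    if "s \<in> cG" "t \<in> U \<inter> W" "s \<star> t \<in> U \<inter> W" for s t
  proof -
    have t: "t \<in> cG" using openin_subset[OF UW(1)] that(2) tG by auto
    have "(t, s \<star> t) \<in> N" using that UW(5) by blast
    then have "(s \<star> t \<star> iG t, t) \<in> D" using N(3) by force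
    then have "(s, t) \<in> D" using that(1) t by (simp add: G.m_assoc)
    then show ?thesis using D(2) smooth_map_on_iff[OF cGG cMA] by blast
  qed
  then interpret C: cocycle_extension G A act f j "U \<inter> W"
    by unfold_locales (use f j UW in auto)
  show thesis by (rule that[OF C.extension_X C.section_X C.factor_set_X])
qed

theorem theorem2:
  fixes G :: "'g lie_struct" and A :: "'a lie_struct" and act :: "'g \<Rightarrow> 'a \<Rightarrow> 'a"
  assumes "lie_group G"
    and "smooth_module G A act"
    and "large_enough G A TYPE('e)"
  shows "equiv (locally_split_extensions G A act :: ('g, 'a, 'e) extension set)
           (extension_equivalence G A act) \<and>
    (\<exists>\<Phi>. bij_betw \<Phi>
           ((locally_split_extensions G A act :: ('g, 'a, 'e) extension set)
              // extension_equivalence G A act)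
           (carrier (lsm_cohomology G A act 2)) \<and>
         (\<forall>X \<in> locally_split_extensions G A act. \<forall>\<sigma>. lsm_section G X \<sigma> \<longrightarrow>
            factor_set G A X \<sigma> \<in> carrier (lsm_cocycles G A act 2) \<and>
            \<Phi> (extension_equivalence G A act `` {X}) = lsm_class G A act 2 (factor_set G A X \<sigma>)))"
proof -
  interpret lie_module G A act by unfold_locales (fact assms(1), fact assms(2))
  let ?Es = "locally_split_extensions G A act :: ('g, 'a, 'e) extension set"
  let ?R = "extension_equivalence G A act :: ('g, 'a, 'e) extension rel"
  let ?H = "carrier (lsm_cohomology G A act 2)"
  note equiv = equiv_extensions[where 'e = 'e]
  \<comment> \<open>An arbitrary section is chosen; that the class does not depend on it is shown
    next.\<close>
  define cl where "cl X = lsm_class G A act 2 (factor_set G A X (SOME \<sigma>. lsm_section G X \<sigma>))" for X :: "('g, 'a, 'e) extension"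
  have some: "lsm_section G X (SOME \<sigma>. lsm_section G X \<sigma>)" if "X \<in> ?Es" for X
    using lie_extension.section_exists that lie_extension_iff someI_ex by metis
  \<comment> \<open>Independence of the section is \<open>equivalent_same_class\<close> for
    \<open>X\<close> and itself, by reflexivity of the equivalence.\<close>
  have cl: "cl X = lsm_class G A act 2 (factor_set G A X \<sigma>)" if "X \<in> ?Es" "lsm_section G X \<sigma>" for X \<sigma>
    unfolding cl_def
    using equivalent_same_class[OF _ some[OF that(1)] that(2)] equiv that(1) by (meson equiv_class_self Image_singleton_iff)
  have cl_eq: "cl X = cl Y \<longleftrightarrow> (X, Y) \<in> ?R" if "X \<in> ?Es" "Y \<in> ?Es" for X Y
    unfolding cl_def
    using equivalent_same_class[OF _ some[OF that(1)] some[OF that(2)]]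
      same_class_equivalent[OF _ _ some[OF that(1)] some[OF that(2)]] that lie_extension_iff by metis
  have fs: "factor_set G A X \<sigma> \<in> carrier (lsm_cocycles G A act 2)" if "X \<in> ?Es" "lsm_section G X \<sigma>" for X \<sigma>
  proof -
    interpret X: lie_extension G A act X using that(1) by (simp add: lie_extension_iff)
    show ?thesis unfolding X.factor_set_fam2 lsm_cocycles_iff using X.fs_cocycle[OF that(2)] by blast
  qed
  have cl_in: "cl X \<in> ?H" if "X \<in> ?Es" for X
    using fs[OF that some[OF that]] unfolding carrier_lsm_cohomology lsm_cocycles_iff cl_def by (elim exE conjE) auto
  have cl_surj: "\<exists>X\<in>?Es. cl X = c" if c: "c \<in> ?H" for c
  proof -
    obtain f where f: "cocycle f" "c = lsm_class G A act 2 (fam2 f)" using c unfolding carrier_lsm_cohomology by blast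
    \<comment> \<open>\<open>large_enough\<close> supplies the copy of the set of pairs inside
      \<open>'e\<close> on which the extension is built.\<close>
    obtain j :: "'g \<times> 'a \<Rightarrow> 'e" where j: "inj_on j (cG \<times> cA)" using assms(3) unfolding large_enough_def by blast
    obtain X :: "('g, 'a, 'e) extension" and \<sigma> where X: "lie_extension G A act X" "lsm_section G X \<sigma>" "factor_set G A X \<sigma> = fam2 f"
      by (rule extension_of_cocycle[OF f(1) j])
    have "X \<in> ?Es" using X(1) by (simp add: lie_extension_iff)
    then show ?thesis using cl[OF _ X(2)] X(3) f(2) by metis
  qed
  \<comment> \<open>Defined on a class through an arbitrary representative; by \<open>cl_eq\<close>
    the choice does not matter, and the same fact gives injectivity.\<close>
  define \<Phi> where "\<Phi> K = cl (SOME X. X \<in> K)" for K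
  have \<Phi>: "\<Phi> (?R `` {X}) = cl X" if X: "X \<in> ?Es" for X
  proof -
    have "X \<in> ?R `` {X}" by (rule equiv_class_self[OF equiv X])
    then have "(X, SOME Y. Y \<in> ?R `` {X}) \<in> ?R" by (metis Image_singleton_iff someI)
    moreover from this have "(SOME Y. Y \<in> ?R `` {X}) \<in> ?Es" unfolding extension_equivalence_def by blast
    ultimately show ?thesis unfolding \<Phi>_def using cl_eq X by metis
  qed
  have "bij_betw \<Phi> (?Es // ?R) ?H"
  proof (rule bij_betw_imageI)
    show "inj_on \<Phi> (?Es // ?R)"
    proof (rule inj_onI)
      fix K L assume "K \<in> ?Es // ?R" "L \<in> ?Es // ?R" and eq: "\<Phi> K = \<Phi> L"
      then obtain X Y where X: "X \<in> ?Es" "K = ?R `` {X}" and Y: "Y \<in> ?Es" "L = ?R `` {Y}" by (metis quotientE)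
      have "(X, Y) \<in> ?R" using eq X Y \<Phi> cl_eq by metis
      then show "K = L" unfolding X Y by (rule equiv_class_eq[OF equiv])
    qed
    show "\<Phi> ` (?Es // ?R) = ?H"
    proof (rule equalityI; rule subsetI)
      fix c assume "c \<in> \<Phi> ` (?Es // ?R)"
      then obtain X where "X \<in> ?Es" "c = \<Phi> (?R `` {X})" by (metis imageE quotientE)
      then show "c \<in> ?H" using \<Phi> cl_in by simp
    next
      fix c assume "c \<in> ?H"
      then obtain X where X: "X \<in> ?Es" "cl X = c" using cl_surj by blast
      show "c \<in> \<Phi> ` (?Es // ?R)" by (rule image_eqI[OF _ quotientI[OF X(1)]]) (use \<Phi> X in simp)
    qed
  qed
  then show ?thesis using equiv fs \<Phi> cl by (intro conjI exI[of _ \<Phi>]) auto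
qed

end
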